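(* Let $d\in\{1,2,3\}$, $c>0$, let $\hat u_0\in X=L^2(\mathbb{R}^d;\mathbb{C})$ be continuous with compact support, and let $b:\mathbb{R}\to\mathbb{R}$ be a (measurable) function. Let $\rho>0$ and let $W_\rho$ be as described in the context. Set $\hat V^\rho:=(J_b\circ\mathcal{R}_\rho)\hat u_0$, i.e. $$\hat V^\rho(\xi,q,\tau)=\left(\tfrac{1}{2\pi i}\right)^{(d-1)/2}e^{-ib(\xi)\tau}\,W_\rho(\xi)\,\hat u_0(|\xi|q),$$ and $V^\rho:=\mathcal{F}_1^{-1}\hat V^\rho$. Assume: (i) there exist $C,\alpha>0$ such that $|V^\rho(z,q,\tau)|\le C(1+|z|)^{-d-\alpha}$ for all $z\in\mathbb{R}$, $q\in S^{d-1}$, $\tau\in(0,\infty)$; (ii) for every $\tau\in(0,\infty)$, the function $\mathbb{R}\times S^{d-1}\ni(\xi,q)\mapsto\hat V^\rho(\xi,q,\tau)\in\mathbb{C}$ is of class $C^{d-1}(\mathbb{R}\times S^{d-1};\mathbb{C})$. Then for every $\tau>0$ and every $k\in\mathbb{R}^d$ with $|k|>\rho$, $$(\hat{\mathcal{Q}}_b^\rho\hat u_0)(k,\tau/\varepsilon^2)\,e^{ic|k|\tau/\varepsilon^2}\to e^{-ib(|k|)\tau}\,\hat u_0(k)\qquad\text{as }\varepsilon\to0 .$$ Moreover, for every $\tau>0$, for the non-regularized reconstruction operators, $$(\hat{\mathcal{Q}}_b\hat u_0)(k,\tau/\varepsilon^2)\,e^{ic|k|\tau/\varepsilon^2}\rightharpoonup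 e^{-ib(|k|)\tau}\,\hat u_0(k)$$ weakly in $L^2(\mathbb{R}^d)$, as functions of $k\in\mathbb{R}^d$, as $\varepsilon\to0$.
   Context: Spaces: $X:=L^2(\mathbb{R}^d;\mathbb{C})$ and $X_S:=L^2(\mathbb{R}\times S^{d-1};\mathbb{C})$, where $S^{d-1}\subset\mathbb{R}^d$ is the unit sphere with surface measure $dS$ (for $d=1$, $S^0=\{+1,-1\}$ with counting measure). Powers of $1/i$ and of $i$ are principal values. Fourier transforms: $(\mathcal{F}_d u)(k)=\int_{\mathbb{R}^d}u(x)e^{-ik\cdot x}\,dx$ and $(\mathcal{F}_d^{-1}\hat u)(x)=(2\pi)^{-d}\int_{\mathbb{R}^d}e^{ix\cdot k}\hat u(k)\,dk$. The one-dimensional transform $\mathcal{F}_1$ acts on profiles with respect to the scalar variable ($z\leftrightarrow\xi$), with $q\in S^{d-1}$ and $\tau$ as parameters. Regularizing function: for $\rho>0$, $W_\rho\in C^{d-1}(\mathbb{R};\mathbb{R})$ satisfies $W_\rho(\xi)=0$ for $\xi\le 0$, $W_\rho(\xi)=|\xi|^{(d-1)/2}$ for $\xi\ge\rho$, and $0\le W_\rho(\xi)\le|\xi|^{(d-1)/2}$ for $\xi\ge 0$. Restriction operators $\mathcal{R},\mathcal{R}_\rho:X\to X_S$: $$\mathcal{R}\hat u_0(\xi,q):=\left(\frac{|\xi|}{2\pi i}\right)^{(d-1)/2}\mathbf{1}_{\{\xi>0\}}\,\hat u_0(|\xi|q),\qquad \mathcal{R}_\rho\hat u_0(\xi,q):=\left(\frac{1}{2\pi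 i}\right)^{(d-1)/2}W_\rho(\xi)\,\hat u_0(|\xi|q).$$ Profile evolution $J_b:X_S\to L^\infty(0,\infty;X_S)$: $\ (J_b\hat V_0)(\xi,q,\tau):=e^{-ib(\xi)\tau}\hat V_0(\xi,q)$. Shell operator $\mathcal{S}:L^\infty(0,\infty;X_S)\to L^\infty(0,\infty;X)$, depending on the parameter $\varepsilon>0$: $$(\mathcal{S}V)(x,t):=\frac{1}{(ct)^{(d-1)/2}}\,\mathbf{1}_{\{|x|<2ct\}}\,V\!\left(|x|-ct,\frac{x}{|x|},\varepsilon^2t\right).$$ Reconstruction operators (depending on $\varepsilon$): $\mathcal{Q}_b:=\mathcal{S}\circ\mathcal{F}_1^{-1}\circ J_b\circ\mathcal{R}$, $\mathcal{Q}_b^\rho:=\mathcal{S}\circ\mathcal{F}_1^{-1}\circ J_b\circ\mathcal{R}_\rho$, $\hat{\mathcal{Q}}_b:=\mathcal{F}_d\circ\mathcal{Q}_b$, $\hat{\mathcal{Q}}_b^\rho:=\mathcal{F}_d\circ\mathcal{Q}_b^\rho$ (with $\mathcal{F}_d$ acting in the spatial variable $x$). *)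

theory Defs
  imports "HOL-Analysis.Analysis"
begin

text \<open>
  The space \<open>\<real>\<^sup>d\<close> is \<open>real ^ 'n\<close> with \<open>d = CARD('n)\<close>. Elements of the function spaces are represented
  by everywhere defined functions. A profile on \<open>\<real> \<times> S\<^sup>d\<^sup>-\<^sup>1\<close> (depending on the parameter \<open>\<tau>\<close>) is a
  curried function of \<open>\<xi>\<close>, \<open>q\<close> (and \<open>\<tau>\<close>), of which only the values at \<open>q \<in> sphere 0 1\<close> matter.
\<close>

definition L2 :: "('a::euclidean_space \<Rightarrow> complex) set" where
  "L2 = {f. f \<in> borel_measurable lebesgue \<and> integrable lebesgue (\<lambda>x. (cmod (f x))\<^sup>2)}"

definition weakly_tendsto_L2 ::
  "('i \<Rightarrow> 'a::euclidean_space \<Rightarrow> complex) \<Rightarrow> ('a \<Rightarrow> complex) \<Rightarrow> 'i filter \<Rightarrow> bool" where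
  "weakly_tendsto_L2 f l F \<longleftrightarrow>
     (\<forall>\<^sub>F i in F. f i \<in> L2) \<and> l \<in> L2 \<and>
     (\<forall>g\<in>L2. ((\<lambda>i. LINT x|lebesgue. f i x * cnj (g x)) \<longlongrightarrow> (LINT x|lebesgue. l x * cnj (g x))) F)"

text \<open>\<open>C\<^sup>k\<close> on an open set \<open>S\<close>; derivatives are real (Frechet) derivatives, also for complex values.\<close>

primrec Ck_on :: "nat \<Rightarrow> 'a::euclidean_space set \<Rightarrow> ('a \<Rightarrow> 'b::euclidean_space) \<Rightarrow> bool" where
  "Ck_on 0 S f \<longleftrightarrow> continuous_on S f"
| "Ck_on (Suc k) S f \<longleftrightarrow>
     (\<forall>x\<in>S. f differentiable (at x)) \<and> (\<forall>v. Ck_on k S (\<lambda>x. frechet_derivative f (at x) v))"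

text \<open>
  \<open>C\<^sup>k\<close> on an embedded submanifold \<open>M\<close> of a Euclidean space: locally the restriction
  of a \<open>C\<^sup>k\<close> function on an open subset of the ambient space.
\<close>

definition Ck_submanifold ::
  "nat \<Rightarrow> 'a::euclidean_space set \<Rightarrow> ('a \<Rightarrow> 'b::euclidean_space) \<Rightarrow> bool" where
  "Ck_submanifold k M f \<longleftrightarrow>
     (\<forall>p\<in>M. \<exists>U g. open U \<and> p \<in> U \<and> Ck_on k U g \<and> (\<forall>x\<in>U \<inter> M. g x = f x))"

text \<open>
  With the dimension \<open>d\<close> as first argument. Note that \<open>0 powr 0 = 0\<close>; this is harmless for \<open>d = 1\<close>, as
  the exponent is only relevant at \<open>\<xi> = 0\<close> in the last clause, where \<open>W 0 = 0\<close> anyway.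
\<close>

definition regularizing :: "nat \<Rightarrow> real \<Rightarrow> (real \<Rightarrow> real) \<Rightarrow> bool" where
  "regularizing d \<rho> W \<longleftrightarrow>
     Ck_on (d - 1) UNIV W \<and>
     (\<forall>\<xi>\<le>0. W \<xi> = 0) \<and>
     (\<forall>\<xi>\<ge>\<rho>. W \<xi> = \<bar>\<xi>\<bar> powr ((real d - 1) / 2)) \<and>
     (\<forall>\<xi>\<ge>0. 0 \<le> W \<xi> \<and> W \<xi> \<le> \<bar>\<xi>\<bar> powr ((real d - 1) / 2))"

text \<open>
  Given by their integral formulas, which are absolutely convergent for all functions to which they
  are applied below. The one-dimensional transform is the instance \<open>'a = real\<close>.
\<close>

definition fourier :: "('a::euclidean_space \<Rightarrow> complex) \<Rightarrow> 'a \<Rightarrow> complex" where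
  "fourier u k = (LINT x|lebesgue. exp (- (\<i> * of_real (k \<bullet> x))) * u x)"

definition inv_fourier :: "('a::euclidean_space \<Rightarrow> complex) \<Rightarrow> 'a \<Rightarrow> complex" where
  "inv_fourier u x =
     1 / of_real ((2 * pi) ^ DIM('a)) * (LINT k|lebesgue. exp (\<i> * of_real (x \<bullet> k)) * u k)"

definition restr_op :: "(real ^ 'n \<Rightarrow> complex) \<Rightarrow> real \<Rightarrow> real ^ 'n \<Rightarrow> complex" where
  "restr_op u \<xi> q =
     (of_real \<bar>\<xi>\<bar> / (2 * of_real pi * \<i>)) powr of_real ((real CARD('n) - 1) / 2) *
     of_bool (\<xi> > 0) * u (\<bar>\<xi>\<bar> *\<^sub>R q)"

definition restr_reg_op ::
  "(real \<Rightarrow> real) \<Rightarrow> (real ^ 'n \<Rightarrow> complex) \<Rightarrow> real \<Rightarrow> real ^ 'n \<Rightarrow> complex" where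
  "restr_reg_op W u \<xi> q =
     (1 / (2 * of_real pi * \<i>)) powr of_real ((real CARD('n) - 1) / 2) *
     of_real (W \<xi>) * u (\<bar>\<xi>\<bar> *\<^sub>R q)"

definition profile_evol ::
  "(real \<Rightarrow> real) \<Rightarrow> (real \<Rightarrow> real ^ 'n \<Rightarrow> complex) \<Rightarrow> real \<Rightarrow> real ^ 'n \<Rightarrow> real \<Rightarrow> complex" where
  "profile_evol b V \<xi> q \<tau> = exp (- (\<i> * of_real (b \<xi> * \<tau>))) * V \<xi> q"

definition profile_inv_fourier ::
  "(real \<Rightarrow> real ^ 'n \<Rightarrow> real \<Rightarrow> complex) \<Rightarrow> real \<Rightarrow> real ^ 'n \<Rightarrow> real \<Rightarrow> complex" where
  "profile_inv_fourier V z q \<tau> = inv_fourier (\<lambda>\<xi>. V \<xi> q \<tau>) z"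

definition shell_op ::
  "real \<Rightarrow> real \<Rightarrow> (real \<Rightarrow> real ^ 'n \<Rightarrow> real \<Rightarrow> complex) \<Rightarrow> real ^ 'n \<Rightarrow> real \<Rightarrow> complex" where
  "shell_op c \<epsilon> V x t =
     1 / of_real ((c * t) powr ((real CARD('n) - 1) / 2)) *
     of_bool (norm x < 2 * c * t) * V (norm x - c * t) (x /\<^sub>R norm x) (\<epsilon>\<^sup>2 * t)"

definition space_fourier :: "(real ^ 'n \<Rightarrow> real \<Rightarrow> complex) \<Rightarrow> real ^ 'n \<Rightarrow> real \<Rightarrow> complex" where
  "space_fourier u k t = fourier (\<lambda>x. u x t) k"

definition recon :: 
  "real \<Rightarrow> real \<Rightarrow> (real \<Rightarrow> real) \<Rightarrow> (real ^ 'n \<Rightarrow> complex) \<Rightarrow> real ^ 'n \<Rightarrow> real \<Rightarrow> complex" where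
  "recon c \<epsilon> b = shell_op c \<epsilon> \<circ> profile_inv_fourier \<circ> profile_evol b \<circ> restr_op"

definition recon_reg :: 
  "real \<Rightarrow> real \<Rightarrow> (real \<Rightarrow> real) \<Rightarrow> (real \<Rightarrow> real) \<Rightarrow> (real ^ 'n \<Rightarrow> complex) \<Rightarrow> real ^ 'n \<Rightarrow> real \<Rightarrow> complex"
  where
  "recon_reg c \<epsilon> b W = shell_op c \<epsilon> \<circ> profile_inv_fourier \<circ> profile_evol b \<circ> restr_reg_op W"

definition recon_hat :: 
  "real \<Rightarrow> real \<Rightarrow> (real \<Rightarrow> real) \<Rightarrow> (real ^ 'n \<Rightarrow> complex) \<Rightarrow> real ^ 'n \<Rightarrow> real \<Rightarrow> complex" where
  "recon_hat c \<epsilon> b = space_fourier \<circ> recon c \<epsilon> b"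

definition recon_reg_hat :: 
  "real \<Rightarrow> real \<Rightarrow> (real \<Rightarrow> real) \<Rightarrow> (real \<Rightarrow> real) \<Rightarrow> (real ^ 'n \<Rightarrow> complex) \<Rightarrow> real ^ 'n \<Rightarrow> real \<Rightarrow> complex"
  where
  "recon_reg_hat c \<epsilon> b W = space_fourier \<circ> recon_reg c \<epsilon> b W"

end

theory Submission
  imports Defs "HOL-Probability.Probability"
begin

text \<open>
  In polar coordinates the Fourier transform of a shell at radius \<open>R = c \<tau> / \<epsilon>\<^sup>2\<close> becomes an integral
  over \<open>z = r - R\<close> of Fourier transforms of densities on the unit sphere at frequency \<open>r k\<close>. Stationary
  phase on the sphere leaves only the contributions of the two poles \<open>\<plusminus>k / |k|\<close>. The phase factor and the
  normalisation of the restriction operator cancel against the pole \<open>k / |k|\<close>, where Fourier inversion in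
  \<open>z\<close> returns the profile; the other pole sees the profile at negative frequency, where it vanishes.
  This gives the pointwise limit.

  For the weak limit the profile need not be regular. Plancherel bounds the shell transform in \<open>L\<^sup>2\<close>,
  uniformly in \<open>R\<close>, by the \<open>L\<^sup>2\<close> norm of the profile. Profiles of the form polynomial times
  \<open>(s (B - s))\<^sub>+\<^sup>4\<close> are smooth enough for the pointwise limit and are dense, so the general case follows
  by approximation.
\<close>

section \<open>Polar coordinates\<close>

text \<open>With r = R + z the phase exp(-i r k.q) splits: the part in z turns V into the density
  f(q) = Vhat(k.q, q), and the part in R is left for stationary phase at frequency R k. At the pole
  -k/|k| this density is the profile at -|k|, hence 0. The radial weight R^(-(d-1)/2) (R + z)^(d-1)
  is R^((d-1)/2) plus lower terms. For d = 3 the term 2z survives as R grows; it is removed not by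
  size but because the sphere integral that it multiplies tends to 0. The expansion costs d - 1
  powers of |z|, so decay of order d + \<alpha> leaves an integrable majorant of order 1 + \<alpha>.
  In the weak limit exp(-i b \<tau>) is merely measurable in s, which rules out the pointwise
  argument. The roughness sits in a radial factor alone, so L^2 approximation in one real variable,
  uniform in q, suffices. The exponent 4 is d + 1 for d = 3: so many integrations by parts without
  boundary terms give decay of order d + 1. Sphere measures are built anew for each direction k/|k|,
  with that direction as the axis.\<close>

lemma translation_invariant_eq_lborel:
  fixes M :: "'a::euclidean_space measure"
  assumes sets: "sets M = sets borel" and sf: "sigma_finite_measure M"
    and inv: "\<And>f a. f \<in> borel_measurable borel \<Longrightarrow> (\<integral>\<^sup>+x. f (x + a) \<partial>M) = (\<integral>\<^sup>+x. f x \<partial>M)"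
    and ball: "emeasure M (ball 0 1) = emeasure lborel (ball (0::'a) 1)"
  shows "M = lborel"
proof (rule measure_eqI)
  interpret sigma_finite_measure M by fact
  interpret P: pair_sigma_finite M "lborel :: 'a measure" ..
  have [measurable_cong]: "sets M = sets borel" by fact
  fix A assume "A \<in> sets M"
  then have [measurable]: "A \<in> sets borel" by (simp add: sets)
  define f g :: "'a \<Rightarrow> ennreal" where "f = indicator A" and "g = indicator (ball 0 1)"
  have [measurable]: "f \<in> borel_measurable borel" "g \<in> borel_measurable borel"
    unfolding f_def g_def by (auto intro!: borel_measurable_indicator)
  have refl: "(\<integral>\<^sup>+y. h (x - y) \<partial>lborel) = (\<integral>\<^sup>+y. h y \<partial>lborel)"
    if [measurable]: "h \<in> borel_measurable borel" for h :: "'a \<Rightarrow> ennreal" and x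
  proof -
    have "(\<integral>\<^sup>+y. h y \<partial>lborel) = (\<integral>\<^sup>+y. h (x + y) \<partial>lborel)"
      by (subst lborel_distr_plus[of x, symmetric]) (simp add: nn_integral_distr)
    also have "\<dots> = (\<integral>\<^sup>+y. h (x + y) \<partial>distr lborel borel uminus)"
      using lborel_affine[of "-1" "0::'a"] by (simp add: density_1)
    also have "\<dots> = (\<integral>\<^sup>+y. h (x - y) \<partial>lborel)"
      by (simp add: nn_integral_distr)
    finally show ?thesis by simp
  qed
  have shift: "(\<integral>\<^sup>+y. f (x + y) \<partial>lborel) = (\<integral>\<^sup>+y. f y \<partial>lborel)" for x
    by (subst (2) lborel_distr_plus[of x, symmetric]) (simp add: nn_integral_distr)
  \<comment> \<open>Uniqueness of Haar measure by double counting: f(x) g(x - y) is integrated over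
    \<open>M\<close> and \<open>lborel\<close> in both orders. Each order can be freed of its shift
    by the invariance of one of the two measures, and g is the indicator of the ball on which they
    agree.\<close>
  have "(\<integral>\<^sup>+x. f x \<partial>M) * (\<integral>\<^sup>+y. g y \<partial>lborel) = (\<integral>\<^sup>+x. f x * (\<integral>\<^sup>+y. g (x - y) \<partial>lborel) \<partial>M)"
    by (subst refl) (simp_all add: nn_integral_multc)
  also have "\<dots> = (\<integral>\<^sup>+x. (\<integral>\<^sup>+y. f x * g (x - y) \<partial>lborel) \<partial>M)"
    by (simp add: nn_integral_cmult)
  also have "\<dots> = (\<integral>\<^sup>+y. (\<integral>\<^sup>+x. f x * g (x - y) \<partial>M) \<partial>lborel)"
    by (rule P.Fubini'[symmetric]) measurable
  also have "\<dots> = (\<integral>\<^sup>+y. (\<integral>\<^sup>+x. f (x + y) * g x \<partial>M) \<partial>lborel)"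
    using inv[of "\<lambda>x. f x * g (x - y)" y for y] by simp
  also have "\<dots> = (\<integral>\<^sup>+x. (\<integral>\<^sup>+y. f (x + y) * g x \<partial>lborel) \<partial>M)"
    by (rule P.Fubini') measurable
  also have "\<dots> = (\<integral>\<^sup>+y. f y \<partial>lborel) * (\<integral>\<^sup>+x. g x \<partial>M)"
    by (simp add: nn_integral_multc shift nn_integral_cmult)
  finally have eq: "emeasure M A * emeasure lborel (ball (0::'a) 1) = emeasure lborel A * emeasure lborel (ball (0::'a) 1)"
    using ball by (simp add: f_def g_def)
  have "emeasure lborel (ball (0::'a) 1) = ennreal (unit_ball_vol DIM('a))"
    by (simp add: emeasure_ball)
  moreover have "unit_ball_vol (real DIM('a)) \<noteq> 0"
    using unit_ball_vol_pos[of "real DIM('a)"] by (metis less_irrefl of_nat_0_le_iff)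
  ultimately show "emeasure M A = emeasure lborel A"
    using eq by (auto simp: mult.commute[of _ "ennreal _"] ennreal_mult_cancel_left)
qed (simp add: sets)

text \<open>An isometry takes balls to balls of equal radius, so the image measure is right on the
  unit ball, and surjectivity pulls every translation back to the source. Source and target may be
  different types: this moves integrals between pairs of reals, \<open>complex\<close>,
  \<open>real \<times> complex\<close> and the ambient space.\<close>

lemma distr_lborel_linear_isometry:
  fixes T :: "'a::euclidean_space \<Rightarrow> 'b::euclidean_space"
  assumes lin: "linear T" and norm: "\<And>x. norm (T x) = norm x" and surj: "surj T"
    and dim: "DIM('a) = DIM('b)"
  shows "distr lborel borel T = lborel"
proof (rule translation_invariant_eq_lborel)
  have [measurable]: "T \<in> borel_measurable borel"
    using lin by (intro borel_measurable_continuous_onI linear_continuous_on) (simp add: linear_linear)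
  have vim: "T -` ball 0 r = ball 0 r" for r by (auto simp: norm)
  have em: "emeasure (distr lborel borel T) (ball 0 r) = emeasure lborel (ball (0::'b) r)" if "r \<ge> 0" for r
    using that by (simp add: emeasure_distr vim emeasure_ball dim)
  show "emeasure (distr lborel borel T) (ball 0 1) = emeasure lborel (ball (0::'b) 1)"
    by (rule em) simp
  show "sigma_finite_measure (distr lborel borel T)"
  proof
    show "\<exists>A. countable A \<and> A \<subseteq> sets (distr lborel borel T) \<and> \<Union> A = space (distr lborel borel T) \<and>
        (\<forall>a\<in>A. emeasure (distr lborel borel T) a \<noteq> \<infinity>)"
    proof (intro exI[of _ "range (\<lambda>n. ball 0 (real n))"] conjI)
      show "\<Union> (range (\<lambda>n. ball 0 (real n))) = space (distr lborel borel T)"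
        by (auto simp: reals_Archimedean2)
    qed (auto simp: em emeasure_ball)
  qed
  fix f :: "'b \<Rightarrow> ennreal" and a assume [measurable]: "f \<in> borel_measurable borel"
  obtain a' where a: "a = T a'" using surj by (metis surjD)
  have "(\<integral>\<^sup>+x. f (x + a) \<partial>distr lborel borel T) = (\<integral>\<^sup>+x. f (T (a' + x)) \<partial>lborel)"
    by (simp add: nn_integral_distr a linear_add[OF lin] add.commute)
  also have "\<dots> = (\<integral>\<^sup>+x. f (T x) \<partial>distr lborel borel ((+) a'))"
    by (simp add: nn_integral_distr)
  also have "\<dots> = (\<integral>\<^sup>+x. f x \<partial>distr lborel borel T)"
    by (simp add: nn_integral_distr lborel_distr_plus)
  finally show "(\<integral>\<^sup>+x. f (x + a) \<partial>distr lborel borel T) = (\<integral>\<^sup>+x. f x \<partial>distr lborel borel T)" .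
qed simp

lemma nn_integral_periodic_shift:
  fixes f :: "real \<Rightarrow> ennreal"
  assumes [measurable]: "f \<in> borel_measurable borel" and per: "\<And>t. f (t + 2 * pi) = f t"
    and a: "0 \<le> a" "a \<le> 2 * pi"
  shows "(\<integral>\<^sup>+t. f (t + a) * indicator {-pi..<pi} t \<partial>lborel) = (\<integral>\<^sup>+t. f t * indicator {-pi..<pi} t \<partial>lborel)"
proof -
  have sh: "(\<integral>\<^sup>+t. g (t + c) \<partial>lborel) = (\<integral>\<^sup>+t. g t \<partial>lborel)"
    if [measurable]: "g \<in> borel_measurable borel" for g :: "real \<Rightarrow> ennreal" and c
    by (subst (2) lborel_distr_plus[of c, symmetric]) (simp add: nn_integral_distr add.commute)
  have "(\<integral>\<^sup>+t. f (t + a) * indicator {-pi..<pi} t \<partial>lborel)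
      = (\<integral>\<^sup>+t. f (t + a) * indicator {-pi+a..<pi+a} (t + a) \<partial>lborel)"
    by (intro nn_integral_cong) (auto split: split_indicator)
  also have "\<dots> = (\<integral>\<^sup>+t. f t * indicator {-pi+a..<pi+a} t \<partial>lborel)"
    by (rule sh) measurable
  also have "\<dots> = (\<integral>\<^sup>+t. f t * indicator {-pi+a..<pi} t + f t * indicator {pi..<pi+a} t \<partial>lborel)"
    using a by (intro nn_integral_cong) (auto split: split_indicator)
  also have "\<dots> = (\<integral>\<^sup>+t. f t * indicator {-pi+a..<pi} t \<partial>lborel) + (\<integral>\<^sup>+t. f t * indicator {pi..<pi+a} t \<partial>lborel)"
    by (rule nn_integral_add) measurable
  \<comment> \<open>The piece beyond pi is moved back by one period and fills the gap at the left
    end.\<close>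
  also have "(\<integral>\<^sup>+t. f t * indicator {pi..<pi+a} t \<partial>lborel)
      = (\<integral>\<^sup>+t. f (t + 2*pi) * indicator {pi..<pi+a} (t + 2*pi) \<partial>lborel)"
    by (rule sh[symmetric]) measurable
  also have "\<dots> = (\<integral>\<^sup>+t. f t * indicator {-pi..<-pi+a} t \<partial>lborel)"
    by (intro nn_integral_cong) (auto simp: per split: split_indicator)
  also have "(\<integral>\<^sup>+t. f t * indicator {-pi+a..<pi} t \<partial>lborel) + \<dots>
      = (\<integral>\<^sup>+t. f t * indicator {-pi+a..<pi} t + f t * indicator {-pi..<-pi+a} t \<partial>lborel)"
    by (rule nn_integral_add[symmetric]) measurable
  also have "\<dots> = (\<integral>\<^sup>+t. f t * indicator {-pi..<pi} t \<partial>lborel)"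
    using a by (intro nn_integral_cong) (auto split: split_indicator)
  finally show ?thesis .
qed

text \<open>The area pi a^2 of a disc fixes the image measure on the half-lines
  \<open>{..a}\<close>, which are stable under intersection and generate the Borel sets; the density
  is the derivative 2 pi r of that area.\<close>

lemma distr_norm_complex:
  "distr lborel borel (norm :: complex \<Rightarrow> real) = density lborel (\<lambda>r. ennreal (2 * pi * r) * indicator {0<..} r)"
proof (rule measure_eqI_generator_eq[where E="range (\<lambda>a::real. {..a})" and \<Omega>=UNIV and A="\<lambda>n. {..real n}"])
  show "Int_stable (range (\<lambda>a::real. {..a}))"
    by (auto simp: Int_stable_def)
  fix X assume "X \<in> range (\<lambda>a::real. {..a})"
  then obtain a where X: "X = {..a}" by auto
  have l: "emeasure (distr lborel borel (norm :: complex \<Rightarrow> real)) X = ennreal (if a \<ge> 0 then pi * a\<^sup>2 else 0)"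
  proof -
    have "norm -` {..a} = (if a \<ge> 0 then cball 0 a else ({} :: complex set))"
    proof (cases "a \<ge> 0")
      case False
      then have "\<not> norm x \<le> a" for x :: complex
        by (meson norm_ge_zero order_trans)
      then show ?thesis using False by auto
    qed auto
    then show ?thesis by (simp add: X emeasure_distr emeasure_cball unit_ball_vol_2)
  qed
  have r: "emeasure (density lborel (\<lambda>r. ennreal (2 * pi * r) * indicator {0<..} r)) X = ennreal (if a \<ge> 0 then pi * a\<^sup>2 else 0)"
  proof (cases "a \<ge> 0")
    case True
    have "emeasure (density lborel (\<lambda>r. ennreal (2 * pi * r) * indicator {0<..} r)) X
        = (\<integral>\<^sup>+r. ennreal (2 * pi * r) * indicator {0..a} r \<partial>lborel)"
      by (subst emeasure_density) (auto simp: X intro!: nn_integral_cong split: split_indicator)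
    also have "\<dots> = ennreal (pi * a\<^sup>2 - pi * 0\<^sup>2)"
      using True by (intro nn_integral_FTC_Icc) (auto intro!: derivative_eq_intros)
    finally show ?thesis using True by simp
  next
    case False
    then show ?thesis
      by (subst emeasure_density) (auto simp: X nn_integral_0_iff_AE split: split_indicator)
  qed
  show "emeasure (distr lborel borel (norm :: complex \<Rightarrow> real)) X =
      emeasure (density lborel (\<lambda>r. ennreal (2 * pi * r) * indicator {0<..} r)) X"
    by (simp only: l r)
next
  show "emeasure (distr lborel borel (norm :: complex \<Rightarrow> real)) {..real n} \<noteq> \<infinity>" for n
  proof -
    have "norm -` {..real n} = (cball 0 (real n) :: complex set)" by auto
    then show ?thesis by (simp add: emeasure_distr emeasure_cball)
  qed
  show "(\<Union>n. {..real n}) = UNIV" using real_arch_simple by auto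
  show "sets (distr lborel borel (norm :: complex \<Rightarrow> real)) = sigma_sets UNIV (range (\<lambda>a::real. {..a}))"
    "sets (density lborel (\<lambda>r. ennreal (2 * pi * r) * indicator {0<..} r)) = sigma_sets UNIV (range (\<lambda>a::real. {..a}))"
    by (simp_all add: borel_eq_atMost)
qed auto

text \<open>Averaging over rotations makes the integrand radial.\<close>

lemma nn_integral_complex_polar:
  fixes F :: "complex \<Rightarrow> ennreal"
  assumes [measurable]: "F \<in> borel_measurable borel"
  shows "(\<integral>\<^sup>+z. F z \<partial>lborel) =
    (\<integral>\<^sup>+r. ennreal r * indicator {0<..} r * (\<integral>\<^sup>+t. F (of_real r * cis t) * indicator {-pi..<pi} t \<partial>lborel) \<partial>lborel)"
proof -
  define G where "G r = (\<integral>\<^sup>+t. F (of_real r * cis t) * indicator {-pi..<pi} t \<partial>lborel)" for r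
  have cis_m[measurable]: "cis \<in> borel_measurable borel"
    by (intro borel_measurable_continuous_onI) (auto intro: continuous_intros)
  have G_m[measurable]: "G \<in> borel_measurable borel"
    unfolding G_def by measurable
  have rot: "distr lborel borel ((*) (cis t)) = (lborel :: complex measure)" for t
  proof (rule distr_lborel_linear_isometry)
    show "linear ((*) (cis t))" by (simp add: linear_iff algebra_simps)
    show "surj ((*) (cis t))"
      by (rule surjI[of _ "\<lambda>z. cis (-t) * z"]) (simp add: cis_mult mult.assoc[symmetric])
  qed (simp_all add: norm_mult)
  have G: "(\<integral>\<^sup>+t. F (cis t * z) * indicator {-pi..<pi} t \<partial>lborel) = G (norm z)" for z
  proof -
    define a where "a = Arg2pi z"
    have a: "0 \<le> a" "a \<le> 2 * pi" and z: "z = of_real (norm z) * cis a"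
      using Arg2pi[of z] Arg2pi_eq[of z] by (auto simp: a_def cis_conv_exp mult.commute is_Arg_def)
    have "(\<integral>\<^sup>+t. F (cis t * z) * indicator {-pi..<pi} t \<partial>lborel)
        = (\<integral>\<^sup>+t. (\<lambda>t. F (of_real (norm z) * cis t)) (t + a) * indicator {-pi..<pi} t \<partial>lborel)"
      by (subst z) (simp add: cis_mult[symmetric] mult_ac)
    also have "\<dots> = G (norm z)"
      unfolding G_def using a by (intro nn_integral_periodic_shift) (auto simp: cis_mult[symmetric])
    finally show ?thesis .
  qed
  have "ennreal (2 * pi) * (\<integral>\<^sup>+z. F z \<partial>lborel) = (\<integral>\<^sup>+t. (\<integral>\<^sup>+z. F z \<partial>lborel) * indicator {-pi..<pi} t \<partial>lborel)"
    by (simp add: nn_integral_cmult mult.commute)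
  also have "\<dots> = (\<integral>\<^sup>+t. (\<integral>\<^sup>+z. F z \<partial>distr lborel borel ((*) (cis t))) * indicator {-pi..<pi} t \<partial>lborel)"
    by (simp add: rot)
  also have "\<dots> = (\<integral>\<^sup>+t. (\<integral>\<^sup>+z. F (cis t * z) * indicator {-pi..<pi} t \<partial>lborel) \<partial>lborel)"
    by (simp add: nn_integral_distr nn_integral_multc)
  also have "\<dots> = (\<integral>\<^sup>+z. (\<integral>\<^sup>+t. F (cis t * z) * indicator {-pi..<pi} t \<partial>lborel) \<partial>lborel)"
    by (rule lborel_pair.Fubini') measurable
  also have "\<dots> = (\<integral>\<^sup>+r. G r \<partial>distr lborel borel (norm :: complex \<Rightarrow> real))"
    by (simp add: G nn_integral_distr)
  also have "\<dots> = (\<integral>\<^sup>+r. ennreal (2 * pi) * (ennreal r * indicator {0<..} r * G r) \<partial>lborel)"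
    unfolding distr_norm_complex
    by (subst nn_integral_density) (auto intro!: nn_integral_cong simp: ennreal_mult mult.assoc split: split_indicator)
  also have "\<dots> = ennreal (2 * pi) * (\<integral>\<^sup>+r. ennreal r * indicator {0<..} r * G r \<partial>lborel)"
    by (rule nn_integral_cmult) measurable
  finally show ?thesis
    by (subst (asm) ennreal_mult_cancel_left) (simp_all add: G_def)
qed

text \<open>Spherical coordinates are planar polar coordinates used twice: once in the complex
  factor, with radius y, and once in the half-plane of the points (x, y) with y > 0. The two
  Jacobians r sin t and r multiply to r^2 sin t.\<close>

lemma nn_integral_real_complex_polar:
  fixes F :: "real \<times> complex \<Rightarrow> ennreal"
  assumes [measurable]: "F \<in> borel_measurable borel"
  shows "(\<integral>\<^sup>+z. F z \<partial>lborel) = (\<integral>\<^sup>+r. ennreal (r\<^sup>2) * indicator {0<..} r *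
    (\<integral>\<^sup>+t. ennreal (sin t) * indicator {0<..<pi} t *
      (\<integral>\<^sup>+p. F (r * cos t, of_real (r * sin t) * cis p) * indicator {-pi..<pi} p \<partial>lborel) \<partial>lborel) \<partial>lborel)"
proof -
  have [measurable]: "F \<in> borel_measurable (borel \<Otimes>\<^sub>M borel)"
    by (simp add: borel_prod)
  have cis_m[measurable]: "cis \<in> borel_measurable borel"
    by (intro borel_measurable_continuous_onI) (auto intro: continuous_intros)
  have Re_m[measurable]: "Re \<in> borel_measurable borel" and Im_m[measurable]: "Im \<in> borel_measurable borel"
    by (auto intro!: borel_measurable_continuous_onI continuous_intros)
  define H where "H w = ennreal (Im w) * indicator {0<..} (Im w) *
    (\<integral>\<^sup>+p. F (Re w, of_real (Im w) * cis p) * indicator {-pi..<pi} p \<partial>lborel)" for w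
  have [measurable]: "H \<in> borel_measurable borel"
    unfolding H_def by measurable
  define T where "T = (\<lambda>(x, y). Complex x y)"
  have T: "distr lborel borel T = (lborel :: complex measure)"
  proof (rule distr_lborel_linear_isometry)
    show "linear T" by (auto simp: linear_iff T_def complex_eq_iff)
    show "surj T" by (rule surjI[of _ "\<lambda>z. (Re z, Im z)"]) (simp add: T_def)
    show "norm (T x) = norm x" for x by (cases x) (simp add: T_def norm_Pair cmod_def)
  qed simp
  have T_m[measurable]: "T \<in> borel_measurable (borel \<Otimes>\<^sub>M borel)"
    unfolding T_def borel_prod
    by (intro borel_measurable_continuous_onI) (auto simp: case_prod_beta Complex_eq intro!: continuous_intros)
  have "(\<integral>\<^sup>+z. F z \<partial>lborel) = (\<integral>\<^sup>+z. F z \<partial>(lborel \<Otimes>\<^sub>M lborel))"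
    by (simp add: lborel_prod)
  also have "\<dots> = (\<integral>\<^sup>+x. (\<integral>\<^sup>+z. F (x, z) \<partial>lborel) \<partial>lborel)"
    by (rule lborel.nn_integral_fst[symmetric]) simp
  also have "\<dots> = (\<integral>\<^sup>+x. (\<integral>\<^sup>+y. H (T (x, y)) \<partial>lborel) \<partial>lborel)"
    by (subst nn_integral_complex_polar) (simp_all add: H_def T_def)
  also have "\<dots> = (\<integral>\<^sup>+z. H (T z) \<partial>(lborel \<Otimes>\<^sub>M lborel))"
    by (rule lborel.nn_integral_fst) simp
  also have "\<dots> = (\<integral>\<^sup>+z. H z \<partial>distr lborel borel T)"
    by (subst nn_integral_distr) (simp_all add: lborel_prod borel_prod[symmetric])
  also have "\<dots> = (\<integral>\<^sup>+r. ennreal r * indicator {0<..} r * (\<integral>\<^sup>+t. H (of_real r * cis t) * indicator {-pi..<pi} t \<partial>lborel) \<partial>lborel)"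
    unfolding T by (rule nn_integral_complex_polar) simp
  also have "\<dots> = (\<integral>\<^sup>+r. ennreal (r\<^sup>2) * indicator {0<..} r *
    (\<integral>\<^sup>+t. ennreal (sin t) * indicator {0<..<pi} t *
      (\<integral>\<^sup>+p. F (r * cos t, of_real (r * sin t) * cis p) * indicator {-pi..<pi} p \<partial>lborel) \<partial>lborel) \<partial>lborel)"
  proof (intro nn_integral_cong)
    fix r :: real
    show "ennreal r * indicator {0<..} r * (\<integral>\<^sup>+t. H (of_real r * cis t) * indicator {-pi..<pi} t \<partial>lborel)
      = ennreal (r\<^sup>2) * indicator {0<..} r *
    (\<integral>\<^sup>+t. ennreal (sin t) * indicator {0<..<pi} t *
      (\<integral>\<^sup>+p. F (r * cos t, of_real (r * sin t) * cis p) * indicator {-pi..<pi} p \<partial>lborel) \<partial>lborel)"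
    proof (cases "r > 0")
      case True
      have "H (of_real r * cis t) * indicator {-pi..<pi} t = ennreal r * (ennreal (sin t) * indicator {0<..<pi} t *
        (\<integral>\<^sup>+p. F (r * cos t, of_real (r * sin t) * cis p) * indicator {-pi..<pi} p \<partial>lborel))" for t
      proof (cases "t \<in> {-pi..<pi}")
        case t: True
        \<comment> \<open>The restriction of \<open>H\<close> to positive imaginary part is what
          shrinks the full range of angles to the range of the polar angle.\<close>
        have "0 < r * sin t \<longleftrightarrow> t \<in> {0<..<pi}"
          using t True sin_gt_zero[of t] sin_ge_zero[of "-t"] by (auto simp: zero_less_mult_iff not_less) (meson linorder_not_less)
        then show ?thesis
          using t True by (auto simp: H_def ennreal_mult sin_gt_zero less_imp_le mult.assoc split: split_indicator)
      qed (auto split: split_indicator)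
      then have "(\<integral>\<^sup>+t. H (of_real r * cis t) * indicator {-pi..<pi} t \<partial>lborel) = ennreal r * 
        (\<integral>\<^sup>+t. ennreal (sin t) * indicator {0<..<pi} t *
        (\<integral>\<^sup>+p. F (r * cos t, of_real (r * sin t) * cis p) * indicator {-pi..<pi} p \<partial>lborel) \<partial>lborel)"
        by (subst nn_integral_cmult[symmetric]) simp_all
      then show ?thesis using True by (simp add: power2_eq_square ennreal_mult mult.assoc)
    qed simp
  qed
  finally show ?thesis .
qed

text \<open>Surface measure of the unit sphere, described by the polar formula. A predicate rather
  than one fixed measure, because later each direction gets a measure from a chart whose axis is
  that direction. The measure lives on the whole space and is concentrated on the sphere.\<close>

definition polar_measure :: "'a::euclidean_space measure \<Rightarrow> bool" where
  "polar_measure \<sigma> \<longleftrightarrow> sets \<sigma> = sets borel \<and> finite_measure \<sigma> \<and> (AE q in \<sigma>. norm q = 1) \<and>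
    (\<forall>F\<in>borel_measurable borel. (\<integral>\<^sup>+x. F x \<partial>lborel) =
      (\<integral>\<^sup>+r. ennreal (r ^ (DIM('a) - 1)) * indicator {0<..} r * (\<integral>\<^sup>+q. F (r *\<^sub>R q) \<partial>\<sigma>) \<partial>lborel))"

text \<open>Separates the calculus from the choice of axes: the polar formula is proved once in a
  model space 'e with an explicit chart \<open>\<gamma>\<close>, and the isometry \<open>T\<close>
  then places the axes of the model along a prescribed orthonormal basis.\<close>

lemma polar_measure_distr:
  fixes T :: "'e::euclidean_space \<Rightarrow> 'a::euclidean_space" and \<gamma> :: "'w \<Rightarrow> 'e"
  assumes lin: "linear T" and norm: "\<And>x. norm (T x) = norm x" and surj: "surj T"
    and dim: "DIM('e) = DIM('a)"
    and fin: "finite_measure \<Omega>" and [measurable]: "\<gamma> \<in> borel_measurable \<Omega>"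
    and norm1: "\<And>w. w \<in> space \<Omega> \<Longrightarrow> norm (\<gamma> w) = 1"
    and polar: "\<And>F :: 'e \<Rightarrow> ennreal. F \<in> borel_measurable borel \<Longrightarrow> (\<integral>\<^sup>+x. F x \<partial>lborel) =
      (\<integral>\<^sup>+r. ennreal (r ^ (DIM('e) - 1)) * indicator {0<..} r * (\<integral>\<^sup>+w. F (r *\<^sub>R \<gamma> w) \<partial>\<Omega>) \<partial>lborel)"
  shows "polar_measure (distr \<Omega> borel (\<lambda>w. T (\<gamma> w)))"
proof -
  have [measurable]: "T \<in> borel_measurable borel"
    using lin by (intro borel_measurable_continuous_onI linear_continuous_on) (simp add: linear_linear)
  show ?thesis
    unfolding polar_measure_def
  proof (intro conjI ballI)
    show "finite_measure (distr \<Omega> borel (\<lambda>w. T (\<gamma> w)))"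
      by (rule finite_measure.finite_measure_distr[OF fin]) simp
    show "AE q in distr \<Omega> borel (\<lambda>w. T (\<gamma> w)). norm q = 1"
      by (simp add: AE_distr_iff norm norm1)
    fix F :: "'a \<Rightarrow> ennreal" assume [measurable]: "F \<in> borel_measurable borel"
    have "(\<integral>\<^sup>+x. F x \<partial>lborel) = (\<integral>\<^sup>+x. F x \<partial>distr lborel borel T)"
      by (simp add: distr_lborel_linear_isometry[OF lin norm surj dim])
    also have "\<dots> = (\<integral>\<^sup>+x. F (T x) \<partial>lborel)"
      by (simp add: nn_integral_distr)
    also have "\<dots> = (\<integral>\<^sup>+r. ennreal (r ^ (DIM('a) - 1)) * indicator {0<..} r *
        (\<integral>\<^sup>+q. F (r *\<^sub>R q) \<partial>distr \<Omega> borel (\<lambda>w. T (\<gamma> w))) \<partial>lborel)"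
      by (subst polar) (simp_all add: dim nn_integral_distr linear_scale[OF lin])
    finally show "(\<integral>\<^sup>+x. F x \<partial>lborel) = (\<integral>\<^sup>+r. ennreal (r ^ (DIM('a) - 1)) * indicator {0<..} r *
        (\<integral>\<^sup>+q. F (r *\<^sub>R q) \<partial>distr \<Omega> borel (\<lambda>w. T (\<gamma> w))) \<partial>lborel)" .
  qed simp
qed

text \<open>Here and in the next two lemmas the first basis vector is prescribed; it will be the
  direction of the frequency k, so that the phase depends on the polar angle alone.\<close>

lemma orthonormal_basis1:
  fixes e :: "'a::euclidean_space"
  assumes "norm e = 1" "DIM('a) = 1"
  shows "\<exists>a. x = a *\<^sub>R e"
proof -
  obtain S where S: "e \<in> S" "card S = DIM('a)" "span S = UNIV"
    using vector_in_orthonormal_basis[OF assms(1)] by metis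
  then have "S = {e}" using assms by (auto simp: card_1_singleton_iff)
  then show ?thesis using S by (metis UNIV_I span_breakdown_eq span_empty eq_iff_diff_eq_0 singletonD)
qed

lemma orthonormal_basis2:
  fixes e :: "'a::euclidean_space"
  assumes "norm e = 1" "DIM('a) = 2"
  obtains e2 where "norm e2 = 1" "e \<bullet> e2 = 0" "\<And>x. \<exists>a b. x = a *\<^sub>R e + b *\<^sub>R e2"
proof -
  obtain S where S: "e \<in> S" "pairwise orthogonal S" "\<And>x. x \<in> S \<Longrightarrow> norm x = 1" "card S = DIM('a)" "span S = UNIV"
    using vector_in_orthonormal_basis[OF assms(1)] by metis
  then obtain e2 where e2: "S = {e, e2}" "e \<noteq> e2" using assms by (auto simp: card_2_iff)
  have "\<exists>a b. x = a *\<^sub>R e + b *\<^sub>R e2" for x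
  proof -
    have "x \<in> span {e, e2}" using S e2 by simp
    then obtain a where "x - a *\<^sub>R e \<in> span {e2}" by (auto simp: span_breakdown_eq)
    then obtain b where "x - a *\<^sub>R e - b *\<^sub>R e2 = 0" by (auto simp: span_breakdown_eq)
    then have "x = a *\<^sub>R e + b *\<^sub>R e2" by (simp add: algebra_simps)
    then show ?thesis by blast
  qed
  then show ?thesis using S e2 by (intro that[of e2]) (auto simp: pairwise_def orthogonal_def)
qed

lemma orthonormal_basis3:
  fixes e :: "'a::euclidean_space"
  assumes "norm e = 1" "DIM('a) = 3"
  obtains e2 e3 where "norm e2 = 1" "norm e3 = 1" "e \<bullet> e2 = 0" "e \<bullet> e3 = 0" "e2 \<bullet> e3 = 0"
    "\<And>x. \<exists>a b c. x = a *\<^sub>R e + b *\<^sub>R e2 + c *\<^sub>R e3"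
proof -
  obtain S where S: "e \<in> S" "pairwise orthogonal S" "\<And>x. x \<in> S \<Longrightarrow> norm x = 1" "card S = DIM('a)" "span S = UNIV"
    using vector_in_orthonormal_basis[OF assms(1)] by metis
  have "card (S - {e}) = 2" using S assms by (simp add: card_Diff_singleton)
  then obtain e2 e3 where e: "S - {e} = {e2, e3}" "e2 \<noteq> e3" by (auto simp: card_2_iff)
  then have e2: "S = {e, e2, e3}" "e \<noteq> e2" "e \<noteq> e3" using S by auto
  have "\<exists>a b c. x = a *\<^sub>R e + b *\<^sub>R e2 + c *\<^sub>R e3" for x
  proof -
    have "x \<in> span {e, e2, e3}" using S e2 by simp
    then obtain a where "x - a *\<^sub>R e \<in> span {e2, e3}" by (auto simp: span_breakdown_eq)
    then obtain b where "x - a *\<^sub>R e - b *\<^sub>R e2 \<in> span {e3}" by (auto simp: span_breakdown_eq)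
    then obtain c where "x - a *\<^sub>R e - b *\<^sub>R e2 - c *\<^sub>R e3 = 0" by (auto simp: span_breakdown_eq)
    then have "x = a *\<^sub>R e + b *\<^sub>R e2 + c *\<^sub>R e3" by (simp add: algebra_simps)
    then show ?thesis by blast
  qed
  then show ?thesis using S e e2 by (intro that[of e2 e3]) (auto simp: pairwise_def orthogonal_def)
qed

lemma polar_measure_dim1:
  fixes e :: "'a::euclidean_space"
  assumes e: "norm e = 1" and dim: "DIM('a) = 1"
  shows "polar_measure (distr (count_space {1, -1}) borel (\<lambda>s. s *\<^sub>R e))"
proof (rule polar_measure_distr[where T="\<lambda>s. s *\<^sub>R e" and \<gamma>="\<lambda>s. s"])
  show "surj (\<lambda>s. s *\<^sub>R e)" using orthonormal_basis1[OF e dim] by (metis surjI surj_def)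
  fix F :: "real \<Rightarrow> ennreal" assume [measurable]: "F \<in> borel_measurable borel"
  have "AE x in lborel. x \<noteq> (0::real)" by (rule AE_lborel_singleton)
  then have "(\<integral>\<^sup>+x. F x \<partial>lborel) = (\<integral>\<^sup>+x. F x * indicator {0<..} x + F x * indicator {..<0} x \<partial>lborel)"
    by (intro nn_integral_cong_AE) (auto split: split_indicator)
  also have "\<dots> = (\<integral>\<^sup>+x. F x * indicator {0<..} x \<partial>lborel) + (\<integral>\<^sup>+x. F x * indicator {..<0} x \<partial>lborel)"
    by (rule nn_integral_add) measurable
  also have "(\<integral>\<^sup>+x. F x * indicator {..<0} x \<partial>lborel) = (\<integral>\<^sup>+x. F x * indicator {..<0} x \<partial>distr lborel borel uminus)"
    by (simp add: lborel_distr_uminus)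
  also have "\<dots> = (\<integral>\<^sup>+x. F (- x) * indicator {0<..} x \<partial>lborel)"
    by (subst nn_integral_distr) (auto intro!: nn_integral_cong split: split_indicator)
  also have "(\<integral>\<^sup>+x. F x * indicator {0<..} x \<partial>lborel) + \<dots> = (\<integral>\<^sup>+x. F x * indicator {0<..} x + F (- x) * indicator {0<..} x \<partial>lborel)"
    by (rule nn_integral_add[symmetric]) measurable
  also have "\<dots> = (\<integral>\<^sup>+r. ennreal (r ^ (DIM(real) - 1)) * indicator {0<..} r * (\<integral>\<^sup>+w. F (r *\<^sub>R w) \<partial>count_space {1,-1}) \<partial>lborel)"
    by (intro nn_integral_cong) (auto simp: nn_integral_count_space_finite split: split_indicator)
  finally show "(\<integral>\<^sup>+x. F x \<partial>lborel) = (\<integral>\<^sup>+r. ennreal (r ^ (DIM(real) - 1)) * indicator {0<..} r * (\<integral>\<^sup>+w. F (r *\<^sub>R w) \<partial>count_space {1,-1}) \<partial>lborel)" .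
qed (auto simp: linear_iff algebra_simps e dim finite_measure_count_space)

lemma polar_measure_dim2:
  fixes e1 e2 :: "'a::euclidean_space"
  assumes e: "norm e1 = 1" "norm e2 = 1" "e1 \<bullet> e2 = 0" "\<And>x. \<exists>a b. x = a *\<^sub>R e1 + b *\<^sub>R e2"
    and dim: "DIM('a) = 2"
  shows "polar_measure (distr (density lborel (indicator {-pi..<pi})) borel (\<lambda>t. cos t *\<^sub>R e1 + sin t *\<^sub>R e2))"
proof -
  have cis_m[measurable]: "cis \<in> borel_measurable borel"
    by (intro borel_measurable_continuous_onI) (auto intro: continuous_intros)
  have "polar_measure (distr (density lborel (indicator {-pi..<pi})) borel (\<lambda>t. (\<lambda>z. Re z *\<^sub>R e1 + Im z *\<^sub>R e2) (cis t)))"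
  proof (rule polar_measure_distr[where T="\<lambda>z. Re z *\<^sub>R e1 + Im z *\<^sub>R e2" and \<gamma>=cis])
    show "surj (\<lambda>z. Re z *\<^sub>R e1 + Im z *\<^sub>R e2)"
      unfolding surj_def by (metis e(4) complex.sel)
    show "norm (Re z *\<^sub>R e1 + Im z *\<^sub>R e2) = norm z" for z
      using e by (simp add: norm_eq_sqrt_inner[of "_ + _"] inner_simps norm_eq_1 inner_commute cmod_def power2_eq_square)
    show "finite_measure (density lborel (indicator {-pi..<pi} :: real \<Rightarrow> ennreal))"
      by (rule finite_measureI) (simp add: emeasure_density)
    fix F :: "complex \<Rightarrow> ennreal" assume [measurable]: "F \<in> borel_measurable borel"
    show "(\<integral>\<^sup>+x. F x \<partial>lborel) = (\<integral>\<^sup>+r. ennreal (r ^ (DIM(complex) - 1)) * indicator {0<..} r *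
        (\<integral>\<^sup>+w. F (r *\<^sub>R cis w) \<partial>density lborel (indicator {-pi..<pi})) \<partial>lborel)"
      by (subst nn_integral_complex_polar) (simp_all add: nn_integral_density scaleR_conv_of_real mult.commute[of "F _"])
  qed (auto simp: linear_iff algebra_simps dim)
  then show ?thesis by simp
qed

lemma polar_measure_dim3:
  fixes e1 e2 e3 :: "'a::euclidean_space"
  assumes e: "norm e1 = 1" "norm e2 = 1" "norm e3 = 1" "e1 \<bullet> e2 = 0" "e1 \<bullet> e3 = 0" "e2 \<bullet> e3 = 0"
    "\<And>x. \<exists>a b c. x = a *\<^sub>R e1 + b *\<^sub>R e2 + c *\<^sub>R e3"
    and dim: "DIM('a) = 3"
  shows "polar_measure (distr (density lborel (\<lambda>t. ennreal (sin t) * indicator {0<..<pi} t) \<Otimes>\<^sub>M density lborel (indicator {-pi..<pi})) borel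
    (\<lambda>(t, p). cos t *\<^sub>R e1 + (sin t * cos p) *\<^sub>R e2 + (sin t * sin p) *\<^sub>R e3))"
proof -
  have cis_m[measurable]: "cis \<in> borel_measurable borel"
    by (intro borel_measurable_continuous_onI) (auto intro: continuous_intros)
  let ?A = "density lborel (\<lambda>t. ennreal (sin t) * indicator {0<..<pi} t)"
  let ?B = "density lborel (indicator {-pi..<pi} :: real \<Rightarrow> ennreal)"
  have A: "finite_measure ?A"
  proof (rule finite_measureI)
    have "emeasure ?A (space ?A) = (\<integral>\<^sup>+t. ennreal (sin t) * indicator {0<..<pi} t \<partial>lborel)"
      by (simp add: emeasure_density)
    also have "\<dots> \<le> (\<integral>\<^sup>+t. indicator {0<..<pi} t \<partial>lborel)"
      by (intro nn_integral_mono) (auto split: split_indicator simp: ennreal_le_1)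
    also have "\<dots> < \<infinity>" by simp
    finally show "emeasure ?A (space ?A) \<noteq> \<infinity>" by simp
  qed
  have B: "finite_measure ?B"
    by (rule finite_measureI) (simp add: emeasure_density)
  interpret A: finite_measure ?A by fact
  interpret B: finite_measure ?B by fact
  let ?T = "\<lambda>(x, z). x *\<^sub>R e1 + Re z *\<^sub>R e2 + Im z *\<^sub>R e3"
  let ?g = "\<lambda>(t, p). (cos t, of_real (sin t) * cis p)"
  have "polar_measure (distr (?A \<Otimes>\<^sub>M ?B) borel (\<lambda>w. ?T (?g w)))"
  proof (rule polar_measure_distr[where T="?T" and \<gamma>="?g"])
    show "linear ?T" by (auto simp: linear_iff algebra_simps)
    show "surj ?T"
      unfolding surj_def
    proof
      fix y obtain a b c where "y = a *\<^sub>R e1 + b *\<^sub>R e2 + c *\<^sub>R e3" using e by metis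
      then show "\<exists>x. y = ?T x" by (intro exI[of _ "(a, Complex b c)"]) simp
    qed
    show "norm (?T x) = norm x" for x
      using e by (cases x) (simp add: norm_eq_sqrt_inner[of "_ + _"] inner_simps norm_eq_1 inner_commute norm_Pair cmod_def power2_eq_square)
    show "finite_measure (?A \<Otimes>\<^sub>M ?B)" 
      by (rule finite_measureI, simp only: space_pair_measure B.emeasure_pair_measure_Times sets.top)
        (simp add: ennreal_mult_eq_top_iff)
    show "?g \<in> borel_measurable (?A \<Otimes>\<^sub>M ?B)" by measurable
    show "norm (?g w) = 1" for w by (cases w) (simp add: norm_Pair norm_mult)
    fix F :: "real \<times> complex \<Rightarrow> ennreal" assume [measurable]: "F \<in> borel_measurable borel"
    have [measurable]: "F \<in> borel_measurable (borel \<Otimes>\<^sub>M borel)"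
      by (simp add: borel_prod)
    show "(\<integral>\<^sup>+x. F x \<partial>lborel) = (\<integral>\<^sup>+r. ennreal (r ^ (DIM(real \<times> complex) - 1)) * indicator {0<..} r *
        (\<integral>\<^sup>+w. F (r *\<^sub>R ?g w) \<partial>(?A \<Otimes>\<^sub>M ?B)) \<partial>lborel)"
      by (subst nn_integral_real_complex_polar, simp)
        (simp add: B.nn_integral_fst[symmetric] nn_integral_density scaleR_conv_of_real mult.commute[of "F _"] mult.assoc power2_eq_square)
  qed (simp add: dim)
  then show ?thesis by (simp add: case_prod_unfold)
qed

section \<open>Oscillatory integrals\<close>

lemma integrable_complex_gaussian:
  assumes "Re a > 0"
  shows "integrable lborel (\<lambda>u::real. exp (- (a * of_real (u\<^sup>2))))"
proof -
  \<comment> \<open>The standard deviation for which the normal density is a multiple of exp(- Re a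
    u^2).\<close>
  define s where "s = 1 / sqrt (2 * Re a)"
  have s: "s > 0" "2 * s\<^sup>2 = 1 / Re a" using assms by (auto simp: s_def power_divide)
  have "integrable lborel (\<lambda>u. sqrt (2 * pi * s\<^sup>2) * normal_density 0 s u)"
    using integrable_normal_density[of s 0] s by simp
  also have "(\<lambda>u. sqrt (2 * pi * s\<^sup>2) * normal_density 0 s u) = (\<lambda>u. exp (- Re a * u\<^sup>2))"
    using s assms by (auto simp: normal_density_def)
  finally have "integrable lborel (\<lambda>u. exp (- Re a * u\<^sup>2))" .
  then show ?thesis
    by (rule Bochner_Integration.integrable_bound)
      (auto simp: norm_exp_eq_Re intro!: borel_measurable_continuous_onI continuous_intros)
qed

definition complex_gaussian :: "complex \<Rightarrow> complex" where
  "complex_gaussian a = (LINT u|lborel. exp (- (a * of_real ((u::real)\<^sup>2))))"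

text \<open>The classical squaring argument survives a complex parameter: the product of two copies
  is a function of the modulus on the plane, and the radial density 2 pi r supplies the factor that
  makes it explicitly integrable.\<close>

lemma complex_gaussian_squared:
  assumes a: "Re a > 0"
  shows "(complex_gaussian a)\<^sup>2 = of_real pi / a"
proof -
  let ?g = "\<lambda>u::real. exp (- (a * of_real (u\<^sup>2)))"
  have a0: "a \<noteq> 0" using a by auto
  note int = integrable_complex_gaussian[OF a]
  have g_m[measurable]: "?g \<in> borel_measurable borel"
    by (intro borel_measurable_continuous_onI continuous_intros)
  define T where "T = (\<lambda>(x, y). Complex x y)"
  have T: "distr lborel borel T = (lborel :: complex measure)"
  proof (rule distr_lborel_linear_isometry)
    show "linear T" by (auto simp: linear_iff T_def complex_eq_iff)
    show "surj T" by (rule surjI[of _ "\<lambda>z. (Re z, Im z)"]) (simp add: T_def)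
    show "norm (T x) = norm x" for x by (cases x) (simp add: T_def norm_Pair cmod_def)
  qed simp
  have T_m[measurable]: "T \<in> borel_measurable (borel \<Otimes>\<^sub>M borel)"
    unfolding T_def borel_prod
    by (intro borel_measurable_continuous_onI) (auto simp: case_prod_beta Complex_eq intro!: continuous_intros)
  have gg: "?g (norm (T z)) = ?g (fst z) * ?g (snd z)" for z
    by (cases z) (simp add: T_def cmod_power2 exp_add[symmetric] algebra_simps)
  have int2: "integrable (lborel \<Otimes>\<^sub>M lborel) (\<lambda>(x, y). ?g x * ?g y)"
  proof (rule lborel_pair.Fubini_integrable)
    show "integrable lborel (\<lambda>x. LINT y|lborel. norm (case (x, y) of (x, y) \<Rightarrow> ?g x * ?g y))"
      using integrable_norm[OF int] by (simp add: norm_mult)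
    show "AE x in lborel. integrable lborel (\<lambda>y. case (x, y) of (x, y) \<Rightarrow> ?g x * ?g y)"
      using int by simp
  qed measurable
  have int3: "integrable (lborel :: complex measure) (\<lambda>z. ?g (norm z))"
    unfolding T[symmetric] using int2
    by (subst integrable_distr_eq) (simp_all add: lborel_prod[symmetric] gg case_prod_unfold del: of_real_power flip: borel_prod)
  have int4: "integrable lborel (\<lambda>r. (2 * pi * r * indicator {0<..} r) *\<^sub>R ?g r)"
  proof -
    have "integrable (distr lborel borel (norm :: complex \<Rightarrow> real)) ?g"
      using int3 by (subst integrable_distr_eq) simp_all
    also have "distr lborel borel (norm :: complex \<Rightarrow> real) = density lborel (\<lambda>r. ennreal (2 * pi * r * indicator {0<..} r))"
      unfolding distr_norm_complex by (intro density_cong) (auto split: split_indicator)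
    finally show ?thesis
      by (subst (asm) integrable_density) (auto split: split_indicator)
  qed
  have "(complex_gaussian a)\<^sup>2 = (LINT x|lborel. LINT y|lborel. ?g x * ?g y)"
    by (simp add: complex_gaussian_def power2_eq_square)
  also have "\<dots> = (LINT z|(lborel \<Otimes>\<^sub>M lborel). (\<lambda>(x, y). ?g x * ?g y) z)"
    using lborel_pair.integral_fst'[OF int2] by simp
  also have "\<dots> = (LINT z|distr lborel borel T. ?g (norm z))"
    by (subst integral_distr) (simp_all add: lborel_prod[symmetric] gg case_prod_unfold del: of_real_power flip: borel_prod)
  also have "\<dots> = (LINT r|distr lborel borel (norm :: complex \<Rightarrow> real). ?g r)"
    by (subst integral_distr) (simp_all add: T)
  also have "distr lborel borel (norm :: complex \<Rightarrow> real) = density lborel (\<lambda>r. ennreal (2 * pi * r * indicator {0<..} r))"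
    unfolding distr_norm_complex by (intro density_cong) (auto split: split_indicator)
  also have "(LINT r|\<dots>. ?g r) = (LINT r|lborel. (2 * pi * r * indicator {0<..} r) *\<^sub>R ?g r)"
    by (rule integral_density) (auto split: split_indicator)
  also have "\<dots> = of_real pi / a"
  proof (rule tendsto_unique[OF _ tendsto_integral_at_top[OF _ int4]])
    \<comment> \<open>Antiderivative of 2 pi r exp(-a r^2). It tends to 0 at infinity, so the value
      comes from the end point 0.\<close>
    let ?P = "\<lambda>r::real. - (of_real pi / a) * ?g r"
    have fin: "(LINT r|lborel. indicator {..y} r *\<^sub>R ((2 * pi * r * indicator {0<..} r) *\<^sub>R ?g r)) = ?P y - ?P 0"
      if "y > 0" for y
    proof -
      have "(LINT r|lborel. indicator {..y} r *\<^sub>R ((2 * pi * r * indicator {0<..} r) *\<^sub>R ?g r))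
        = (LINT r|lborel. indicator {0..y} r *\<^sub>R (of_real (2 * pi * r) * ?g r))"
        by (intro Bochner_Integration.integral_cong) (auto simp: scaleR_conv_of_real split: split_indicator)
      also have "\<dots> = ?P y - ?P 0"
        using that a0
        by (intro integral_FTC_Icc)
          (auto intro!: derivative_eq_intros continuous_intros has_vector_derivative_real_field
            simp: field_simps power2_eq_square)
      finally show ?thesis .
    qed
    have lim: "((\<lambda>y::real. ?g y) \<longlongrightarrow> 0) at_top"
    proof (rule Lim_null_comparison)
      show "\<forall>\<^sub>F y in at_top. norm (?g y) \<le> inverse (Re a * y\<^sup>2)"
      proof (rule eventually_at_top_linorderI[of 1])
        fix y :: real assume "1 \<le> y"
        then have p: "Re a * y\<^sup>2 > 0" using a by simp
        have "norm (?g y) = inverse (exp (Re a * y\<^sup>2))" by (simp add: norm_exp_eq_Re flip: exp_minus)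
        also have "\<dots> \<le> inverse (Re a * y\<^sup>2)"
          using p exp_ge_add_one_self[of "Re a * y\<^sup>2"] by (intro le_imp_inverse_le) linarith+
        finally show "norm (?g y) \<le> inverse (Re a * y\<^sup>2)" .
      qed
      show "((\<lambda>y. inverse (Re a * y\<^sup>2)) \<longlongrightarrow> 0) at_top"
        using a by (intro tendsto_inverse_0_at_top filterlim_tendsto_pos_mult_at_top[OF tendsto_const] filterlim_pow_at_top filterlim_ident) auto
    qed
    have "((\<lambda>y. ?P y - ?P 0) \<longlongrightarrow> - (of_real pi / a) * 0 - ?P 0) at_top"
      by (intro tendsto_intros lim)
    then have "((\<lambda>y. ?P y - ?P 0) \<longlongrightarrow> of_real pi / a) at_top" by simp
    then show "((\<lambda>y. LINT r|lborel. indicator {..y} r *\<^sub>R ((2 * pi * r * indicator {0<..} r) *\<^sub>R ?g r)) \<longlongrightarrow> of_real pi / a) at_top"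
    proof (rule Lim_transform_eventually)
      show "\<forall>\<^sub>F y in at_top. ?P y - ?P 0 = (LINT r|lborel. indicator {..y} r *\<^sub>R ((2 * pi * r * indicator {0<..} r) *\<^sub>R ?g r))"
        using eventually_gt_at_top[of 0] by eventually_elim (simp only: fin)
    qed
  qed simp_all
  finally show ?thesis .
qed

text \<open>The square determines the integral up to sign. Divided by its expected value it becomes
  a continuous function of the real parameter with values in {1, -1}, hence constant, and at
  parameter 0 the integrand is positive.\<close>

lemma complex_gaussian_eq:
  "complex_gaussian (1 - \<i> * of_real m) = csqrt (of_real pi) / csqrt (1 - \<i> * of_real m)"
proof -
  define a where "a x = 1 - \<i> * of_real x" for x :: real
  have Re_a: "Re (a x) = 1" for x by (simp add: a_def)
  then have a0: "a x \<noteq> 0" for x by (metis zero_complex.sel(1) zero_neq_one)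
  define s where "s x = complex_gaussian (a x) * csqrt (a x) / csqrt (of_real pi)" for x
  have s2: "(s x)\<^sup>2 = 1" for x
    using complex_gaussian_squared[of "a x"] Re_a a0[of x]
    by (simp add: s_def power_mult_distrib power_divide flip: of_real_power)
  have cont_g: "isCont (\<lambda>x. complex_gaussian (a x)) x" for x
  proof -
    have "((\<lambda>x. complex_gaussian (a x)) \<longlongrightarrow> complex_gaussian (a x)) (at x)"
      unfolding complex_gaussian_def
    proof (subst tendsto_at_iff_sequentially, intro allI impI, unfold comp_def)
      fix X :: "nat \<Rightarrow> real" assume X: "X \<longlonglongrightarrow> x"
      show "(\<lambda>n. LINT u|lborel. exp (- (a (X n) * of_real (u\<^sup>2)))) \<longlonglongrightarrow> (LINT u|lborel. exp (- (a x * of_real (u\<^sup>2))))"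
      proof (rule integral_dominated_convergence)
        show "integrable lborel (\<lambda>u. norm (exp (- (1 * of_real ((u::real)\<^sup>2)) :: complex)))"
          by (intro integrable_norm integrable_complex_gaussian) simp
        show "AE u in lborel. (\<lambda>n. exp (- (a (X n) * of_real (u\<^sup>2)))) \<longlonglongrightarrow> exp (- (a x * of_real (u\<^sup>2)))"
          unfolding a_def by (intro always_eventually allI tendsto_intros X)
      qed (auto simp: norm_exp_eq_Re a_def intro!: borel_measurable_continuous_onI continuous_intros)
    qed
    then show ?thesis by (simp add: isCont_def)
  qed
  have cont_s: "isCont s x" for x
  proof -
    have "isCont (\<lambda>x. csqrt (a x)) x"
      unfolding a_def by (rule isCont_o2[of _ "\<lambda>x. 1 - \<i> * of_real x"])
        (auto intro!: continuous_intros continuous_at_csqrt simp: complex_nonpos_Reals_iff)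
    then show ?thesis unfolding s_def by (intro continuous_intros cont_g) auto
  qed
  have s_cases: "s x = 1 \<or> s x = -1" for x using s2[of x] by (simp add: power2_eq_1_iff)
  have s0: "s 0 = 1"
  proof -
    have "complex_gaussian (a 0) = of_real (LINT u|lborel. exp (- (u::real)\<^sup>2))"
      unfolding complex_gaussian_def a_def integral_complex_of_real[symmetric]
      by (intro Bochner_Integration.integral_cong) (auto simp: exp_of_real[symmetric])
    moreover have "(LINT u|lborel. exp (- (u::real)\<^sup>2)) \<ge> 0" by (rule Bochner_Integration.integral_nonneg) simp
    ultimately have "Re (s 0) \<ge> 0" by (simp add: s_def a_def of_real_sqrt[symmetric] flip: of_real_divide)
    then show ?thesis using s_cases[of 0] by auto
  qed
  \<comment> \<open>A connected finite set in the plane is a single point.\<close>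
  have "connected (range s)"
    using cont_s by (intro connected_continuous_image continuous_at_imp_continuous_on) auto
  moreover have "finite (range s)"
    by (rule finite_subset[of _ "{1, -1}"]) (use s_cases in auto)
  ultimately have "\<exists>y. range s = {y}"
    by (metis connected_finite_iff_sing empty_not_UNIV image_is_empty)
  then have "s m = 1" using s0 by (metis rangeI singletonD)
  then show ?thesis using a0[of m] by (simp add: s_def field_simps a_def)
qed

section \<open>Oscillatory integrals with phase l cos t\<close>

text \<open>With t the angle between q and the axis e this is exp(-i l e.q). The stationary points
  are t = 0 and t = pi, the two poles.\<close>

definition osc :: "real \<Rightarrow> real \<Rightarrow> complex" where
  "osc l t = exp (- (\<i> * of_real (l * cos t)))"

lemma norm_osc [simp]: "norm (osc l t) = 1"
  by (simp add: osc_def norm_exp_eq_Re)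

lemma continuous_on_osc [continuous_intros]: "continuous_on S (osc l)"
  unfolding osc_def by (intro continuous_intros)

lemma osc_uminus [simp]: "osc l (- t) = osc l t"
  by (simp add: osc_def)

lemma has_vector_derivative_osc:
  "(osc l has_vector_derivative (\<i> * of_real (l * sin t) * osc l t)) (at t within S)"
proof -
  have "((\<lambda>z. exp (- (\<i> * (of_real l * cos z)))) has_field_derivative \<i> * (of_real l * sin (of_real t)) * exp (- (\<i> * (of_real l * cos (of_real t)))))
      (at (of_real t))"
    by (auto intro!: derivative_eq_intros)
  from has_vector_derivative_real_field[OF this] show ?thesis
    unfolding osc_def by (auto simp: o_def cos_of_real sin_of_real)
qed

text \<open>The derivative of \<open>osc l\<close> is i l sin t times \<open>osc l\<close> itself.
  An amplitude that already carries the factor sin t can therefore be integrated by parts across the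
  stationary points without a division.\<close>

lemma osc_by_parts:
  fixes H H' :: "real \<Rightarrow> complex"
  assumes ab: "a \<le> b" and H: "\<And>t. t \<in> {a..b} \<Longrightarrow> (H has_vector_derivative H' t) (at t within {a..b})"
    and H': "continuous_on {a..b} H'"
  shows "\<i> * of_real l * integral {a..b} (\<lambda>t. H t * of_real (sin t) * osc l t) =
    H b * osc l b - H a * osc l a - integral {a..b} (\<lambda>t. H' t * osc l t)"
proof -
  have cH: "continuous_on {a..b} H"
    using H by (rule continuous_on_vector_derivative)
  have 1: "((\<lambda>t. H t * (\<i> * of_real (l * sin t) * osc l t) + H' t * osc l t) has_integral (H b * osc l b - H a * osc l a)) {a..b}"
    by (intro fundamental_theorem_of_calculus ab has_vector_derivative_mult H has_vector_derivative_osc)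
  have 2: "((\<lambda>t. H' t * osc l t) has_integral integral {a..b} (\<lambda>t. H' t * osc l t)) {a..b}"
    by (intro integrable_integral integrable_continuous_interval continuous_intros H')
  have "((\<lambda>t. (\<i> * of_real l) * (H t * of_real (sin t) * osc l t)) has_integral
     (H b * osc l b - H a * osc l a - integral {a..b} (\<lambda>t. H' t * osc l t))) {a..b}"
    using has_integral_diff[OF 1 2] by (simp add: mult_ac)
  from integral_unique[OF this] show ?thesis
    by (simp only: integral_mult_right)
qed

lemma norm_diff_diff_le:
  fixes x y z :: "'a::real_normed_vector"
  shows "norm (x - y - z) \<le> norm x + norm y + norm z"
  using norm_triangle_ineq4[of "x - y" z] norm_triangle_ineq4[of x y] by linarith

lemma osc_by_parts_bound:
  fixes H H' :: "real \<Rightarrow> complex"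
  assumes ab: "a \<le> b" and H: "\<And>t. t \<in> {a..b} \<Longrightarrow> (H has_vector_derivative H' t) (at t within {a..b})"
    and H': "continuous_on {a..b} H'"
    and M: "\<And>t. t \<in> {a..b} \<Longrightarrow> norm (H t) \<le> M" and M': "\<And>t. t \<in> {a..b} \<Longrightarrow> norm (H' t) \<le> M'"
    and l: "l > 0"
  shows "norm (integral {a..b} (\<lambda>t. H t * of_real (sin t) * osc l t)) \<le> (2 * M + M' * (b - a)) / l"
proof -
  have eq: "\<i> * of_real l * integral {a..b} (\<lambda>t. H t * of_real (sin t) * osc l t) =
    H b * osc l b - H a * osc l a - integral {a..b} (\<lambda>t. H' t * osc l t)"
    by (rule osc_by_parts) (use ab H H' in auto)
  have "norm (\<i> * of_real l * integral {a..b} (\<lambda>t. H t * of_real (sin t) * osc l t))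
    \<le> norm (H b * osc l b) + norm (H a * osc l a) + norm (integral {a..b} (\<lambda>t. H' t * osc l t))"
    unfolding eq by (rule norm_diff_diff_le)
  also have "\<dots> \<le> M + M + M' * (b - a)"
    using M M' ab by (intro add_mono integral_bound continuous_intros H') (auto simp: norm_mult)
  finally show ?thesis using l by (simp add: norm_mult field_simps)
qed

text \<open>Isolates the strips around the poles, where sin t vanishes and division by it is
  impossible.\<close>

lemma integral_split3:
  fixes f :: "real \<Rightarrow> complex"
  assumes "continuous_on {0..pi} f" "0 < d" "d < pi / 2"
  shows "integral {0..pi} f = integral {0..d} f + integral {d..pi - d} f + integral {pi - d..pi} f"
proof -
  have "f integrable_on {0..pi}" using assms by (intro integrable_continuous_interval)
  moreover from this have "f integrable_on {0..pi - d}"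
    by (rule integrable_on_subinterval) (use assms in auto)
  ultimately show ?thesis
    using assms Henstock_Kurzweil_Integration.integral_combine[of 0 d "pi - d" f]
      Henstock_Kurzweil_Integration.integral_combine[of 0 "pi - d" pi f] by simp
qed

lemma has_vector_derivative_divide_sin:
  fixes F :: "real \<Rightarrow> complex"
  assumes "(F has_vector_derivative F') (at t within S)" "sin t \<noteq> 0"
  shows "((\<lambda>t. F t / of_real (sin t)) has_vector_derivative
    (F' * of_real (sin t) - F t * of_real (cos t)) / of_real ((sin t)\<^sup>2)) (at t within S)"
proof -
  have "((\<lambda>t. inverse (of_real (sin t) :: complex)) has_vector_derivative of_real (- (cos t / (sin t)\<^sup>2))) (at t within S)"
  proof -
    have "((\<lambda>t. of_real (inverse (sin t)) :: complex) has_vector_derivative of_real (- (cos t / (sin t)\<^sup>2))) (at t within S)"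
    proof (rule has_vector_derivative_of_real)
      have "((\<lambda>t. inverse (sin t)) has_real_derivative - (inverse (sin t) * cos t * inverse (sin t))) (at t within S)"
        using assms(2) by (intro DERIV_inverse' DERIV_sin DERIV_subset[OF DERIV_sin subset_UNIV])
      then show "((\<lambda>t. inverse (sin t)) has_real_derivative - (cos t / (sin t)\<^sup>2)) (at t within S)"
        by (simp add: power2_eq_square field_simps)
    qed
    then show ?thesis by simp
  qed
  from has_vector_derivative_mult[OF assms(1) this] show ?thesis
    using assms(2) by (simp add: divide_inverse power2_eq_square algebra_simps)
qed

text \<open>A Riemann-Lebesgue lemma. Integration by parts needs a derivative and a factor sin t:
  the first is gained by replacing g with a polynomial, the second by dividing by sin t away from
  the poles. The two strips at the poles are bounded by their length.\<close>

lemma osc_integral_tendsto_0: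
  fixes g :: "real \<Rightarrow> complex"
  assumes g: "continuous_on {0..pi} g"
  shows "((\<lambda>l. integral {0..pi} (\<lambda>t. g t * osc l t)) \<longlongrightarrow> 0) at_top"
proof (rule tendstoI)
  fix e :: real assume e: "e > 0"
  \<comment> \<open>Over an interval of length pi the polynomial approximation then costs e/4. With
    C/l < e/4 and two strips of e/8 each, the total stays below e.\<close>
  define e' where "e' = e / (4 * pi)"
  have e': "e' > 0" using e by (simp add: e'_def)
  obtain p where p: "polynomial_function p" and gp: "\<And>t. t \<in> {0..pi} \<Longrightarrow> norm (g t - p t) < e'"
    using Stone_Weierstrass_polynomial_function[OF _ g e'] by auto
  obtain p' where p': "polynomial_function p'" and dp: "\<And>t. (p has_vector_derivative p' t) (at t)"
    using has_vector_derivative_polynomial_function[OF p] by metis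
  have cp: "continuous_on S p" and cp': "continuous_on S p'" for S
    using p p' by (auto intro: continuous_on_polymonial_function)
  obtain M where M: "M > 0" "\<And>t. t \<in> {0..pi} \<Longrightarrow> norm (p t) \<le> M"
    using compact_imp_bounded[OF compact_continuous_image[OF cp compact_Icc[of 0 pi]]] by (auto simp: bounded_pos)
  define d where "d = min (e / (8 * M)) (pi / 4)"
  have d: "0 < d" "d < pi / 2" "M * d \<le> e / 8"
    using e M by (auto simp: d_def min_def field_simps)
  have sin: "sin t > 0" if "t \<in> {d..pi - d}" for t using that d by (intro sin_gt_zero) auto
  define H where "H t = p t / of_real (sin t)" for t
  define H' where "H' t = (p' t * of_real (sin t) - p t * of_real (cos t)) / of_real ((sin t)\<^sup>2)" for t
  have dH: "(H has_vector_derivative H' t) (at t within {d..pi - d})" if "t \<in> {d..pi - d}" for t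
    unfolding H_def H'_def using sin[OF that]
    by (intro has_vector_derivative_divide_sin has_vector_derivative_at_within[OF dp]) auto
  have cH': "continuous_on {d..pi - d} H'"
    unfolding H'_def using sin by (intro continuous_intros cp cp') (auto dest: sin)
  have cH: "continuous_on {d..pi - d} H"
    unfolding H_def using sin by (intro continuous_intros cp) (auto dest: sin)
  obtain K where K: "\<And>t. t \<in> {d..pi - d} \<Longrightarrow> norm (H t) \<le> K"
    using compact_imp_bounded[OF compact_continuous_image[OF cH compact_Icc]] unfolding bounded_iff by blast
  obtain K' where K': "\<And>t. t \<in> {d..pi - d} \<Longrightarrow> norm (H' t) \<le> K'"
    using compact_imp_bounded[OF compact_continuous_image[OF cH' compact_Icc]] unfolding bounded_iff by blast
  define C where "C = 2 * K + K' * (pi - d - d)"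
  have "((\<lambda>l. C / l) \<longlongrightarrow> 0) at_top"
    by (intro tendsto_divide_0[OF tendsto_const] filterlim_at_top_imp_at_infinity filterlim_ident)
  then have "\<forall>\<^sub>F l in at_top. dist (C / l) 0 < e / 4"
    using e by (intro tendstoD) auto
  then show "\<forall>\<^sub>F l in at_top. dist (integral {0..pi} (\<lambda>t. g t * osc l t)) 0 < e"
    using eventually_gt_at_top[of 0]
  proof eventually_elim
    case (elim l)
    have co: "continuous_on S (\<lambda>t. p t * osc l t)" for S by (intro continuous_intros cp)
    have "norm (integral {d..pi - d} (\<lambda>t. p t * osc l t)) = norm (integral {d..pi - d} (\<lambda>t. H t * of_real (sin t) * osc l t))"
    proof (intro arg_cong[where f=norm] integral_cong)
      fix t assume "t \<in> {d..pi - d}"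
      then show "p t * osc l t = H t * of_real (sin t) * osc l t"
        using sin[of t] by (simp add: H_def)
    qed
    also have "\<dots> \<le> C / l"
      unfolding C_def using d elim by (intro osc_by_parts_bound[where H'=H'] dH cH' K K') auto
    finally have 1: "norm (integral {d..pi - d} (\<lambda>t. p t * osc l t)) \<le> C / l" .
    have 2: "norm (integral {0..d} (\<lambda>t. p t * osc l t)) \<le> M * (d - 0)"
      using d M by (intro integral_bound co) (auto simp: norm_mult)
    have 3: "norm (integral {pi - d..pi} (\<lambda>t. p t * osc l t)) \<le> M * (pi - (pi - d))"
      using d M by (intro integral_bound co) (auto simp: norm_mult)
    have 4: "norm (integral {0..pi} (\<lambda>t. (g t - p t) * osc l t)) \<le> e' * (pi - 0)"
      using gp by (intro integral_bound continuous_intros g cp) (auto simp: norm_mult intro: less_imp_le)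
    have "integral {0..pi} (\<lambda>t. g t * osc l t) = integral {0..pi} (\<lambda>t. (g t - p t) * osc l t + p t * osc l t)"
      by (simp add: algebra_simps)
    also have "\<dots> = integral {0..pi} (\<lambda>t. (g t - p t) * osc l t) + integral {0..pi} (\<lambda>t. p t * osc l t)"
      by (intro Henstock_Kurzweil_Integration.integral_add integrable_continuous_interval continuous_intros g cp)
    also have "norm \<dots> \<le> norm (integral {0..pi} (\<lambda>t. (g t - p t) * osc l t))
      + (norm (integral {0..d} (\<lambda>t. p t * osc l t)) + norm (integral {d..pi - d} (\<lambda>t. p t * osc l t))
        + norm (integral {pi - d..pi} (\<lambda>t. p t * osc l t)))"
      unfolding integral_split3[OF co d(1,2)]
      by (intro order_trans[OF norm_triangle_ineq] add_mono order_refl)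
    finally have "norm (integral {0..pi} (\<lambda>t. g t * osc l t)) \<le> e' * pi + M * d + C / l + M * d"
      using 1 2 3 4 by simp
    also have "\<dots> < e"
    proof -
      have "\<bar>C / l\<bar> < e / 4" using elim(1) unfolding dist_real_def by (simp only: diff_0_right)
      then have "C / l < e / 4" by linarith
      moreover have "e' * pi = e / 4" by (simp add: e'_def)
      ultimately show ?thesis using d e by linarith
    qed
    finally show ?case by simp
  qed
qed

text \<open>One integration by parts: the boundary term at 0 is the limit, the one at pi vanishes
  with F, and the remaining integral of F' tends to 0 by the Riemann-Lebesgue lemma. This is exact
  stationary phase on the 2-sphere, where the surface measure supplies sin t.\<close>

lemma osc_sin_integral_limit:
  fixes F F' :: "real \<Rightarrow> complex"
  assumes F: "\<And>t. t \<in> {0..pi} \<Longrightarrow> (F has_vector_derivative F' t) (at t within {0..pi})"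
    and F': "continuous_on {0..pi} F'" and Fpi: "F pi = 0"
  shows "((\<lambda>l. of_real l * exp (\<i> * of_real l) * integral {0..pi} (\<lambda>t. F t * of_real (sin t) * osc l t)) \<longlongrightarrow> \<i> * F 0) at_top"
proof -
  have eq: "of_real l * exp (\<i> * of_real l) * integral {0..pi} (\<lambda>t. F t * of_real (sin t) * osc l t)
    = \<i> * F 0 + \<i> * (exp (\<i> * of_real l) * integral {0..pi} (\<lambda>t. F' t * osc l t))" for l
  proof -
    have e: "exp (\<i> * of_real l) * osc l 0 = 1"
      by (simp add: osc_def exp_minus_inverse)
    define I J where "I = integral {0..pi} (\<lambda>t. F t * of_real (sin t) * osc l t)"
      and "J = integral {0..pi} (\<lambda>t. F' t * osc l t)"
    have "\<i> * of_real l * I = F pi * osc l pi - F 0 * osc l 0 - J"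
      unfolding I_def J_def by (rule osc_by_parts) (use F F' in auto)
    then have IJ: "\<i> * of_real l * I = - F 0 * osc l 0 - J" using Fpi by simp
    have "of_real l * exp (\<i> * of_real l) * I
      = - \<i> * exp (\<i> * of_real l) * (\<i> * of_real l * I)"
      by (simp add: algebra_simps)
    also have "\<dots> = \<i> * F 0 * (exp (\<i> * of_real l) * osc l 0) + \<i> * (exp (\<i> * of_real l) * J)"
      unfolding IJ by (simp add: algebra_simps)
    finally show ?thesis by (simp add: e I_def J_def)
  qed
  have "((\<lambda>l. exp (\<i> * of_real l) * integral {0..pi} (\<lambda>t. F' t * osc l t)) \<longlongrightarrow> 0) at_top"
    using osc_integral_tendsto_0[OF F'] by (simp add: tendsto_norm_zero_iff[symmetric, where 'b=complex] norm_mult norm_exp_eq_Re)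
  from tendsto_add[OF tendsto_const tendsto_mult_right_zero[OF this, of \<i>], of "\<i> * F 0"]
  show ?thesis unfolding eq by simp
qed

text \<open>A weak Jordan inequality: up to pi/3 the derivative cos is at least 1/2, and beyond it
  sin is at least 1/2 while t/4 is at most 1/2.\<close>

lemma sin_ge_quarter:
  assumes "0 \<le> t" "t \<le> pi / 2"
  shows "t / 4 \<le> sin t"
proof (cases "t \<le> pi / 3")
  case True
  have "sin 0 - 0 / 4 \<le> sin t - t / 4"
  proof (rule DERIV_nonneg_imp_nondecreasing[OF assms(1)])
    fix x assume x: "0 \<le> x" "x \<le> t"
    then have "cos (pi / 3) \<le> cos x" using True by (intro cos_monotone_0_pi_le) auto
    then show "\<exists>y. ((\<lambda>t. sin t - t / 4) has_real_derivative y) (at x) \<and> 0 \<le> y"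
      by (intro exI[of _ "cos x - 1 / 4"]) (auto intro!: derivative_eq_intros simp: cos_60)
  qed
  then show ?thesis by simp
next
  case False
  have "sin (pi / 3) \<le> sin t" using False assms by (intro sin_monotone_2pi_le) auto
  moreover have "sqrt 3 \<ge> 1" by (rule real_le_rsqrt) simp
  moreover have "t / 4 \<le> 1 / 2" using assms pi_less_4 by simp
  ultimately show ?thesis unfolding sin_60 by linarith
qed

text \<open>Vanishing at both poles makes F of the size of sin t, so the quotient F / sin is bounded
  by 4B and can be integrated by parts outside strips of width d. Each strip costs only B d^2,
  because F is small there. The width d is left free for later balancing.\<close>

lemma osc_integral_endpoint_bound:
  fixes F F' :: "real \<Rightarrow> complex"
  assumes F: "\<And>t. t \<in> {0..pi} \<Longrightarrow> (F has_vector_derivative F' t) (at t within {0..pi})"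
    and F': "continuous_on {0..pi} F'" and F0: "F 0 = 0" and Fpi: "F pi = 0"
    and B: "\<And>t. t \<in> {0..pi} \<Longrightarrow> norm (F' t) \<le> B"
    and d: "0 < d" "d < pi / 2" and l: "l > 0"
  shows "norm (integral {0..pi} (\<lambda>t. F t * osc l t)) \<le> 2 * B * d\<^sup>2 + (8 * B + 20 * B / d * pi) / l"
proof -
  have B0: "B \<ge> 0" by (rule order_trans[OF norm_ge_zero B[of 0]]) simp
  have cF: "continuous_on {0..pi} F"
    using F by (rule continuous_on_vector_derivative)
  have lip: "norm (F y - F x) \<le> B * norm (y - x)" if "x \<in> {0..pi}" "y \<in> {0..pi}" for x y
  proof (rule differentiable_bound[of "{0..pi}" F "\<lambda>t h. h *\<^sub>R F' t"])
    fix t assume t: "t \<in> {0..pi}"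
    show "(F has_derivative (\<lambda>h. h *\<^sub>R F' t)) (at t within {0..pi})"
      using F[OF t] by (simp add: has_vector_derivative_def)
    show "onorm (\<lambda>h. h *\<^sub>R F' t) \<le> B"
      by (rule onorm_le) (use B[OF t] in \<open>simp add: mult.commute[of B] mult_left_mono\<close>)
  qed (use that in auto)
  have b1: "norm (F t) \<le> B * t" "norm (F t) \<le> B * (pi - t)" if "t \<in> {0..pi}" for t
    using lip[of 0 t] lip[of pi t] that F0 Fpi by (auto simp: abs_minus_commute)
  have s1: "min t (pi - t) / 4 \<le> sin t" if "t \<in> {0..pi}" for t
    using sin_ge_quarter[of t] sin_ge_quarter[of "pi - t"] that by (cases "t \<le> pi / 2") (auto simp: min_def)
  have b2: "norm (F t) \<le> 4 * B * sin t" if "t \<in> {0..pi}" for t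
  proof -
    have "norm (F t) \<le> B * min t (pi - t)" using b1[OF that] by (auto simp: min_def)
    also have "\<dots> \<le> B * (4 * sin t)" using s1[OF that] B0 by (intro mult_left_mono) auto
    finally show ?thesis by simp
  qed
  have sub: "t \<in> {0..pi}" if "t \<in> {d..pi - d}" for t using that d by auto
  have sd: "sin t \<ge> d / 4" if "t \<in> {d..pi - d}" for t
    using s1[OF sub[OF that]] that by (auto simp: min_def split: if_splits)
  have sin: "sin t > 0" if "t \<in> {d..pi - d}" for t using sd[OF that] d by linarith
  define H where "H t = F t / of_real (sin t)" for t
  define H' where "H' t = (F' t * of_real (sin t) - F t * of_real (cos t)) / of_real ((sin t)\<^sup>2)" for t
  have ssub: "{d..pi - d} \<subseteq> {0..pi}" using d by simp
  have dH: "(H has_vector_derivative H' t) (at t within {d..pi - d})" if "t \<in> {d..pi - d}" for t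
  proof -
    have "(F has_vector_derivative F' t) (at t within {d..pi - d})"
      by (rule has_vector_derivative_within_subset[OF F[OF sub[OF that]] ssub])
    moreover have "sin t \<noteq> 0" using sin[OF that] by simp
    ultimately show ?thesis
      unfolding H_def[abs_def] H'_def by (rule has_vector_derivative_divide_sin)
  qed
  have cH': "continuous_on {d..pi - d} H'"
    unfolding H'_def using sin
    by (intro continuous_intros continuous_on_subset[OF F' ssub] continuous_on_subset[OF cF ssub]) (auto dest: sin)
  have K: "norm (H t) \<le> 4 * B" if "t \<in> {d..pi - d}" for t
    using b2[OF sub[OF that]] sin[OF that] by (simp add: H_def norm_divide field_simps)
  have K': "norm (H' t) \<le> 20 * B / d" if t: "t \<in> {d..pi - d}" for t
  proof -
    \<comment> \<open>The two terms of the quotient rule give 5B sin t in total; divided by sin^2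
      and with sin t at least d/4 this yields 20B/d.\<close>
    have "norm (F' t * of_real (sin t) - F t * of_real (cos t)) \<le> norm (F' t) * sin t + norm (F t) * \<bar>cos t\<bar>"
      using sin[OF t] by (intro order_trans[OF norm_triangle_ineq4]) (simp add: norm_mult)
    also have "\<dots> \<le> B * sin t + (4 * B * sin t) * 1"
      using sin[OF t] B[OF sub[OF t]] b2[OF sub[OF t]] B0
      by (intro add_mono mult_mono mult_right_mono) auto
    finally have "norm (H' t) \<le> (5 * B * sin t) / (sin t)\<^sup>2"
      using sin[OF t] by (simp add: H'_def norm_divide norm_power divide_right_mono)
    also have "\<dots> = 5 * B / sin t" using sin[OF t] by (simp add: power2_eq_square)
    also have "\<dots> \<le> 5 * B / (d / 4)" using sd[OF t] d B0 by (intro divide_left_mono) (auto intro!: mult_pos_pos sin[OF t])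
    finally show ?thesis by simp
  qed
  have co: "continuous_on {0..pi} (\<lambda>t. F t * osc l t)" by (intro continuous_intros cF)
  have "norm (integral {d..pi - d} (\<lambda>t. F t * osc l t)) = norm (integral {d..pi - d} (\<lambda>t. H t * of_real (sin t) * osc l t))"
  proof (intro arg_cong[where f=norm] integral_cong)
    fix t assume "t \<in> {d..pi - d}"
    then show "F t * osc l t = H t * of_real (sin t) * osc l t"
      using sin[of t] by (simp add: H_def)
  qed
  also have "\<dots> \<le> (2 * (4 * B) + 20 * B / d * (pi - d - d)) / l"
    using d by (intro osc_by_parts_bound[where H'=H'] dH cH' K K' l) auto
  also have "\<dots> \<le> (8 * B + 20 * B / d * pi) / l"
    using d B0 l by (intro divide_right_mono add_mono mult_left_mono) auto
  finally have 1: "norm (integral {d..pi - d} (\<lambda>t. F t * osc l t)) \<le> (8 * B + 20 * B / d * pi) / l" .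
  have 2: "norm (integral {0..d} (\<lambda>t. F t * osc l t)) \<le> (B * d) * (d - 0)"
  proof (intro integral_bound continuous_on_subset[OF co])
    fix t assume t: "t \<in> {0..d}"
    then have "norm (F t) \<le> B * t" using d by (intro b1) auto
    also have "\<dots> \<le> B * d" using t B0 by (intro mult_left_mono) auto
    finally show "norm (F t * osc l t) \<le> B * d" by (simp add: norm_mult)
  qed (use d in auto)
  have 3: "norm (integral {pi - d..pi} (\<lambda>t. F t * osc l t)) \<le> (B * d) * (pi - (pi - d))"
  proof (intro integral_bound continuous_on_subset[OF co])
    fix t assume t: "t \<in> {pi - d..pi}"
    then have "norm (F t) \<le> B * (pi - t)" using d by (intro b1) auto
    also have "\<dots> \<le> B * d" using t B0 by (intro mult_left_mono) auto
    finally show "norm (F t * osc l t) \<le> B * d" by (simp add: norm_mult)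
  qed (use d in auto)
  have "norm (integral {0..pi} (\<lambda>t. F t * osc l t)) \<le> norm (integral {0..d} (\<lambda>t. F t * osc l t))
     + norm (integral {d..pi - d} (\<lambda>t. F t * osc l t)) + norm (integral {pi - d..pi} (\<lambda>t. F t * osc l t))"
    unfolding integral_split3[OF co d]
    by (intro order_trans[OF norm_triangle_ineq] add_mono order_refl)
  then show ?thesis using 1 2 3 by (simp add: power2_eq_square)
qed

text \<open>On the circle the leading term has size l^(-1/2); an amplitude that vanishes at the
  stationary points must be shown to contribute less than that.\<close>

lemma osc_integral_sqrt_tendsto_0:
  fixes F F' :: "real \<Rightarrow> complex"
  assumes F: "\<And>t. t \<in> {0..pi} \<Longrightarrow> (F has_vector_derivative F' t) (at t within {0..pi})"
    and F': "continuous_on {0..pi} F'" and F0: "F 0 = 0" and Fpi: "F pi = 0"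
  shows "((\<lambda>l. of_real (sqrt l) * integral {0..pi} (\<lambda>t. F t * osc l t)) \<longlongrightarrow> 0) at_top"
proof -
  obtain B where B: "\<And>t. t \<in> {0..pi} \<Longrightarrow> norm (F' t) \<le> B"
    using compact_imp_bounded[OF compact_continuous_image[OF F' compact_Icc]] unfolding bounded_iff by blast
  define h where "h l = 2 * B * l powr (-1/6) + 8 * B * l powr (-1/2) + 20 * B * pi * l powr (-1/6)" for l :: real
  have h: "(h \<longlongrightarrow> 2 * B * 0 + 8 * B * 0 + 20 * B * pi * 0) at_top"
    unfolding h_def by (intro tendsto_intros tendsto_neg_powr filterlim_ident) auto
  show ?thesis
  proof (rule Lim_null_comparison)
    show "(h \<longlongrightarrow> 0) at_top" using h by simp
    show "\<forall>\<^sub>F l in at_top. norm (of_real (sqrt l) * integral {0..pi} (\<lambda>t. F t * osc l t)) \<le> h l"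
      using eventually_gt_at_top[of 1]
    proof eventually_elim
      case (elim l)
      \<comment> \<open>Balances the strip term d^2 against the interior term 1/(d l). Both become
        l^(-2/3), which leaves l^(-1/6) after multiplication by sqrt l.\<close>
      define d where "d = l powr (-1/3)"
      have d: "0 < d" "d < pi / 2"
      proof -
        have "l powr (-1/3) < l powr 0" using elim by (intro powr_less_mono) auto
        then show "d < pi / 2" using elim pi_gt3 by (simp add: d_def)
      qed (use elim in \<open>simp add: d_def\<close>)
      have "norm (of_real (sqrt l) * integral {0..pi} (\<lambda>t. F t * osc l t)) \<le> sqrt l * (2 * B * d\<^sup>2 + (8 * B + 20 * B / d * pi) / l)"
        using osc_integral_endpoint_bound[OF F F' F0 Fpi B d, of l] elim
        by (auto simp: norm_mult intro!: mult_left_mono)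
      also have "\<dots> = 2 * B * (l powr (1/2) * (l powr (-1/3) * l powr (-1/3))) + 8 * B * (l powr (1/2) * l powr (-1))
          + 20 * B * pi * (l powr (1/2) * l powr (1/3) * l powr (-1))"
        using elim by (simp add: d_def powr_half_sqrt powr_minus_divide power2_eq_square field_simps)
      also have "\<dots> = h l"
        unfolding h_def by (simp only: powr_add[symmetric]) simp
      finally show ?case .
    qed
  qed
qed

text \<open>A model amplitude made for exact computation: with u = sin(t/2) one has cos t = 1 -
  2u^2, and the factor cos(t/2) is the Jacobian, so the integral becomes a Gaussian with parameter a
  = 1 - 2il cut off at |u| = 1. The amplitude is 1 at t = 0 and vanishes at the opposite
  pole.\<close>

lemma osc_gaussian_integral_limit:
  "((\<lambda>l. of_real (sqrt l) * exp (\<i> * of_real l) *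
     integral {-pi..pi} (\<lambda>t. of_real (cos (t / 2) * exp (- (sin (t / 2))\<^sup>2)) * osc l t)) \<longlongrightarrow> of_real (sqrt pi) * (1 + \<i>)) at_top"
proof -
  define a where "a l = 1 - \<i> * of_real (2 * l)" for l :: real
  have Re_a: "Re (a l) = 1" for l by (simp add: a_def)
  then have a0: "a l \<noteq> 0" for l by (metis zero_complex.sel(1) zero_neq_one)
  let ?g = "\<lambda>l u::real. exp (- (a l * of_real (u\<^sup>2)))"
  have cg: "continuous_on S (?g l)" for S l by (intro continuous_intros)
  have ng: "norm (?g l u) \<le> 1" for l u by (simp add: norm_exp_eq_Re Re_a flip: of_real_power)
  have subst: "exp (\<i> * of_real l) * integral {-pi..pi} (\<lambda>t. of_real (cos (t / 2) * exp (- (sin (t / 2))\<^sup>2)) * osc l t)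
    = 2 * integral {-1..1} (?g l)" for l
  proof -
    have "((\<lambda>t. (cos (t / 2) / 2) *\<^sub>R ?g l (sin (t / 2))) has_integral integral {sin (-pi / 2)..sin (pi / 2)} (?g l)) {-pi..pi}"
      by (rule has_integral_substitution[where c="-1" and d=1, OF _ _ _ cg]) (auto intro!: derivative_eq_intros)
    then have 1: "integral {-pi..pi} (\<lambda>t. (cos (t / 2) / 2) *\<^sub>R ?g l (sin (t / 2))) = integral {-1..1} (?g l)"
      by (auto dest: integral_unique)
    have 2: "exp (\<i> * of_real l) * (of_real (cos (t / 2) * exp (- (sin (t / 2))\<^sup>2)) * osc l t)
      = 2 * ((cos (t / 2) / 2) *\<^sub>R ?g l (sin (t / 2)))" for t
    proof -
      have "cos t = 1 - 2 * (sin (t / 2))\<^sup>2" using cos_double_sin[of "t / 2"] by simp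
      note c = this
      have "\<i> * of_real l + of_real (- (sin (t / 2))\<^sup>2) + - (\<i> * of_real (l * cos t)) = - (a l * of_real ((sin (t / 2))\<^sup>2))"
        unfolding c by (simp add: a_def algebra_simps)
      then have "exp (\<i> * of_real l) * of_real (exp (- (sin (t / 2))\<^sup>2)) * osc l t = ?g l (sin (t / 2))"
        unfolding osc_def exp_of_real[symmetric] exp_add[symmetric] by simp
      then show ?thesis by (simp add: scaleR_conv_of_real mult_ac)
    qed
    have "exp (\<i> * of_real l) * integral {-pi..pi} (\<lambda>t. of_real (cos (t / 2) * exp (- (sin (t / 2))\<^sup>2)) * osc l t)
      = integral {-pi..pi} (\<lambda>t. 2 * ((cos (t / 2) / 2) *\<^sub>R ?g l (sin (t / 2))))"
      unfolding integral_mult_right[symmetric] 2 ..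
    also have "\<dots> = 2 * integral {-1..1} (?g l)"
      unfolding integral_mult_right 1 ..
    finally show ?thesis .
  qed
  \<comment> \<open>Integration by parts with exp(-a u^2)/(2 a u): two boundary terms and the
    integral of \<open>Q\<close>, each at most 1/(2|a|).\<close>
  have tail: "norm (integral {1..y} (?g l)) \<le> 3 / (2 * norm (a l))" if y: "y \<ge> 1" for y l
  proof -
    define P where "P u = - ?g l u / (2 * a l * of_real u)" for u
    define Q where "Q u = ?g l u / (2 * a l * of_real (u\<^sup>2))" for u
    have "((\<lambda>u. ?g l u + Q u) has_integral P y - P 1) {1..y}"
    proof (rule fundamental_theorem_of_calculus[OF y])
      fix u assume u: "u \<in> {1..y}"
      have "((\<lambda>z. - exp (- (a l * z\<^sup>2)) / (2 * a l * z)) has_field_derivative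
        (exp (- (a l * (of_real u)\<^sup>2)) + exp (- (a l * (of_real u)\<^sup>2)) / (2 * a l * (of_real u)\<^sup>2))) (at (of_real u))"
        using u a0[of l] by (auto intro!: derivative_eq_intros simp: field_simps power2_eq_square)
      from has_vector_derivative_real_field[OF this]
      show "(P has_vector_derivative ?g l u + Q u) (at u within {1..y})"
        by (simp add: P_def[abs_def] Q_def)
    qed
    moreover have cQ: "continuous_on {1..y} Q"
      unfolding Q_def using a0[of l] by (intro continuous_intros) auto
    then have "(Q has_integral integral {1..y} Q) {1..y}"
      by (intro integrable_integral integrable_continuous_interval)
    ultimately have "((\<lambda>u. ?g l u + Q u - Q u) has_integral P y - P 1 - integral {1..y} Q) {1..y}"
      by (rule has_integral_diff)
    then have e1: "integral {1..y} (?g l) = P y - P 1 - integral {1..y} Q"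
      by (simp add: integral_unique)
    have nP: "norm (P u) \<le> 1 / (2 * norm (a l))" if "u \<ge> 1" for u
    proof -
      have "norm (P u) = norm (?g l u) / (2 * norm (a l) * u)" using that by (simp add: P_def norm_divide norm_mult)
      also have "\<dots> \<le> 1 / (2 * norm (a l) * 1)"
        using ng[of l u] a0[of l] that by (intro frac_le mult_left_mono) auto
      finally show ?thesis by simp
    qed
    have e3: "norm (integral {1..y} Q) \<le> 1 / (2 * norm (a l))"
    proof -
      have "((\<lambda>u::real. inverse (u\<^sup>2)) has_integral (- inverse y - (- inverse 1))) {1..y}"
      proof (rule fundamental_theorem_of_calculus[OF y])
        fix u assume "u \<in> {1..y}"
        then have "((\<lambda>u. - inverse u) has_real_derivative inverse (u\<^sup>2)) (at u within {1..y})"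
          by (auto intro!: derivative_eq_intros simp: power2_eq_square)
        then show "((\<lambda>u. - inverse u) has_vector_derivative inverse (u\<^sup>2)) (at u within {1..y})"
          by (simp add: has_real_derivative_iff_has_vector_derivative)
      qed
      then have I: "((\<lambda>u::real. 1 / (2 * norm (a l)) * inverse (u\<^sup>2)) has_integral (1 / (2 * norm (a l)) * (- inverse y - (- inverse 1)))) {1..y}"
        by (rule has_integral_mult_right)
      have "norm (integral {1..y} Q) \<le> integral {1..y} (\<lambda>u. 1 / (2 * norm (a l)) * inverse (u\<^sup>2))"
      proof (rule integral_norm_bound_integral[OF integrable_continuous_interval[OF cQ] has_integral_integrable[OF I]])
        fix u assume "u \<in> {1..y}"
        then show "norm (Q u) \<le> 1 / (2 * norm (a l)) * inverse (u\<^sup>2)"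
          using ng[of l u] a0[of l] by (simp add: Q_def norm_divide norm_mult norm_power divide_simps)
      qed
      also have "\<dots> = 1 / (2 * norm (a l)) * (- inverse y - (- inverse 1))"
        by (rule integral_unique[OF I])
      also have "\<dots> \<le> 1 / (2 * norm (a l)) * 1"
        using y by (intro mult_left_mono) auto
      finally show ?thesis by simp
    qed
    have "norm (integral {1..y} (?g l)) \<le> 1 / (2 * norm (a l)) + 1 / (2 * norm (a l)) + 1 / (2 * norm (a l))"
      unfolding e1 by (rule order_trans[OF norm_diff_diff_le add_mono[OF add_mono[OF nP[OF y] nP[OF order_refl]] e3]])
    then show ?thesis by simp
  qed
  \<comment> \<open>The cut-off removes two equal tails. Since |a| is at least 2l, the error is of
    order 1/l and stays negligible after multiplication by sqrt l.\<close>
  have approx: "norm (complex_gaussian (a l) - integral {-1..1} (?g l)) \<le> 3 / norm (a l)" for l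
  proof (rule Lim_norm_ubound[OF trivial_limit_at_top_linorder])
    show "((\<lambda>y. integral {-y..y} (?g l) - integral {-1..1} (?g l)) \<longlongrightarrow> complex_gaussian (a l) - integral {-1..1} (?g l)) at_top"
    proof (rule tendsto_diff[OF _ tendsto_const])
      have "((\<lambda>y. LINT u|lborel. indicator {-y..y} u *\<^sub>R ?g l u) \<longlongrightarrow> complex_gaussian (a l)) at_top"
        unfolding complex_gaussian_def
      proof (rule integral_dominated_convergence_at_top)
        show "integrable lborel (\<lambda>u. norm (?g l u))"
          using integrable_norm[OF integrable_complex_gaussian[of "a l"]] by (simp add: Re_a)
        show "AE u in lborel. ((\<lambda>y. indicator {-y..y} u *\<^sub>R ?g l u) \<longlongrightarrow> ?g l u) at_top"
        proof (intro always_eventually allI)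
          fix u :: real
          show "((\<lambda>y. indicator {-y..y} u *\<^sub>R ?g l u) \<longlongrightarrow> ?g l u) at_top"
            by (rule tendsto_eventually, rule eventually_at_top_linorderI[of "\<bar>u\<bar>"]) (auto simp: indicator_def)
        qed
        show "?g l \<in> borel_measurable lborel" by (simp add: borel_measurable_continuous_onI cg)
        then show "(\<lambda>u. indicator {-y..y} u *\<^sub>R ?g l u) \<in> borel_measurable lborel" for y by simp
      qed (auto simp: indicator_def)
      then show "((\<lambda>y. integral {-y..y} (?g l)) \<longlongrightarrow> complex_gaussian (a l)) at_top"
      proof (rule Lim_transform_eventually)
        have "(LINT u|lborel. indicator {-y..y} u *\<^sub>R ?g l u) = integral {-y..y} (?g l)" for y
          using set_borel_integral_eq_integral(2)[OF borel_integrable_atLeastAtMost', OF cg[of "{-y..y}" l]]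
          by (simp add: set_lebesgue_integral_def)
        then show "\<forall>\<^sub>F y in at_top. (LINT u|lborel. indicator {-y..y} u *\<^sub>R ?g l u) = integral {-y..y} (?g l)"
          by simp
      qed
    qed
    show "\<forall>\<^sub>F y in at_top. norm (integral {-y..y} (?g l) - integral {-1..1} (?g l)) \<le> 3 / norm (a l)"
    proof (rule eventually_at_top_linorderI[of 1])
      fix y :: real assume y: "1 \<le> y"
      have "integral {-y..y} (?g l) = integral {-y..-1} (?g l) + integral {-1..1} (?g l) + integral {1..y} (?g l)"
        using y Henstock_Kurzweil_Integration.integral_combine[of "-y" "-1" 1, OF _ _ integrable_continuous_interval[OF cg[of _ l]]]
          Henstock_Kurzweil_Integration.integral_combine[of "-y" 1 y, OF _ _ integrable_continuous_interval[OF cg[of _ l]]]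
        by simp
      moreover have "integral {-y..-1} (?g l) = integral {1..y} (?g l)"
        using Henstock_Kurzweil_Integration.integral_reflect_real[of y 1 "?g l"] by simp
      ultimately have "integral {-y..y} (?g l) - integral {-1..1} (?g l) = 2 * integral {1..y} (?g l)"
        by (simp only: mult_2) simp
      then have "norm (integral {-y..y} (?g l) - integral {-1..1} (?g l)) = 2 * norm (integral {1..y} (?g l))"
        by (simp only: norm_mult norm_numeral)
      then show "norm (integral {-y..y} (?g l) - integral {-1..1} (?g l)) \<le> 3 / norm (a l)"
        using tail[OF y, of l] by simp
    qed
  qed
  have lim1: "((\<lambda>l. of_real (sqrt l) * 2 * complex_gaussian (a l)) \<longlongrightarrow> of_real (sqrt pi) * (1 + \<i>)) at_top"
  proof (rule Lim_transform_eventually)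
    have "((\<lambda>l. 2 * of_real (sqrt pi) / csqrt (of_real (inverse l) - 2 * \<i>)) \<longlongrightarrow> 2 * of_real (sqrt pi) / csqrt (of_real 0 - 2 * \<i>)) at_top"
      by (intro tendsto_intros tendsto_inverse_0_at_top filterlim_ident continuous_within_tendsto_compose'[OF continuous_at_csqrt])
        (auto simp: complex_nonpos_Reals_iff)
    also have "csqrt (of_real 0 - 2 * \<i>) = 1 - \<i>"
      by (rule csqrt_unique) (auto simp: power2_eq_square algebra_simps)
    also have "2 * of_real (sqrt pi) / (1 - \<i>) = of_real (sqrt pi) * (1 + \<i>)"
    proof -
      have "1 - \<i> \<noteq> 0" by (simp add: complex_eq_iff)
      moreover have "(1 + \<i>) * (1 - \<i>) = 2" by (simp add: algebra_simps)
      ultimately show ?thesis by (simp add: divide_eq_eq mult.assoc)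
    qed
    finally show "((\<lambda>l. 2 * of_real (sqrt pi) / csqrt (of_real (inverse l) - 2 * \<i>)) \<longlongrightarrow> of_real (sqrt pi) * (1 + \<i>)) at_top" .
    show "\<forall>\<^sub>F l in at_top. 2 * of_real (sqrt pi) / csqrt (of_real (inverse l) - 2 * \<i>) = of_real (sqrt l) * 2 * complex_gaussian (a l)"
      using eventually_gt_at_top[of 0]
    proof eventually_elim
      case (elim l)
      define w where "w = of_real (inverse l) - 2 * \<i>"
      have w0: "w \<noteq> 0" unfolding w_def by (simp add: complex_eq_iff)
      have "of_real l * w = of_real (l * inverse l) - of_real l * (2 * \<i>)"
        unfolding w_def right_diff_distrib of_real_mult ..
      then have al: "a l = of_real l * w" using elim by (simp add: a_def)
      \<comment> \<open>A positive real factor leaves the principal branch unchanged, so sqrt l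
        cancels and only csqrt(1/l - 2i) is left, with limit 1 - i.\<close>
      have "csqrt (of_real l * w) = of_real (sqrt l) * csqrt w"
      proof (rule csqrt_unique)
        show "(of_real (sqrt l) * csqrt w)\<^sup>2 = of_real l * w"
          using elim by (simp add: power_mult_distrib flip: of_real_power)
        show "0 < Re (of_real (sqrt l) * csqrt w) \<or> Re (of_real (sqrt l) * csqrt w) = 0 \<and> 0 \<le> Im (of_real (sqrt l) * csqrt w)"
          using csqrt_principal[of w] elim by (auto simp: zero_less_mult_iff)
      qed
      then have g: "complex_gaussian (a l) = of_real (sqrt pi) / (of_real (sqrt l) * csqrt w)"
        using complex_gaussian_eq[of "2 * l"] unfolding a_def[symmetric] al by simp
      show ?case
        unfolding g w_def[symmetric] using elim w0 by simp
    qed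
  qed
  have lim2: "((\<lambda>l. of_real (sqrt l) * 2 * (complex_gaussian (a l) - integral {-1..1} (?g l))) \<longlongrightarrow> 0) at_top"
  proof (rule Lim_null_comparison)
    show "\<forall>\<^sub>F l in at_top. norm (of_real (sqrt l) * 2 * (complex_gaussian (a l) - integral {-1..1} (?g l))) \<le> 3 * l powr (-1/2)"
      using eventually_gt_at_top[of 0]
    proof eventually_elim
      case (elim l)
      have "2 * l \<le> norm (a l)" using abs_Im_le_cmod[of "a l"] elim by (simp add: a_def)
      then have "3 / norm (a l) \<le> 3 / (2 * l)" using elim by (intro divide_left_mono) (auto simp: a0)
      then have "norm (complex_gaussian (a l) - integral {-1..1} (?g l)) \<le> 3 / (2 * l)"
        using approx[of l] by linarith
      then have "sqrt l * 2 * norm (complex_gaussian (a l) - integral {-1..1} (?g l)) \<le> sqrt l * 2 * (3 / (2 * l))"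
        by (rule mult_left_mono) (use elim in simp)
      then have "norm (of_real (sqrt l) * 2 * (complex_gaussian (a l) - integral {-1..1} (?g l))) \<le> sqrt l * 2 * (3 / (2 * l))"
        using elim by (simp only: norm_mult norm_of_real norm_numeral abs_of_nonneg[OF real_sqrt_ge_zero[OF less_imp_le]])
      also have "\<dots> = 3 * (l powr (1/2) * l powr (-1))"
        using elim by (simp add: powr_half_sqrt powr_minus_divide)
      also have "\<dots> = 3 * l powr (-1/2)" by (simp only: powr_add[symmetric]) simp
      finally show ?case .
    qed
    have "((\<lambda>l::real. 3 * l powr (-1/2)) \<longlongrightarrow> 3 * 0) at_top"
      by (intro tendsto_intros tendsto_neg_powr filterlim_ident) auto
    then show "((\<lambda>l::real. 3 * l powr (-1/2)) \<longlongrightarrow> 0) at_top" by simp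
  qed
  have "(\<lambda>l. of_real (sqrt l) * 2 * complex_gaussian (a l) - of_real (sqrt l) * 2 * (complex_gaussian (a l) - integral {-1..1} (?g l)))
    = (\<lambda>l. of_real (sqrt l) * (2 * integral {-1..1} (?g l)))"
    by (simp only: right_diff_distrib mult.assoc) simp
  with tendsto_diff[OF lim1 lim2] show ?thesis
    unfolding mult.assoc subst by (simp only: diff_zero)
qed

text \<open>Subtracting F 0 times the model amplitude leaves a function that vanishes at 0 and at
  both ends. On each half of the interval it falls under the sqrt l estimate, so the model integral
  alone determines the limit.\<close>

lemma osc_circle_integral_limit:
  fixes F F' :: "real \<Rightarrow> complex"
  assumes F: "\<And>t. t \<in> {-pi..pi} \<Longrightarrow> (F has_vector_derivative F' t) (at t within {-pi..pi})"
    and F': "continuous_on {-pi..pi} F'" and Fpi: "F pi = 0" "F (- pi) = 0"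
  shows "((\<lambda>l. of_real (sqrt l) * exp (\<i> * of_real l) * integral {-pi..pi} (\<lambda>t. F t * osc l t)) \<longlongrightarrow>
    of_real (sqrt pi) * (1 + \<i>) * F 0) at_top"
proof -
  define K where "K t = (of_real (cos (t / 2) * exp (- (sin (t / 2))\<^sup>2)) :: complex)" for t
  define K' where "K' t = (of_real (- (sin (t / 2) * (1 / 2)) * exp (- (sin (t / 2))\<^sup>2)
      - cos (t / 2) * exp (- (sin (t / 2))\<^sup>2) * (sin (t / 2) * cos (t / 2))) :: complex)" for t
  have dK: "(K has_vector_derivative K' t) (at t within S)" for t S
    unfolding K_def K'_def
    by (rule has_vector_derivative_of_real) (auto intro!: derivative_eq_intros simp: algebra_simps)
  have cK': "continuous_on S K'" and cK: "continuous_on S K" for S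
    unfolding K_def K'_def by (intro continuous_intros; simp)+
  define G where "G t = F t - F 0 * K t" for t
  define G' where "G' t = F' t - F 0 * K' t" for t
  have dG: "(G has_vector_derivative G' t) (at t within {-pi..pi})" if "t \<in> {-pi..pi}" for t
    unfolding G_def G'_def by (intro derivative_intros F dK that)
  have cG': "continuous_on {-pi..pi} G'" unfolding G'_def by (intro continuous_intros F' cK')
  have cG: "continuous_on {-pi..pi} G" using dG by (rule continuous_on_vector_derivative)
  have G0: "G 0 = 0" "G pi = 0" "G (- pi) = 0" by (auto simp: G_def K_def Fpi)
  have sub: "{0..pi} \<subseteq> {-pi..pi}" by auto
  have r: "((\<lambda>l. of_real (sqrt l) * integral {0..pi} (\<lambda>t. G t * osc l t)) \<longlongrightarrow> 0) at_top"
  proof (rule osc_integral_sqrt_tendsto_0[of G G'])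
    fix t assume "t \<in> {0..pi}"
    then show "(G has_vector_derivative G' t) (at t within {0..pi})"
      by (intro has_vector_derivative_within_subset[OF dG[of t] sub]) auto
  qed (auto intro: continuous_on_subset[OF cG' sub] G0)
  have l: "((\<lambda>l. of_real (sqrt l) * integral {0..pi} (\<lambda>t. G (- t) * osc l t)) \<longlongrightarrow> 0) at_top"
  proof (rule osc_integral_sqrt_tendsto_0[of "\<lambda>t. G (- t)" "\<lambda>t. - G' (- t)"])
    fix t assume t: "t \<in> {0..pi}"
    have "(G has_vector_derivative G' (- t)) (at (- t) within uminus ` {0..pi})"
      by (rule has_vector_derivative_within_subset[OF dG]) (use t in auto)
    moreover have "(uminus has_vector_derivative -1) (at t within {0..pi})"
      by (auto intro!: derivative_eq_intros)
    ultimately show "((\<lambda>t. G (- t)) has_vector_derivative - G' (- t)) (at t within {0..pi})"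
      using vector_diff_chain_within[of uminus "-1" t "{0..pi}" G "G' (- t)"] by (simp add: o_def)
  next
    show "continuous_on {0..pi} (\<lambda>t. - G' (- t))"
      by (intro continuous_intros continuous_on_compose2[OF cG']) auto
  qed (auto simp: G0)
  have split: "integral {-pi..pi} (\<lambda>t. F t * osc l t) =
    F 0 * integral {-pi..pi} (\<lambda>t. K t * osc l t) + (integral {0..pi} (\<lambda>t. G t * osc l t) + integral {0..pi} (\<lambda>t. G (- t) * osc l t))" for l
  proof -
    have co: "continuous_on {-pi..pi} (\<lambda>t. G t * osc l t)" by (intro continuous_intros cG)
    have "integral {-pi..pi} (\<lambda>t. F t * osc l t) = integral {-pi..pi} (\<lambda>t. F 0 * (K t * osc l t) + G t * osc l t)"
      by (simp add: G_def algebra_simps)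
    also have "\<dots> = integral {-pi..pi} (\<lambda>t. F 0 * (K t * osc l t)) + integral {-pi..pi} (\<lambda>t. G t * osc l t)"
      by (intro Henstock_Kurzweil_Integration.integral_add integrable_continuous_interval continuous_intros cK cG)
    also have "integral {-pi..pi} (\<lambda>t. F 0 * (K t * osc l t)) = F 0 * integral {-pi..pi} (\<lambda>t. K t * osc l t)"
      by (rule integral_mult_right)
    also have "integral {-pi..pi} (\<lambda>t. G t * osc l t) = integral {-pi..0} (\<lambda>t. G t * osc l t) + integral {0..pi} (\<lambda>t. G t * osc l t)"
      by (rule Henstock_Kurzweil_Integration.integral_combine[symmetric]) (auto intro!: integrable_continuous_interval co)
    also have "integral {-pi..0} (\<lambda>t. G t * osc l t) = integral {0..pi} (\<lambda>t. G (- t) * osc l t)"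
      using Henstock_Kurzweil_Integration.integral_reflect_real[of pi 0 "\<lambda>t. G (- t) * osc l t"] by simp
    finally show ?thesis by (simp add: add_ac)
  qed
  define A where "A l = integral {0..pi} (\<lambda>t. G t * osc l t) + integral {0..pi} (\<lambda>t. G (- t) * osc l t)" for l
  define KI where "KI l = integral {-pi..pi} (\<lambda>t. K t * osc l t)" for l
  have "((\<lambda>l. of_real (sqrt l) * A l) \<longlongrightarrow> 0) at_top"
    using tendsto_add_zero[OF r l] by (simp add: A_def distrib_left)
  from tendsto_norm_zero[OF this] have "((\<lambda>l. norm (exp (\<i> * of_real l) * (of_real (sqrt l) * A l))) \<longlongrightarrow> 0) at_top"
    by (simp add: norm_mult norm_exp_eq_Re)
  then have lim_A: "((\<lambda>l. exp (\<i> * of_real l) * (of_real (sqrt l) * A l)) \<longlongrightarrow> 0) at_top"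
    by (rule tendsto_norm_zero_cancel)
  have lim_K: "((\<lambda>l. of_real (sqrt l) * exp (\<i> * of_real l) * KI l * F 0) \<longlongrightarrow> of_real (sqrt pi) * (1 + \<i>) * F 0) at_top"
    unfolding KI_def K_def by (intro tendsto_mult osc_gaussian_integral_limit tendsto_const)
  have eq: "of_real (sqrt l) * exp (\<i> * of_real l) * integral {-pi..pi} (\<lambda>t. F t * osc l t) =
    of_real (sqrt l) * exp (\<i> * of_real l) * KI l * F 0 + exp (\<i> * of_real l) * (of_real (sqrt l) * A l)" for l
    unfolding split A_def[symmetric] KI_def[symmetric] by (simp only: distrib_left mult_ac)
  from tendsto_add[OF lim_K lim_A] show ?thesis unfolding eq add_0_right .
qed

section \<open>Stationary phase on the sphere\<close>

lemma Ck_on_1_has_derivative: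
  assumes "Ck_on (Suc 0) U g" "x \<in> U"
  shows "(g has_derivative frechet_derivative g (at x)) (at x)"
  using assms frechet_derivative_works by (auto simp: )

lemma Ck_on_Suc_imp: "open U \<Longrightarrow> Ck_on (Suc k) U g \<Longrightarrow> Ck_on k U g"
proof (induction k arbitrary: g)
  case 0
  then show ?case
    by (auto intro!: differentiable_imp_continuous_on differentiable_at_imp_differentiable_on)
qed auto

lemma Ck_on_imp_continuous_on: "open U \<Longrightarrow> Ck_on k U g \<Longrightarrow> continuous_on U g"
proof (induction k)
  case (Suc k) then show ?case using Ck_on_Suc_imp by blast
qed simp

lemma Ck_submanifold_mono:
  assumes "Ck_submanifold (Suc k) M f"
  shows "Ck_submanifold k M f"
  using assms Ck_on_Suc_imp unfolding Ck_submanifold_def by meson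

lemma Ck_submanifold_imp_continuous_on:
  assumes "Ck_submanifold k M f"
  shows "continuous_on M f"
  unfolding continuous_on_def
proof
  fix p assume p: "p \<in> M"
  then obtain U g where U: "open U" "p \<in> U" "Ck_on k U g" "\<forall>x\<in>U \<inter> M. g x = f x"
    using assms unfolding Ck_submanifold_def by meson
  have "isCont g p"
    using Ck_on_imp_continuous_on[OF U(1,3)] U by (simp add: continuous_on_eq_continuous_at)
  then have "(g \<longlongrightarrow> f p) (at p within M)"
    using U p by (metis IntI continuous_at_imp_continuous_at_within continuous_within)
  moreover have "\<forall>\<^sub>F x in at p within M. g x = f x"
    using U by (auto simp: eventually_at_topological)
  ultimately show "(f \<longlongrightarrow> f p) (at p within M)"
    by (rule Lim_transform_eventually)
qed

text \<open>Local extensions of f differ from patch to patch, but the derivative of f along a curve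
  in the sphere does not depend on them. It can therefore be defined globally, and its continuity is
  checked locally by the chain rule.\<close>

lemma Ck_submanifold_param_derivative:
  fixes f :: "'a::euclidean_space \<Rightarrow> complex" and \<gamma> \<gamma>' :: "real \<times> real \<Rightarrow> 'a"
  assumes f: "Ck_submanifold (Suc 0) S f" and S: "\<And>x. \<gamma> x \<in> S"
    and cont: "continuous_on UNIV \<gamma>" and cont': "continuous_on UNIV \<gamma>'"
    and deriv: "\<And>t p. ((\<lambda>s. \<gamma> (s, p)) has_vector_derivative \<gamma>' (t, p)) (at t)"
  obtains D where "continuous_on UNIV D" "\<And>t p. ((\<lambda>s. f (\<gamma> (s, p))) has_vector_derivative D (t, p)) (at t)"
proof -
  define D where "D = (\<lambda>(t, p). vector_derivative (\<lambda>s. f (\<gamma> (s, p))) (at t))"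
  have loc: "\<exists>W D'. open W \<and> x \<in> W \<and> continuous_on W D' \<and>
    (\<forall>t p. (t, p) \<in> W \<longrightarrow> ((\<lambda>s. f (\<gamma> (s, p))) has_vector_derivative D' (t, p)) (at t))" for x
  proof -
    obtain U g where U: "open U" "\<gamma> x \<in> U" "Ck_on (Suc 0) U g" "\<And>y. y \<in> U \<inter> S \<Longrightarrow> g y = f y"
      using f S[of x] unfolding Ck_submanifold_def by meson
    define G where "G y = frechet_derivative g (at y)" for y
    have dg: "(g has_derivative G y) (at y)" if "y \<in> U" for y
      using Ck_on_1_has_derivative[OF U(3) that] by (simp add: G_def)
    have cG: "continuous_on U (\<lambda>y. G y v)" for v using U(3) by (simp add: G_def)
    define W where "W = \<gamma> -` U"
    have W: "open W" "x \<in> W" using U cont by (auto simp: W_def continuous_on_open_vimage)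
    \<comment> \<open>Expanded in the basis, because \<open>Ck_on\<close> gives continuity of the
      derivative only in each fixed direction while \<gamma>' varies with the point.\<close>
    define D' where "D' y = (\<Sum>b\<in>Basis. (\<gamma>' y \<bullet> b) *\<^sub>R G (\<gamma> y) b)" for y
    have D': "D' y = G (\<gamma> y) (\<gamma>' y)" if "y \<in> W" for y
    proof -
      have "linear (G (\<gamma> y))" using dg that by (auto simp: W_def intro: has_derivative_linear)
      then have "G (\<gamma> y) (\<Sum>b\<in>Basis. (\<gamma>' y \<bullet> b) *\<^sub>R b) = D' y"
        by (simp add: D'_def linear_sum linear_scale)
      then show ?thesis by (simp add: euclidean_representation)
    qed
    have cD': "continuous_on W D'"
      unfolding D'_def
    proof (intro continuous_on_sum continuous_on_scaleR continuous_on_inner continuous_on_const)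
      show "continuous_on W \<gamma>'" by (rule continuous_on_subset[OF cont']) simp
      show "continuous_on W (\<lambda>y. G (\<gamma> y) b)" for b
        by (rule continuous_on_compose2[OF cG continuous_on_subset[OF cont]]) (auto simp: W_def)
    qed
    have "((\<lambda>s. f (\<gamma> (s, p))) has_vector_derivative D' (t, p)) (at t)" if tp: "(t, p) \<in> W" for t p
    proof (rule has_vector_derivative_transform_within_open)
      have "((\<lambda>s. \<gamma> (s, p)) has_derivative (\<lambda>h. h *\<^sub>R \<gamma>' (t, p))) (at t)"
        using deriv[of p t] by (simp add: has_vector_derivative_def)
      moreover have "(g has_derivative G (\<gamma> (t, p))) (at (\<gamma> (t, p)))"
        using tp by (intro dg) (simp add: W_def)
      ultimately have "((\<lambda>s. g (\<gamma> (s, p))) has_derivative (\<lambda>h. G (\<gamma> (t, p)) (h *\<^sub>R \<gamma>' (t, p)))) (at t)"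
        by (rule has_derivative_compose)
      moreover have "linear (G (\<gamma> (t, p)))" using dg tp by (auto simp: W_def intro: has_derivative_linear)
      ultimately show "((\<lambda>s. g (\<gamma> (s, p))) has_vector_derivative D' (t, p)) (at t)"
        by (simp add: has_vector_derivative_def D'[OF tp] linear_scale)
      have "open ((\<lambda>s. (s, p)) -` W)" by (intro open_vimage W) (auto intro: continuous_intros)
      then show "open {s. (s, p) \<in> W}" by (simp add: vimage_def)
    qed (use tp U S in \<open>auto simp: W_def\<close>)
    then show ?thesis using W cD' by blast
  qed
  show ?thesis
  proof (rule that[of D])
    show "((\<lambda>s. f (\<gamma> (s, p))) has_vector_derivative D (t, p)) (at t)" for t p
    proof -
      obtain d where "((\<lambda>s. f (\<gamma> (s, p))) has_vector_derivative d) (at t)"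
        using loc[of "(t, p)"] by blast
      then show ?thesis by (simp add: D_def vector_derivative_at)
    qed
    have "isCont D x" for x
    proof -
      obtain W D' where W: "open W" "x \<in> W" "continuous_on W D'"
        "\<And>t p. (t, p) \<in> W \<Longrightarrow> ((\<lambda>s. f (\<gamma> (s, p))) has_vector_derivative D' (t, p)) (at t)"
        using loc[of x] by blast
      have "D y = D' y" if "y \<in> W" for y
        using W(4)[of "fst y" "snd y"] that by (cases y) (auto simp: D_def intro: vector_derivative_at)
      then have "\<forall>\<^sub>F y in nhds x. D y = D' y"
        using W(1,2) eventually_nhds by blast
      moreover have "isCont D' x" using W by (meson continuous_on_eq_continuous_at)
      ultimately show ?thesis by (simp add: isCont_cong)
    qed
    then show "continuous_on UNIV D" by (simp add: continuous_at_imp_continuous_on)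
  qed
qed

section \<open>Sphere integrals in dimensions 1, 2 and 3\<close>

text \<open>The constant of the restriction operators. Its reciprocal is the stationary phase factor
  of one pole of the sphere, which is why the normalisation cancels in the limit.\<close>

definition plane_const :: "nat \<Rightarrow> complex" where
  "plane_const d = (1 / (2 * of_real pi * \<i>)) powr of_real ((real d - 1) / 2)"

lemma plane_const_1: "plane_const 1 = 1"
  by (simp add: plane_const_def powr_def)

lemma plane_const_3: "plane_const 3 = 1 / (2 * of_real pi * \<i>)"
  by (simp add: plane_const_def)

text \<open>Identifies the principal root with the factor that came out of the Gaussian integral;
  the positive real part decides the branch.\<close>

lemma plane_const_2: "inverse (plane_const 2) = of_real (sqrt pi) * (1 + \<i>)"
proof -
  have "1 / (2 * of_real pi * \<i>) = - \<i> / (2 * of_real pi)" by (simp add: field_simps)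
  have "plane_const 2 = csqrt (1 / (2 * of_real pi * \<i>))"
    by (simp add: plane_const_def csqrt_conv_powr)
  also have "\<dots> = inverse (of_real (sqrt pi) * (1 + \<i>))"
  proof (rule csqrt_unique)
    have "(of_real (sqrt pi) * (1 + \<i>))\<^sup>2 = 2 * of_real pi * \<i>"
      by (simp add: power2_eq_square algebra_simps flip: of_real_mult) 
    then show "(inverse (of_real (sqrt pi) * (1 + \<i>)))\<^sup>2 = 1 / (2 * of_real pi * \<i>)"
      unfolding power_inverse by (simp only: inverse_eq_divide)
    have "inverse (of_real (sqrt pi) * (1 + \<i>)) = of_real (inverse (2 * sqrt pi)) * (1 - \<i>)"
    proof (rule inverse_unique)
      have "of_real (sqrt pi) * (1 + \<i>) * (of_real (inverse (2 * sqrt pi)) * (1 - \<i>)) = of_real (sqrt pi * inverse (2 * sqrt pi)) * ((1 + \<i>) * (1 - \<i>))"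
        by (simp only: of_real_mult mult_ac)
      also have "(1 + \<i>) * (1 - \<i>) = 2" by (simp add: algebra_simps)
      also have "sqrt pi * inverse (2 * sqrt pi) = 1 / 2" by simp
      finally show "of_real (sqrt pi) * (1 + \<i>) * (of_real (inverse (2 * sqrt pi)) * (1 - \<i>)) = 1" by simp
    qed
    then show "0 < Re (inverse (of_real (sqrt pi) * (1 + \<i>))) \<or> Re (inverse (of_real (sqrt pi) * (1 + \<i>))) = 0 \<and> 0 \<le> Im (inverse (of_real (sqrt pi) * (1 + \<i>)))"
      by simp
  qed
  finally show ?thesis by simp
qed

text \<open>The indicator makes the integrand depend on f on the sphere only, so that continuity of
  f there already gives Borel measurability on the whole space.\<close>

definition sphere_transform :: "'a::euclidean_space measure \<Rightarrow> ('a \<Rightarrow> complex) \<Rightarrow> 'a \<Rightarrow> complex" where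
  "sphere_transform \<sigma> f k = (LINT q|\<sigma>. indicator (sphere 0 1) q *\<^sub>R (f q * exp (- (\<i> * of_real (k \<bullet> q)))))"

text \<open>The sphere consists of two points and one of them carries f = 0, so the asymptotic
  relation is an exact identity for every l.\<close>

lemma sphere_asymptotics_dim1:
  fixes e :: "'a::euclidean_space"
  assumes e: "norm e = 1" and dim: "DIM('a) = 1" and f: "f (- e) = 0"
  defines "\<sigma> \<equiv> distr (count_space {1, -1}) borel (\<lambda>s. s *\<^sub>R e)"
  shows "exp (\<i> * of_real l) * sphere_transform \<sigma> f (l *\<^sub>R e) = f e"
proof -
  have ee: "e \<bullet> e = 1" using e by (simp add: norm_eq_1)
  have S: "sphere 0 1 = {e, - e}"
  proof (intro set_eqI iffI)
    fix x assume "x \<in> sphere (0::'a) 1"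
    moreover obtain a where "x = a *\<^sub>R e" using orthonormal_basis1[OF e dim] by metis
    ultimately show "x \<in> {e, - e}" using e by (auto simp: abs_if split: if_splits)
  qed (use e in auto)
  have "continuous_on {e, - e} (\<lambda>q. f q * exp (- (\<i> * of_real (l *\<^sub>R e \<bullet> q))))"
    by (rule continuous_on_finite) simp
  then have m: "(\<lambda>q. indicator (sphere 0 1) q *\<^sub>R (f q * exp (- (\<i> * of_real (l *\<^sub>R e \<bullet> q))))) \<in> borel_measurable borel"
    unfolding S by (intro borel_measurable_continuous_on_indicator) auto
  have sum2: "(\<Sum>s\<in>{1, -1}. g s) = g 1 + g (-1)" for g :: "real \<Rightarrow> complex"
    by simp
  have "sphere_transform \<sigma> f (l *\<^sub>R e) = f e * exp (- (\<i> * of_real l))"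
    unfolding sphere_transform_def \<sigma>_def
    by (subst integral_distr[OF _ m], simp, subst lebesgue_integral_count_space_finite, simp, unfold sum2)
      (simp add: e f ee)
  then show ?thesis by (simp add: exp_minus_inverse flip: exp_minus)
qed

text \<open>In the angle from e1 the transform is a circle integral; f(-e1) = 0 makes the amplitude
  vanish at both ends of the angle interval, where the second stationary point sits.\<close>

lemma sphere_asymptotics_dim2:
  fixes e1 e2 :: "'a::euclidean_space"
  assumes e: "norm e1 = 1" "norm e2 = 1" "e1 \<bullet> e2 = 0"
    and f: "Ck_submanifold (Suc 0) (sphere 0 1) f" "f (- e1) = 0"
  defines "\<sigma> \<equiv> distr (density lborel (indicator {-pi..<pi})) borel (\<lambda>t. cos t *\<^sub>R e1 + sin t *\<^sub>R e2)"
  shows "((\<lambda>l. of_real (sqrt l) * exp (\<i> * of_real l) * sphere_transform \<sigma> f (l *\<^sub>R e1)) \<longlongrightarrow>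
    of_real (sqrt pi) * (1 + \<i>) * f e1) at_top"
proof -
  \<comment> \<open>The dummy second parameter lets the derivative lemma, which is stated for
    two-parameter charts, serve the circle as well.\<close>
  define \<gamma> where "\<gamma> = (\<lambda>(t, p::real). cos t *\<^sub>R e1 + sin t *\<^sub>R e2)"
  define \<gamma>' where "\<gamma>' = (\<lambda>(t, p::real). (- sin t) *\<^sub>R e1 + cos t *\<^sub>R e2)"
  have \<gamma>_S: "\<gamma> x \<in> sphere 0 1" for x
    using e by (cases x) (simp add: \<gamma>_def norm_eq_sqrt_inner inner_simps inner_commute power2_eq_square[symmetric])
  have c: "continuous_on UNIV \<gamma>" "continuous_on UNIV \<gamma>'"
    unfolding \<gamma>_def \<gamma>'_def case_prod_unfold by (intro continuous_intros)+
  have d\<gamma>: "((\<lambda>s. \<gamma> (s, p)) has_vector_derivative \<gamma>' (t, p)) (at t)" for t p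
    unfolding \<gamma>_def \<gamma>'_def prod.case by (auto intro!: derivative_eq_intros)
  obtain D where D: "continuous_on UNIV D" "\<And>t p. ((\<lambda>s. f (\<gamma> (s, p))) has_vector_derivative D (t, p)) (at t)"
    using Ck_submanifold_param_derivative[OF f(1) \<gamma>_S c d\<gamma>] by blast
  define F where "F t = f (\<gamma> (t, 0))" for t
  have cf: "continuous_on (sphere 0 1) f" using f(1) by (rule Ck_submanifold_imp_continuous_on)
  have cF: "continuous_on UNIV F" unfolding F_def
    by (intro continuous_on_compose2[OF cf] continuous_on_compose2[OF c(1)] continuous_intros) (use \<gamma>_S in auto)
  have eq: "sphere_transform \<sigma> f (l *\<^sub>R e1) = integral {-pi..pi} (\<lambda>t. F t * osc l t)" for l
  proof -
    have m: "(\<lambda>q. indicator (sphere 0 1) q *\<^sub>R (f q * exp (- (\<i> * of_real (l *\<^sub>R e1 \<bullet> q))))) \<in> borel_measurable borel"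
      by (intro borel_measurable_continuous_on_indicator continuous_intros cf) auto
    have g_m: "(\<lambda>t. cos t *\<^sub>R e1 + sin t *\<^sub>R e2) \<in> borel_measurable borel" by measurable
    have in1: "e1 \<bullet> (cos t *\<^sub>R e1 + sin t *\<^sub>R e2) = cos t" for t
      using e by (simp add: inner_simps norm_eq_1)
    have ind: "indicator (sphere 0 1) (cos t *\<^sub>R e1 + sin t *\<^sub>R e2) = (1::real)" for t
      using \<gamma>_S[of "(t, 0)"] by (simp only: \<gamma>_def prod.case indicator_simps)
    have eqt: "indicator (sphere 0 1) (cos t *\<^sub>R e1 + sin t *\<^sub>R e2) *\<^sub>R (f (cos t *\<^sub>R e1 + sin t *\<^sub>R e2) *
        exp (- (\<i> * of_real (l *\<^sub>R e1 \<bullet> (cos t *\<^sub>R e1 + sin t *\<^sub>R e2))))) = F t * osc l t" for t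
      by (simp only: ind in1 inner_scaleR_left F_def \<gamma>_def prod.case osc_def scaleR_one)
    have cfo: "continuous_on S (\<lambda>t. F t * osc l t)" for S
      by (intro continuous_intros continuous_on_subset[OF cF]) auto
    have [measurable]: "F \<in> borel_measurable borel" "osc l \<in> borel_measurable borel"
      by (rule borel_measurable_continuous_onI, rule cF, rule borel_measurable_continuous_onI, rule continuous_on_osc)
    have "sphere_transform \<sigma> f (l *\<^sub>R e1) = (LINT t|density lborel (indicator {-pi..<pi}). F t * osc l t)"
      unfolding sphere_transform_def \<sigma>_def eqt[symmetric] by (rule integral_distr[OF _ m]) simp
    also have "density lborel (indicator {-pi..<pi}) = density lborel (\<lambda>t. ennreal (indicator {-pi..<pi} (t::real)))"
      by (rule density_cong) (auto split: split_indicator)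
    also have "(LINT t|density lborel (\<lambda>t. ennreal (indicator {-pi..<pi} t)). F t * osc l t) = (LINT t|lborel. indicator {-pi..<pi} t *\<^sub>R (F t * osc l t))"
      by (rule integral_density) simp_all
    also have "\<dots> = (LINT t|lborel. indicator {-pi..pi} t *\<^sub>R (F t * osc l t))"
    proof (rule integral_cong_AE)
      show "AE t in lborel. indicator {-pi..<pi} t *\<^sub>R (F t * osc l t) = indicator {-pi..pi} t *\<^sub>R (F t * osc l t)"
        using AE_lborel_singleton[of pi] by eventually_elim (auto split: split_indicator)
    qed simp_all
    also have "\<dots> = integral {-pi..pi} (\<lambda>t. F t * osc l t)"
      using set_borel_integral_eq_integral(2)[OF borel_integrable_atLeastAtMost'[OF cfo]]
      by (simp add: set_lebesgue_integral_def)
    finally show ?thesis .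
  qed
  have "((\<lambda>l. of_real (sqrt l) * exp (\<i> * of_real l) * integral {-pi..pi} (\<lambda>t. F t * osc l t)) \<longlongrightarrow>
    of_real (sqrt pi) * (1 + \<i>) * F 0) at_top"
  proof (rule osc_circle_integral_limit[of F "\<lambda>t. D (t, 0)"])
    show "(F has_vector_derivative D (t, 0)) (at t within {-pi..pi})" for t
      unfolding F_def by (rule has_vector_derivative_at_within[OF D(2)])
    show "continuous_on {-pi..pi} (\<lambda>t. D (t, 0))"
      by (intro continuous_on_compose2[OF D(1)] continuous_intros) auto
  qed (use f in \<open>auto simp: F_def \<gamma>_def\<close>)
  then show ?thesis unfolding eq by (simp add: F_def \<gamma>_def)
qed

definition sphere_param :: "'a::euclidean_space \<Rightarrow> 'a \<Rightarrow> 'a \<Rightarrow> real \<times> real \<Rightarrow> 'a" where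
  "sphere_param e1 e2 e3 = (\<lambda>(t, p). cos t *\<^sub>R e1 + (sin t * cos p) *\<^sub>R e2 + (sin t * sin p) *\<^sub>R e3)"

abbreviation sphere_measure3 :: "'a::euclidean_space \<Rightarrow> 'a \<Rightarrow> 'a \<Rightarrow> 'a measure" where
  "sphere_measure3 e1 e2 e3 \<equiv> distr (density lborel (\<lambda>t. ennreal (sin t) * indicator {0<..<pi} t) \<Otimes>\<^sub>M
    density lborel (indicator {-pi..<pi})) borel (sphere_param e1 e2 e3)"

lemma continuous_on_sphere_param: "continuous_on S (sphere_param e1 e2 e3)"
  unfolding sphere_param_def case_prod_unfold by (intro continuous_intros)

lemma sphere_param_in_sphere:
  assumes e: "norm e1 = 1" "norm e2 = 1" "norm e3 = 1" "e1 \<bullet> e2 = 0" "e1 \<bullet> e3 = 0" "e2 \<bullet> e3 = 0"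
  shows "sphere_param e1 e2 e3 x \<in> sphere 0 1"
proof -
  obtain t p where x: "x = (t, p)" by (cases x)
  have n: "e1 \<bullet> e1 = 1" "e2 \<bullet> e2 = 1" "e3 \<bullet> e3 = 1" using e by (auto simp: norm_eq_1)
  have "sphere_param e1 e2 e3 x \<bullet> sphere_param e1 e2 e3 x = (cos t)\<^sup>2 + ((sin t * cos p)\<^sup>2 + (sin t * sin p)\<^sup>2)"
    using e by (simp add: x sphere_param_def inner_add_left inner_add_right inner_commute n power2_eq_square)
  also have "\<dots> = 1"
    by (simp add: power_mult_distrib flip: distrib_left)
  finally have "sphere_param e1 e2 e3 x \<bullet> sphere_param e1 e2 e3 x = 1" .
  then show ?thesis by (simp add: norm_eq_sqrt_inner)
qed

text \<open>The phase depends only on the polar angle, so the azimuth can be integrated out first.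
  The factor sin t of the surface measure stays visible, since it is what integration by parts
  uses.\<close>

lemma sphere_transform_dim3:
  fixes e1 e2 e3 :: "'a::euclidean_space"
  assumes e: "norm e1 = 1" "norm e2 = 1" "norm e3 = 1" "e1 \<bullet> e2 = 0" "e1 \<bullet> e3 = 0" "e2 \<bullet> e3 = 0"
    and ch: "continuous_on (sphere 0 1) h"
  shows "sphere_transform (sphere_measure3 e1 e2 e3) h (l *\<^sub>R e1) =
    integral {0..pi} (\<lambda>t. integral {-pi..pi} (\<lambda>p. h (sphere_param e1 e2 e3 (t, p))) * of_real (sin t) * osc l t)"
proof -
  let ?g = "sphere_param e1 e2 e3"
  define A where "A = density lborel (\<lambda>t. ennreal (sin t) * indicator {0<..<pi} t)"
  define B where "B = density lborel (indicator {-pi..<pi} :: real \<Rightarrow> ennreal)"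
  have A': "A = density lborel (\<lambda>t. ennreal (sin t * indicator {0<..<pi} t))"
    unfolding A_def by (rule density_cong) (auto split: split_indicator)
  have B': "B = density lborel (\<lambda>t. ennreal (indicator {-pi..<pi} t))"
    unfolding B_def by (rule density_cong) (auto split: split_indicator)
  have [measurable_cong]: "sets A = sets borel" "sets B = sets borel" by (simp_all add: A_def B_def)
  have "finite_measure A"
  proof (rule finite_measureI)
    have "emeasure A (space A) = (\<integral>\<^sup>+t. ennreal (sin t) * indicator {0<..<pi} t \<partial>lborel)"
      by (simp add: A_def emeasure_density)
    also have "\<dots> \<le> (\<integral>\<^sup>+t. indicator {0<..<pi} t \<partial>lborel)"
      by (intro nn_integral_mono) (auto split: split_indicator simp: ennreal_le_1)
    also have "\<dots> < \<infinity>" by simp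
    finally show "emeasure A (space A) \<noteq> \<infinity>" by simp
  qed
  moreover have "finite_measure B"
    by (rule finite_measureI) (simp add: emeasure_density B_def)
  ultimately interpret A: finite_measure A + B: finite_measure B by auto
  interpret P: pair_sigma_finite A B ..
  interpret AB: finite_measure "A \<Otimes>\<^sub>M B"
    by (rule finite_measureI, simp only: space_pair_measure B.emeasure_pair_measure_Times sets.top)
        (simp add: ennreal_mult_eq_top_iff)
  have m: "(\<lambda>q. indicator (sphere 0 1) q *\<^sub>R (h q * exp (- (\<i> * of_real (l *\<^sub>R e1 \<bullet> q))))) \<in> borel_measurable borel"
    by (intro borel_measurable_continuous_on_indicator continuous_intros ch) auto
  have S: "?g x \<in> sphere 0 1" for x using e by (rule sphere_param_in_sphere)
  have in1: "e1 \<bullet> ?g (t, p) = cos t" for t p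
    using e by (simp add: sphere_param_def inner_simps norm_eq_1)
  have eqt: "indicator (sphere 0 1) (?g z) *\<^sub>R (h (?g z) * exp (- (\<i> * of_real (l *\<^sub>R e1 \<bullet> ?g z)))) = h (?g z) * osc l (fst z)" for z
  proof (cases z)
    case (Pair t p)
    show ?thesis
      using S[of z] by (simp only: Pair fst_conv in1 inner_scaleR_left osc_def scaleR_one indicator_simps)
  qed
  have chg: "continuous_on T (\<lambda>z. h (?g z))" for T
    by (rule continuous_on_compose2[OF ch continuous_on_sphere_param]) (use S in auto)
  have [measurable]: "osc l \<in> borel_measurable borel" "(\<lambda>z. h (?g z)) \<in> borel_measurable (borel \<Otimes>\<^sub>M borel)"
    by (rule borel_measurable_continuous_onI, rule continuous_on_osc, unfold borel_prod, rule borel_measurable_continuous_onI, rule chg)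
  have "compact (sphere (0::'a) 1)" by simp
  then obtain K where K: "\<And>q. q \<in> sphere 0 1 \<Longrightarrow> norm (h q) \<le> K"
    using compact_imp_bounded[OF compact_continuous_image[OF ch]] unfolding bounded_iff by blast
  have int: "integrable (A \<Otimes>\<^sub>M B) (\<lambda>z. h (?g z) * osc l (fst z))"
    by (rule AB.integrable_const_bound[of _ K]) (use K S in \<open>simp_all add: norm_mult\<close>)
  have "?g \<in> borel_measurable (A \<Otimes>\<^sub>M B)"
  proof -
    have "?g \<in> borel_measurable (borel \<Otimes>\<^sub>M borel)"
      unfolding borel_prod by (rule borel_measurable_continuous_onI, rule continuous_on_sphere_param)
    then show ?thesis by simp
  qed
  then have "sphere_transform (sphere_measure3 e1 e2 e3) h (l *\<^sub>R e1) = (LINT z|(A \<Otimes>\<^sub>M B). h (?g z) * osc l (fst z))"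
    unfolding sphere_transform_def A_def[symmetric] B_def[symmetric] eqt[symmetric] by (intro integral_distr m)
  also have "\<dots> = (LINT t|A. LINT p|B. h (?g (t, p)) * osc l t)"
    using P.integral_fst'[OF int] by simp
  also have "\<dots> = (LINT t|A. integral {-pi..pi} (\<lambda>p. h (?g (t, p))) * osc l t)"
  proof (rule Bochner_Integration.integral_cong[OF refl])
    fix t
    have cp: "continuous_on T (\<lambda>p. h (?g (t, p)))" for T
      by (rule continuous_on_compose2[OF chg[of UNIV]]) (auto intro!: continuous_intros)
    have [measurable]: "(\<lambda>p. h (?g (t, p))) \<in> borel_measurable borel" by simp
    have "(LINT p|B. h (?g (t, p)) * osc l t) = (LINT p|B. h (?g (t, p))) * osc l t" by simp
    also have "(LINT p|B. h (?g (t, p))) = (LINT p|lborel. indicator {-pi..<pi} p *\<^sub>R h (?g (t, p)))"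
      unfolding B' by (rule integral_density) simp_all
    also have "\<dots> = (LINT p|lborel. indicator {-pi..pi} p *\<^sub>R h (?g (t, p)))"
    proof (rule integral_cong_AE)
      show "AE p in lborel. indicator {-pi..<pi} p *\<^sub>R h (?g (t, p)) = indicator {-pi..pi} p *\<^sub>R h (?g (t, p))"
        using AE_lborel_singleton[of pi] by eventually_elim (auto split: split_indicator)
    qed simp_all
    also have "\<dots> = integral {-pi..pi} (\<lambda>p. h (?g (t, p)))"
      using set_borel_integral_eq_integral(2)[OF borel_integrable_atLeastAtMost'[OF cp]]
      by (simp add: set_lebesgue_integral_def)
    finally show "(LINT p|B. h (?g (t, p)) * osc l t) = integral {-pi..pi} (\<lambda>p. h (?g (t, p))) * osc l t" .
  qed
  also have "\<dots> = integral {0..pi} (\<lambda>t. integral {-pi..pi} (\<lambda>p. h (?g (t, p))) * of_real (sin t) * osc l t)"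
  proof -
    define H where "H t = integral {-pi..pi} (\<lambda>p. h (?g (t, p)))" for t
    have cH: "continuous_on UNIV H"
      unfolding H_def cbox_interval[symmetric] by (rule integral_continuous_on_param) (use chg in \<open>simp add: case_prod_unfold\<close>)
    have cfo: "continuous_on S (\<lambda>t. H t * of_real (sin t) * osc l t)" for S
      by (intro continuous_intros continuous_on_subset[OF cH]) auto
    have [measurable]: "H \<in> borel_measurable borel" by (rule borel_measurable_continuous_onI, rule cH)
    have "(LINT t|A. H t * osc l t) = (LINT t|lborel. (sin t * indicator {0<..<pi} t) *\<^sub>R (H t * osc l t))"
      unfolding A' by (rule integral_density) (auto split: split_indicator intro!: AE_I2 sin_ge_zero)
    also have "\<dots> = (LINT t|lborel. indicator {0..pi} t *\<^sub>R (H t * of_real (sin t) * osc l t))"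
      by (rule Bochner_Integration.integral_cong) (auto split: split_indicator simp: scaleR_conv_of_real order.order_iff_strict)
    also have "\<dots> = integral {0..pi} (\<lambda>t. H t * of_real (sin t) * osc l t)"
      using set_borel_integral_eq_integral(2)[OF borel_integrable_atLeastAtMost'[OF cfo]]
      by (simp add: set_lebesgue_integral_def)
    finally show ?thesis unfolding H_def .
  qed
  finally show ?thesis .
qed

text \<open>At a pole the azimuth has no effect, so the azimuthal integral F equals 2 pi times the
  value of f there: the wanted limit at t = 0 and zero at t = pi. Differentiation under the integral
  gives F'.\<close>

lemma sphere_asymptotics_dim3:
  fixes e1 e2 e3 :: "'a::euclidean_space"
  assumes e: "norm e1 = 1" "norm e2 = 1" "norm e3 = 1" "e1 \<bullet> e2 = 0" "e1 \<bullet> e3 = 0" "e2 \<bullet> e3 = 0"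
    and f: "Ck_submanifold (Suc 0) (sphere 0 1) f" "f (- e1) = 0"
  shows "((\<lambda>l. of_real l * exp (\<i> * of_real l) * sphere_transform (sphere_measure3 e1 e2 e3) f (l *\<^sub>R e1)) \<longlongrightarrow>
    2 * of_real pi * \<i> * f e1) at_top"
proof -
  let ?g = "sphere_param e1 e2 e3"
  define g' where "g' = (\<lambda>(t, p). (- sin t) *\<^sub>R e1 + (cos t * cos p) *\<^sub>R e2 + (cos t * sin p) *\<^sub>R e3)"
  have S: "?g x \<in> sphere 0 1" for x using e by (rule sphere_param_in_sphere)
  have c': "continuous_on UNIV g'"
    unfolding g'_def case_prod_unfold by (intro continuous_intros)
  have dg: "((\<lambda>s. ?g (s, p)) has_vector_derivative g' (t, p)) (at t)" for t p
    unfolding sphere_param_def g'_def prod.case by (auto intro!: derivative_eq_intros)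
  obtain D where D: "continuous_on UNIV D" "\<And>t p. ((\<lambda>s. f (?g (s, p))) has_vector_derivative D (t, p)) (at t)"
    using Ck_submanifold_param_derivative[OF f(1) S continuous_on_sphere_param c' dg] by blast
  have cf: "continuous_on (sphere 0 1) f" using f(1) by (rule Ck_submanifold_imp_continuous_on)
  have cfg: "continuous_on T (\<lambda>z. f (?g z))" for T
    by (rule continuous_on_compose2[OF cf continuous_on_sphere_param]) (use S in auto)
  define F where "F t = integral {-pi..pi} (\<lambda>p. f (?g (t, p)))" for t
  define F' where "F' t = integral {-pi..pi} (\<lambda>p. D (t, p))" for t
  have "((\<lambda>l. of_real l * exp (\<i> * of_real l) * integral {0..pi} (\<lambda>t. F t * of_real (sin t) * osc l t)) \<longlongrightarrow> \<i> * F 0) at_top"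
  proof (rule osc_sin_integral_limit[of F F'])
    fix t :: real assume "t \<in> {0..pi}"
    then show "(F has_vector_derivative F' t) (at t within {0..pi})"
      unfolding F_def F'_def cbox_interval[symmetric]
    proof (intro leibniz_rule_vector_derivative)
      show "((\<lambda>x. f (?g (x, p))) has_vector_derivative D (x, p)) (at x within cbox 0 pi)" for x p
        by (rule has_vector_derivative_at_within[OF D(2)])
      show "(\<lambda>p. f (?g (x, p))) integrable_on cbox (- pi) pi" for x
        by (intro integrable_continuous continuous_on_compose2[OF cfg[of UNIV]]) (auto intro!: continuous_intros)
      show "continuous_on (cbox 0 pi \<times> cbox (- pi) pi) (\<lambda>(x, t). D (x, t))"
        using continuous_on_subset[OF D(1)] by (simp add: case_prod_unfold)
    qed auto
  next
    show "continuous_on {0..pi} F'"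
      unfolding F'_def cbox_interval[symmetric]
      by (rule integral_continuous_on_param) (use continuous_on_subset[OF D(1)] in \<open>simp add: case_prod_unfold\<close>)
    show "F pi = 0" using f by (simp add: F_def sphere_param_def)
  qed
  moreover have "F 0 = 2 * of_real pi * f e1"
    by (simp add: F_def sphere_param_def scaleR_conv_of_real)
  ultimately show ?thesis
    unfolding sphere_transform_dim3[OF e cf] F_def by (simp add: mult_ac)
qed

text \<open>Plain decay without a rate, for densities that are merely continuous. It disposes of the
  first-moment correction that only dimension 3 produces.\<close>

lemma sphere_transform_dim3_tendsto_0:
  fixes e1 e2 e3 :: "'a::euclidean_space"
  assumes e: "norm e1 = 1" "norm e2 = 1" "norm e3 = 1" "e1 \<bullet> e2 = 0" "e1 \<bullet> e3 = 0" "e2 \<bullet> e3 = 0"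
    and cf: "continuous_on (sphere 0 1) f"
  shows "((\<lambda>l. sphere_transform (sphere_measure3 e1 e2 e3) f (l *\<^sub>R e1)) \<longlongrightarrow> 0) at_top"
  unfolding sphere_transform_dim3[OF e cf]
proof (rule osc_integral_tendsto_0)
  have S: "sphere_param e1 e2 e3 x \<in> sphere 0 1" for x using e by (rule sphere_param_in_sphere)
  have cfg: "continuous_on T (\<lambda>z. f (sphere_param e1 e2 e3 z))" for T
    by (rule continuous_on_compose2[OF cf continuous_on_sphere_param]) (use S in auto)
  have "continuous_on {0..pi} (\<lambda>t. integral {-pi..pi} (\<lambda>p. f (sphere_param e1 e2 e3 (t, p))))"
    unfolding cbox_interval[symmetric]
    by (rule integral_continuous_on_param) (use cfg in \<open>simp add: case_prod_unfold\<close>)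
  then show "continuous_on {0..pi} (\<lambda>t. integral {-pi..pi} (\<lambda>p. f (sphere_param e1 e2 e3 (t, p))) * of_real (sin t))"
    by (intro continuous_intros)
qed

text \<open>The order \<open>min 1 (DIM('a) - 1)\<close> asks for continuity on the two-point sphere
  and for one derivative in dimensions 2 and 3. The measure is obtained together with its
  asymptotics because its chart is centred at e.\<close>

lemma sphere_asymptotics:
  fixes e :: "'a::euclidean_space"
  assumes e: "norm e = 1" and dim: "DIM('a) \<in> {1, 2, 3}"
  obtains \<sigma> where "polar_measure \<sigma>"
    "\<And>f. Ck_submanifold (min 1 (DIM('a) - 1)) (sphere 0 1) f \<Longrightarrow> f (- e) = 0 \<Longrightarrow>
      ((\<lambda>l. of_real (l powr ((real DIM('a) - 1) / 2)) * exp (\<i> * of_real l) * sphere_transform \<sigma> f (l *\<^sub>R e)) \<longlongrightarrow>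
        f e / plane_const DIM('a)) at_top"
    "\<And>f. DIM('a) = 3 \<Longrightarrow> continuous_on (sphere 0 1) f \<Longrightarrow> ((\<lambda>l. sphere_transform \<sigma> f (l *\<^sub>R e)) \<longlongrightarrow> 0) at_top"
proof -
  consider "DIM('a) = 1" | "DIM('a) = 2" | "DIM('a) = 3" using dim by auto
  then show ?thesis
  proof cases
    case 1
    show ?thesis
    proof (rule that[OF polar_measure_dim1[OF e 1]])
      fix f :: "'a \<Rightarrow> complex" assume f: "f (- e) = 0"
      have "\<forall>\<^sub>F l in at_top. f e / plane_const DIM('a) = of_real (l powr ((real DIM('a) - 1) / 2)) * exp (\<i> * of_real l) *
          sphere_transform (distr (count_space {1, -1}) borel (\<lambda>s. s *\<^sub>R e)) f (l *\<^sub>R e)"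
        using eventually_gt_at_top[of 0]
        by eventually_elim (simp add: 1 plane_const_1[unfolded One_nat_def] mult.assoc sphere_asymptotics_dim1[where f=f and e=e, OF e 1 f])
      then show "((\<lambda>l. of_real (l powr ((real DIM('a) - 1) / 2)) * exp (\<i> * of_real l) *
          sphere_transform (distr (count_space {1, -1}) borel (\<lambda>s. s *\<^sub>R e)) f (l *\<^sub>R e)) \<longlongrightarrow> f e / plane_const DIM('a)) at_top"
        by (rule Lim_transform_eventually[OF tendsto_const])
    qed (use 1 in simp)
  next
    case 2
    obtain e2 where e2: "norm e2 = 1" "e \<bullet> e2 = 0" "\<And>x. \<exists>a b. x = a *\<^sub>R e + b *\<^sub>R e2"
      using orthonormal_basis2[OF e 2] by metis
    show ?thesis
    proof (rule that[OF polar_measure_dim2[OF e e2 2]])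
      fix f :: "'a \<Rightarrow> complex" assume f: "Ck_submanifold (min 1 (DIM('a) - 1)) (sphere 0 1) f" "f (- e) = 0"
      from sphere_asymptotics_dim2[of e e2 f] f e e2 2
      have "((\<lambda>l. of_real (sqrt l) * exp (\<i> * of_real l) * sphere_transform (distr (density lborel (indicator {-pi..<pi})) borel
          (\<lambda>t. cos t *\<^sub>R e + sin t *\<^sub>R e2)) f (l *\<^sub>R e)) \<longlongrightarrow> of_real (sqrt pi) * (1 + \<i>) * f e) at_top"
        by simp
      moreover have "f e / plane_const DIM('a) = of_real (sqrt pi) * (1 + \<i>) * f e"
        unfolding 2 plane_const_2[symmetric] by (simp add: divide_inverse)
      ultimately show "((\<lambda>l. of_real (l powr ((real DIM('a) - 1) / 2)) * exp (\<i> * of_real l) * sphere_transform (distr (density lborel (indicator {-pi..<pi})) borel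
          (\<lambda>t. cos t *\<^sub>R e + sin t *\<^sub>R e2)) f (l *\<^sub>R e)) \<longlongrightarrow> f e / plane_const DIM('a)) at_top"
      proof (elim ssubst Lim_transform_eventually)
        show "\<forall>\<^sub>F l in at_top. of_real (sqrt l) * exp (\<i> * of_real l) * g l =
            of_real (l powr ((real DIM('a) - 1) / 2)) * exp (\<i> * of_real l) * g l" for g :: "real \<Rightarrow> complex"
          using eventually_gt_at_top[of 0] by eventually_elim (simp add: 2 powr_half_sqrt)
      qed
    qed (use 2 in simp)
  next
    case 3
    obtain e2 e3 where e23: "norm e2 = 1" "norm e3 = 1" "e \<bullet> e2 = 0" "e \<bullet> e3 = 0" "e2 \<bullet> e3 = 0"
      "\<And>x. \<exists>a b c. x = a *\<^sub>R e + b *\<^sub>R e2 + c *\<^sub>R e3"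
      using orthonormal_basis3[OF e 3] by metis
    show ?thesis
    proof (rule that[OF polar_measure_dim3[OF e e23 3, folded sphere_param_def]])
      fix f :: "'a \<Rightarrow> complex" assume f: "Ck_submanifold (min 1 (DIM('a) - 1)) (sphere 0 1) f" "f (- e) = 0"
      have "((\<lambda>l. of_real l * exp (\<i> * of_real l) * sphere_transform (sphere_measure3 e e2 e3) f (l *\<^sub>R e)) \<longlongrightarrow> 2 * of_real pi * \<i> * f e) at_top"
        using f by (intro sphere_asymptotics_dim3 e e23) (simp_all add: 3)
      moreover have "f e / plane_const DIM('a) = 2 * of_real pi * \<i> * f e"
        unfolding 3 plane_const_3 by simp
      ultimately show "((\<lambda>l. of_real (l powr ((real DIM('a) - 1) / 2)) * exp (\<i> * of_real l) * sphere_transform (sphere_measure3 e e2 e3) f (l *\<^sub>R e)) \<longlongrightarrow> f e / plane_const DIM('a)) at_top"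
      proof (elim ssubst Lim_transform_eventually)
        show "\<forall>\<^sub>F l in at_top. of_real l * exp (\<i> * of_real l) * g l =
            of_real (l powr ((real DIM('a) - 1) / 2)) * exp (\<i> * of_real l) * g l" for g :: "real \<Rightarrow> complex"
          using eventually_gt_at_top[of 0] by eventually_elim (simp add: 3)
      qed
    next
      fix f :: "'a \<Rightarrow> complex" assume "continuous_on (sphere 0 1) f"
      then show "((\<lambda>l. sphere_transform (sphere_measure3 e e2 e3) f (l *\<^sub>R e)) \<longlongrightarrow> 0) at_top"
        by (intro sphere_transform_dim3_tendsto_0 e e23)
    qed
  qed
qed

section \<open>Plancherel inequality and Fourier inversion\<close>

text \<open>Rescaling by d reduces the integral to the characteristic function of the standard
  normal distribution.\<close>

lemma gaussian_fourier_real: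
  assumes d: "d > 0"
  shows "integrable lborel (\<lambda>z. exp (\<i> * of_real (y * z)) * of_real (exp (- (d\<^sup>2 * z\<^sup>2) / 2)))" (is ?int)
    and "(LINT z|lborel. exp (\<i> * of_real (y * z)) * of_real (exp (- (d\<^sup>2 * z\<^sup>2) / 2))) =
      of_real (sqrt (2 * pi) / d * exp (- (y\<^sup>2) / (2 * d\<^sup>2)))" (is ?eq)
proof -
  let ?f = "\<lambda>z. exp (\<i> * of_real (y * z)) * of_real (exp (- (d\<^sup>2 * z\<^sup>2) / 2))"
  have cf: "continuous_on UNIV ?f" by (intro continuous_intros) auto
  have g: "integrable lborel (\<lambda>u::real. exp (- (of_real (d\<^sup>2 / 2) * of_real (u\<^sup>2)) :: complex))"
    by (rule integrable_complex_gaussian) (use d in simp)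
  have "exp (- (of_real (d\<^sup>2 / 2) * of_real (u\<^sup>2)) :: complex) = of_real (exp (- (d\<^sup>2 * u\<^sup>2) / 2))" for u :: real
    by (simp add: exp_of_real[symmetric])
  with g have "integrable lborel (\<lambda>u. complex_of_real (exp (- (d\<^sup>2 * u\<^sup>2) / 2)))" by simp
  then show ?int
    by (rule Bochner_Integration.integrable_bound)
      (auto intro!: borel_measurable_continuous_onI cf AE_I2 simp: norm_mult norm_exp_eq_Re)
  have "(LINT z|lborel. ?f z) = \<bar>1 / d\<bar> *\<^sub>R (LINT w|lborel. ?f (0 + 1 / d * w))"
    by (rule lborel_integral_real_affine) (use d in simp)
  also have "(LINT w|lborel. ?f (0 + 1 / d * w)) = (LINT w|lborel. of_real (sqrt (2 * pi)) * (std_normal_density w *\<^sub>R exp (\<i> * of_real (y / d * w))))"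
    using d by (intro Bochner_Integration.integral_cong) (auto simp: std_normal_density_def scaleR_conv_of_real power_divide field_simps)
  also have "\<dots> = of_real (sqrt (2 * pi)) * (LINT w|lborel. std_normal_density w *\<^sub>R exp (\<i> * of_real (y / d * w)))"
    by (rule integral_mult_right_zero)
  also have "(LINT w|lborel. std_normal_density w *\<^sub>R exp (\<i> * of_real (y / d * w))) = char std_normal_distribution (y / d)"
    unfolding char_def by (subst integral_density) auto
  also have "\<dots> = of_real (exp (- (y\<^sup>2) / (2 * d\<^sup>2)))"
    by (simp add: char_std_normal_distribution power_divide)
  finally show ?eq using d by (simp add: scaleR_conv_of_real)
qed

text \<open>Both the character and the Gaussian factor over the coordinates, so the integral is a
  product of one-dimensional ones.\<close>

lemma gaussian_fourier:
  fixes y :: "'a::euclidean_space"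
  assumes d: "d > 0"
  shows "integrable lborel (\<lambda>k. exp (\<i> * of_real (y \<bullet> k)) * of_real (exp (- (d\<^sup>2 * (norm k)\<^sup>2) / 2)))" (is ?int)
    and "(LINT k|lborel. exp (\<i> * of_real (y \<bullet> k)) * of_real (exp (- (d\<^sup>2 * (norm k)\<^sup>2) / 2))) =
      of_real ((sqrt (2 * pi) / d) ^ DIM('a) * exp (- (norm y)\<^sup>2 / (2 * d\<^sup>2)))" (is ?eq)
proof -
  let ?g = "\<lambda>b z. exp (\<i> * of_real ((y \<bullet> b) * z)) * of_real (exp (- (d\<^sup>2 * z\<^sup>2) / 2))"
  let ?T = "\<lambda>f. \<Sum>b\<in>Basis. f b *\<^sub>R (b::'a)"
  have sq: "(norm x)\<^sup>2 = (\<Sum>b\<in>Basis. (x \<bullet> b)\<^sup>2)" for x :: 'a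
    unfolding power2_norm_eq_inner by (subst euclidean_inner) (simp add: power2_eq_square)
  have prod: "exp (\<i> * of_real (y \<bullet> k)) * of_real (exp (- (d\<^sup>2 * (norm k)\<^sup>2) / 2)) = (\<Prod>b\<in>Basis. ?g b (k \<bullet> b))" for k
  proof -
    have "(\<Prod>b\<in>Basis. ?g b (k \<bullet> b)) = (\<Prod>b\<in>Basis. exp (\<i> * of_real ((y \<bullet> b) * (k \<bullet> b)))) * (\<Prod>b\<in>Basis. of_real (exp (- (d\<^sup>2 * (k \<bullet> b)\<^sup>2) / 2)))"
      by (rule prod.distrib)
    also have "(\<Prod>b\<in>Basis. exp (\<i> * of_real ((y \<bullet> b) * (k \<bullet> b)))) = exp (\<i> * of_real (y \<bullet> k))"
      by (simp add: exp_sum[symmetric] sum_distrib_left[symmetric] euclidean_inner[of y k] del: of_real_mult)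
    also have "(\<Prod>b\<in>Basis. of_real (exp (- (d\<^sup>2 * (k \<bullet> b)\<^sup>2) / 2))) = (of_real (exp (- (d\<^sup>2 * (norm k)\<^sup>2) / 2)) :: complex)"
      unfolding of_real_prod[symmetric] sq
      by (subst exp_sum[symmetric]) (simp_all add: sum_distrib_left sum_divide_distrib sum_negf)
    finally show ?thesis by simp
  qed
  interpret product_sigma_finite "\<lambda>_::'a. lborel :: real measure" ..
  have Tb: "?T f \<bullet> b = f b" if "b \<in> Basis" for f b
    using that by simp
  have int: "integrable (\<Pi>\<^sub>M b\<in>Basis. lborel) (\<lambda>f. \<Prod>b\<in>Basis. ?g b (f b))"
    by (rule product_integrable_prod) (simp, rule gaussian_fourier_real(1)[OF d])
  have [measurable]: "?T \<in> borel_measurable (\<Pi>\<^sub>M b\<in>Basis. lborel)" by measurable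
  have m: "(\<lambda>k. exp (\<i> * of_real (y \<bullet> k)) * of_real (exp (- (d\<^sup>2 * (norm k)\<^sup>2) / 2))) \<in> borel_measurable borel"
    by (intro borel_measurable_continuous_onI continuous_intros) auto
  have prod': "(\<Prod>b\<in>Basis. ?g b (?T f \<bullet> b)) = (\<Prod>b\<in>Basis. ?g b (f b))" for f
    by (rule prod.cong[OF refl]) (simp only: Tb)
  show ?int
    by (subst lborel_eq, subst integrable_distr_eq[OF _ m], simp, unfold prod prod', rule int)
  have "(LINT k|lborel. exp (\<i> * of_real (y \<bullet> k)) * of_real (exp (- (d\<^sup>2 * (norm k)\<^sup>2) / 2)))
     = integral\<^sup>L (\<Pi>\<^sub>M b\<in>Basis. lborel) (\<lambda>f. \<Prod>b\<in>Basis. ?g b (f b))"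
    by (subst lborel_eq, subst integral_distr[OF _ m], simp, unfold prod prod', rule refl)
  also have "\<dots> = (\<Prod>b\<in>Basis. LINT z|lborel. ?g b z)"
    by (rule product_integral_prod) (simp, rule gaussian_fourier_real(1)[OF d])
  also have "\<dots> = (\<Prod>b\<in>Basis. of_real (sqrt (2 * pi) / d * exp (- ((y \<bullet> b)\<^sup>2) / (2 * d\<^sup>2))))"
    by (intro prod.cong refl gaussian_fourier_real d)
  also have "\<dots> = of_real ((sqrt (2 * pi) / d) ^ DIM('a) * exp (- (norm y)\<^sup>2 / (2 * d\<^sup>2)))"
    unfolding of_real_prod[symmetric] prod.distrib sq
    by (subst exp_sum[symmetric]) (simp_all add: sum_divide_distrib sum_negf)
  finally show ?eq .
qed

text \<open>The mass is the same for every width d of the regulariser; it is the source of the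
  constant in the Plancherel bound.\<close>

lemma gaussian_kernel_integral:
  assumes d: "d > 0"
  shows "(\<integral>\<^sup>+y. ennreal ((sqrt (2 * pi) / d) ^ DIM('a) * exp (- (norm y)\<^sup>2 / (2 * d\<^sup>2))) \<partial>(lborel :: 'a::euclidean_space measure)) =
    ennreal ((2 * pi) ^ DIM('a))"
proof -
  have k: "exp (- (norm y)\<^sup>2 / (2 * d\<^sup>2)) = exp (- ((1 / d)\<^sup>2 * (norm y)\<^sup>2) / 2)" for y :: 'a
    using d by (simp add: field_simps)
  have d': "1 / d > 0" using d by simp
  let ?e = "\<lambda>y::'a. exp (- ((1 / d)\<^sup>2 * (norm y)\<^sup>2) / 2)"
  have int': "integrable lborel (\<lambda>y. complex_of_real (?e y))"
    using gaussian_fourier(1)[OF d', of "0::'a"] by (simp only: inner_zero_left of_real_0 mult_zero_right exp_zero mult_1_left)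
  then have int: "integrable lborel ?e"
    by (simp only: complex_of_real_integrable_eq)
  have "complex_of_real (LINT y|lborel. ?e y) = of_real ((sqrt (2 * pi) * d) ^ DIM('a))"
    using gaussian_fourier(2)[OF d', of "0::'a"]
    by (simp only: integral_complex_of_real[symmetric] inner_zero_left of_real_0 mult_zero_right exp_zero mult_1_left) simp
  then have val: "(LINT y|lborel. ?e y) = (sqrt (2 * pi) * d) ^ DIM('a)"
    by (simp only: of_real_eq_iff)
  have "(\<integral>\<^sup>+y. ennreal ((sqrt (2 * pi) / d) ^ DIM('a) * ?e y) \<partial>lborel) = ennreal (LINT y|lborel. (sqrt (2 * pi) / d) ^ DIM('a) * ?e y)"
    using d int by (intro nn_integral_eq_integral integrable_mult_right AE_I2) simp_all
  also have "(LINT y|lborel. (sqrt (2 * pi) / d) ^ DIM('a) * ?e y) = (sqrt (2 * pi) / d) ^ DIM('a) * (sqrt (2 * pi) * d) ^ DIM('a)"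
    by (simp only: integral_mult_right_zero val)
  also have "\<dots> = ((sqrt (2 * pi) / d) * (sqrt (2 * pi) * d)) ^ DIM('a)"
    by (rule power_mult_distrib[symmetric])
  also have "(sqrt (2 * pi) / d) * (sqrt (2 * pi) * d) = 2 * pi"
    using d by simp
  finally show ?thesis unfolding k .
qed

text \<open>The same integral as \<open>fourier\<close>, but over \<open>lborel\<close>, where
  product measures and Fubini are at hand.\<close>

definition lfourier :: "('a::euclidean_space \<Rightarrow> complex) \<Rightarrow> 'a \<Rightarrow> complex" where
  "lfourier u k = (LINT x|lborel. exp (- (\<i> * of_real (k \<bullet> x))) * u x)"

lemma continuous_lfourier:
  assumes u: "integrable lborel u"
  shows "continuous_on UNIV (lfourier u)"
  unfolding continuous_on_sequentially comp_def
proof (intro ballI allI impI)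
  fix X and k :: 'a assume "(\<forall>n. X n \<in> UNIV) \<and> X \<longlonglongrightarrow> k"
  then have X: "X \<longlonglongrightarrow> k" by simp
  have [measurable]: "u \<in> borel_measurable lborel" using u by auto
  show "(\<lambda>n. lfourier u (X n)) \<longlonglongrightarrow> lfourier u k"
    unfolding lfourier_def
  proof (rule integral_dominated_convergence)
    show "integrable lborel (\<lambda>x. norm (u x))" using u by simp
    show "AE x in lborel. (\<lambda>n. exp (- (\<i> * of_real (X n \<bullet> x))) * u x) \<longlonglongrightarrow> exp (- (\<i> * of_real (k \<bullet> x))) * u x"
      by (intro always_eventually allI tendsto_intros X)
  qed (auto simp: norm_mult norm_exp_eq_Re)
qed

lemma integrable_mult_cnj:
  fixes f :: "'a::euclidean_space \<Rightarrow> complex"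
  assumes f: "integrable lborel f"
  shows "integrable (lborel \<Otimes>\<^sub>M lborel) (\<lambda>(x, y). f x * cnj (f y))"
proof (rule lborel_pair.Fubini_integrable)
  have [measurable]: "f \<in> borel_measurable borel" using borel_measurable_integrable[OF f] by simp
  have [measurable]: "cnj \<in> borel_measurable borel"
    by (intro borel_measurable_continuous_onI continuous_intros)
  show "(\<lambda>(x, y). f x * cnj (f y)) \<in> borel_measurable (lborel \<Otimes>\<^sub>M lborel)" by measurable
  show "integrable lborel (\<lambda>x. LINT y|lborel. norm (case (x, y) of (x, y) \<Rightarrow> f x * cnj (f y)))"
    using f by (simp add: norm_mult)
qed (use f in auto)

text \<open>A Gaussian factor in k makes Fubini legal: the integral of |lfourier u|^2 becomes a
  double integral of u(x) cnj(u(y)) against a kernel in y - x whose mass is independent of the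
  width. An inequality suffices throughout, so the factor is finally removed by Fatou, and u may
  have infinite L^2 norm.\<close>

lemma plancherel_le:
  fixes u :: "'a::euclidean_space \<Rightarrow> complex"
  assumes u: "integrable lborel u"
  shows "(\<integral>\<^sup>+k. ennreal ((cmod (lfourier u k))\<^sup>2) \<partial>lborel) \<le> ennreal ((2 * pi) ^ DIM('a)) * (\<integral>\<^sup>+x. ennreal ((cmod (u x))\<^sup>2) \<partial>lborel)"
proof -
  have [measurable]: "u \<in> borel_measurable borel" using borel_measurable_integrable[OF u] by simp
  have cnj_m[measurable]: "cnj \<in> borel_measurable borel"
    by (intro borel_measurable_continuous_onI continuous_intros)
  have F_m[measurable]: "lfourier u \<in> borel_measurable borel"
    by (rule borel_measurable_continuous_onI[OF continuous_lfourier[OF u]])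
  let ?N = "\<integral>\<^sup>+x. ennreal ((cmod (u x))\<^sup>2) \<partial>lborel"
  define \<Phi> :: "real \<Rightarrow> 'a \<Rightarrow> real" where "\<Phi> d y = (sqrt (2 * pi) / d) ^ DIM('a) * exp (- (norm y)\<^sup>2 / (2 * d\<^sup>2))" for d y
  define K :: "real \<Rightarrow> 'a \<Rightarrow> real" where "K d k = exp (- (d\<^sup>2 * (norm k)\<^sup>2) / 2)" for d k
  have [measurable]: "\<Phi> d \<in> borel_measurable borel" "K d \<in> borel_measurable borel" for d
    unfolding \<Phi>_def K_def by measurable
  have \<Phi>0: "\<Phi> d y \<ge> 0" if "d > 0" for d y using that by (simp add: \<Phi>_def)
  have main: "(\<integral>\<^sup>+k. ennreal ((cmod (lfourier u k))\<^sup>2 * K d k) \<partial>lborel) \<le> ennreal ((2 * pi) ^ DIM('a)) * ?N" if d: "d > 0" for d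
  proof -
    have intK: "integrable lborel (\<lambda>k::'a. complex_of_real (K d k))"
      using gaussian_fourier(1)[OF d, of "0::'a"] by (simp add: K_def)
    interpret LLL: pair_sigma_finite "(lborel :: 'a measure) \<Otimes>\<^sub>M (lborel :: 'a measure)" "lborel :: 'a measure"
      by (intro pair_sigma_finite.intro sigma_finite_pair_measure lborel.sigma_finite_measure_axioms)
    define w where "w z = u (fst z) * cnj (u (snd z))" for z
    have int_w: "integrable (lborel \<Otimes>\<^sub>M lborel) w"
    proof -
      have "integrable (lborel \<Otimes>\<^sub>M lborel) (\<lambda>(x, y). u x * cnj (u y))"
        by (rule integrable_mult_cnj[OF u])
      then show ?thesis by (simp add: w_def[abs_def] case_prod_unfold)
    qed
    have [measurable]: "w \<in> borel_measurable (lborel \<Otimes>\<^sub>M lborel)" using int_w by auto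
    \<comment> \<open>The pair z holds both copies of the space variable. The norm of
      \<open>G\<close> is a product in z and k, which gives joint integrability.\<close>
    define G where "G k z = exp (- (\<i> * of_real (k \<bullet> (fst z - snd z)))) * w z * of_real (K d k)" for k z
    have G_m[measurable]: "(\<lambda>(z, k). G k z) \<in> borel_measurable ((lborel \<Otimes>\<^sub>M lborel) \<Otimes>\<^sub>M lborel)"
      unfolding G_def by measurable
    have G_m'[measurable]: "(\<lambda>k. G k z) \<in> borel_measurable borel" for z
      unfolding G_def by measurable
    have nG: "norm (G k z) = norm (w z) * K d k" for k z
      by (simp add: G_def norm_mult norm_exp_eq_Re K_def)
    have sq: "complex_of_real ((cmod (lfourier u k))\<^sup>2 * K d k) = (LINT z|(lborel \<Otimes>\<^sub>M lborel). G k z)" for k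
    proof -
      let ?a = "\<lambda>x. exp (- (\<i> * of_real (k \<bullet> x))) * u x"
      have ia: "integrable lborel ?a"
        by (rule Bochner_Integration.integrable_bound[OF u]) (auto simp: norm_mult norm_exp_eq_Re)
      note ia2 = integrable_mult_cnj[OF ia]
      have "complex_of_real ((cmod (lfourier u k))\<^sup>2) = lfourier u k * cnj (lfourier u k)"
        by (rule complex_norm_square)
      also have "\<dots> = (LINT x|lborel. ?a x) * (LINT y|lborel. cnj (?a y))"
        unfolding lfourier_def integral_bounded_linear[OF bounded_linear_cnj ia] ..
      also have "\<dots> = (LINT x|lborel. LINT y|lborel. ?a x * cnj (?a y))"
        by (simp only: integral_mult_right_zero integral_mult_left_zero)
      also have "\<dots> = (LINT z|(lborel \<Otimes>\<^sub>M lborel). (\<lambda>(x, y). ?a x * cnj (?a y)) z)"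
        using lborel_pair.integral_fst'[OF ia2] by simp
      also have "\<dots> * of_real (K d k) = (LINT z|(lborel \<Otimes>\<^sub>M lborel). (\<lambda>(x, y). ?a x * cnj (?a y)) z * of_real (K d k))"
        by (rule integral_mult_left_zero[symmetric])
      also have "\<dots> = (LINT z|(lborel \<Otimes>\<^sub>M lborel). G k z)"
      proof (rule Bochner_Integration.integral_cong[OF refl])
        fix z :: "'a \<times> 'a"
        obtain x y where z: "z = (x, y)" by (cases z)
        have c: "cnj (exp (- (\<i> * of_real (k \<bullet> y)))) = exp (\<i> * of_real (k \<bullet> y))"
          by (simp add: exp_cnj)
        have m: "exp (- (\<i> * of_real (k \<bullet> (x - y)))) = exp (- (\<i> * of_real (k \<bullet> x))) * exp (\<i> * of_real (k \<bullet> y))"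
          unfolding exp_add[symmetric] by (simp add: inner_diff_right algebra_simps)
        show "(\<lambda>(x, y). ?a x * cnj (?a y)) z * of_real (K d k) = G k z"
          by (simp only: z prod.case G_def w_def fst_conv snd_conv m complex_cnj_mult c mult_ac)
      qed
      finally show ?thesis by simp
    qed
    have int_G: "integrable ((lborel \<Otimes>\<^sub>M lborel) \<Otimes>\<^sub>M lborel) (\<lambda>(z, k). G k z)"
    proof (rule LLL.Fubini_integrable)
      show "integrable (lborel \<Otimes>\<^sub>M lborel) (\<lambda>z. LINT k|lborel. norm (case (z, k) of (z, k) \<Rightarrow> G k z))"
        using int_w by (simp add: nG)
      show "AE z in lborel \<Otimes>\<^sub>M lborel. integrable lborel (\<lambda>k. case (z, k) of (z, k) \<Rightarrow> G k z)"
      proof (intro always_eventually allI)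
        fix z
        have "integrable lborel (\<lambda>k. norm (w z) * K d k)"
          using integrable_norm[OF intK] by (simp add: K_def)
        then show "integrable lborel (\<lambda>k. case (z, k) of (z, k) \<Rightarrow> G k z)"
          by (rule Bochner_Integration.integrable_bound) (auto simp: nG K_def)
      qed
    qed simp
    have inner: "(LINT k|lborel. G k z) = w z * of_real (\<Phi> d (snd z - fst z))" for z
    proof -
      have "(LINT k|lborel. G k z) = (LINT k|lborel. w z * (exp (\<i> * of_real ((snd z - fst z) \<bullet> k)) * of_real (exp (- (d\<^sup>2 * (norm k)\<^sup>2) / 2))))"
        by (intro Bochner_Integration.integral_cong) (auto simp: G_def K_def inner_diff_left inner_diff_right inner_commute algebra_simps)
      also have "\<dots> = w z * of_real (\<Phi> d (snd z - fst z))"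
        unfolding \<Phi>_def by (simp only: integral_mult_right_zero gaussian_fourier(2)[OF d])
      finally show ?thesis .
    qed
    have intL: "integrable lborel (\<lambda>k. complex_of_real ((cmod (lfourier u k))\<^sup>2 * K d k))"
      unfolding sq by (rule LLL.integrable_snd[OF int_G])
    have "complex_of_real (LINT k|lborel. (cmod (lfourier u k))\<^sup>2 * K d k) = (LINT k|lborel. LINT z|(lborel \<Otimes>\<^sub>M lborel). G k z)"
      unfolding sq[symmetric] by (rule integral_complex_of_real[symmetric])
    also have "\<dots> = (LINT z|(lborel \<Otimes>\<^sub>M lborel). LINT k|lborel. G k z)"
      by (rule LLL.Fubini_integral[OF int_G])
    finally have "ennreal (LINT k|lborel. (cmod (lfourier u k))\<^sup>2 * K d k) \<le> ennreal (norm (LINT z|(lborel \<Otimes>\<^sub>M lborel). w z * of_real (\<Phi> d (snd z - fst z))))"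
      unfolding inner by (metis (no_types, lifting) abs_ge_self ennreal_leI norm_of_real)
    also have "\<dots> \<le> (\<integral>\<^sup>+z. ennreal (norm (w z * of_real (\<Phi> d (snd z - fst z)))) \<partial>(lborel \<Otimes>\<^sub>M lborel))"
      by (rule integral_norm_bound_ennreal) (use LLL.integrable_fst[OF int_G] in \<open>simp add: inner\<close>)
    \<comment> \<open>The elementary bound xy <= (x^2 + y^2)/2 takes the place of Cauchy-Schwarz:
      each half contains a square in one variable only, and the other variable integrates the kernel
      to its mass.\<close>
    also have "\<dots> \<le> (\<integral>\<^sup>+z. ennreal (1/2) * (ennreal ((cmod (u (fst z)))\<^sup>2) * ennreal (\<Phi> d (snd z - fst z))) +
        ennreal (1/2) * (ennreal ((cmod (u (snd z)))\<^sup>2) * ennreal (\<Phi> d (snd z - fst z))) \<partial>(lborel \<Otimes>\<^sub>M lborel))"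
    proof (rule nn_integral_mono)
      fix z :: "'a \<times> 'a"
      let ?x = "cmod (u (fst z))" and ?y = "cmod (u (snd z))" and ?p = "\<Phi> d (snd z - fst z)"
      have "?x * ?y \<le> 1/2 * ?x\<^sup>2 + 1/2 * ?y\<^sup>2"
        using sum_squares_bound[of ?x ?y] by simp
      then have "?x * ?y * ?p \<le> (1/2 * ?x\<^sup>2 + 1/2 * ?y\<^sup>2) * ?p"
        by (rule mult_right_mono) (rule \<Phi>0[OF d])
      then have "ennreal (?x * ?y * ?p) \<le> ennreal (1/2 * (?x\<^sup>2 * ?p) + 1/2 * (?y\<^sup>2 * ?p))"
        by (intro ennreal_leI) (simp add: algebra_simps)
      also have "\<dots> = ennreal (1/2) * (ennreal (?x\<^sup>2) * ennreal ?p) + ennreal (1/2) * (ennreal (?y\<^sup>2) * ennreal ?p)"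
        using \<Phi>0[OF d, of "snd z - fst z"] by (simp only: ennreal_plus ennreal_mult mult_nonneg_nonneg zero_le_power2 zero_le_divide_1_iff zero_le_numeral)
      finally show "ennreal (norm (w z * of_real ?p)) \<le> ennreal (1/2) * (ennreal (?x\<^sup>2) * ennreal ?p) + ennreal (1/2) * (ennreal (?y\<^sup>2) * ennreal ?p)"
        using \<Phi>0[OF d, of "snd z - fst z"] by (simp add: w_def norm_mult)
    qed
    also have "\<dots> = ennreal (1/2) * (\<integral>\<^sup>+z. ennreal ((cmod (u (fst z)))\<^sup>2) * ennreal (\<Phi> d (snd z - fst z)) \<partial>(lborel \<Otimes>\<^sub>M lborel)) +
        ennreal (1/2) * (\<integral>\<^sup>+z. ennreal ((cmod (u (snd z)))\<^sup>2) * ennreal (\<Phi> d (snd z - fst z)) \<partial>(lborel \<Otimes>\<^sub>M lborel))"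
      by (simp add: nn_integral_add nn_integral_cmult)
    also have "(\<integral>\<^sup>+z. ennreal ((cmod (u (fst z)))\<^sup>2) * ennreal (\<Phi> d (snd z - fst z)) \<partial>(lborel \<Otimes>\<^sub>M lborel)) = ?N * ennreal ((2 * pi) ^ DIM('a))"
    proof -
      have "(\<integral>\<^sup>+z. ennreal ((cmod (u (fst z)))\<^sup>2) * ennreal (\<Phi> d (snd z - fst z)) \<partial>(lborel \<Otimes>\<^sub>M lborel)) =
        (\<integral>\<^sup>+x. \<integral>\<^sup>+y. ennreal ((cmod (u x))\<^sup>2) * ennreal (\<Phi> d (y - x)) \<partial>lborel \<partial>lborel)"
        by (subst lborel.nn_integral_fst[symmetric]) simp_all
      also have "\<dots> = (\<integral>\<^sup>+x. ennreal ((cmod (u x))\<^sup>2) * ennreal ((2 * pi) ^ DIM('a)) \<partial>lborel)"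
      proof (intro nn_integral_cong)
        fix x :: 'a
        have "(\<integral>\<^sup>+y. ennreal (\<Phi> d (y - x)) \<partial>lborel) = (\<integral>\<^sup>+y. ennreal (\<Phi> d (y - x)) \<partial>distr lborel borel ((+) x))"
          by (simp add: lborel_distr_plus)
        also have "\<dots> = (\<integral>\<^sup>+y. ennreal (\<Phi> d y) \<partial>lborel)" by (subst nn_integral_distr) simp_all
        also have "\<dots> = ennreal ((2 * pi) ^ DIM('a))" unfolding \<Phi>_def by (rule gaussian_kernel_integral[OF d])
        finally show "(\<integral>\<^sup>+y. ennreal ((cmod (u x))\<^sup>2) * ennreal (\<Phi> d (y - x)) \<partial>lborel) = ennreal ((cmod (u x))\<^sup>2) * ennreal ((2 * pi) ^ DIM('a))"
          by (simp add: nn_integral_cmult)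
      qed
      finally show ?thesis by (simp add: nn_integral_multc)
    qed
    also have "(\<integral>\<^sup>+z. ennreal ((cmod (u (snd z)))\<^sup>2) * ennreal (\<Phi> d (snd z - fst z)) \<partial>(lborel \<Otimes>\<^sub>M lborel)) = ?N * ennreal ((2 * pi) ^ DIM('a))"
    proof -
      have "(\<integral>\<^sup>+z. ennreal ((cmod (u (snd z)))\<^sup>2) * ennreal (\<Phi> d (snd z - fst z)) \<partial>(lborel \<Otimes>\<^sub>M lborel)) =
        (\<integral>\<^sup>+y. \<integral>\<^sup>+x. ennreal ((cmod (u y))\<^sup>2) * ennreal (\<Phi> d (y - x)) \<partial>lborel \<partial>lborel)"
        by (subst lborel_pair.nn_integral_snd[symmetric]) (simp_all add: case_prod_unfold)
      also have "\<dots> = (\<integral>\<^sup>+x. ennreal ((cmod (u x))\<^sup>2) * ennreal ((2 * pi) ^ DIM('a)) \<partial>lborel)"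
      proof (intro nn_integral_cong)
        fix y :: 'a
        have sym: "\<Phi> d (y - x) = \<Phi> d (x - y)" for x by (simp add: \<Phi>_def norm_minus_commute)
        have "(\<integral>\<^sup>+x. ennreal (\<Phi> d (y - x)) \<partial>lborel) = (\<integral>\<^sup>+x. ennreal (\<Phi> d (x - y)) \<partial>distr lborel borel ((+) y))"
          unfolding sym by (simp add: lborel_distr_plus)
        also have "\<dots> = (\<integral>\<^sup>+x. ennreal (\<Phi> d x) \<partial>lborel)" by (subst nn_integral_distr) simp_all
        also have "\<dots> = ennreal ((2 * pi) ^ DIM('a))" unfolding \<Phi>_def by (rule gaussian_kernel_integral[OF d])
        finally show "(\<integral>\<^sup>+x. ennreal ((cmod (u y))\<^sup>2) * ennreal (\<Phi> d (y - x)) \<partial>lborel) = ennreal ((cmod (u y))\<^sup>2) * ennreal ((2 * pi) ^ DIM('a))"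
          by (simp add: nn_integral_cmult)
      qed
      finally show ?thesis by (simp add: nn_integral_multc)
    qed
    also have "ennreal (1/2) * (?N * ennreal ((2 * pi) ^ DIM('a))) + ennreal (1/2) * (?N * ennreal ((2 * pi) ^ DIM('a))) = ennreal ((2 * pi) ^ DIM('a)) * ?N"
      unfolding distrib_right[symmetric] by (subst ennreal_plus[symmetric]) (simp_all add: mult.commute)
    finally have "ennreal (LINT k|lborel. (cmod (lfourier u k))\<^sup>2 * K d k) \<le> ennreal ((2 * pi) ^ DIM('a)) * ?N" .
    moreover have "(\<integral>\<^sup>+k. ennreal ((cmod (lfourier u k))\<^sup>2 * K d k) \<partial>lborel) = ennreal (LINT k|lborel. (cmod (lfourier u k))\<^sup>2 * K d k)"
      using intL by (intro nn_integral_eq_integral) (auto simp: K_def complex_of_real_integrable_eq simp del: of_real_mult)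
    ultimately show ?thesis by simp
  qed
  have lim: "(\<lambda>n. ennreal ((cmod (lfourier u k))\<^sup>2 * K (inverse (real (Suc n))) k)) \<longlonglongrightarrow> ennreal ((cmod (lfourier u k))\<^sup>2)" for k
  proof -
    have "(\<lambda>n. (cmod (lfourier u k))\<^sup>2 * K (inverse (real (Suc n))) k) \<longlonglongrightarrow> (cmod (lfourier u k))\<^sup>2 * exp (- (0\<^sup>2 * (norm k)\<^sup>2) / 2)"
      unfolding K_def by (intro tendsto_intros LIMSEQ_inverse_real_of_nat) simp_all
    then show ?thesis by (intro tendsto_ennrealI) simp
  qed
  have "(\<integral>\<^sup>+k. ennreal ((cmod (lfourier u k))\<^sup>2) \<partial>lborel) = (\<integral>\<^sup>+k. liminf (\<lambda>n. ennreal ((cmod (lfourier u k))\<^sup>2 * K (inverse (real (Suc n))) k)) \<partial>lborel)"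
    by (rule nn_integral_cong, rule lim_imp_Liminf[OF _ lim, symmetric], simp)
  \<comment> \<open>Fatou along widths tending to 0, where the Gaussian factor tends to 1.\<close>
  also have "\<dots> \<le> liminf (\<lambda>n. \<integral>\<^sup>+k. ennreal ((cmod (lfourier u k))\<^sup>2 * K (inverse (real (Suc n))) k) \<partial>lborel)"
    by (rule nn_integral_liminf) measurable
  also have "\<dots> \<le> ennreal ((2 * pi) ^ DIM('a)) * ?N"
    by (rule Liminf_le, simp, rule always_eventually) (use main in simp)
  finally show ?thesis .
qed

text \<open>A Gaussian factor is inserted into the outer integral and its limit is computed twice:
  by dominated convergence, since h is integrable, and after Fubini as a convolution of A with an
  approximate identity, since A is bounded and continuous.\<close>

lemma fourier_inversion_real:
  fixes A :: "real \<Rightarrow> complex"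
  assumes cA: "continuous_on UNIV A" and iA: "integrable lborel A" and bA: "\<And>x. norm (A x) \<le> M"
    and ih: "integrable lborel (\<lambda>z. LINT s|lborel. exp (\<i> * of_real (z * s)) * A s)"
  shows "(LINT z|lborel. exp (- (\<i> * of_real (z * x))) * (LINT s|lborel. exp (\<i> * of_real (z * s)) * A s)) = of_real (2 * pi) * A x"
proof -
  define h where "h z = (LINT s|lborel. exp (\<i> * of_real (z * s)) * A s)" for z
  define K where "K d z = exp (- (d\<^sup>2 * z\<^sup>2) / 2)" for d z :: real
  define d where "d n = inverse (real (Suc n))" for n
  have d: "d n > 0" for n by (simp add: d_def)
  have d0: "d \<longlonglongrightarrow> 0" unfolding d_def by (rule LIMSEQ_inverse_real_of_nat)
  have A_m[measurable]: "A \<in> borel_measurable borel" by (rule borel_measurable_continuous_onI[OF cA])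
  have ih': "integrable lborel h" using ih by (simp add: h_def[abs_def])
  have h_m[measurable]: "h \<in> borel_measurable borel" using borel_measurable_integrable[OF ih'] by simp
  have K_m[measurable]: "K c \<in> borel_measurable borel" for c unfolding K_def by measurable
  have K1: "0 \<le> K c z" "K c z \<le> 1" for c z by (auto simp: K_def)
  have lim1: "(\<lambda>n. LINT z|lborel. exp (- (\<i> * of_real (z * x))) * h z * of_real (K (d n) z)) \<longlonglongrightarrow>
      (LINT z|lborel. exp (- (\<i> * of_real (z * x))) * h z)"
  proof (rule integral_dominated_convergence)
    show "integrable lborel (\<lambda>z. norm (h z))" using ih' by simp
    show "AE z in lborel. (\<lambda>n. exp (- (\<i> * of_real (z * x))) * h z * of_real (K (d n) z)) \<longlonglongrightarrow> exp (- (\<i> * of_real (z * x))) * h z"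
    proof (intro always_eventually allI)
      fix z
      have "(\<lambda>n. exp (- (\<i> * of_real (z * x))) * h z * of_real (K (d n) z)) \<longlonglongrightarrow>
        exp (- (\<i> * of_real (z * x))) * h z * of_real (exp (- (0\<^sup>2 * z\<^sup>2) / 2))"
        unfolding K_def by (intro tendsto_intros d0) simp_all
      then show "(\<lambda>n. exp (- (\<i> * of_real (z * x))) * h z * of_real (K (d n) z)) \<longlonglongrightarrow> exp (- (\<i> * of_real (z * x))) * h z"
        by simp
    qed
    show "AE z in lborel. norm (exp (- (\<i> * of_real (z * x))) * h z * of_real (K (d n) z)) \<le> norm (h z)" for n
      using K1 by (intro always_eventually allI) (simp add: norm_mult norm_exp_eq_Re mult_left_le)
  qed measurable
  have eq: "(LINT z|lborel. exp (- (\<i> * of_real (z * x))) * h z * of_real (K c z)) =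
      (LINT w|lborel. A (x + c * w) * of_real (sqrt (2 * pi) * exp (- (w\<^sup>2) / 2)))" if c: "c > 0" for c
  proof -
    let ?G = "\<lambda>s z. A s * (exp (\<i> * of_real ((s - x) * z)) * of_real (K c z))"
    have iK: "integrable lborel (K c)"
    proof -
      have "integrable lborel (\<lambda>z. complex_of_real (K c z))"
        using gaussian_fourier_real(1)[OF c, of 0] by (simp only: K_def mult_zero_left of_real_0 mult_zero_right exp_zero mult_1_left)
      then show ?thesis by (simp only: complex_of_real_integrable_eq)
    qed
    have nG: "norm (?G s z) = norm (A s) * K c z" for s z
      using K1 by (simp add: norm_mult norm_exp_eq_Re)
    have intG: "integrable (lborel \<Otimes>\<^sub>M lborel) (\<lambda>(s, z). ?G s z)"
    proof (rule lborel_pair.Fubini_integrable)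
      show "integrable lborel (\<lambda>s. LINT z|lborel. norm (case (s, z) of (s, z) \<Rightarrow> ?G s z))"
        unfolding prod.case nG using iA by simp
      show "AE s in lborel. integrable lborel (\<lambda>z. case (s, z) of (s, z) \<Rightarrow> ?G s z)"
      proof (intro always_eventually allI)
        fix s
        have "integrable lborel (\<lambda>z. norm (A s) * K c z)" using iK by simp
        then show "integrable lborel (\<lambda>z. case (s, z) of (s, z) \<Rightarrow> ?G s z)"
        proof (rule Bochner_Integration.integrable_bound)
          show "AE z in lborel. norm (case (s, z) of (s, z) \<Rightarrow> ?G s z) \<le> norm (norm (A s) * K c z)"
            unfolding prod.case nG by (intro always_eventually allI) simp
        qed simp
      qed
    qed measurable
    have "exp (- (\<i> * of_real (z * x))) * h z * of_real (K c z) = (LINT s|lborel. ?G s z)" for z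
    proof -
      have "exp (- (\<i> * of_real (z * x))) * h z * of_real (K c z) =
          (LINT s|lborel. exp (- (\<i> * of_real (z * x))) * (exp (\<i> * of_real (z * s)) * A s) * of_real (K c z))"
        unfolding h_def by (simp only: integral_mult_right_zero integral_mult_left_zero)
      also have "\<dots> = (LINT s|lborel. ?G s z)"
      proof (rule Bochner_Integration.integral_cong[OF refl])
        fix s
        have "exp (\<i> * of_real ((s - x) * z)) = exp (- (\<i> * of_real (z * x))) * exp (\<i> * of_real (z * s))"
          unfolding exp_add[symmetric] by (simp add: algebra_simps)
        then show "exp (- (\<i> * of_real (z * x))) * (exp (\<i> * of_real (z * s)) * A s) * of_real (K c z) = ?G s z"
          by (simp only: mult_ac)
      qed
      finally show ?thesis .
    qed
    then have "(LINT z|lborel. exp (- (\<i> * of_real (z * x))) * h z * of_real (K c z)) = (LINT z|lborel. LINT s|lborel. ?G s z)"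
      by (simp only:)
    also have "\<dots> = (LINT s|lborel. LINT z|lborel. ?G s z)"
      by (rule lborel_pair.Fubini_integral[OF intG])
    also have "\<dots> = (LINT s|lborel. A s * of_real (sqrt (2 * pi) / c * exp (- ((s - x)\<^sup>2) / (2 * c\<^sup>2))))"
      unfolding K_def by (simp only: integral_mult_right_zero gaussian_fourier_real(2)[OF c])
    \<comment> \<open>The substitution s = x + c w moves the width c from the kernel into the
      argument of A, so that a fixed Gaussian dominates.\<close>
    also have "\<dots> = \<bar>c\<bar> *\<^sub>R (LINT w|lborel. A (x + c * w) * of_real (sqrt (2 * pi) / c * exp (- ((x + c * w - x)\<^sup>2) / (2 * c\<^sup>2))))"
      by (rule lborel_integral_real_affine) (use c in simp)
    also have "\<dots> = (LINT w|lborel. \<bar>c\<bar> *\<^sub>R (A (x + c * w) * of_real (sqrt (2 * pi) / c * exp (- ((x + c * w - x)\<^sup>2) / (2 * c\<^sup>2)))))"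
      by (rule integral_scaleR_right[symmetric])
    also have "\<dots> = (LINT w|lborel. A (x + c * w) * of_real (sqrt (2 * pi) * exp (- (w\<^sup>2) / 2)))"
      using c by (intro Bochner_Integration.integral_cong) (auto simp: scaleR_conv_of_real power_mult_distrib)
    finally show ?thesis .
  qed
  have K_int: "integrable lborel (\<lambda>w::real. exp (- (w\<^sup>2) / 2))" "(LINT w|lborel. exp (- (w\<^sup>2) / 2)) = sqrt (2 * pi)"
  proof -
    have i: "integrable lborel (\<lambda>w. complex_of_real (exp (- (w\<^sup>2) / 2)))"
      using gaussian_fourier_real(1)[of 1 0] by simp
    then show "integrable lborel (\<lambda>w::real. exp (- (w\<^sup>2) / 2))" by (simp only: complex_of_real_integrable_eq)
    have "complex_of_real (LINT w|lborel. exp (- (w\<^sup>2) / 2)) = of_real (sqrt (2 * pi))"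
      unfolding integral_complex_of_real[symmetric] using gaussian_fourier_real(2)[of 1 0] by simp
    then show "(LINT w|lborel. exp (- (w\<^sup>2) / 2)) = sqrt (2 * pi)" by (simp only: of_real_eq_iff)
  qed
  have lim2: "(\<lambda>n. LINT w|lborel. A (x + d n * w) * of_real (sqrt (2 * pi) * exp (- (w\<^sup>2) / 2))) \<longlonglongrightarrow>
      (LINT w|lborel. A x * of_real (sqrt (2 * pi) * exp (- (w\<^sup>2) / 2)))"
  proof (rule integral_dominated_convergence)
    show "integrable lborel (\<lambda>w. M * (sqrt (2 * pi) * exp (- (w\<^sup>2) / 2)))" using K_int(1) by simp
    show "AE w in lborel. (\<lambda>n. A (x + d n * w) * of_real (sqrt (2 * pi) * exp (- (w\<^sup>2) / 2))) \<longlonglongrightarrow> A x * of_real (sqrt (2 * pi) * exp (- (w\<^sup>2) / 2))"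
    proof (intro always_eventually allI tendsto_mult tendsto_const)
      fix w
      have "(\<lambda>n. x + d n * w) \<longlonglongrightarrow> x + 0 * w" by (intro tendsto_intros d0)
      then show "(\<lambda>n. A (x + d n * w)) \<longlonglongrightarrow> A x"
        using cA by (intro continuous_on_tendsto_compose[OF cA]) auto
    qed
    show "AE w in lborel. norm (A (x + d n * w) * of_real (sqrt (2 * pi) * exp (- (w\<^sup>2) / 2))) \<le> M * (sqrt (2 * pi) * exp (- (w\<^sup>2) / 2))" for n
      by (intro always_eventually allI) (simp add: norm_mult mult_right_mono bA)
  qed measurable
  have "(LINT w|lborel. A x * of_real (sqrt (2 * pi) * exp (- (w\<^sup>2) / 2))) = A x * of_real (sqrt (2 * pi) * sqrt (2 * pi))"
    by (simp only: integral_mult_right_zero integral_complex_of_real K_int)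
  also have "\<dots> = of_real (2 * pi) * A x" by simp
  finally have "(LINT w|lborel. A x * of_real (sqrt (2 * pi) * exp (- (w\<^sup>2) / 2))) = of_real (2 * pi) * A x" .
  with lim2 have "(\<lambda>n. LINT z|lborel. exp (- (\<i> * of_real (z * x))) * h z * of_real (K (d n) z)) \<longlonglongrightarrow> of_real (2 * pi) * A x"
    unfolding eq[OF d] by (simp only:)
  from LIMSEQ_unique[OF lim1 this] show ?thesis by (simp only: h_def)
qed

lemma integrable_one_plus_abs_powr:
  assumes a: "a > 0"
  shows "integrable lborel (\<lambda>z::real. (1 + \<bar>z\<bar>) powr (- 1 - a))"
proof -
  have "((\<lambda>x. x powr (- 1 - a)) has_integral - (1 powr (- 1 - a + 1)) / (- 1 - a + 1)) {1..}"
    by (rule has_integral_powr_to_inf) (use a in auto)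
  then have "(\<lambda>x. x powr (- 1 - a)) absolutely_integrable_on {1..}"
    by (intro nonnegative_absolutely_integrable_1) auto
  then have 1: "integrable lborel (\<lambda>x. indicator {1..} x *\<^sub>R x powr (- 1 - a))"
    unfolding set_integrable_def by (subst (asm) integrable_completion) simp_all
  have 2: "integrable lborel (\<lambda>z. indicator {1..} (1 + 1 * z) *\<^sub>R (1 + 1 * z) powr (- 1 - a))"
    by (rule lborel_integrable_real_affine[OF 1]) simp
  have 3: "integrable lborel (\<lambda>z. indicator {1..} (1 + (-1) * z) *\<^sub>R (1 + (-1) * z) powr (- 1 - a))"
    by (rule lborel_integrable_real_affine[OF 1]) simp
  show ?thesis
    by (rule Bochner_Integration.integrable_bound[OF Bochner_Integration.integrable_add[OF 2 3]])
      (auto simp: indicator_def abs_if)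
qed

lemma continuous_on_integral_dominated:
  fixes g :: "'z \<Rightarrow> 'q::metric_space \<Rightarrow> complex"
  assumes cg: "\<And>z. continuous_on S (g z)" and m: "\<And>q. q \<in> S \<Longrightarrow> (\<lambda>z. g z q) \<in> borel_measurable M"
    and w: "integrable M w" and b: "\<And>z q. q \<in> S \<Longrightarrow> norm (g z q) \<le> w z"
  shows "continuous_on S (\<lambda>q. LINT z|M. g z q)"
  unfolding continuous_on_sequentially comp_def
proof (intro allI ballI impI)
  fix X q assume q: "q \<in> S" and X: "(\<forall>n. X n \<in> S) \<and> X \<longlonglongrightarrow> q"
  show "(\<lambda>n. LINT z|M. g z (X n)) \<longlonglongrightarrow> (LINT z|M. g z q)"
  proof (rule integral_dominated_convergence[where w=w])
    show "AE z in M. (\<lambda>n. g z (X n)) \<longlonglongrightarrow> g z q"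
      using continuous_on_tendsto_compose[OF cg, of X q] X q by auto
  qed (use m q X b w in auto)
qed

text \<open>Rephrases the polar formula for nonnegative functions as an identity of measures, from
  which integrability and values of complex integrals can be transported.\<close>

lemma polar_measure_distr_eq:
  fixes \<sigma> :: "'a::euclidean_space measure"
  assumes "polar_measure \<sigma>"
  shows "distr (density (lborel \<Otimes>\<^sub>M \<sigma>) (\<lambda>(r, q). ennreal (r ^ (DIM('a) - 1) * indicator {0<..} r))) borel (\<lambda>(r, q). r *\<^sub>R q) = lborel"
proof (rule measure_eqI)
  have s[measurable_cong]: "sets \<sigma> = sets borel" and fin: "finite_measure \<sigma>" using assms by (auto simp: polar_measure_def)
  interpret finite_measure \<sigma> by fact
  fix A :: "'a set" assume "A \<in> sets (distr (density (lborel \<Otimes>\<^sub>M \<sigma>) (\<lambda>(r, q). ennreal (r ^ (DIM('a) - 1) * indicator {0<..} r))) borel (\<lambda>(r, q). r *\<^sub>R q))"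
  then have A[measurable]: "A \<in> sets borel" by simp
  have "emeasure lborel A = (\<integral>\<^sup>+x. indicator A x \<partial>lborel)" by simp
  also have "\<dots> = (\<integral>\<^sup>+r. ennreal (r ^ (DIM('a) - 1)) * indicator {0<..} r * (\<integral>\<^sup>+q. indicator A (r *\<^sub>R q) \<partial>\<sigma>) \<partial>lborel)"
    using assms unfolding polar_measure_def by (blast intro: borel_measurable_indicator A)
  also have "\<dots> = (\<integral>\<^sup>+r. \<integral>\<^sup>+q. ennreal (r ^ (DIM('a) - 1) * indicator {0<..} r) * indicator A (r *\<^sub>R q) \<partial>\<sigma> \<partial>lborel)"
    by (intro nn_integral_cong) (simp add: nn_integral_cmult split: split_indicator)
  also have "\<dots> = (\<integral>\<^sup>+p. (\<lambda>(r, q). ennreal (r ^ (DIM('a) - 1) * indicator {0<..} r) * indicator A (r *\<^sub>R q)) p \<partial>(lborel \<Otimes>\<^sub>M \<sigma>))"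
    by (subst nn_integral_fst[symmetric]) simp_all
  also have "\<dots> = emeasure (distr (density (lborel \<Otimes>\<^sub>M \<sigma>) (\<lambda>(r, q). ennreal (r ^ (DIM('a) - 1) * indicator {0<..} r))) borel (\<lambda>(r, q). r *\<^sub>R q)) A"
    by (subst emeasure_distr, simp, simp, subst emeasure_density)
      (auto intro!: nn_integral_cong simp: space_pair_measure split: split_indicator)
  finally show "emeasure (distr (density (lborel \<Otimes>\<^sub>M \<sigma>) (\<lambda>(r, q). ennreal (r ^ (DIM('a) - 1) * indicator {0<..} r))) borel (\<lambda>(r, q). r *\<^sub>R q)) A = emeasure lborel A" ..
qed simp

lemma polar_integral:
  fixes \<sigma> :: "'a::euclidean_space measure" and F :: "'a \<Rightarrow> complex"
  assumes pm: "polar_measure \<sigma>" and F: "integrable lborel F"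
  shows "integrable (lborel \<Otimes>\<^sub>M \<sigma>) (\<lambda>(r, q). (r ^ (DIM('a) - 1) * indicator {0<..} r) *\<^sub>R F (r *\<^sub>R q))"
    and "(LINT x|lborel. F x) = (LINT p|(lborel \<Otimes>\<^sub>M \<sigma>). (\<lambda>(r, q). (r ^ (DIM('a) - 1) * indicator {0<..} r) *\<^sub>R F (r *\<^sub>R q)) p)"
proof -
  have s[measurable_cong]: "sets \<sigma> = sets borel" using pm by (auto simp: polar_measure_def)
  have [measurable]: "F \<in> borel_measurable borel" using borel_measurable_integrable[OF F] by simp
  let ?\<mu> = "density (lborel \<Otimes>\<^sub>M \<sigma>) (\<lambda>p. ennreal (fst p ^ (DIM('a) - 1) * indicator {0<..} (fst p)))"
  let ?g = "\<lambda>p. fst p *\<^sub>R snd p"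
  have eq: "distr ?\<mu> borel ?g = lborel"
    using polar_measure_distr_eq[OF pm] by (simp add: case_prod_unfold)
  have nn: "AE p in (lborel :: real measure) \<Otimes>\<^sub>M \<sigma>. 0 \<le> fst p ^ (DIM('a) - 1) * (indicator {0<..} (fst p) :: real)"
    by (intro AE_I2) (simp add: indicator_def)
  have "integrable (distr ?\<mu> borel ?g) F" unfolding eq by (rule F)
  then have "integrable ?\<mu> (\<lambda>p. F (?g p))" by (subst (asm) integrable_distr_eq) simp_all
  then have "integrable (lborel \<Otimes>\<^sub>M \<sigma>) (\<lambda>p. (fst p ^ (DIM('a) - 1) * indicator {0<..} (fst p)) *\<^sub>R F (?g p))"
    by (subst (asm) integrable_density[OF _ _ nn]) simp_all
  then show "integrable (lborel \<Otimes>\<^sub>M \<sigma>) (\<lambda>(r, q). (r ^ (DIM('a) - 1) * indicator {0<..} r) *\<^sub>R F (r *\<^sub>R q))"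
    by (simp add: case_prod_unfold)
  have "(LINT x|lborel. F x) = (LINT x|distr ?\<mu> borel ?g. F x)" unfolding eq ..
  also have "\<dots> = (LINT p|?\<mu>. F (?g p))" by (rule integral_distr) simp_all
  also have "\<dots> = (LINT p|(lborel \<Otimes>\<^sub>M \<sigma>). (fst p ^ (DIM('a) - 1) * indicator {0<..} (fst p)) *\<^sub>R F (?g p))"
    by (rule integral_density[OF _ _ nn]) simp_all
  finally show "(LINT x|lborel. F x) = (LINT p|(lborel \<Otimes>\<^sub>M \<sigma>). (\<lambda>(r, q). (r ^ (DIM('a) - 1) * indicator {0<..} r) *\<^sub>R F (r *\<^sub>R q)) p)"
    by (simp add: case_prod_unfold)
qed

section \<open>Pointwise limit of the shell transform\<close>

text \<open>The spatial Fourier transform of a shell of radius R = ct whose profile is frozen at one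
  slow time. At x = 0 the direction \<open>x /\<^sub>R norm x\<close> is 0, which is not on the
  sphere; this point is negligible but has to be excluded in several arguments.\<close>

definition shell_transform :: "real \<Rightarrow> (real \<Rightarrow> 'a::euclidean_space \<Rightarrow> complex) \<Rightarrow> 'a \<Rightarrow> complex" where
  "shell_transform R V k = of_real (R powr (- ((real DIM('a) - 1) / 2))) *
    (LINT x|lborel. exp (- (\<i> * of_real (k \<bullet> x))) * (of_bool (norm x < 2 * R) * V (norm x - R) (x /\<^sub>R norm x)))"

lemma shell_profile_measurable:
  fixes V :: "real \<Rightarrow> 'a::euclidean_space \<Rightarrow> complex"
  assumes cV: "continuous_on (UNIV \<times> sphere 0 1) (\<lambda>(z, q). V z q)"
  shows "(\<lambda>x. V (norm x - R) (x /\<^sub>R norm x)) \<in> borel_measurable borel"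
proof (rule borel_measurable_continuous_countable_exceptions[of "{0}"])
  have "continuous_on (- {0}) (\<lambda>x. (\<lambda>(z, q). V z q) (norm x - R, x /\<^sub>R norm x))"
    by (rule continuous_on_compose2[OF cV]) (auto intro!: continuous_intros)
  then show "continuous_on (- {0}) (\<lambda>x. V (norm x - R) (x /\<^sub>R norm x))" by simp
qed simp

lemma profile_measurable_on_sphere:
  fixes V :: "real \<Rightarrow> 'a::euclidean_space \<Rightarrow> complex"
  assumes cV: "continuous_on (UNIV \<times> sphere 0 1) (\<lambda>(z, q). V z q)"
  shows "(\<lambda>(z, q). indicator (sphere 0 1) q *\<^sub>R V z q) \<in> borel_measurable (borel \<Otimes>\<^sub>M borel)"
proof -
  have "closed (UNIV \<times> sphere (0::'a) 1 :: (real \<times> 'a) set)" by (intro closed_Times) auto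
  then have "(\<lambda>p. indicator (UNIV \<times> sphere 0 1) p *\<^sub>R (\<lambda>(z, q). V z q) p) \<in> borel_measurable borel"
    by (intro borel_measurable_continuous_on_indicator cV) auto
  also have "(\<lambda>p. indicator (UNIV \<times> sphere 0 1) p *\<^sub>R (\<lambda>(z, q). V z q) p) = (\<lambda>(z, q). indicator (sphere 0 1) q *\<^sub>R V z q)"
    by (auto simp: fun_eq_iff indicator_def)
  finally show ?thesis unfolding borel_prod .
qed

text \<open>Here n = d - 1, and \<open>wR\<close> is the Jacobian (R + z)^n over the amplitude
  R^(n/2), cut off at |z| < R. Expanding the power there leaves z R^(-1/2) for n = 1 and z^2/R for n
  = 2 once the terms that do not vanish have been subtracted.\<close>

lemma shell_transform_limit_weight:
  fixes n :: nat and wR :: "real \<Rightarrow> real \<Rightarrow> real"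
  assumes n: "n \<in> {0, 1, 2}"
  defines "wR R z \<equiv> R powr (- (real n / 2)) * ((R + z) ^ n * of_bool (- R < z \<and> z < R))"
  defines "E R z \<equiv> wR R z - R powr (real n / 2) - (if n = 2 then 2 * z else 0)"
  shows "R \<ge> 1 \<Longrightarrow> \<bar>E R z\<bar> \<le> 3 * (1 + \<bar>z\<bar>) ^ n" and "((\<lambda>R. E R z) \<longlongrightarrow> 0) at_top"
proof -
  have inside: "E R z = (if n = 0 then 0 else if n = 1 then z * R powr (- (1/2)) else z\<^sup>2 * R powr (- 1))"
    if R: "R \<ge> 1" "\<bar>z\<bar> < R" for R
  proof -
    have b: "of_bool (- R < z \<and> z < R) = (1::real)" using R by auto
    have R1: "R powr 1 = R" using R by simp
    have "R powr (- (1/2)) * R powr 1 = R powr (- (1/2) + 1)" by (simp only: powr_add)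
    then have p1: "R powr (- (1/2)) * R = R powr (1/2)" unfolding R1 by simp
    have "R powr (- 1) * R powr 1 = R powr (- 1 + 1)" by (simp only: powr_add)
    also have "\<dots> = R powr 0" by simp
    also have "\<dots> = 1" using R by simp
    finally have p2: "R powr (- 1) * R = 1" unfolding R1 .
    note p = p1 p2
    consider "n = 0" | "n = 1" | "n = 2" using n by auto
    then show ?thesis
    proof cases
      case 1 then show ?thesis unfolding E_def wR_def b using R by simp
    next
      case 2 then show ?thesis unfolding E_def wR_def b using R p by (simp add: algebra_simps)
    next
      case 3
      have "R powr (-1) * (R + z)\<^sup>2 = (R powr (-1) * R) * R + 2 * (R powr (-1) * R) * z + z\<^sup>2 * R powr (-1)"
        by (simp add: power2_eq_square algebra_simps)
      then show ?thesis unfolding E_def wR_def b using R 3 p by simp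
    qed
  qed
  show "((\<lambda>R. E R z) \<longlongrightarrow> 0) at_top"
  proof (rule Lim_transform_eventually)
    have a: "((\<lambda>R. z * R powr (- (1/2))) \<longlongrightarrow> 0) at_top" and b: "((\<lambda>R. z\<^sup>2 * R powr (- 1)) \<longlongrightarrow> 0) at_top"
      by (intro tendsto_mult_right_zero tendsto_neg_powr filterlim_ident; simp)+
    consider "n = 0" | "n \<noteq> 0" "n = 1" | "n \<noteq> 0" "n \<noteq> 1" by blast
    then show "((\<lambda>R. if n = 0 then 0 else if n = 1 then z * R powr (- (1/2)) else z\<^sup>2 * R powr (- 1)) \<longlongrightarrow> 0) at_top"
      by cases (simp_all only: if_True if_False simp_thms a b tendsto_const)
    show "\<forall>\<^sub>F R in at_top. (if n = 0 then 0 else if n = 1 then z * R powr (- (1/2)) else z\<^sup>2 * R powr (- 1)) = E R z"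
      using eventually_ge_at_top[of 1] eventually_gt_at_top[of "\<bar>z\<bar>"]
      by eventually_elim (simp only: inside)
  qed
  show "\<bar>E R z\<bar> \<le> 3 * (1 + \<bar>z\<bar>) ^ n" if R: "R \<ge> 1"
  proof (cases "\<bar>z\<bar> < R")
    case True
    have 1: "R powr (- (1/2)) \<le> 1" "R powr (-1) \<le> 1" "R powr (- (1/2)) \<ge> 0" "R powr (-1) \<ge> 0"
      using R powr_mono[of "- (1/2)" 0 R] powr_mono[of "- 1" 0 R] by simp_all
    have z1: "\<bar>z * R powr (- (1/2))\<bar> \<le> \<bar>z\<bar>"
      using mult_left_mono[OF 1(1), of "\<bar>z\<bar>"] by (simp only: abs_mult abs_of_nonneg[OF 1(3)] abs_ge_zero mult_1_right)
    have "\<bar>z\<^sup>2 * R powr (- 1)\<bar> \<le> \<bar>z\<bar>\<^sup>2"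
      using mult_left_mono[OF 1(2), of "\<bar>z\<bar>\<^sup>2"] by (simp only: abs_mult abs_of_nonneg[OF 1(4)] power_abs zero_le_power abs_ge_zero mult_1_right)
    moreover have "\<bar>z\<bar>\<^sup>2 \<le> (1 + \<bar>z\<bar>)\<^sup>2" by (rule power_mono) auto
    moreover have "0 \<le> (1 + \<bar>z\<bar>)\<^sup>2" by simp
    ultimately have z2: "\<bar>z\<^sup>2 * R powr (- 1)\<bar> \<le> 3 * (1 + \<bar>z\<bar>)\<^sup>2" by linarith
    consider "n = 0" | "n = 1" | "n = 2" using n by auto
    then show ?thesis unfolding inside[OF R True]
    proof cases
      case 2
      have "\<bar>z * R powr (- (1/2))\<bar> \<le> 3 * (1 + \<bar>z\<bar>)" by (rule order_trans[OF z1]) simp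
      then show "\<bar>if n = 0 then 0 else if n = 1 then z * R powr (- (1/2)) else z\<^sup>2 * R powr (- 1)\<bar> \<le> 3 * (1 + \<bar>z\<bar>) ^ n"
        by (simp only: 2 one_neq_zero if_False if_True power_one_right refl)
    next
      case 3
      show "\<bar>if n = 0 then 0 else if n = 1 then z * R powr (- (1/2)) else z\<^sup>2 * R powr (- 1)\<bar> \<le> 3 * (1 + \<bar>z\<bar>) ^ n"
        unfolding 3 using z2 by (simp only: if_False numeral_eq_one_iff zero_neq_numeral[symmetric] zero_neq_numeral semiring_norm not_False_eq_True)
    qed simp
  next
    case False
    then have b: "of_bool (- R < z \<and> z < R) = (0::real)" using R by auto
    \<comment> \<open>Outside the cut-off the weight is 0 and the subtracted terms remain. They are
      controlled because R is itself at most |z| there.\<close>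
    have z: "1 \<le> \<bar>z\<bar>" "R \<le> \<bar>z\<bar>" using False R by auto
    have "R powr (1/2) \<le> R powr 1" using R by (intro powr_mono) auto
    then have s: "R powr (1/2) \<le> \<bar>z\<bar>" using z R by simp
    have zz: "1 + \<bar>z\<bar> \<le> (1 + \<bar>z\<bar>)\<^sup>2" by (rule self_le_power) auto
    have E: "E R z = - (R powr (real n / 2)) - (if n = 2 then 2 * z else 0)"
      unfolding E_def wR_def b by simp
    consider "n = 0" | "n = 1" | "n = 2" using n by auto
    then show ?thesis
    proof cases
      case 1 then show ?thesis unfolding E using R by simp
    next
      case 2 then show ?thesis unfolding E using s by simp
    next
      case 3
      have "\<bar>- R - 2 * z\<bar> \<le> 3 * \<bar>z\<bar>" using z R by linarith
      also have "\<dots> \<le> 3 * (1 + \<bar>z\<bar>)\<^sup>2" using zz by linarith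
      finally show ?thesis unfolding E using 3 R by simp
    qed
  qed
qed

text \<open>The expansion of the radial weight is integrated term by term: the constant term yields
  the sphere transform of the zeroth moment f in z, the linear term that of the first moment m, and
  the error \<open>E\<close> vanishes by dominated convergence. The bound (1 + |z|)^(d-1) on the
  error is exactly what the decay of V can afford.\<close>

lemma shell_transform_sphere_decomposition:
  fixes V :: "real \<Rightarrow> 'a::euclidean_space \<Rightarrow> complex" and k :: 'a
  assumes dim: "DIM('a) \<in> {1, 2, 3}" and pm: "polar_measure \<sigma>"
    and cV: "continuous_on (UNIV \<times> sphere 0 1) (\<lambda>(z, q). V z q)"
    and a: "a > 0" and bV: "\<And>z q. q \<in> sphere 0 1 \<Longrightarrow> norm (V z q) \<le> C * (1 + \<bar>z\<bar>) powr (- real DIM('a) - a)"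
  defines "f \<equiv> \<lambda>q. LINT z|lborel. exp (- (\<i> * of_real (z * (k \<bullet> q)))) * V z q"
  defines "m \<equiv> \<lambda>q. LINT z|lborel. of_real z * (exp (- (\<i> * of_real (z * (k \<bullet> q)))) * V z q)"
  shows "((\<lambda>R. shell_transform R V k - of_real (R powr ((real DIM('a) - 1) / 2)) * sphere_transform \<sigma> f (R *\<^sub>R k)
      - (if DIM('a) = 3 then 2 * sphere_transform \<sigma> m (R *\<^sub>R k) else 0)) \<longlongrightarrow> 0) at_top"
    and "DIM('a) = 3 \<Longrightarrow> continuous_on (sphere 0 1) m"
proof -
  define n where "n = DIM('a) - 1"
  have n: "n \<in> {0, 1, 2}" "real DIM('a) - 1 = real n" "DIM('a) = Suc n" "n = 2 \<longleftrightarrow> DIM('a) = 3" using dim by (auto simp: n_def)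
  define wR where "wR R z = R powr (- (real n / 2)) * ((R + z) ^ n * of_bool (- R < z \<and> z < R))" for R z :: real
  define E where "E R z = wR R z - R powr (real n / 2) - (if n = 2 then 2 * z else 0)" for R z :: real
  have E_bound: "\<bar>E R z\<bar> \<le> 3 * (1 + \<bar>z\<bar>) ^ n" if "R \<ge> 1" for R z
    using shell_transform_limit_weight(1)[OF n(1) that] unfolding E_def wR_def .
  have E_lim: "((\<lambda>R. E R z) \<longlongrightarrow> 0) at_top" for z
    using shell_transform_limit_weight(2)[OF n(1)] unfolding E_def wR_def .
  have s[measurable_cong]: "sets \<sigma> = sets borel" and fin: "finite_measure \<sigma>" and AE1: "AE q in \<sigma>. norm q = 1"
    using pm by (auto simp: polar_measure_def)
  interpret \<sigma>: finite_measure \<sigma> by fact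
  interpret P: pair_sigma_finite "lborel :: real measure" \<sigma> ..
  \<comment> \<open>The profile on the sphere with the z-part of the phase built in; only exp(-i R
    k.q) remains outside.\<close>
  define W where "W z q = indicator (sphere 0 1) q *\<^sub>R V z q * exp (- (\<i> * of_real (z * (k \<bullet> q))))" for z q
  have W_m[measurable]: "(\<lambda>(z, q). W z q) \<in> borel_measurable (borel \<Otimes>\<^sub>M borel)"
    unfolding W_def case_prod_unfold
    by (intro borel_measurable_times profile_measurable_on_sphere[OF cV, unfolded case_prod_unfold]) measurable
  \<comment> \<open>\<open>N\<close> is the growth allowed for a weight and \<open>D\<close> the
    majorant left after multiplying the profile by it: -d - a plus n = d - 1 gives the exponent -1 -
    a.\<close>
  define N where "N z = (1 + \<bar>z\<bar>) ^ n" for z :: real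
  define D where "D z = \<bar>C\<bar> * (1 + \<bar>z\<bar>) powr (- 1 - a)" for z :: real
  have D: "integrable lborel D" unfolding D_def using integrable_one_plus_abs_powr[OF a] by simp
  have bW: "N z * norm (W z q) \<le> D z" for z q
  proof (cases "q \<in> sphere 0 1")
    case True
    have "norm (W z q) = norm (V z q)" using True by (simp add: W_def norm_mult norm_exp_eq_Re)
    also have "\<dots> \<le> \<bar>C\<bar> * (1 + \<bar>z\<bar>) powr (- real DIM('a) - a)"
      using bV[OF True, of z] by (rule order_trans) (simp add: mult_right_mono)
    finally have "N z * norm (W z q) \<le> N z * (\<bar>C\<bar> * (1 + \<bar>z\<bar>) powr (- real DIM('a) - a))"
      by (rule mult_left_mono) (simp add: N_def)
    also have "\<dots> = \<bar>C\<bar> * ((1 + \<bar>z\<bar>) powr real n * (1 + \<bar>z\<bar>) powr (- real DIM('a) - a))"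
      by (simp add: N_def powr_realpow)
    also have "\<dots> = D z" unfolding powr_add[symmetric] D_def n(3) by simp
    finally show ?thesis .
  qed (simp add: W_def D_def)
  have D0: "D z \<ge> 0" for z by (simp add: D_def)
  have N1: "N z \<ge> 1" for z by (simp add: N_def one_le_power)
  have bW1: "norm (W z q) \<le> D z" for z q
  proof -
    have "1 * norm (W z q) \<le> N z * norm (W z q)" by (rule mult_right_mono) (simp_all add: N1)
    then show ?thesis using bW[of z q] by simp
  qed
  have intD: "integrable (lborel \<Otimes>\<^sub>M \<sigma>) (\<lambda>p. D (fst p))"
  proof -
    have "integrable (lborel \<Otimes>\<^sub>M \<sigma>) (\<lambda>(z, q). D z)"
    proof (rule P.Fubini_integrable)
      have [measurable]: "D \<in> borel_measurable borel" using borel_measurable_integrable[OF D] by simp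
      show "(\<lambda>(z, q). D z) \<in> borel_measurable (lborel \<Otimes>\<^sub>M \<sigma>)" by measurable
    qed (use D in \<open>simp_all add: abs_of_nonneg[OF D0]\<close>)
    then show ?thesis by (simp add: case_prod_unfold)
  qed
  have int_gen: "integrable (lborel \<Otimes>\<^sub>M \<sigma>) (\<lambda>p. of_real (g (fst p)) * (exp (- (\<i> * of_real (R * (k \<bullet> snd p)))) * W (fst p) (snd p)))"
    if [measurable]: "g \<in> borel_measurable borel" and g: "\<And>z. \<bar>g z\<bar> \<le> c * N z" for g :: "real \<Rightarrow> real" and c R
  proof (rule Bochner_Integration.integrable_bound)
    show "integrable (lborel \<Otimes>\<^sub>M \<sigma>) (\<lambda>p. c * D (fst p))" using intD by simp
    have W_m': "(\<lambda>p. W (fst p) (snd p)) \<in> borel_measurable (lborel \<Otimes>\<^sub>M \<sigma>)"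
      using W_m by (simp add: case_prod_unfold)
    then show "(\<lambda>p. of_real (g (fst p)) * (exp (- (\<i> * of_real (R * (k \<bullet> snd p)))) * W (fst p) (snd p))) \<in> borel_measurable (lborel \<Otimes>\<^sub>M \<sigma>)"
      by measurable
    have c: "c \<ge> 0" using g[of 0] by (simp add: N_def)
    show "AE p in lborel \<Otimes>\<^sub>M \<sigma>. norm (of_real (g (fst p)) * (exp (- (\<i> * of_real (R * (k \<bullet> snd p)))) * W (fst p) (snd p))) \<le> norm (c * D (fst p))"
    proof (intro always_eventually allI)
      fix p :: "real \<times> 'a"
      have "norm (of_real (g (fst p)) * (exp (- (\<i> * of_real (R * (k \<bullet> snd p)))) * W (fst p) (snd p))) = \<bar>g (fst p)\<bar> * norm (W (fst p) (snd p))"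
        by (simp add: norm_mult norm_exp_eq_Re)
      also have "\<dots> \<le> (c * N (fst p)) * norm (W (fst p) (snd p))" by (rule mult_right_mono) (simp_all add: g)
      also have "\<dots> \<le> c * D (fst p)" using bW[of "fst p" "snd p"] c by (simp add: mult.assoc mult_left_mono)
      finally show "norm (of_real (g (fst p)) * (exp (- (\<i> * of_real (R * (k \<bullet> snd p)))) * W (fst p) (snd p))) \<le> norm (c * D (fst p))"
        by simp
    qed
  qed
  have N_const: "\<bar>c\<bar> \<le> \<bar>c\<bar> * N z" for c z :: real using N1[of z] mult_left_mono[of 1 "N z" "\<bar>c\<bar>"] by simp
  have N_lin: "\<bar>2 * z\<bar> \<le> 2 * N z" if "n = 2" for z :: real
    unfolding N_def that using self_le_power[of "1 + \<bar>z\<bar>" 2] by (simp add: abs_mult)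
  have wR_m[measurable]: "wR R \<in> borel_measurable borel" for R unfolding wR_def by measurable
  have E_m[measurable]: "E R \<in> borel_measurable borel" for R unfolding E_def by measurable
  define G where "G R g = (LINT p|(lborel \<Otimes>\<^sub>M \<sigma>). of_real (g (fst p)) * (exp (- (\<i> * of_real (R * (k \<bullet> snd p)))) * W (fst p) (snd p)))" for R and g :: "real \<Rightarrow> real"
  have G_iter: "G R g = (LINT q|\<sigma>. LINT z|lborel. of_real (g z) * (exp (- (\<i> * of_real (R * (k \<bullet> q)))) * W z q))"
    if "g \<in> borel_measurable borel" "\<And>z. \<bar>g z\<bar> \<le> c * N z" for g R c
    using P.integral_snd[of "\<lambda>z q. of_real (g z) * (exp (- (\<i> * of_real (R * (k \<bullet> q)))) * W z q)"] int_gen[OF that]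
    by (simp add: G_def case_prod_unfold)
  have cVz: "continuous_on (sphere 0 1) (V z)" for z
  proof -
    have "continuous_on (sphere 0 1) (\<lambda>q. (\<lambda>(z, q). V z q) (z, q))"
      by (rule continuous_on_compose2[OF cV]) (auto intro!: continuous_on_Pair continuous_on_const continuous_on_id)
    then show ?thesis by simp
  qed
  have V_m: "(\<lambda>z. V z q) \<in> borel_measurable borel" if "q \<in> sphere 0 1" for q
  proof (rule borel_measurable_continuous_onI)
    have "continuous_on UNIV (\<lambda>z. (\<lambda>(z, q). V z q) (z, q))"
      by (rule continuous_on_compose2[OF cV]) (use that in \<open>auto intro!: continuous_on_Pair continuous_on_const continuous_on_id\<close>)
    then show "continuous_on UNIV (\<lambda>z. V z q)" by simp
  qed
  have bV1: "norm (V z q) \<le> D z" "N z * norm (V z q) \<le> D z" if "q \<in> sphere 0 1" for z q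
    using bW1[of z q] bW[of z q] that by (simp_all add: W_def norm_mult norm_exp_eq_Re)
  show "continuous_on (sphere 0 1) m" if d3: "DIM('a) = 3"
    unfolding m_def
  proof (rule continuous_on_integral_dominated[where w=D])
    show "continuous_on (sphere 0 1) (\<lambda>q. of_real z * (exp (- (\<i> * of_real (z * (k \<bullet> q)))) * V z q))" for z
      by (intro continuous_intros cVz)
    fix q :: 'a assume q: "q \<in> sphere 0 1"
    show "(\<lambda>z. of_real z * (exp (- (\<i> * of_real (z * (k \<bullet> q)))) * V z q)) \<in> borel_measurable lborel"
      using V_m[OF q] by measurable
    fix z
    have "n = 2" using n(4) d3 by simp
    from N_lin[OF this, of z] have "\<bar>z\<bar> \<le> N z" by (simp add: abs_mult)
    then have "\<bar>z\<bar> * norm (V z q) \<le> N z * norm (V z q)" by (rule mult_right_mono) simp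
    then show "norm (of_real z * (exp (- (\<i> * of_real (z * (k \<bullet> q)))) * V z q)) \<le> D z"
      using bV1(2)[OF q, of z] by (simp add: norm_mult norm_exp_eq_Re)
  qed (rule D)
  have W_int: "(LINT z|lborel. of_real (g z) * (exp (- (\<i> * of_real (R * (k \<bullet> q)))) * W z q)) =
      indicator (sphere 0 1) q *\<^sub>R ((LINT z|lborel. of_real (g z) * (exp (- (\<i> * of_real (z * (k \<bullet> q)))) * V z q)) * exp (- (\<i> * of_real (R *\<^sub>R k \<bullet> q))))"
    for g :: "real \<Rightarrow> real" and R q
  proof -
    have "(LINT z|lborel. of_real (g z) * (exp (- (\<i> * of_real (R * (k \<bullet> q)))) * W z q)) =
      (LINT z|lborel. indicator (sphere 0 1) q *\<^sub>R ((of_real (g z) * (exp (- (\<i> * of_real (z * (k \<bullet> q)))) * V z q)) * exp (- (\<i> * of_real (R *\<^sub>R k \<bullet> q)))))"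
      by (rule Bochner_Integration.integral_cong) (simp_all add: W_def scaleR_conv_of_real mult_ac)
    then show ?thesis
      by (simp only: integral_scaleR_right integral_mult_left_zero)
  qed
  have G_const: "G R (\<lambda>z. c) = of_real c * sphere_transform \<sigma> f (R *\<^sub>R k)" for R c
  proof -
    have "G R (\<lambda>z. c) = (LINT q|\<sigma>. LINT z|lborel. of_real c * (exp (- (\<i> * of_real (R * (k \<bullet> q)))) * W z q))"
      by (rule G_iter[OF _ N_const]) simp
    also have "\<dots> = (LINT q|\<sigma>. of_real c * (indicator (sphere 0 1) q *\<^sub>R (f q * exp (- (\<i> * of_real (R *\<^sub>R k \<bullet> q))))))"
      unfolding W_int f_def by (simp only: integral_mult_right_zero scaleR_conv_of_real mult_ac)
    finally show ?thesis unfolding sphere_transform_def by (simp only: integral_mult_right_zero)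
  qed
  have G_lin: "G R (\<lambda>z. 2 * z) = 2 * sphere_transform \<sigma> m (R *\<^sub>R k)" if n2: "n = 2" for R
  proof -
    have "G R (\<lambda>z. 2 * z) = (LINT q|\<sigma>. LINT z|lborel. of_real (2 * z) * (exp (- (\<i> * of_real (R * (k \<bullet> q)))) * W z q))"
      by (rule G_iter[OF _ N_lin[OF n2]]) simp
    also have "\<dots> = (LINT q|\<sigma>. 2 * (indicator (sphere 0 1) q *\<^sub>R (m q * exp (- (\<i> * of_real (R *\<^sub>R k \<bullet> q))))))"
      unfolding W_int m_def by (simp only: of_real_mult of_real_numeral mult.assoc integral_mult_right_zero mult_scaleR_right)
    finally show ?thesis unfolding sphere_transform_def by (simp only: integral_mult_right_zero)
  qed
  have G_E: "((\<lambda>R. G R (E R)) \<longlongrightarrow> 0) at_top"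
  proof -
    have W_m': "(\<lambda>p. W (fst p) (snd p)) \<in> borel_measurable (lborel \<Otimes>\<^sub>M \<sigma>)"
      using W_m by (simp add: case_prod_unfold)
    have "((\<lambda>R. G R (E R)) \<longlongrightarrow> (LINT p|((lborel :: real measure) \<Otimes>\<^sub>M \<sigma>). 0)) at_top"
      unfolding G_def
    proof (rule integral_dominated_convergence_at_top)
      show "integrable (lborel \<Otimes>\<^sub>M \<sigma>) (\<lambda>p. 3 * D (fst p))" using intD by simp
      show "(\<lambda>p. of_real (E R (fst p)) * (exp (- (\<i> * of_real (R * (k \<bullet> snd p)))) * W (fst p) (snd p))) \<in> borel_measurable (lborel \<Otimes>\<^sub>M \<sigma>)" for R
        using W_m' by measurable
      show "AE p in lborel \<Otimes>\<^sub>M \<sigma>. ((\<lambda>R. of_real (E R (fst p)) * (exp (- (\<i> * of_real (R * (k \<bullet> snd p)))) * W (fst p) (snd p))) \<longlongrightarrow> 0) at_top"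
      proof (intro always_eventually allI)
        fix p :: "real \<times> 'a"
        have "((\<lambda>R. \<bar>E R (fst p)\<bar> * norm (W (fst p) (snd p))) \<longlongrightarrow> 0) at_top"
          by (intro tendsto_mult_left_zero tendsto_rabs_zero E_lim)
        then have "((\<lambda>R. norm (of_real (E R (fst p)) * (exp (- (\<i> * of_real (R * (k \<bullet> snd p)))) * W (fst p) (snd p)))) \<longlongrightarrow> 0) at_top"
          by (simp add: norm_mult norm_exp_eq_Re)
        then show "((\<lambda>R. of_real (E R (fst p)) * (exp (- (\<i> * of_real (R * (k \<bullet> snd p)))) * W (fst p) (snd p))) \<longlongrightarrow> 0) at_top"
          by (rule tendsto_norm_zero_cancel)
      qed
      show "\<forall>\<^sub>F R in at_top. AE p in lborel \<Otimes>\<^sub>M \<sigma>. norm (of_real (E R (fst p)) * (exp (- (\<i> * of_real (R * (k \<bullet> snd p)))) * W (fst p) (snd p))) \<le> 3 * D (fst p)"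
        using eventually_ge_at_top[of 1]
      proof eventually_elim
        case (elim R)
        show ?case
        proof (intro always_eventually allI)
          fix p :: "real \<times> 'a"
          have "norm (of_real (E R (fst p)) * (exp (- (\<i> * of_real (R * (k \<bullet> snd p)))) * W (fst p) (snd p))) = \<bar>E R (fst p)\<bar> * norm (W (fst p) (snd p))"
            by (simp add: norm_mult norm_exp_eq_Re)
          also have "\<dots> \<le> (3 * N (fst p)) * norm (W (fst p) (snd p))"
            unfolding N_def by (rule mult_right_mono[OF E_bound[OF elim]]) simp
          also have "\<dots> \<le> 3 * D (fst p)" using bW[of "fst p" "snd p"] by simp
          finally show "norm (of_real (E R (fst p)) * (exp (- (\<i> * of_real (R * (k \<bullet> snd p)))) * W (fst p) (snd p))) \<le> 3 * D (fst p)" .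
        qed
      qed
    qed simp
    then show ?thesis by simp
  qed
  have G_shell: "shell_transform R V k = G R (wR R)" if R: "R \<ge> 1" for R
  proof -
    \<comment> \<open>The polar Jacobian after the shift r = R + z. The cut-off |x| < 2R and r > 0
      become -R < z < R, so for fixed R this weight is bounded.\<close>
    let ?h0 = "\<lambda>z. (R + z) ^ n * of_bool (- R < z \<and> z < R)"
    have h0: "\<bar>?h0 z\<bar> \<le> (2 * R) ^ n * N z" for z
    proof (cases "- R < z \<and> z < R")
      case True
      then have "\<bar>?h0 z\<bar> = (R + z) ^ n" by simp
      also have "\<dots> \<le> (2 * R) ^ n" using True by (intro power_mono) auto
      also have "\<dots> \<le> (2 * R) ^ n * N z" using N1[of z] R by simp
      finally show ?thesis .
    qed (use R in \<open>auto simp: N_def\<close>)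
    have h0_m: "?h0 \<in> borel_measurable borel" by measurable
    define U where "U x = exp (- (\<i> * of_real (k \<bullet> x))) * (of_bool (norm x < 2 * R) * V (norm x - R) (x /\<^sub>R norm x))" for x
    have U_m[measurable]: "U \<in> borel_measurable borel"
      using shell_profile_measurable[OF cV, of R] unfolding U_def by measurable
    have intU: "integrable lborel U"
    proof (rule Bochner_Integration.integrable_bound)
      show "integrable lborel (\<lambda>x::'a. \<bar>C\<bar> * indicator (cball 0 (2 * R)) x)"
        by (intro integrable_mult_right integrable_real_indicator emeasure_bounded_finite[unfolded infinity_ennreal_def]) (simp_all add: emeasure_bounded_finite[unfolded infinity_ennreal_def])
      show "AE x in lborel. norm (U x) \<le> norm (\<bar>C\<bar> * indicator (cball 0 (2 * R)) x)"
        using AE_lborel_singleton[of 0]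
      proof eventually_elim
        case (elim x)
        then have "norm (V (norm x - R) (x /\<^sub>R norm x)) \<le> D (norm x - R)" by (intro bV1) simp
        also have "\<dots> \<le> \<bar>C\<bar> * (1 + \<bar>norm x - R\<bar>) powr 0"
          unfolding D_def using a by (intro mult_left_mono powr_mono) auto
        also have "(1 + \<bar>norm x - R\<bar>) powr 0 = 1" using abs_ge_zero[of "norm x - R"] by (simp add: add_nonneg_eq_0_iff)
        finally show ?case by (auto simp: U_def norm_mult norm_exp_eq_Re)
      qed
    qed simp
    define H where "H p = of_real (fst p ^ n * of_bool (0 < fst p \<and> fst p < 2 * R)) * (exp (- (\<i> * of_real (R * (k \<bullet> snd p)))) * W (fst p - R) (snd p))" for p
    have H_m: "H \<in> borel_measurable (lborel \<Otimes>\<^sub>M \<sigma>)"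
    proof -
      have "(\<lambda>p. W (fst p - R) (snd p)) \<in> borel_measurable (lborel \<Otimes>\<^sub>M \<sigma>)"
        using measurable_compose[OF _ W_m, of "\<lambda>p. (fst p - R, snd p)" "lborel \<Otimes>\<^sub>M \<sigma>"] by simp
      then show ?thesis unfolding H_def by measurable
    qed
    note U_polar = polar_integral[OF pm intU]
    \<comment> \<open>Polar coordinates produce all q in the ambient space; V is controlled on the
      sphere only, hence the identification of integrands almost everywhere.\<close>
    have "AE p in (lborel :: real measure) \<Otimes>\<^sub>M \<sigma>. norm (snd p) = 1"
    proof (rule P.AE_pair_measure)
      show "{p \<in> space ((lborel :: real measure) \<Otimes>\<^sub>M \<sigma>). norm (snd p) = 1} \<in> sets (lborel \<Otimes>\<^sub>M \<sigma>)"
        by measurable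
    qed (use AE1 in simp)
    then have U_H: "AE p in lborel \<Otimes>\<^sub>M \<sigma>. (\<lambda>(r, q). (r ^ (DIM('a) - 1) * indicator {0<..} r) *\<^sub>R U (r *\<^sub>R q)) p = H p"
    proof eventually_elim
      case (elim p)
      obtain r q where p: "p = (r, q)" by (cases p)
      show ?case
      proof (cases "0 < r")
        case True
        have "exp (- (\<i> * of_real (k \<bullet> (r *\<^sub>R q)))) = exp (- (\<i> * of_real (R * (k \<bullet> q)))) * exp (- (\<i> * of_real ((r - R) * (k \<bullet> q))))"
          unfolding exp_add[symmetric] by (simp add: algebra_simps)
        then show ?thesis
          using True elim by (auto simp: p H_def U_def W_def n(3) scaleR_conv_of_real)
      qed (simp add: p H_def)
    qed
    have H_int: "integrable (lborel \<Otimes>\<^sub>M \<sigma>) H"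
      by (rule integrable_cong_AE_imp[OF U_polar(1) H_m U_H])
    have "(LINT x|lborel. U x) = (LINT p|(lborel \<Otimes>\<^sub>M \<sigma>). H p)"
      unfolding U_polar(2) by (rule integral_cong_AE[OF borel_measurable_integrable[OF U_polar(1)] H_m U_H])
    also have "\<dots> = (LINT q|\<sigma>. LINT r|lborel. of_real (r ^ n * of_bool (0 < r \<and> r < 2 * R)) * (exp (- (\<i> * of_real (R * (k \<bullet> q)))) * W (r - R) q))"
    proof -
      have "integrable (lborel \<Otimes>\<^sub>M \<sigma>) (case_prod (\<lambda>r q. H (r, q)))" using H_int by (simp add: case_prod_unfold)
      from P.integral_snd[OF this] have "(LINT p|(lborel \<Otimes>\<^sub>M \<sigma>). H p) = (LINT q|\<sigma>. LINT r|lborel. H (r, q))"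
        by (simp add: case_prod_unfold)
      then show ?thesis by (simp only: H_def fst_conv snd_conv)
    qed
    also have "\<dots> = (LINT q|\<sigma>. LINT z|lborel. of_real (?h0 z) * (exp (- (\<i> * of_real (R * (k \<bullet> q)))) * W z q))"
    proof (rule Bochner_Integration.integral_cong[OF refl])
      fix q
      have "(LINT r|lborel. of_real (r ^ n * of_bool (0 < r \<and> r < 2 * R)) * (exp (- (\<i> * of_real (R * (k \<bullet> q)))) * W (r - R) q))
        = \<bar>1\<bar> *\<^sub>R (LINT z|lborel. of_real ((R + 1 * z) ^ n * of_bool (0 < R + 1 * z \<and> R + 1 * z < 2 * R)) * (exp (- (\<i> * of_real (R * (k \<bullet> q)))) * W (R + 1 * z - R) q))"
        by (rule lborel_integral_real_affine) simp
      also have "\<dots> = (LINT z|lborel. of_real (?h0 z) * (exp (- (\<i> * of_real (R * (k \<bullet> q)))) * W z q))"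
        by (simp, rule Bochner_Integration.integral_cong) auto
      finally show "(LINT r|lborel. of_real (r ^ n * of_bool (0 < r \<and> r < 2 * R)) * (exp (- (\<i> * of_real (R * (k \<bullet> q)))) * W (r - R) q)) = \<dots>" .
    qed
    also have "\<dots> = G R ?h0" by (rule G_iter[OF h0_m h0, symmetric])
    finally have "shell_transform R V k = of_real (R powr (- (real n / 2))) * G R ?h0"
      by (simp add: shell_transform_def U_def n(2))
    also have "\<dots> = G R (wR R)"
      unfolding G_def wR_def by (simp only: integral_mult_right_zero[symmetric] of_real_mult mult.assoc)
    finally show ?thesis .
  qed
  have "((\<lambda>R. shell_transform R V k - of_real (R powr ((real DIM('a) - 1) / 2)) * sphere_transform \<sigma> f (R *\<^sub>R k)
      - (if DIM('a) = 3 then 2 * sphere_transform \<sigma> m (R *\<^sub>R k) else 0)) \<longlongrightarrow> 0) at_top"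
  proof (rule Lim_transform_eventually[OF G_E])
    show "\<forall>\<^sub>F R in at_top. G R (E R) = shell_transform R V k - of_real (R powr ((real DIM('a) - 1) / 2)) * sphere_transform \<sigma> f (R *\<^sub>R k)
      - (if DIM('a) = 3 then 2 * sphere_transform \<sigma> m (R *\<^sub>R k) else 0)"
      using eventually_ge_at_top[of 1]
    proof eventually_elim
      case (elim R)
      let ?Q = "\<lambda>p. exp (- (\<i> * of_real (R * (k \<bullet> snd p)))) * W (fst p) (snd p)"
      have iE: "integrable (lborel \<Otimes>\<^sub>M \<sigma>) (\<lambda>p. of_real (E R (fst p)) * ?Q p)"
        by (rule int_gen[where c=3]) (use E_bound[OF elim] in \<open>simp_all add: N_def\<close>)
      have iC: "integrable (lborel \<Otimes>\<^sub>M \<sigma>) (\<lambda>p. of_real (R powr (real n / 2)) * ?Q p)"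
        by (rule int_gen[where g="\<lambda>_. R powr (real n / 2)", OF _ N_const]) simp
      have iL: "integrable (lborel \<Otimes>\<^sub>M \<sigma>) (\<lambda>p. of_real (if n = 2 then 2 * fst p else 0) * ?Q p)"
      proof (rule int_gen[where c=2 and g="\<lambda>z. if n = 2 then 2 * z else 0"])
        show "\<bar>if n = 2 then 2 * z else 0\<bar> \<le> 2 * N z" for z
          using N_lin[of z] N1[of z] by (cases "n = 2") auto
      qed simp
      have "G R (wR R) = (LINT p|(lborel \<Otimes>\<^sub>M \<sigma>). of_real (E R (fst p)) * ?Q p + (of_real (R powr (real n / 2)) * ?Q p + of_real (if n = 2 then 2 * fst p else 0) * ?Q p))"
        unfolding G_def by (rule Bochner_Integration.integral_cong[OF refl]) (simp add: E_def algebra_simps)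
      also have "\<dots> = G R (E R) + (G R (\<lambda>z. R powr (real n / 2)) + G R (\<lambda>z. if n = 2 then 2 * z else 0))"
        unfolding G_def Bochner_Integration.integral_add[OF iE Bochner_Integration.integrable_add[OF iC iL]]
          Bochner_Integration.integral_add[OF iC iL] ..
      also have "G R (\<lambda>z. if n = 2 then 2 * z else 0) = (if DIM('a) = 3 then 2 * sphere_transform \<sigma> m (R *\<^sub>R k) else 0)"
      proof (cases "n = 2")
        case True
        then show ?thesis using G_lin[OF True] n(4) by simp
      next
        case False
        then show ?thesis using n(4) by (simp add: G_def)
      qed
      finally show ?case
        unfolding G_shell[OF elim] G_const n(2) by simp
    qed
  qed
  then show "((\<lambda>R. shell_transform R V k - of_real (R powr ((real DIM('a) - 1) / 2)) * sphere_transform \<sigma> f (R *\<^sub>R k)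
      - (if DIM('a) = 3 then 2 * sphere_transform \<sigma> m (R *\<^sub>R k) else 0)) \<longlongrightarrow> 0) at_top" .
qed

text \<open>The sphere asymptotics are used at l = R |k| along e = k/|k|. They carry the amplitude
  (R |k|)^s where the shell has R^s, and this mismatch is the power of |k| in the
  denominator.\<close>

theorem shell_transform_limit:
  fixes V :: "real \<Rightarrow> 'a::euclidean_space \<Rightarrow> complex" and k :: 'a
  assumes dim: "DIM('a) \<in> {1, 2, 3}" and k: "k \<noteq> 0"
    and cV: "continuous_on (UNIV \<times> sphere 0 1) (\<lambda>(z, q). V z q)"
    and a: "a > 0" and bV: "\<And>z q. q \<in> sphere 0 1 \<Longrightarrow> norm (V z q) \<le> C * (1 + \<bar>z\<bar>) powr (- real DIM('a) - a)"
  defines "f \<equiv> \<lambda>q. LINT z|lborel. exp (- (\<i> * of_real (z * (k \<bullet> q)))) * V z q"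
  assumes fC: "Ck_submanifold (min 1 (DIM('a) - 1)) (sphere 0 1) f" and f0: "f (- (k /\<^sub>R norm k)) = 0"
  shows "((\<lambda>R. exp (\<i> * of_real (R * norm k)) * shell_transform R V k) \<longlongrightarrow>
    f (k /\<^sub>R norm k) / (plane_const DIM('a) * of_real (norm k powr ((real DIM('a) - 1) / 2)))) at_top"
proof -
  define e where "e = k /\<^sub>R norm k"
  define s where "s = (real DIM('a) - 1) / 2"
  have e: "norm e = 1" "k = norm k *\<^sub>R e" using k by (simp_all add: e_def)
  have nk: "norm k > 0" using k by simp
  obtain \<sigma> where pm: "polar_measure \<sigma>"
    and S1: "\<And>f. Ck_submanifold (min 1 (DIM('a) - 1)) (sphere 0 1) f \<Longrightarrow> f (- e) = 0 \<Longrightarrow>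
      ((\<lambda>l. of_real (l powr ((real DIM('a) - 1) / 2)) * exp (\<i> * of_real l) * sphere_transform \<sigma> f (l *\<^sub>R e)) \<longlongrightarrow>
        f e / plane_const DIM('a)) at_top"
    and S2: "\<And>f. DIM('a) = 3 \<Longrightarrow> continuous_on (sphere 0 1) f \<Longrightarrow> ((\<lambda>l. sphere_transform \<sigma> f (l *\<^sub>R e)) \<longlongrightarrow> 0) at_top"
    using sphere_asymptotics[OF e(1) dim] by blast
  define m where "m q = (LINT z|lborel. of_real z * (exp (- (\<i> * of_real (z * (k \<bullet> q)))) * V z q))" for q
  have D: "((\<lambda>R. shell_transform R V k - of_real (R powr s) * sphere_transform \<sigma> f (R *\<^sub>R k)
      - (if DIM('a) = 3 then 2 * sphere_transform \<sigma> m (R *\<^sub>R k) else 0)) \<longlongrightarrow> 0) at_top"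
    using shell_transform_sphere_decomposition(1)[OF dim pm cV a bV, of k] unfolding f_def m_def s_def .
  have fl: "filterlim (\<lambda>R. R * norm k) at_top at_top"
    by (rule filterlim_at_top_mult_tendsto_pos[OF tendsto_const nk filterlim_ident])
  have Rk: "(R * norm k) *\<^sub>R e = R *\<^sub>R k" for R using k by (simp add: e_def)
  have M: "((\<lambda>R. if DIM('a) = 3 then 2 * sphere_transform \<sigma> m (R *\<^sub>R k) else 0) \<longlongrightarrow> 0) at_top"
  proof (cases "DIM('a) = 3")
    case True
    have "continuous_on (sphere 0 1) m"
      using shell_transform_sphere_decomposition(2)[OF dim pm cV a bV True] unfolding m_def .
    from filterlim_compose[OF S2[OF True this] fl]
    have "((\<lambda>R. sphere_transform \<sigma> m (R *\<^sub>R k)) \<longlongrightarrow> 0) at_top" by (simp only: Rk)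
    from tendsto_mult_right_zero[OF this, of 2] show ?thesis using True by simp
  qed simp
  have "((\<lambda>R. shell_transform R V k - of_real (R powr s) * sphere_transform \<sigma> f (R *\<^sub>R k)) \<longlongrightarrow> 0) at_top"
    using tendsto_add[OF D M] by simp
  then have "((\<lambda>R. norm (exp (\<i> * of_real (R * norm k)) * (shell_transform R V k - of_real (R powr s) * sphere_transform \<sigma> f (R *\<^sub>R k)))) \<longlongrightarrow> 0) at_top"
    by (simp add: norm_mult norm_exp_eq_Re tendsto_norm_zero)
  then have Z: "((\<lambda>R. exp (\<i> * of_real (R * norm k)) * (shell_transform R V k - of_real (R powr s) * sphere_transform \<sigma> f (R *\<^sub>R k))) \<longlongrightarrow> 0) at_top"
    by (rule tendsto_norm_zero_cancel)
  have "((\<lambda>R. of_real ((R * norm k) powr s) * exp (\<i> * of_real (R * norm k)) * sphere_transform \<sigma> f (R *\<^sub>R k)) \<longlongrightarrow>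
        f e / plane_const DIM('a)) at_top"
    using filterlim_compose[OF S1[OF fC f0[folded e_def]] fl] by (simp only: Rk s_def)
  from tendsto_divide[OF this tendsto_const[of "of_real (norm k powr s)"]]
  have "((\<lambda>R. of_real ((R * norm k) powr s) * exp (\<i> * of_real (R * norm k)) * sphere_transform \<sigma> f (R *\<^sub>R k) / of_real (norm k powr s)) \<longlongrightarrow>
        f e / plane_const DIM('a) / of_real (norm k powr s)) at_top" using k by simp
  from tendsto_add[OF Z this]
  have "((\<lambda>R. exp (\<i> * of_real (R * norm k)) * (shell_transform R V k - of_real (R powr s) * sphere_transform \<sigma> f (R *\<^sub>R k))
      + of_real ((R * norm k) powr s) * exp (\<i> * of_real (R * norm k)) * sphere_transform \<sigma> f (R *\<^sub>R k) / of_real (norm k powr s))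
     \<longlongrightarrow> f e / plane_const DIM('a) / of_real (norm k powr s)) at_top" by simp
  then have "((\<lambda>R. exp (\<i> * of_real (R * norm k)) * shell_transform R V k) \<longlongrightarrow> f e / plane_const DIM('a) / of_real (norm k powr s)) at_top"
  proof (rule Lim_transform_eventually)
    show "\<forall>\<^sub>F R in at_top. exp (\<i> * of_real (R * norm k)) * (shell_transform R V k - of_real (R powr s) * sphere_transform \<sigma> f (R *\<^sub>R k))
      + of_real ((R * norm k) powr s) * exp (\<i> * of_real (R * norm k)) * sphere_transform \<sigma> f (R *\<^sub>R k) / of_real (norm k powr s)
      = exp (\<i> * of_real (R * norm k)) * shell_transform R V k"
      using eventually_gt_at_top[of 0]
    proof eventually_elim
      case (elim R)
      have "complex_of_real ((R * norm k) powr s) = of_real (R powr s) * of_real (norm k powr s)"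
        using elim nk by (simp add: powr_mult)
      then show ?case using nk by (simp add: right_diff_distrib)
    qed
  qed
  then show ?thesis by (simp add: e_def s_def)
qed

section \<open>Profiles supported in a bounded band of positive frequencies\<close>

text \<open>Meant for the map taking q to (k.q, q): joint smoothness of the profile in frequency and
  direction becomes smoothness on the sphere of the density seen by stationary phase.\<close>

lemma Ck_submanifold_compose_linear:
  fixes F :: "'b::euclidean_space \<Rightarrow> complex" and L :: "'a::euclidean_space \<Rightarrow> 'b"
  assumes k: "k \<le> 1" and F: "Ck_submanifold k M F" and L: "linear L" and LM: "\<And>x. x \<in> S \<Longrightarrow> L x \<in> M"
  shows "Ck_submanifold k S (\<lambda>x. F (L x))"
  unfolding Ck_submanifold_def
proof
  have bl: "bounded_linear L" using L by (simp add: linear_linear)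
  have cL: "continuous_on T L" for T using L by (simp add: linear_continuous_on linear_linear)
  fix p assume "p \<in> S"
  then obtain U g where U: "open U" "L p \<in> U" "Ck_on k U g" "\<forall>x\<in>U \<inter> M. g x = F x"
    using F LM unfolding Ck_submanifold_def by meson
  have "Ck_on k (L -` U) (\<lambda>x. g (L x))"
  proof (cases "k = 0")
    case True
    then show ?thesis using U(3) by (auto intro: continuous_on_compose2[OF _ cL])
  next
    case False
    then have k1: "k = Suc 0" using k by simp
    have d: "((\<lambda>x. g (L x)) has_derivative (\<lambda>v. frechet_derivative g (at (L x)) (L v))) (at x)" if "x \<in> L -` U" for x
    proof -
      have "(L has_derivative L) (at x)" by (rule bounded_linear_imp_has_derivative[OF bl])
      moreover have "(g has_derivative frechet_derivative g (at (L x))) (at (L x))"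
        using Ck_on_1_has_derivative[OF U(3)[unfolded k1]] that by simp
      ultimately show ?thesis by (rule has_derivative_compose)
    qed
    have fd: "frechet_derivative (\<lambda>x. g (L x)) (at x) v = frechet_derivative g (at (L x)) (L v)" if "x \<in> L -` U" for x v
      using frechet_derivative_at[OF d[OF that]] by (metis)
    have "continuous_on (L -` U) (\<lambda>x. frechet_derivative g (at (L x)) (L v))" for v
      by (rule continuous_on_compose2[of U "\<lambda>y. frechet_derivative g (at y) (L v)", OF _ cL]) (use U(3) k1 in auto)
    then have "continuous_on (L -` U) (\<lambda>x. frechet_derivative (\<lambda>x. g (L x)) (at x) v)" for v
      by (rule continuous_on_eq) (simp add: fd)
    then show ?thesis using d by (auto simp: k1 differentiable_def)
  qed
  moreover have "open (L -` U)" using U(1) cL by (metis continuous_on_open_vimage open_UNIV Int_UNIV_right)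
  ultimately show "\<exists>V h. open V \<and> p \<in> V \<and> Ck_on k V h \<and> (\<forall>x\<in>V \<inter> S. h x = F (L x))"
    using U LM by (intro exI[of _ "L -` U"] exI[of _ "\<lambda>x. g (L x)"]) auto
qed

text \<open>What makes the inverse transform in s absolutely convergent and jointly continuous in z
  and q. Regularity in s is kept apart, since the phase with b is only measurable.\<close>

definition band_profile :: "real \<Rightarrow> real \<Rightarrow> (real \<Rightarrow> 'a::euclidean_space \<Rightarrow> complex) \<Rightarrow> bool" where
  "band_profile B M Vh \<longleftrightarrow> (\<forall>q\<in>sphere 0 1. (\<lambda>s. Vh s q) \<in> borel_measurable lebesgue) \<and>
    (\<forall>s. \<forall>q\<in>sphere 0 1. norm (Vh s q) \<le> M) \<and> (\<forall>s. \<forall>q\<in>sphere 0 1. s \<notin> {0..B} \<longrightarrow> Vh s q = 0) \<and>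
    (\<forall>s. continuous_on (sphere 0 1) (Vh s))"

lemma band_profile_bound:
  assumes "band_profile B M Vh" "q \<in> sphere 0 1"
  shows "norm (Vh s q) \<le> \<bar>M\<bar> * indicator {0..B} s"
  using assms unfolding band_profile_def by (cases "s \<in> {0..B}") (auto intro: order_trans[OF _ abs_ge_self])

lemma integrable_indicator_lebesgue_Icc: "integrable lebesgue (\<lambda>s. c * indicator {a..b::real} s :: real)"
  by (intro integrable_mult_right integrable_real_indicator) (simp_all add: emeasure_bounded_finite[unfolded infinity_ennreal_def])

lemma inv_fourier_real: "inv_fourier u z = 1 / of_real (2 * pi) * (LINT s|lebesgue. exp (\<i> * of_real (z * s)) * u s)"
  for u :: "real \<Rightarrow> complex"
  by (simp add: inv_fourier_def)

lemma band_profile_inv_fourier_continuous: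
  fixes Vh :: "real \<Rightarrow> 'a::euclidean_space \<Rightarrow> complex"
  assumes Vh: "band_profile B M Vh"
  shows "continuous_on (UNIV \<times> sphere 0 1) (\<lambda>(z, q). inv_fourier (\<lambda>s. Vh s q) z)"
proof -
  have "continuous_on (UNIV \<times> sphere 0 1) (\<lambda>p. LINT s|lebesgue. exp (\<i> * of_real (fst p * s)) * Vh s (snd p))"
  proof (rule continuous_on_integral_dominated[where w="\<lambda>s. \<bar>M\<bar> * indicator {0..B} s"])
    show "continuous_on (UNIV \<times> sphere 0 1) (\<lambda>p. exp (\<i> * of_real (fst p * s)) * Vh s (snd p))" for s
    proof (intro continuous_intros)
      have "continuous_on (sphere 0 1) (Vh s)" using Vh by (simp add: band_profile_def)
      then show "continuous_on (UNIV \<times> sphere 0 1) (\<lambda>p. Vh s (snd p))"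
        by (rule continuous_on_compose2) (auto intro!: continuous_intros)
    qed
    fix p :: "real \<times> 'a" assume p: "p \<in> UNIV \<times> sphere 0 1"
    then have q: "snd p \<in> sphere 0 1" by auto
    have "(\<lambda>s. exp (\<i> * of_real (fst p * s))) \<in> borel_measurable lebesgue"
      by (intro borel_measurable_continuous_onI[THEN measurable_completion] measurable_completion) (simp add: borel_measurable_continuous_onI continuous_intros)
    then show "(\<lambda>s. exp (\<i> * of_real (fst p * s)) * Vh s (snd p)) \<in> borel_measurable lebesgue"
      using Vh q by (intro borel_measurable_times) (auto simp: band_profile_def)
    show "norm (exp (\<i> * of_real (fst p * s)) * Vh s (snd p)) \<le> \<bar>M\<bar> * indicator {0..B} s" for s
      using band_profile_bound[OF Vh q] by (simp add: norm_mult norm_exp_eq_Re)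
  qed (rule integrable_indicator_lebesgue_Icc)
  then show ?thesis
    unfolding inv_fourier_real case_prod_unfold by (intro continuous_intros)
qed

text \<open>Fourier inversion in z identifies the density f on the sphere as Vh (k.q) q. At k/|k|
  the frequency is |k|; at the opposite pole it is -|k|, where the profile is zero, which is the
  hypothesis f(-e) = 0 of the stationary phase lemma.\<close>

lemma band_profile_shell_limit:
  fixes Vh :: "real \<Rightarrow> 'a::euclidean_space \<Rightarrow> complex" and k :: 'a
  assumes dim: "DIM('a) \<in> {1, 2, 3}" and k: "k \<noteq> 0" and Vh: "band_profile B M Vh"
    and a: "a > 0" and bV: "\<And>z q. q \<in> sphere 0 1 \<Longrightarrow> norm (inv_fourier (\<lambda>s. Vh s q) z) \<le> C * (1 + \<bar>z\<bar>) powr (- real DIM('a) - a)"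
    and cont: "\<And>q. q \<in> sphere 0 1 \<Longrightarrow> continuous_on UNIV (\<lambda>s. Vh s q)"
    and smooth: "Ck_submanifold (min 1 (DIM('a) - 1)) (sphere 0 1) (\<lambda>q. Vh (k \<bullet> q) q)"
    and neg: "\<And>s q. s \<le> 0 \<Longrightarrow> Vh s q = 0"
  shows "((\<lambda>R. exp (\<i> * of_real (R * norm k)) * shell_transform R (\<lambda>z q. inv_fourier (\<lambda>s. Vh s q) z) k) \<longlongrightarrow>
    Vh (norm k) (k /\<^sub>R norm k) / (plane_const DIM('a) * of_real (norm k powr ((real DIM('a) - 1) / 2)))) at_top"
proof -
  define V where "V z q = inv_fourier (\<lambda>s. Vh s q) z" for z q
  define f where "f q = (LINT z|lborel. exp (- (\<i> * of_real (z * (k \<bullet> q)))) * V z q)" for q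
  have cV: "continuous_on (UNIV \<times> sphere 0 1) (\<lambda>(z, q). V z q)"
    unfolding V_def by (rule band_profile_inv_fourier_continuous[OF Vh])
  have f_eq: "f q = Vh (k \<bullet> q) q" if q: "q \<in> sphere 0 1" for q
  proof -
    let ?A = "\<lambda>s. Vh s q"
    have cA: "continuous_on UNIV ?A" by (rule cont[OF q])
    then have A_m[measurable]: "?A \<in> borel_measurable borel" by (rule borel_measurable_continuous_onI)
    have iA: "integrable lborel ?A"
    proof (rule Bochner_Integration.integrable_bound)
      show "integrable lborel (\<lambda>s. \<bar>M\<bar> * indicator {0..B} s :: real)"
        by (intro integrable_mult_right integrable_real_indicator) (simp_all add: emeasure_bounded_finite[unfolded infinity_ennreal_def])
      show "AE s in lborel. norm (?A s) \<le> norm (\<bar>M\<bar> * indicator {0..B} s)"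
        using band_profile_bound[OF Vh q] by (intro always_eventually allI) (simp add: abs_mult)
    qed simp
    have bA: "norm (?A s) \<le> \<bar>M\<bar>" for s
      using Vh q unfolding band_profile_def by (auto intro: order_trans[OF _ abs_ge_self])
    define h where "h z = (LINT s|lborel. exp (\<i> * of_real (z * s)) * ?A s)" for z
    have Vh_h: "V z q = 1 / of_real (2 * pi) * h z" for z
      unfolding V_def inv_fourier_real h_def by (subst integral_completion) simp_all
    then have hV: "h = (\<lambda>z. of_real (2 * pi) * V z q)" by auto
    have V_m: "(\<lambda>z. V z q) \<in> borel_measurable borel"
    proof (rule borel_measurable_continuous_onI)
      have "continuous_on UNIV (\<lambda>z. (\<lambda>(z, q). V z q) (z, q))"
        by (rule continuous_on_compose2[OF cV]) (use q in \<open>auto intro!: continuous_on_Pair continuous_on_const continuous_on_id\<close>)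
      then show "continuous_on UNIV (\<lambda>z. V z q)" by simp
    qed
    have "integrable lborel (\<lambda>z. V z q)"
    proof (rule Bochner_Integration.integrable_bound)
      show "integrable lborel (\<lambda>z. \<bar>C\<bar> * (1 + \<bar>z\<bar>) powr (- 1 - a))"
        using integrable_one_plus_abs_powr[OF a] by simp
      show "AE z in lborel. norm (V z q) \<le> norm (\<bar>C\<bar> * (1 + \<bar>z\<bar>) powr (- 1 - a))"
      proof (intro always_eventually allI)
        fix z :: real
        have "norm (V z q) \<le> C * (1 + \<bar>z\<bar>) powr (- real DIM('a) - a)" unfolding V_def by (rule bV[OF q])
        also have "\<dots> \<le> \<bar>C\<bar> * (1 + \<bar>z\<bar>) powr (- 1 - a)"
          using dim by (intro mult_mono powr_mono) auto
        finally show "norm (V z q) \<le> norm (\<bar>C\<bar> * (1 + \<bar>z\<bar>) powr (- 1 - a))" by simp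
      qed
    qed (simp add: V_m)
    then have ih: "integrable lborel h" unfolding hV by simp
    have "of_real (2 * pi) * f q = (LINT z|lborel. exp (- (\<i> * of_real (z * (k \<bullet> q)))) * h z)"
      unfolding f_def hV integral_mult_right_zero[symmetric] by (intro Bochner_Integration.integral_cong) simp_all
    also have "\<dots> = of_real (2 * pi) * Vh (k \<bullet> q) q"
      unfolding h_def by (rule fourier_inversion_real[OF cA iA bA ih[unfolded h_def]])
    finally show ?thesis by simp
  qed
  have fC: "Ck_submanifold (min 1 (DIM('a) - 1)) (sphere 0 1) f"
    using smooth unfolding Ck_submanifold_def by (simp add: f_eq Ball_def) 
  have e: "norm (k /\<^sub>R norm k) = 1" "k \<bullet> (k /\<^sub>R norm k) = norm k"
    using k by (simp_all add: power2_norm_eq_inner[symmetric] power2_eq_square)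
  have f0: "f (- (k /\<^sub>R norm k)) = 0"
    using e by (subst f_eq) (auto intro!: neg)
  have f1: "f (k /\<^sub>R norm k) = Vh (norm k) (k /\<^sub>R norm k)"
    using e by (subst f_eq) auto
  have "((\<lambda>R. exp (\<i> * of_real (R * norm k)) * shell_transform R V k) \<longlongrightarrow>
    f (k /\<^sub>R norm k) / (plane_const DIM('a) * of_real (norm k powr ((real DIM('a) - 1) / 2)))) at_top"
    unfolding f_def
    by (rule shell_transform_limit[OF dim k cV a bV[folded V_def] fC[unfolded f_def] f0[unfolded f_def]])
  then show ?thesis unfolding f1 V_def .
qed

text \<open>At t = \<tau> / \<epsilon>^2 the slow time \<open>\<epsilon>\<^sup>2 * t\<close> is
  \<tau> and the radius ct is R, so the profile stays fixed while \<epsilon> -> 0 turns into R ->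
  infinity.\<close>

lemma space_fourier_shell_op:
  fixes V :: "real \<Rightarrow> real ^ 'n \<Rightarrow> real \<Rightarrow> complex"
  assumes cV: "continuous_on (UNIV \<times> sphere 0 1) (\<lambda>(z, q). V z q \<tau>)" and pos: "c > 0" "\<epsilon> > 0" "\<tau> > 0"
  shows "space_fourier (shell_op c \<epsilon> V) k (\<tau> / \<epsilon>\<^sup>2) = shell_transform (c * \<tau> / \<epsilon>\<^sup>2) (\<lambda>z q. V z q \<tau>) k"
proof -
  define R where "R = c * \<tau> / \<epsilon>\<^sup>2"
  have [measurable]: "(\<lambda>x. V (norm x - R) (x /\<^sub>R norm x) \<tau>) \<in> borel_measurable borel"
    using shell_profile_measurable[OF cV] .
  have "space_fourier (shell_op c \<epsilon> V) k (\<tau> / \<epsilon>\<^sup>2) = (LINT x|lebesgue. of_real (R powr (- ((real CARD('n) - 1) / 2))) *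
    (exp (- (\<i> * of_real (k \<bullet> x))) * (of_bool (norm x < 2 * R) * V (norm x - R) (x /\<^sub>R norm x) \<tau>)))"
    unfolding space_fourier_def fourier_def shell_op_def
    using pos by (intro Bochner_Integration.integral_cong) (auto simp: R_def powr_minus field_simps)
  also have "\<dots> = (LINT x|lborel. of_real (R powr (- ((real CARD('n) - 1) / 2))) *
    (exp (- (\<i> * of_real (k \<bullet> x))) * (of_bool (norm x < 2 * R) * V (norm x - R) (x /\<^sub>R norm x) \<tau>)))"
    by (rule integral_completion) measurable
  finally show ?thesis
    unfolding shell_transform_def R_def[symmetric] by (simp only: integral_mult_right_zero DIM_cart DIM_real mult_1_right)
qed

lemma filterlim_inverse_square_at_top:
  assumes "c > 0"
  shows "filterlim (\<lambda>\<epsilon>::real. c / \<epsilon>\<^sup>2) at_top (at_right 0)"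
proof -
  have "((\<lambda>\<epsilon>::real. \<epsilon>\<^sup>2 / c) \<longlongrightarrow> 0\<^sup>2 / c) (at_right 0)"
    using assms by (intro tendsto_intros) auto
  then have "((\<lambda>\<epsilon>::real. \<epsilon>\<^sup>2 / c) \<longlongrightarrow> 0) (at_right 0)" by simp
  moreover have "\<forall>\<^sub>F \<epsilon>::real in at_right 0. 0 < \<epsilon>\<^sup>2 / c"
    using assms by (auto simp: eventually_at_filter)
  ultimately have "filterlim (\<lambda>\<epsilon>::real. inverse (\<epsilon>\<^sup>2 / c)) at_top (at_right 0)"
    by (rule filterlim_inverse_at_top)
  then show ?thesis by simp
qed

lemma compact_support_bounded:
  fixes u :: "'a::euclidean_space \<Rightarrow> complex"
  assumes cu: "continuous_on UNIV u" and supp: "compact (closure {k. u k \<noteq> 0})"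
  obtains B M where "B > 0" "\<And>x. norm x \<ge> B \<Longrightarrow> u x = 0" "M > 0" "\<And>x. norm (u x) \<le> M"
proof -
  define S where "S = closure {k. u k \<noteq> 0}"
  have S: "compact S" using supp by (simp only: S_def)
  obtain b where b: "\<And>x. x \<in> S \<Longrightarrow> norm x \<le> b"
  proof -
    have "bounded S" by (rule compact_imp_bounded[OF S])
    then obtain b where "\<forall>x\<in>S. norm x \<le> b" unfolding bounded_iff ..
    then show thesis by (intro that[of b]) (rule bspec)
  qed
  obtain m where m: "\<And>x. x \<in> S \<Longrightarrow> norm (u x) \<le> m"
  proof -
    have "bounded (u ` S)" by (rule compact_imp_bounded[OF compact_continuous_image[OF continuous_on_subset[OF cu subset_UNIV] S]])
    then obtain b where "\<forall>x\<in>u ` S. norm x \<le> b" unfolding bounded_iff ..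
    then show thesis by (intro that[of b]) (erule bspec, rule imageI)
  qed
  have cl: "x \<in> S" if "u x \<noteq> 0" for x using closure_subset[of "{k. u k \<noteq> 0}"] that unfolding S_def by (rule subsetD[OF _ CollectI])
  show ?thesis
  proof (rule that[of "\<bar>b\<bar> + 1" "\<bar>m\<bar> + 1"])
    show "u x = 0" if "norm x \<ge> \<bar>b\<bar> + 1" for x
    proof (rule ccontr)
      assume "u x \<noteq> 0"
      from b[OF cl[OF this]] that show False by linarith
    qed
    show "norm (u x) \<le> \<bar>m\<bar> + 1" for x
    proof (cases "u x = 0")
      case False
      from m[OF cl[OF this]] show ?thesis by linarith
    qed simp
  qed auto
qed

text \<open>Covers both restriction operators: g is the phase of the profile evolution, w the radial
  weight (regularised or pure power), and \<open>\<kappa>\<close> the constant in front.\<close>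

lemma band_profile_weighted:
  fixes u :: "'a::euclidean_space \<Rightarrow> complex" and w :: "real \<Rightarrow> real" and g :: "real \<Rightarrow> complex"
  assumes cu: "continuous_on UNIV u" and B: "\<And>x. norm x \<ge> B \<Longrightarrow> u x = 0" and M: "\<And>x. norm (u x) \<le> M"
    and w_m: "w \<in> borel_measurable borel" and w0: "\<And>s. s \<le> 0 \<Longrightarrow> w s = 0"
    and wM: "\<And>s. s \<in> {0..B} \<Longrightarrow> \<bar>w s\<bar> \<le> Mw" "Mw \<ge> 0" and g: "g \<in> borel_measurable lebesgue" "\<And>s. norm (g s) \<le> 1"
  shows "band_profile B (norm \<kappa> * Mw * M) (\<lambda>s q. g s * (\<kappa> * of_real (w s) * u (\<bar>s\<bar> *\<^sub>R q)))"
  unfolding band_profile_def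
proof (intro conjI ballI allI impI)
  fix q :: 'a assume q: "q \<in> sphere 0 1"
  have "(\<lambda>s. u (\<bar>s\<bar> *\<^sub>R q)) \<in> borel_measurable borel"
    by (intro borel_measurable_continuous_onI continuous_on_compose2[OF cu]) (auto intro!: continuous_intros)
  then have "(\<lambda>s. \<kappa> * of_real (w s) * u (\<bar>s\<bar> *\<^sub>R q)) \<in> borel_measurable borel"
    using w_m by measurable
  then have "(\<lambda>s. \<kappa> * of_real (w s) * u (\<bar>s\<bar> *\<^sub>R q)) \<in> borel_measurable lebesgue"
    by (intro measurable_completion) simp
  then show "(\<lambda>s. g s * (\<kappa> * of_real (w s) * u (\<bar>s\<bar> *\<^sub>R q))) \<in> borel_measurable lebesgue"
    by (rule borel_measurable_times[OF g(1)])
  fix s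
  show z: "g s * (\<kappa> * of_real (w s) * u (\<bar>s\<bar> *\<^sub>R q)) = 0" if "s \<notin> {0..B}"
    using that(1) q w0[of s] B[of "\<bar>s\<bar> *\<^sub>R q"] by (cases "s \<le> 0") auto
  have M0: "M \<ge> 0" using norm_ge_zero order_trans[OF norm_ge_zero M[of 0]] by simp
  show "norm (g s * (\<kappa> * of_real (w s) * u (\<bar>s\<bar> *\<^sub>R q))) \<le> norm \<kappa> * Mw * M"
  proof (cases "s \<in> {0..B}")
    case True
    have "norm (g s * (\<kappa> * of_real (w s) * u (\<bar>s\<bar> *\<^sub>R q))) = norm (g s) * (norm \<kappa> * \<bar>w s\<bar> * norm (u (\<bar>s\<bar> *\<^sub>R q)))"
      by (simp add: norm_mult)
    also have "\<dots> \<le> 1 * (norm \<kappa> * Mw * M)"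
      using wM True M g(2) by (intro mult_mono mult_nonneg_nonneg) auto
    finally show ?thesis by simp
  next
    case False
    show ?thesis unfolding z[OF False] using M0 wM(2) by simp
  qed
next
  fix s
  show "continuous_on (sphere 0 1) (\<lambda>q. g s * (\<kappa> * of_real (w s) * u (\<bar>s\<bar> *\<^sub>R q)))"
    by (intro continuous_intros continuous_on_compose2[OF cu]) auto
qed

lemma plane_const_nonzero: "plane_const d \<noteq> 0"
  by (simp add: plane_const_def)

theorem regularized_reconstruction_limit:
  fixes u0 :: "real ^ 'n \<Rightarrow> complex" and b W :: "real \<Rightarrow> real" and c \<rho> :: real
  assumes dim: "CARD('n) \<in> {1, 2, 3}" and c: "c > 0"
    and u0_cont: "continuous_on UNIV u0"
    and u0_supp: "compact (closure {k. u0 k \<noteq> 0})"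
    and b: "b \<in> borel_measurable lebesgue"
    and \<rho>: "\<rho> > 0"
    and W: "regularizing CARD('n) \<rho> W"
    and a: "\<alpha> > 0" and decay: "\<And>z q. q \<in> sphere 0 1 \<Longrightarrow>
        cmod (profile_inv_fourier (profile_evol b (restr_reg_op W u0)) z q \<tau>)
          \<le> C * (1 + \<bar>z\<bar>) powr (- real CARD('n) - \<alpha>)"
    and smooth: "Ck_submanifold (CARD('n) - 1) (UNIV \<times> sphere 0 1)
        (\<lambda>(\<xi>, q). profile_evol b (restr_reg_op W u0) \<xi> q \<tau>)"
    and \<tau>: "\<tau> > 0" and k: "norm k > \<rho>"
  shows "((\<lambda>\<epsilon>. recon_reg_hat c \<epsilon> b W u0 k (\<tau> / \<epsilon>\<^sup>2) * exp (\<i> * of_real (c * norm k * \<tau> / \<epsilon>\<^sup>2)))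
         \<longlongrightarrow> exp (- (\<i> * of_real (b (norm k) * \<tau>))) * u0 k) (at_right 0)"
proof -
  define Vh where "Vh \<xi> q = profile_evol b (restr_reg_op W u0) \<xi> q \<tau>" for \<xi> q
  have Vh_eq: "Vh = (\<lambda>s q. exp (- (\<i> * of_real (b s * \<tau>))) * (plane_const CARD('n) * of_real (W s) * u0 (\<bar>s\<bar> *\<^sub>R q)))"
    by (simp add: Vh_def fun_eq_iff profile_evol_def restr_reg_op_def plane_const_def)
  have k0: "k \<noteq> 0" "norm k > 0" using k \<rho> by auto
  have dim': "DIM(real ^ 'n) \<in> {1, 2, 3}" using dim by simp
  obtain B M where B: "B > 0" "\<And>x. norm x \<ge> B \<Longrightarrow> u0 x = 0" and M: "M > 0" "\<And>x. norm (u0 x) \<le> M"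
    using compact_support_bounded[OF u0_cont u0_supp] by blast
  have cW: "continuous_on UNIV W"
    using W Ck_on_imp_continuous_on[OF open_UNIV] unfolding regularizing_def by blast
  have W0: "W s = 0" if "s \<le> 0" for s using W that unfolding regularizing_def by blast
  obtain Mw where Mw: "\<And>s. s \<in> {0..B} \<Longrightarrow> \<bar>W s\<bar> \<le> Mw"
  proof -
    have "bounded (W ` {0..B})"
      by (rule compact_imp_bounded[OF compact_continuous_image[OF continuous_on_subset[OF cW subset_UNIV] compact_Icc]])
    then obtain m where "\<forall>x\<in>W ` {0..B}. norm x \<le> m" unfolding bounded_iff ..
    then show thesis by (intro that[of m]) auto
  qed
  have Mw0: "Mw \<ge> 0" using Mw[of 0] B(1) by auto
  have g_m: "(\<lambda>s. exp (- (\<i> * of_real (b s * \<tau>)))) \<in> borel_measurable lebesgue"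
  proof -
    have "(\<lambda>x. exp (- (\<i> * of_real (x * \<tau>)))) \<in> borel_measurable borel"
      by (intro borel_measurable_continuous_onI continuous_intros)
    from measurable_compose[OF b this] show ?thesis .
  qed
  have Vh: "band_profile B (norm (plane_const CARD('n)) * Mw * M) Vh"
    unfolding Vh_eq
    by (rule band_profile_weighted[OF u0_cont B(2) M(2) borel_measurable_continuous_onI[OF cW] W0 Mw Mw0 g_m])
      (auto simp: norm_exp_eq_Re)
  have V_eq: "profile_inv_fourier (profile_evol b (restr_reg_op W u0)) z q \<tau> = inv_fourier (\<lambda>s. Vh s q) z" for z q
    by (simp add: profile_inv_fourier_def Vh_def)
  have smooth': "Ck_submanifold (min 1 (CARD('n) - 1)) (UNIV \<times> sphere 0 1) (\<lambda>p. Vh (fst p) (snd p))"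
  proof -
    have "Ck_submanifold (CARD('n) - 1) (UNIV \<times> sphere 0 1) (\<lambda>p. Vh (fst p) (snd p))"
      using smooth by (simp add: Vh_def case_prod_unfold)
    \<comment> \<open>In dimensions 1 and 2 the two orders agree; in dimension 3 one derivative is
      dropped.\<close>
    moreover have "CARD('n) - 1 = min 1 (CARD('n) - 1) \<or> CARD('n) - 1 = Suc (min 1 (CARD('n) - 1))" using dim by auto
    ultimately show ?thesis using Ck_submanifold_mono by metis
  qed
  have lin: "linear (\<lambda>q. (k \<bullet> q, q))" by (auto simp: linear_iff inner_simps)
  have fS: "Ck_submanifold (min 1 (CARD('n) - 1)) (sphere 0 1) (\<lambda>q. Vh (k \<bullet> q) q)"
    using Ck_submanifold_compose_linear[OF _ smooth' lin, of "sphere 0 1"] by simp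
  have cont: "continuous_on UNIV (\<lambda>s. Vh s q)" if q: "q \<in> sphere 0 1" for q
  proof -
    have "continuous_on UNIV (\<lambda>s. (\<lambda>p. Vh (fst p) (snd p)) (s, q))"
      by (rule continuous_on_compose2[OF Ck_submanifold_imp_continuous_on[OF smooth']])
        (use q in \<open>auto intro!: continuous_on_Pair continuous_on_const continuous_on_id\<close>)
    then show ?thesis by simp
  qed
  have lim: "((\<lambda>R. exp (\<i> * of_real (R * norm k)) * shell_transform R (\<lambda>z q. inv_fourier (\<lambda>s. Vh s q) z) k) \<longlongrightarrow>
    Vh (norm k) (k /\<^sub>R norm k) / (plane_const DIM(real ^ 'n) * of_real (norm k powr ((real DIM(real ^ 'n) - 1) / 2)))) at_top"
  proof (rule band_profile_shell_limit[OF dim' k0(1) Vh a])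
    show "norm (inv_fourier (\<lambda>s. Vh s q) z) \<le> C * (1 + \<bar>z\<bar>) powr (- real DIM(real ^ 'n) - \<alpha>)" if "q \<in> sphere 0 1" for z q
      using decay[OF that, of z] unfolding V_eq by simp
    show "Vh s q = 0" if "s \<le> 0" for s q using W0[OF that] by (simp add: Vh_eq)
  qed (use cont fS in auto)
  have "Vh (norm k) (k /\<^sub>R norm k) / (plane_const DIM(real ^ 'n) * of_real (norm k powr ((real DIM(real ^ 'n) - 1) / 2)))
      = exp (- (\<i> * of_real (b (norm k) * \<tau>))) * u0 k"
  proof -
    \<comment> \<open>This is where |k| > \<rho> enters: beyond the regularised range the weight is
      the pure power, which cancels the denominator of the limit.\<close>
    have "W (norm k) = norm k powr ((real CARD('n) - 1) / 2)" using W k unfolding regularizing_def by simp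
    then show ?thesis using k0 plane_const_nonzero[of "CARD('n)"] by (simp add: Vh_eq)
  qed
  with lim have lim': "((\<lambda>R. exp (\<i> * of_real (R * norm k)) * shell_transform R (\<lambda>z q. inv_fourier (\<lambda>s. Vh s q) z) k) \<longlongrightarrow>
    exp (- (\<i> * of_real (b (norm k) * \<tau>))) * u0 k) at_top" by simp
  have fl: "filterlim (\<lambda>\<epsilon>. c * \<tau> / \<epsilon>\<^sup>2) at_top (at_right 0)"
    by (rule filterlim_inverse_square_at_top) (use c \<tau> in simp)
  show ?thesis
  proof (rule Lim_transform_eventually[OF filterlim_compose[OF lim' fl]])
    have cV: "continuous_on (UNIV \<times> sphere 0 1) (\<lambda>(z, q). profile_inv_fourier (profile_evol b (restr_reg_op W u0)) z q \<tau>)"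
      unfolding V_eq by (rule band_profile_inv_fourier_continuous[OF Vh])
    have "\<forall>\<^sub>F \<epsilon>::real in at_right 0. \<epsilon> > 0" by (simp add: eventually_at_right_less)
    then show "\<forall>\<^sub>F \<epsilon> in at_right 0. exp (\<i> * of_real (c * \<tau> / \<epsilon>\<^sup>2 * norm k)) * shell_transform (c * \<tau> / \<epsilon>\<^sup>2) (\<lambda>z q. inv_fourier (\<lambda>s. Vh s q) z) k =
        recon_reg_hat c \<epsilon> b W u0 k (\<tau> / \<epsilon>\<^sup>2) * exp (\<i> * of_real (c * norm k * \<tau> / \<epsilon>\<^sup>2))"
    proof eventually_elim
      case (elim \<epsilon>)
      have "c * \<tau> / \<epsilon>\<^sup>2 * norm k = c * norm k * \<tau> / \<epsilon>\<^sup>2" by simp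
      note e = this
      have st: "space_fourier (shell_op c \<epsilon> (profile_inv_fourier (profile_evol b (restr_reg_op W u0)))) k (\<tau> / \<epsilon>\<^sup>2) =
          shell_transform (c * \<tau> / \<epsilon>\<^sup>2) (\<lambda>z q. inv_fourier (\<lambda>s. Vh s q) z) k"
        using space_fourier_shell_op[where V="profile_inv_fourier (profile_evol b (restr_reg_op W u0))" and \<tau>=\<tau>, OF cV c elim \<tau>, of k]
        unfolding V_eq .
      have r: "recon_reg_hat c \<epsilon> b W u0 k (\<tau> / \<epsilon>\<^sup>2) = shell_transform (c * \<tau> / \<epsilon>\<^sup>2) (\<lambda>z q. inv_fourier (\<lambda>s. Vh s q) z) k"
        by (simp only: recon_reg_hat_def recon_reg_def o_def st)
      show ?case unfolding r e by (rule mult.commute)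
    qed
  qed
qed

section \<open>Bump profiles\<close>

text \<open>A global C^1 notion with an explicit derivative, for which closure under sums, products
  and composition is immediate; it is converted to \<open>Ck_on\<close> once at the end.\<close>

definition C1_fun :: "('a::euclidean_space \<Rightarrow> 'b::euclidean_space) \<Rightarrow> bool" where
  "C1_fun f \<longleftrightarrow> (\<exists>D. (\<forall>x. (f has_derivative D x) (at x)) \<and> (\<forall>v. continuous_on UNIV (\<lambda>x. D x v)))"

lemma C1_fun_imp_Ck_on:
  assumes "C1_fun f"
  shows "Ck_on (Suc 0) UNIV f"
proof -
  obtain D where D: "\<And>x. (f has_derivative D x) (at x)" "\<And>v. continuous_on UNIV (\<lambda>x. D x v)"
    using assms unfolding C1_fun_def by blast
  have "frechet_derivative f (at x) = D x" for x
    using frechet_derivative_at[OF D(1)] by metis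
  then show ?thesis using D by (auto simp: differentiable_def)
qed

lemma C1_fun_continuous: "C1_fun f \<Longrightarrow> continuous_on UNIV f"
proof -
  assume "C1_fun f"
  then obtain D where D: "\<And>x. (f has_derivative D x) (at x)" unfolding C1_fun_def by blast
  show ?thesis by (rule continuous_at_imp_continuous_on) (use has_derivative_continuous[OF D] in blast)
qed

lemma C1_fun_add: "C1_fun f \<Longrightarrow> C1_fun g \<Longrightarrow> C1_fun (\<lambda>x. f x + g x)"
proof -
  assume "C1_fun f" "C1_fun g"
  then obtain D E where D: "\<And>x. (f has_derivative D x) (at x)" "\<And>v. continuous_on UNIV (\<lambda>x. D x v)"
    and E: "\<And>x. (g has_derivative E x) (at x)" "\<And>v. continuous_on UNIV (\<lambda>x. E x v)"
    unfolding C1_fun_def by blast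
  show ?thesis unfolding C1_fun_def
    by (intro exI[of _ "\<lambda>x v. D x v + E x v"] conjI allI has_derivative_add continuous_on_add D E)
qed

lemma C1_fun_mult:
  fixes f g :: "'a::euclidean_space \<Rightarrow> 'b::{euclidean_space, real_normed_algebra}"
  assumes "C1_fun f" "C1_fun g" shows "C1_fun (\<lambda>x. f x * g x)"
proof -
  obtain D E where D: "\<And>x. (f has_derivative D x) (at x)" "\<And>v. continuous_on UNIV (\<lambda>x. D x v)"
    and E: "\<And>x. (g has_derivative E x) (at x)" "\<And>v. continuous_on UNIV (\<lambda>x. E x v)"
    using assms unfolding C1_fun_def by blast
  show ?thesis unfolding C1_fun_def
    by (intro exI[of _ "\<lambda>x v. f x * E x v + D x v * g x"] conjI allI has_derivative_mult continuous_on_add continuous_on_mult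
        D E C1_fun_continuous assms)
qed

lemma C1_fun_bounded_linear_compose:
  assumes "C1_fun f" "bounded_linear h" shows "C1_fun (\<lambda>x. h (f x))"
proof -
  obtain D where D: "\<And>x. (f has_derivative D x) (at x)" "\<And>v. continuous_on UNIV (\<lambda>x. D x v)"
    using assms unfolding C1_fun_def by blast
  show ?thesis unfolding C1_fun_def
    by (intro exI[of _ "\<lambda>x v. h (D x v)"] conjI allI bounded_linear.has_derivative[OF assms(2)] bounded_linear.continuous_on[OF assms(2)] D)
qed

lemma C1_fun_compose_inner:
  fixes A A' :: "real \<Rightarrow> real"
  assumes A: "\<And>t. (A has_real_derivative A' t) (at t)" and A': "continuous_on UNIV A'"
  shows "C1_fun (\<lambda>x. A (k \<bullet> x))"
  unfolding C1_fun_def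
proof (intro exI[of _ "\<lambda>x v. A' (k \<bullet> x) * (k \<bullet> v)"] conjI allI)
  fix x v
  have "((\<lambda>x. k \<bullet> x) has_derivative (\<lambda>v. k \<bullet> v)) (at x)" by (auto intro!: derivative_eq_intros)
  moreover have "(A has_derivative (\<lambda>h. A' (k \<bullet> x) * h)) (at (k \<bullet> x))"
    using A[of "k \<bullet> x"] by (simp add: has_field_derivative_def)
  ultimately show "((\<lambda>x. A (k \<bullet> x)) has_derivative (\<lambda>v. A' (k \<bullet> x) * (k \<bullet> v))) (at x)"
    by (rule has_derivative_compose)
  show "continuous_on UNIV (\<lambda>x. A' (k \<bullet> x) * (k \<bullet> v))"
    by (intro continuous_intros continuous_on_compose2[OF A']) auto
qed

lemma C1_fun_real_polynomial:
  assumes "real_polynomial_function p" shows "C1_fun p"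
  using assms
proof induction
  case (linear f)
  then show ?case unfolding C1_fun_def
    by (intro exI[of _ "\<lambda>x. f"]) (auto intro: bounded_linear_imp_has_derivative)
next
  case (const c)
  show ?case unfolding C1_fun_def by (intro exI[of _ "\<lambda>x v. 0"]) auto
qed (auto intro: C1_fun_add C1_fun_mult)

lemma DERIV_max_0_power:
  "((\<lambda>x::real. (max 0 x) ^ Suc (Suc n)) has_real_derivative real (Suc (Suc n)) * (max 0 x) ^ Suc n) (at x)"
proof -
  consider "x > 0" | "x < 0" | "x = 0" by linarith
  then show ?thesis
  proof cases
    case 1
    have "((\<lambda>x::real. x ^ Suc (Suc n)) has_real_derivative real (Suc (Suc n)) * x ^ Suc n) (at x)"
      using DERIV_pow[of "Suc (Suc n)" x] by simp
    then have "((\<lambda>x::real. (max 0 x) ^ Suc (Suc n)) has_real_derivative real (Suc (Suc n)) * x ^ Suc n) (at x)"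
      by (rule has_field_derivative_transform_within_open[of _ _ _ "{0<..}"]) (use 1 in auto)
    then show ?thesis using 1 by (simp add: max_def)
  next
    case 2
    have "((\<lambda>x::real. 0) has_real_derivative 0) (at x)" by simp
    then have "((\<lambda>x::real. (max 0 x) ^ Suc (Suc n)) has_real_derivative 0) (at x)"
      by (rule has_field_derivative_transform_within_open[of _ _ _ "{..<0}"]) (use 2 in auto)
    then show ?thesis using 2 by (simp add: max_def)
  next
    case 3
    have "((\<lambda>h::real. (max 0 h) ^ Suc (Suc n) / h) \<longlongrightarrow> 0) (at 0)"
    proof (rule Lim_null_comparison)
      show "\<forall>\<^sub>F h::real in at 0. norm ((max 0 h) ^ Suc (Suc n) / h) \<le> \<bar>h\<bar> ^ Suc n"
      proof (intro always_eventually allI)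
        fix h :: real
        show "norm ((max 0 h) ^ Suc (Suc n) / h) \<le> \<bar>h\<bar> ^ Suc n"
        proof (cases "h > 0")
          case False
          then have m0: "max 0 h = 0" by simp
          show ?thesis unfolding m0 by simp
        qed simp
      qed
      have "((\<lambda>h::real. \<bar>h\<bar> ^ Suc n) \<longlongrightarrow> \<bar>0\<bar> ^ Suc n) (at 0)" by (intro tendsto_intros)
      then show "((\<lambda>h::real. \<bar>h\<bar> ^ Suc n) \<longlongrightarrow> 0) (at 0)" by simp
    qed
    then show ?thesis using 3 by (simp add: DERIV_def)
  qed
qed

text \<open>Keeps the amplitude polynomial after a derivative in s, so that integration by parts can
  be iterated.\<close>

lemma real_polynomial_partial_derivative:
  fixes p :: "real \<times> 'a::euclidean_space \<Rightarrow> real"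
  assumes "real_polynomial_function p"
  shows "\<exists>p'. real_polynomial_function p' \<and> (\<forall>s q. ((\<lambda>s. p (s, q)) has_real_derivative p' (s, q)) (at s))"
  using assms
proof induction
  case (linear f)
  have lin: "linear f" using linear by (simp add: bounded_linear.linear)
  have eq: "f (s, q) = s * f (1, 0) + f (0, q)" for s q
  proof -
    have "f (s, q) = f (s *\<^sub>R (1, 0) + (0, q))" by simp
    also have "\<dots> = s *\<^sub>R f (1, 0) + f (0, q)" by (simp only: linear_add[OF lin] linear_scale[OF lin])
    finally show ?thesis by simp
  qed
  have "((\<lambda>s. f (s, q)) has_real_derivative f (1, 0)) (at s)" for s q
    by (subst eq) (auto intro!: derivative_eq_intros)
  then show ?case by (intro exI[of _ "\<lambda>_. f (1, 0)"]) (auto intro: real_polynomial_function.intros(2))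
next
  case (const c)
  show ?case by (intro exI[of _ "\<lambda>_. 0"]) (auto intro: real_polynomial_function.intros(2))
next
  case (add f g)
  then obtain f' g' where "real_polynomial_function f'" "\<And>s q. ((\<lambda>s. f (s, q)) has_real_derivative f' (s, q)) (at s)"
    "real_polynomial_function g'" "\<And>s q. ((\<lambda>s. g (s, q)) has_real_derivative g' (s, q)) (at s)" by blast
  then show ?case
    by (intro exI[of _ "\<lambda>x. f' x + g' x"]) (auto intro!: real_polynomial_function.intros(3) DERIV_add)
next
  case (mult f g)
  then obtain f' g' where "real_polynomial_function f'" "\<And>s q. ((\<lambda>s. f (s, q)) has_real_derivative f' (s, q)) (at s)"
    "real_polynomial_function g'" "\<And>s q. ((\<lambda>s. g (s, q)) has_real_derivative g' (s, q)) (at s)" by blast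
  then show ?case using mult.hyps
    by (intro exI[of _ "\<lambda>x. f' x * g x + g' x * f x"])
      (auto intro!: real_polynomial_function.intros(3) real_polynomial_function.intros(4) DERIV_mult)
qed

text \<open>Each integration by parts trades one factor z for one power of s(B - s). As long as a
  power is left the boundary terms vanish, and the new amplitude has the same shape with another
  polynomial. Uniformity in q comes from compactness in the base case.\<close>

lemma real_polynomial_bump_decay:
  fixes p :: "real \<times> 'a::euclidean_space \<Rightarrow> real"
  assumes p: "real_polynomial_function p" and B: "B > 0" and j: "j \<le> m"
  shows "\<exists>C. \<forall>q\<in>sphere 0 1. \<forall>z. \<bar>z\<bar> ^ j *
    norm (integral {0..B} (\<lambda>s. exp (\<i> * of_real (z * s)) * of_real ((s * (B - s)) ^ m * p (s, q)))) \<le> C"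
  using p j
proof (induction j arbitrary: p m)
  case 0
  have "continuous_on UNIV p" using 0(1) by (rule C1_fun_continuous[OF C1_fun_real_polynomial])
  then have cp: "continuous_on T p" for T by (rule continuous_on_subset) simp
  have "continuous_on ({0..B} \<times> sphere 0 1) (\<lambda>x. (fst x * (B - fst x)) ^ m * p x)"
    by (intro continuous_intros cp)
  moreover have "compact ({0..B} \<times> sphere (0::'a) 1)" by (intro compact_Times) auto
  ultimately have "bounded ((\<lambda>x. (fst x * (B - fst x)) ^ m * p x) ` ({0..B} \<times> sphere 0 1))"
    by (intro compact_imp_bounded compact_continuous_image)
  then obtain K where K0: "\<forall>y\<in>(\<lambda>x. (fst x * (B - fst x)) ^ m * p x) ` ({0..B} \<times> sphere 0 1). norm y \<le> K"
    unfolding bounded_iff ..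
  have K: "\<bar>(fst x * (B - fst x)) ^ m * p x\<bar> \<le> K" if "x \<in> {0..B} \<times> sphere 0 1" for x
    using bspec[OF K0 imageI[OF that]] by (simp only: real_norm_def)
  show ?case
  proof (intro exI[of _ "K * (B - 0)"] ballI allI)
    fix q :: 'a and z assume q: "q \<in> sphere 0 1"
    have "norm (integral {0..B} (\<lambda>s. exp (\<i> * of_real (z * s)) * of_real ((s * (B - s)) ^ m * p (s, q)))) \<le> K * (B - 0)"
    proof (rule integral_bound)
      show "continuous_on {0..B} (\<lambda>s. exp (\<i> * of_real (z * s)) * of_real ((s * (B - s)) ^ m * p (s, q)))"
        by (intro continuous_intros continuous_on_compose2[OF cp[of UNIV]]) auto
      show "norm (exp (\<i> * of_real (z * s)) * of_real ((s * (B - s)) ^ m * p (s, q))) \<le> K" if "s \<in> {0..B}" for s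
        using K[of "(s, q)"] that q by (simp only: norm_mult norm_of_real norm_exp_i_times fst_conv snd_conv mem_Times_iff) simp
    qed (use B in simp)
    then show "\<bar>z\<bar> ^ 0 * norm (integral {0..B} (\<lambda>s. exp (\<i> * of_real (z * s)) * of_real ((s * (B - s)) ^ m * p (s, q)))) \<le> K * (B - 0)"
      by simp
  qed
next
  case (Suc j)
  then obtain m' where m: "m = Suc m'" "j \<le> m'" by (cases m) auto
  obtain p' where p': "real_polynomial_function p'" "\<And>s q. ((\<lambda>s. p (s, q)) has_real_derivative p' (s, q)) (at s)"
    using real_polynomial_partial_derivative[OF Suc.prems(1)] by blast
  \<comment> \<open>The product rule applied to (s(B - s))^m p, with (s(B - s))^(m-1) taken
    out.\<close>
  define P where "P x = real m * (B - 2 * fst x) * p x + fst x * (B - fst x) * p' x" for x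
  have lf: "real_polynomial_function (fst :: real \<times> 'a \<Rightarrow> real)"
    by (rule real_polynomial_function.intros(1)[OF bounded_linear_fst])
  have P: "real_polynomial_function P"
    unfolding P_def
    by (intro real_polynomial_function.intros(3) real_polynomial_function.intros(4) real_polynomial_function.intros(2) real_polynomial_function_diff lf p'(1) Suc.prems(1))
  obtain C where C: "\<And>q z. q \<in> sphere 0 1 \<Longrightarrow> \<bar>z\<bar> ^ j *
    norm (integral {0..B} (\<lambda>s. exp (\<i> * of_real (z * s)) * of_real ((s * (B - s)) ^ m' * P (s, q)))) \<le> C"
    using Suc.IH[OF P m(2)] by blast
  show ?case
  proof (intro exI[of _ C] ballI allI)
    fix q :: 'a and z assume q: "q \<in> sphere 0 1"
    let ?E = "\<lambda>s::real. exp (\<i> * of_real (z * s))"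
    define F where "F s = (s * (B - s)) ^ m * p (s, q)" for s
    define F' where "F' s = (s * (B - s)) ^ m' * P (s, q)" for s
    have dF: "(F has_real_derivative F' s) (at s)" for s
      unfolding F_def F'_def P_def m(1)
      by (rule derivative_eq_intros p'(2) refl | simp add: algebra_simps)+
    have dE: "(?E has_vector_derivative \<i> * of_real z * ?E s) (at s within {0..B})" for s
    proof -
      have "((\<lambda>x. exp (\<i> * (of_real z * x))) has_field_derivative \<i> * of_real z * exp (\<i> * (of_real z * of_real s))) (at (of_real s))"
        by (auto intro!: derivative_eq_intros)
      from has_vector_derivative_real_field[OF this] show ?thesis by simp
    qed
    have dF2: "((\<lambda>s. complex_of_real (F s)) has_vector_derivative of_real (F' s)) (at s within {0..B})" for s
      by (rule has_vector_derivative_of_real[OF has_field_derivative_at_within[OF dF]])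
    have "((\<lambda>s. ?E s * of_real (F' s) + \<i> * of_real z * ?E s * of_real (F s)) has_integral (?E B * of_real (F B) - ?E 0 * of_real (F 0))) {0..B}"
      by (rule fundamental_theorem_of_calculus) (use B has_vector_derivative_mult[OF dE dF2] in auto)
    moreover have F0: "F B = 0" "F 0 = 0" by (simp_all add: F_def m)
    ultimately have I0: "((\<lambda>s. ?E s * of_real (F' s) + \<i> * of_real z * (?E s * of_real (F s))) has_integral 0) {0..B}"
      by (simp add: mult.assoc)
    have cF: "continuous_on {0..B} F"
      using dF by (meson DERIV_continuous_on has_field_derivative_at_within)
    have "((\<lambda>s. \<i> * of_real z * (?E s * of_real (F s))) has_integral \<i> * of_real z * integral {0..B} (\<lambda>s. ?E s * of_real (F s))) {0..B}"
      by (intro has_integral_mult_right integrable_integral integrable_continuous_interval continuous_intros cF)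
    from has_integral_diff[OF I0 this]
    have "((\<lambda>s. ?E s * of_real (F' s)) has_integral - (\<i> * of_real z * integral {0..B} (\<lambda>s. ?E s * of_real (F s)))) {0..B}"
      by simp
    then have "integral {0..B} (\<lambda>s. ?E s * of_real (F' s)) = - (\<i> * of_real z * integral {0..B} (\<lambda>s. ?E s * of_real (F s)))"
      by (rule integral_unique)
    then have "norm (integral {0..B} (\<lambda>s. ?E s * of_real (F' s))) = \<bar>z\<bar> * norm (integral {0..B} (\<lambda>s. ?E s * of_real (F s)))"
      by (simp only: norm_minus_cancel norm_mult norm_of_real norm_ii mult_1_left)
    then have "\<bar>z\<bar> ^ Suc j * norm (integral {0..B} (\<lambda>s. ?E s * of_real (F s))) = \<bar>z\<bar> ^ j * norm (integral {0..B} (\<lambda>s. ?E s * of_real (F' s)))"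
      by (simp only: power_Suc mult_ac)
    also have "\<dots> \<le> C" unfolding F'_def by (rule C[OF q])
    finally show "\<bar>z\<bar> ^ Suc j * norm (integral {0..B} (\<lambda>s. ?E s * of_real ((s * (B - s)) ^ m * p (s, q)))) \<le> C"
      unfolding F_def .
  qed
qed

lemma one_plus_power_le:
  fixes t :: real
  assumes "t \<ge> 0"
  shows "(1 + t) ^ j \<le> 2 ^ j * (1 + t ^ j)"
proof (cases "t \<le> 1")
  case True
  then have "(1 + t) ^ j \<le> 2 ^ j" using assms by (intro power_mono) auto
  also have "\<dots> \<le> 2 ^ j * (1 + t ^ j)" using assms by simp
  finally show ?thesis .
next
  case False
  then have "(1 + t) ^ j \<le> (2 * t) ^ j" using assms by (intro power_mono) auto
  also have "\<dots> \<le> 2 ^ j * (1 + t ^ j)" by (simp add: power_mult_distrib)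
  finally show ?thesis .
qed

text \<open>Two real polynomials serve as real and imaginary part, to suit the real
  Stone-Weierstrass theorem. The factor with \<open>max 0\<close> confines the profile to [0, B] and
  is C^1 across the ends for exponents from 2 on.\<close>

definition bump_profile :: "real \<Rightarrow> nat \<Rightarrow> (real \<times> 'a::euclidean_space \<Rightarrow> real) \<Rightarrow> (real \<times> 'a \<Rightarrow> real) \<Rightarrow> real \<Rightarrow> 'a \<Rightarrow> complex" where
  "bump_profile B m p r s q = of_real ((max 0 (s * (B - s))) ^ m) * Complex (p (s, q)) (r (s, q))"

lemma continuous_on_bump_profile:
  assumes "real_polynomial_function p" "real_polynomial_function r"
  shows "continuous_on T (\<lambda>(s, q). bump_profile B m p r s q)"
proof -
  have "continuous_on T p" "continuous_on T r"
    using assms C1_fun_continuous[OF C1_fun_real_polynomial] by (blast intro: continuous_on_subset)+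
  then show ?thesis unfolding bump_profile_def case_prod_unfold Complex_eq prod.collapse
    by (intro continuous_intros)
qed

lemma continuous_on_bump_profile_section:
  assumes "real_polynomial_function p" "real_polynomial_function r"
  shows "continuous_on T (\<lambda>s. bump_profile B m p r s q)"
proof -
  have "continuous_on T ((\<lambda>(s, q). bump_profile B m p r s q) \<circ> (\<lambda>s. (s, q)))"
    by (rule continuous_on_compose[OF continuous_on_Pair[OF continuous_on_id continuous_on_const] continuous_on_bump_profile[OF assms]])
  then show ?thesis by (simp add: o_def)
qed

lemma bump_profile_shell_limit:
  fixes p r :: "real \<times> 'a::euclidean_space \<Rightarrow> real" and k :: 'a
  assumes dim: "DIM('a) \<in> {1, 2, 3}" and k: "k \<noteq> 0" and p: "real_polynomial_function p" and r: "real_polynomial_function r"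
    and B: "B > 0" and m: "m \<ge> 4" and Vh: "band_profile B M (bump_profile B m p r)"
  shows "((\<lambda>R. exp (\<i> * of_real (R * norm k)) * shell_transform R (\<lambda>z q. inv_fourier (\<lambda>s. bump_profile B m p r s q) z) k) \<longlongrightarrow>
    bump_profile B m p r (norm k) (k /\<^sub>R norm k) / (plane_const DIM('a) * of_real (norm k powr ((real DIM('a) - 1) / 2)))) at_top"
proof -
  define j where "j = DIM('a) + 1"
  have j: "j \<le> m" using dim m by (auto simp: j_def)
  have cpr: "continuous_on T p" "continuous_on T r" for T
    using p r C1_fun_continuous[OF C1_fun_real_polynomial] by (blast intro: continuous_on_subset)+
  have out: "bump_profile B m p r s q = 0" if "s \<notin> {0<..<B}" for s q
  proof -
    have "s * (B - s) \<le> 0" using that B by (auto simp: mult_le_0_iff not_less)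
    then show ?thesis using m by (simp add: bump_profile_def max_def)
  qed
  have lin: "real_polynomial_function (h \<circ> (\<lambda>q. (k \<bullet> q, q)))" if "real_polynomial_function h" for h :: "real \<times> 'a \<Rightarrow> real"
    by (rule real_polynomial_function_compose[OF _ that])
      (auto intro!: polynomial_function_bounded_linear bounded_linear_Pair bounded_linear_inner_right bounded_linear_ident)
  have C1: "C1_fun (\<lambda>q. bump_profile B m p r (k \<bullet> q) q)"
  proof -
    obtain n where n: "m = Suc (Suc n)" by (rule that[of "m - 2"]) (use m in simp)
    define A where "A t = (max 0 (t * (B - t))) ^ m" for t :: real
    define A' where "A' t = real m * (max 0 (t * (B - t))) ^ (m - 1) * (B - 2 * t)" for t :: real
    have dA: "(A has_real_derivative A' t) (at t)" for t
    proof -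
      have "((\<lambda>t::real. t * (B - t)) has_real_derivative B - 2 * t) (at t)" by (auto intro!: derivative_eq_intros)
      from DERIV_chain2[OF DERIV_max_0_power[of n "t * (B - t)"] this] show ?thesis
        unfolding A_def[abs_def] A'_def n by simp
    qed
    have "continuous_on UNIV A'" unfolding A'_def by (intro continuous_intros)
    then have CA: "C1_fun (\<lambda>q::'a. A (k \<bullet> q))" by (rule C1_fun_compose_inner[OF dA])
    have Cp: "C1_fun (\<lambda>q. h (k \<bullet> q, q))" if "real_polynomial_function h" for h :: "real \<times> 'a \<Rightarrow> real"
      using C1_fun_real_polynomial[OF lin[OF that]] by (simp add: o_def)
    have "C1_fun (\<lambda>q. complex_of_real (A (k \<bullet> q) * p (k \<bullet> q, q)) + \<i> * complex_of_real (A (k \<bullet> q) * r (k \<bullet> q, q)))"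
      by (intro C1_fun_add C1_fun_bounded_linear_compose[OF _ bounded_linear_of_real] C1_fun_bounded_linear_compose[OF _ bounded_linear_mult_right, of _ \<i>]
          C1_fun_mult CA Cp p r)
    moreover have "complex_of_real (A (k \<bullet> q) * p (k \<bullet> q, q)) + \<i> * complex_of_real (A (k \<bullet> q) * r (k \<bullet> q, q)) = bump_profile B m p r (k \<bullet> q) q" for q
      by (simp add: bump_profile_def A_def Complex_eq algebra_simps)
    ultimately show ?thesis by simp
  qed
  have smooth: "Ck_submanifold (min 1 (DIM('a) - 1)) (sphere 0 1) (\<lambda>q. bump_profile B m p r (k \<bullet> q) q)"
  proof -
    have 1: "Ck_submanifold (Suc 0) (sphere 0 1) (\<lambda>q. bump_profile B m p r (k \<bullet> q) q)"
      unfolding Ck_submanifold_def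
    proof
      fix x :: 'a
      show "\<exists>U g. open U \<and> x \<in> U \<and> Ck_on (Suc 0) U g \<and> (\<forall>x\<in>U \<inter> sphere 0 1. g x = bump_profile B m p r (k \<bullet> x) x)"
        using C1_fun_imp_Ck_on[OF C1] open_UNIV UNIV_I[of x] by blast
    qed
    show ?thesis
    proof (cases "DIM('a) = 1")
      case True
      then have e: "min 1 (DIM('a) - 1) = 0" by simp
      show ?thesis unfolding e by (rule Ck_submanifold_mono[OF 1])
    next
      case False
      moreover have "DIM('a) > 0" by (rule DIM_positive)
      ultimately have e: "min 1 (DIM('a) - 1) = Suc 0" by linarith
      show ?thesis unfolding e by (rule 1)
    qed
  qed
  \<comment> \<open>Bounds with the factors 1 and |z|^j together control (1 + |z|)^j, which gives
    polynomial decay for small and large z at once.\<close>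
  obtain c0 where c0: "\<And>q z. q \<in> sphere 0 1 \<Longrightarrow> \<bar>z\<bar> ^ 0 * norm (integral {0..B} (\<lambda>s. exp (\<i> * of_real (z * s)) * of_real ((s * (B - s)) ^ m * p (s, q)))) \<le> c0"
    using real_polynomial_bump_decay[OF p B le0[of m]] by blast
  obtain c1 where c1: "\<And>q z. q \<in> sphere 0 1 \<Longrightarrow> \<bar>z\<bar> ^ j * norm (integral {0..B} (\<lambda>s. exp (\<i> * of_real (z * s)) * of_real ((s * (B - s)) ^ m * p (s, q)))) \<le> c1"
    using real_polynomial_bump_decay[OF p B j] by blast
  obtain d0 where d0: "\<And>q z. q \<in> sphere 0 1 \<Longrightarrow> \<bar>z\<bar> ^ 0 * norm (integral {0..B} (\<lambda>s. exp (\<i> * of_real (z * s)) * of_real ((s * (B - s)) ^ m * r (s, q)))) \<le> d0"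
    using real_polynomial_bump_decay[OF r B le0[of m]] by blast
  obtain d1 where d1: "\<And>q z. q \<in> sphere 0 1 \<Longrightarrow> \<bar>z\<bar> ^ j * norm (integral {0..B} (\<lambda>s. exp (\<i> * of_real (z * s)) * of_real ((s * (B - s)) ^ m * r (s, q)))) \<le> d1"
    using real_polynomial_bump_decay[OF r B j] by blast
  define C where "C = 2 ^ j * (c0 + c1 + d0 + d1)"
  have bV: "norm (inv_fourier (\<lambda>s. bump_profile B m p r s q) z) \<le> C * (1 + \<bar>z\<bar>) powr (- real DIM('a) - 1)" if q: "q \<in> sphere 0 1" for z q
  proof -
    let ?I = "\<lambda>h. integral {0..B} (\<lambda>s. exp (\<i> * of_real (z * s)) * of_real ((s * (B - s)) ^ m * h (s, q)))"
    let ?f = "\<lambda>s. exp (\<i> * of_real (z * s)) * bump_profile B m p r s q"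
    have cf: "continuous_on T ?f" for T
      by (rule continuous_on_mult[OF _ continuous_on_bump_profile_section[OF p r]]) (intro continuous_intros)
    have "?f \<in> borel_measurable lborel"
      using borel_measurable_continuous_onI[OF cf] by (simp only: measurable_lborel1 measurable_lborel2)
    then have "(LINT s|lebesgue. ?f s) = (LINT s|lborel. ?f s)"
      by (rule integral_completion)
    also have "\<dots> = (LINT s|lborel. indicator {0..B} s *\<^sub>R ?f s)"
      using out by (intro Bochner_Integration.integral_cong) (auto simp: indicator_def)
    also have "\<dots> = integral {0..B} ?f"
      using set_borel_integral_eq_integral(2)[OF borel_integrable_atLeastAtMost'[OF cf[of "{0..B}"]]]
      by (simp add: set_lebesgue_integral_def)
    also have "\<dots> = integral {0..B} (\<lambda>s. exp (\<i> * of_real (z * s)) * of_real ((s * (B - s)) ^ m * p (s, q)) + \<i> * (exp (\<i> * of_real (z * s)) * of_real ((s * (B - s)) ^ m * r (s, q))))"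
    proof (rule integral_cong)
      fix s assume "s \<in> {0..B}"
      then have "max 0 (s * (B - s)) = s * (B - s)" by (simp add: max_def)
      then show "?f s = exp (\<i> * of_real (z * s)) * of_real ((s * (B - s)) ^ m * p (s, q)) + \<i> * (exp (\<i> * of_real (z * s)) * of_real ((s * (B - s)) ^ m * r (s, q)))"
        by (simp add: bump_profile_def Complex_eq algebra_simps)
    qed
    also have "\<dots> = ?I p + \<i> * ?I r"
    proof (rule integral_unique[OF has_integral_add[OF integrable_integral has_integral_mult_right[OF integrable_integral]]])
      show "(\<lambda>s. exp (\<i> * of_real (z * s)) * of_real ((s * (B - s)) ^ m * p (s, q))) integrable_on {0..B}"
        "(\<lambda>s. exp (\<i> * of_real (z * s)) * of_real ((s * (B - s)) ^ m * r (s, q))) integrable_on {0..B}"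
        by (intro integrable_continuous_interval continuous_intros continuous_on_compose2[OF cpr(1)[of UNIV]] continuous_on_compose2[OF cpr(2)[of UNIV]]; simp)+
    qed
    finally have I: "(LINT s|lebesgue. ?f s) = ?I p + \<i> * ?I r" .
    have "norm (inv_fourier (\<lambda>s. bump_profile B m p r s q) z) = 1 / (2 * pi) * norm (?I p + \<i> * ?I r)"
      unfolding inv_fourier_real I by (simp add: norm_mult norm_divide)
    also have "\<dots> \<le> 1 * norm (?I p + \<i> * ?I r)"
      using pi_gt3 by (intro mult_right_mono) auto
    also have "\<dots> \<le> norm (?I p) + norm (?I r)"
      using norm_triangle_ineq[of "?I p" "\<i> * ?I r"] by (simp add: norm_mult)
    finally have n: "norm (inv_fourier (\<lambda>s. bump_profile B m p r s q) z) \<le> norm (?I p) + norm (?I r)" .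
    have "(1 + \<bar>z\<bar>) ^ j * norm (inv_fourier (\<lambda>s. bump_profile B m p r s q) z) \<le> (2 ^ j * (1 + \<bar>z\<bar> ^ j)) * (norm (?I p) + norm (?I r))"
      by (intro mult_mono one_plus_power_le n) auto
    also have "\<dots> = 2 ^ j * ((\<bar>z\<bar> ^ 0 * norm (?I p) + \<bar>z\<bar> ^ j * norm (?I p)) + (\<bar>z\<bar> ^ 0 * norm (?I r) + \<bar>z\<bar> ^ j * norm (?I r)))"
      by (simp only: power_0) (simp only: distrib_left distrib_right mult_1_left mult.assoc add_ac)
    also have "\<dots> \<le> 2 ^ j * ((c0 + c1) + (d0 + d1))"
      by (intro mult_left_mono add_mono c0 c1 d0 d1 q) auto
    finally have main: "(1 + \<bar>z\<bar>) ^ j * norm (inv_fourier (\<lambda>s. bump_profile B m p r s q) z) \<le> C"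
      by (simp only: C_def add.assoc)
    have pos: "1 + \<bar>z\<bar> > 0" by simp
    have "(1 + \<bar>z\<bar>) powr (- real DIM('a) - 1) = inverse ((1 + \<bar>z\<bar>) ^ j)"
    proof -
      have "- real DIM('a) - 1 = - real j" by (simp add: j_def)
      then show ?thesis by (simp only: powr_minus powr_realpow[OF pos])
    qed
    moreover have "norm (inv_fourier (\<lambda>s. bump_profile B m p r s q) z) \<le> C / (1 + \<bar>z\<bar>) ^ j"
      using main pos by (simp add: pos_le_divide_eq mult.commute)
    ultimately show ?thesis by (simp only: divide_inverse)
  qed
  show ?thesis
  proof (rule band_profile_shell_limit[OF dim k Vh zero_less_one bV])
    show "continuous_on UNIV (\<lambda>s. bump_profile B m p r s q)" for q
      by (rule continuous_on_bump_profile_section[OF p r])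
    show "bump_profile B m p r s q = 0" if "s \<le> 0" for s q using that by (intro out) auto
  qed (use smooth in auto)
qed

section \<open>Mean-square bounds and weak convergence\<close>

text \<open>After Plancherel in x and polar coordinates the Jacobian r^(d-1) meets the squared
  amplitude R^(-(d-1)). The cut-off r < 2R bounds their product by 2^(d-1), and this makes the
  estimate uniform in R.\<close>

lemma shell_transform_L2_le:
  fixes V :: "real \<Rightarrow> 'a::euclidean_space \<Rightarrow> complex"
  assumes pm: "polar_measure (\<sigma> :: 'a measure)" and R: "R > 0"
    and cV: "continuous_on (UNIV \<times> sphere 0 1) (\<lambda>(z, q). V z q)" and bV: "\<And>z q. q \<in> sphere 0 1 \<Longrightarrow> norm (V z q) \<le> C"
    and N: "\<And>q. q \<in> sphere 0 1 \<Longrightarrow> (\<integral>\<^sup>+z. ennreal ((cmod (V z q))\<^sup>2) \<partial>lborel) \<le> N"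
  shows "(\<integral>\<^sup>+k. ennreal ((cmod (shell_transform R V k))\<^sup>2) \<partial>lborel) \<le>
      ennreal ((2 * pi) ^ DIM('a) * 2 ^ (DIM('a) - 1)) * (N * emeasure \<sigma> (space \<sigma>))"
    and "shell_transform R V \<in> borel_measurable borel"
    and "integrable lborel (\<lambda>x. of_bool (norm x < 2 * R) * V (norm x - R) (x /\<^sub>R norm x))"
proof -
  define n where "n = DIM('a) - 1"
  have "DIM('a) > 0" by (rule DIM_positive)
  then have n: "real DIM('a) - 1 = real n" by (simp add: n_def)
  have sets_\<sigma>[measurable_cong]: "sets \<sigma> = sets borel" and fin: "finite_measure \<sigma>" and sph: "AE q in \<sigma>. norm q = 1"
    and polar: "\<And>F :: 'a \<Rightarrow> ennreal. F \<in> borel_measurable borel \<Longrightarrow> (\<integral>\<^sup>+x. F x \<partial>lborel) =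
      (\<integral>\<^sup>+r. ennreal (r ^ n) * indicator {0<..} r * (\<integral>\<^sup>+q. F (r *\<^sub>R q) \<partial>\<sigma>) \<partial>lborel)"
    using pm unfolding polar_measure_def n_def by auto
  interpret S: finite_measure \<sigma> by (rule fin)
  interpret P: pair_sigma_finite "lborel :: real measure" \<sigma> by unfold_locales
  define U where "U x = of_bool (norm x < 2 * R) * V (norm x - R) (x /\<^sub>R norm x)" for x
  note [measurable] = shell_profile_measurable[OF cV, of R]
  have U_m[measurable]: "U \<in> borel_measurable borel" unfolding U_def[abs_def] by measurable
  \<comment> \<open>At x = 0 the direction is 0, off the sphere, so the bound C does not apply and
    the value there is added by hand.\<close>
  have Ub: "norm (U x) \<le> (\<bar>C\<bar> + norm (V (- R) 0)) * indicator (ball 0 (2 * R)) x" for x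
  proof (cases "x = 0")
    case True
    then show ?thesis using R by (simp add: U_def)
  next
    case False
    then have "x /\<^sub>R norm x \<in> sphere 0 1" by simp
    from bV[OF this, of "norm x - R"] have "norm (V (norm x - R) (x /\<^sub>R norm x)) \<le> \<bar>C\<bar> + norm (V (- R) 0)"
      using norm_ge_zero[of "V (- R) 0"] abs_ge_self[of C] by linarith
    then show ?thesis by (simp add: U_def indicator_def)
  qed
  have iU: "integrable lborel U"
  proof (rule Bochner_Integration.integrable_bound)
    have "emeasure lborel (ball 0 (2 * R) :: 'a set) < top"
      by (rule emeasure_bounded_finite[unfolded infinity_ennreal_def]) simp
    then show "integrable lborel (\<lambda>x::'a. (\<bar>C\<bar> + norm (V (- R) 0)) * indicator (ball 0 (2 * R)) x)"
      by (intro integrable_mult_right integrable_real_indicator) simp_all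
    show "AE x in lborel. norm (U x) \<le> norm ((\<bar>C\<bar> + norm (V (- R) 0)) * indicator (ball 0 (2 * R)) x)"
      using Ub order_trans[OF _ abs_ge_self] by (intro AE_I2) (auto simp only: real_norm_def)
  qed simp
  then show "integrable lborel (\<lambda>x. of_bool (norm x < 2 * R) * V (norm x - R) (x /\<^sub>R norm x))"
    unfolding U_def[abs_def] .
  define c where "c = R powr (- (real n / 2))"
  have F_m[measurable]: "lfourier U \<in> borel_measurable borel"
    by (rule borel_measurable_continuous_onI[OF continuous_lfourier[OF iU]])
  have st: "shell_transform R V = (\<lambda>k. of_real c * lfourier U k)"
    by (simp add: fun_eq_iff shell_transform_def lfourier_def U_def c_def n)
  show "shell_transform R V \<in> borel_measurable borel" unfolding st by measurable
  have c2: "c\<^sup>2 = inverse (R ^ n)"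
  proof -
    have "c\<^sup>2 = R powr (- real n)" unfolding c_def power2_eq_square powr_add[symmetric] by simp
    then show ?thesis by (simp only: powr_minus powr_realpow[OF R])
  qed
  define h where "h p = ennreal ((cmod ((\<lambda>(z, q). indicator (sphere 0 1) q *\<^sub>R V z q) p))\<^sup>2)" for p
  have h_m[measurable]: "h \<in> borel_measurable (borel \<Otimes>\<^sub>M borel)"
    unfolding h_def[abs_def] using profile_measurable_on_sphere[OF cV] by measurable
  have hq: "h (z, q) = ennreal ((cmod (V z q))\<^sup>2)" if "norm q = 1" for z q
    using that by (simp add: h_def)
  define H where "H z = (\<integral>\<^sup>+q. h (z, q) \<partial>\<sigma>)" for z
  have H_m[measurable]: "H \<in> borel_measurable borel"
    unfolding H_def[abs_def] by measurable
  have pt: "ennreal (c\<^sup>2) * (ennreal (r ^ n) * indicator {0<..} r * (\<integral>\<^sup>+q. ennreal ((cmod (U (r *\<^sub>R q)))\<^sup>2) \<partial>\<sigma>)) \<le> ennreal (2 ^ n) * H (r - R)" for r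
  proof (cases "0 < r \<and> r < 2 * R")
    case True
    have "(\<integral>\<^sup>+q. ennreal ((cmod (U (r *\<^sub>R q)))\<^sup>2) \<partial>\<sigma>) = H (r - R)"
      unfolding H_def
    proof (rule nn_integral_cong_AE)
      show "AE q in \<sigma>. ennreal ((cmod (U (r *\<^sub>R q)))\<^sup>2) = h (r - R, q)"
        using sph by eventually_elim (use True in \<open>simp add: hq U_def\<close>)
    qed
    moreover have "ennreal (c\<^sup>2) * ennreal (r ^ n) \<le> ennreal (2 ^ n)"
    proof -
      have "c\<^sup>2 * r ^ n = (r / R) ^ n" unfolding c2 by (simp add: power_divide divide_inverse mult.commute power_mult_distrib power_inverse)
      also have "\<dots> \<le> 2 ^ n" using True R by (intro power_mono) (auto simp: divide_le_eq)
      finally show ?thesis using True by (simp add: ennreal_mult'[symmetric])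
    qed
    ultimately show ?thesis using True by (simp add: mult.assoc[symmetric] mult_right_mono)
  next
    case False
    show ?thesis
    proof (cases "r > 0")
      case True
      have "(\<integral>\<^sup>+q. ennreal ((cmod (U (r *\<^sub>R q)))\<^sup>2) \<partial>\<sigma>) = (\<integral>\<^sup>+q. 0 \<partial>\<sigma>)"
      proof (rule nn_integral_cong_AE)
        show "AE q in \<sigma>. ennreal ((cmod (U (r *\<^sub>R q)))\<^sup>2) = 0"
          using sph by eventually_elim (use True False in \<open>simp add: U_def\<close>)
      qed
      then show ?thesis by simp
    qed simp
  qed
  have "(\<integral>\<^sup>+k. ennreal ((cmod (shell_transform R V k))\<^sup>2) \<partial>lborel) = (\<integral>\<^sup>+k. ennreal (c\<^sup>2) * ennreal ((cmod (lfourier U k))\<^sup>2) \<partial>lborel)"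
    unfolding st by (simp add: norm_mult power_mult_distrib ennreal_mult')
  also have "\<dots> = ennreal (c\<^sup>2) * (\<integral>\<^sup>+k. ennreal ((cmod (lfourier U k))\<^sup>2) \<partial>lborel)"
    by (rule nn_integral_cmult) measurable
  also have "\<dots> \<le> ennreal (c\<^sup>2) * (ennreal ((2 * pi) ^ DIM('a)) * (\<integral>\<^sup>+x. ennreal ((cmod (U x))\<^sup>2) \<partial>lborel))"
    by (intro mult_left_mono plancherel_le[OF iU]) simp
  also have "\<dots> = ennreal ((2 * pi) ^ DIM('a)) * (ennreal (c\<^sup>2) * (\<integral>\<^sup>+x. ennreal ((cmod (U x))\<^sup>2) \<partial>lborel))"
    by (rule mult.left_commute)
  also have "ennreal (c\<^sup>2) * (\<integral>\<^sup>+x. ennreal ((cmod (U x))\<^sup>2) \<partial>lborel) =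
      (\<integral>\<^sup>+r. ennreal (c\<^sup>2) * (ennreal (r ^ n) * indicator {0<..} r * (\<integral>\<^sup>+q. ennreal ((cmod (U (r *\<^sub>R q)))\<^sup>2) \<partial>\<sigma>)) \<partial>lborel)"
    by (subst polar, measurable, rule nn_integral_cmult[symmetric], measurable)
  also have "ennreal ((2 * pi) ^ DIM('a)) * \<dots> \<le> ennreal ((2 * pi) ^ DIM('a)) * (\<integral>\<^sup>+r. ennreal (2 ^ n) * H (r - R) \<partial>lborel)"
    by (intro mult_left_mono nn_integral_mono pt) simp
  also have "(\<integral>\<^sup>+r. ennreal (2 ^ n) * H (r - R) \<partial>lborel) = ennreal (2 ^ n) * (\<integral>\<^sup>+r. H (r - R) \<partial>lborel)"
    by (rule nn_integral_cmult) measurable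
  also have "(\<integral>\<^sup>+r. H (r - R) \<partial>lborel) = (\<integral>\<^sup>+z. H z \<partial>lborel)"
    using nn_integral_real_affine[OF H_m, of 1 "- R"] by simp
  also have "\<dots> = (\<integral>\<^sup>+q. (\<integral>\<^sup>+z. h (z, q) \<partial>lborel) \<partial>\<sigma>)"
  proof -
    have "h \<in> borel_measurable (lborel \<Otimes>\<^sub>M \<sigma>)" by measurable
    from P.Fubini[OF this] show ?thesis unfolding H_def by simp
  qed
  also have "\<dots> \<le> (\<integral>\<^sup>+q. N \<partial>\<sigma>)"
  proof (rule nn_integral_mono_AE)
    show "AE q in \<sigma>. (\<integral>\<^sup>+z. h (z, q) \<partial>lborel) \<le> N"
      using sph
    proof eventually_elim
      case (elim q)
      then show ?case using N[of q] by (simp add: hq)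
    qed
  qed
  also have "(\<integral>\<^sup>+q. N \<partial>\<sigma>) = N * emeasure \<sigma> (space \<sigma>)" by simp
  finally have "(\<integral>\<^sup>+k. ennreal ((cmod (shell_transform R V k))\<^sup>2) \<partial>lborel) \<le>
      ennreal ((2 * pi) ^ DIM('a)) * (ennreal (2 ^ n) * (N * emeasure \<sigma> (space \<sigma>)))"
    by (simp add: mult_left_mono)
  also have "\<dots> = ennreal ((2 * pi) ^ DIM('a) * 2 ^ n) * (N * emeasure \<sigma> (space \<sigma>))"
  proof -
    have "ennreal ((2 * pi) ^ DIM('a) * 2 ^ n) = ennreal ((2 * pi) ^ DIM('a)) * ennreal (2 ^ n)"
      by (rule ennreal_mult) simp_all
    then show ?thesis by (simp only: mult.assoc)
  qed
  finally show "(\<integral>\<^sup>+k. ennreal ((cmod (shell_transform R V k))\<^sup>2) \<partial>lborel) \<le>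
      ennreal ((2 * pi) ^ DIM('a) * 2 ^ (DIM('a) - 1)) * (N * emeasure \<sigma> (space \<sigma>))" unfolding n_def .
qed

text \<open>The inverse transform is a reflected \<open>lfourier\<close> divided by 2 pi; Plancherel
  leaves the factor 1/(2 pi), which is below 1.\<close>

lemma inv_fourier_L2_le:
  fixes f :: "real \<Rightarrow> complex"
  assumes f: "integrable lborel f"
  shows "(\<integral>\<^sup>+z. ennreal ((cmod (inv_fourier f z))\<^sup>2) \<partial>lborel) \<le> (\<integral>\<^sup>+s. ennreal ((cmod (f s))\<^sup>2) \<partial>lborel)"
proof -
  have [measurable]: "f \<in> borel_measurable borel" using f by auto
  have F_m[measurable]: "lfourier f \<in> borel_measurable borel"
    by (rule borel_measurable_continuous_onI[OF continuous_lfourier[OF f]])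
  have eq: "inv_fourier f z = 1 / of_real (2 * pi) * lfourier f (- z)" for z
  proof -
    have "(LINT s|lebesgue. exp (\<i> * of_real (z * s)) * f s) = (LINT s|lborel. exp (\<i> * of_real (z * s)) * f s)"
      by (rule integral_completion) measurable
    then show ?thesis unfolding inv_fourier_real lfourier_def by simp
  qed
  have "(\<integral>\<^sup>+z. ennreal ((cmod (inv_fourier f z))\<^sup>2) \<partial>lborel) =
      (\<integral>\<^sup>+z. ennreal ((1 / (2 * pi))\<^sup>2) * ennreal ((cmod (lfourier f (- z)))\<^sup>2) \<partial>lborel)"
    unfolding eq norm_mult power_mult_distrib by (simp add: norm_divide ennreal_mult')
  also have "\<dots> = ennreal ((1 / (2 * pi))\<^sup>2) * (\<integral>\<^sup>+z. ennreal ((cmod (lfourier f (- z)))\<^sup>2) \<partial>lborel)"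
    by (rule nn_integral_cmult) measurable
  also have "(\<integral>\<^sup>+z. ennreal ((cmod (lfourier f (- z)))\<^sup>2) \<partial>lborel) = (\<integral>\<^sup>+z. ennreal ((cmod (lfourier f z))\<^sup>2) \<partial>lborel)"
    using nn_integral_real_affine[of "\<lambda>z. ennreal ((cmod (lfourier f z))\<^sup>2)" "-1" 0] by simp
  also have "ennreal ((1 / (2 * pi))\<^sup>2) * \<dots> \<le> ennreal ((1 / (2 * pi))\<^sup>2) * (ennreal ((2 * pi) ^ DIM(real)) * (\<integral>\<^sup>+s. ennreal ((cmod (f s))\<^sup>2) \<partial>lborel))"
    by (intro mult_left_mono plancherel_le[OF f]) simp
  also have "\<dots> = ennreal (1 / (2 * pi)) * (\<integral>\<^sup>+s. ennreal ((cmod (f s))\<^sup>2) \<partial>lborel)"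
    unfolding mult.assoc[symmetric]
    by (subst ennreal_mult'[symmetric]) (simp_all add: power2_eq_square)
  also have "\<dots> \<le> 1 * (\<integral>\<^sup>+s. ennreal ((cmod (f s))\<^sup>2) \<partial>lborel)"
  proof (rule mult_right_mono)
    show "ennreal (1 / (2 * pi)) \<le> 1" using pi_gt3 by (simp add: ennreal_le_1)
  qed simp
  finally show ?thesis by simp
qed

lemma band_profile_integrable:
  assumes Vh: "band_profile B M Vh" and q: "q \<in> sphere 0 1"
  shows "integrable lebesgue (\<lambda>s. exp (\<i> * of_real (z * s)) * Vh s q)" "norm (inv_fourier (\<lambda>s. Vh s q) z) \<le> \<bar>M\<bar> * \<bar>B\<bar>"
proof -
  have ii: "integrable lebesgue (\<lambda>s. \<bar>M\<bar> * indicator {0..B} s)" by (rule integrable_indicator_lebesgue_Icc)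
  have m: "(\<lambda>s. Vh s q) \<in> borel_measurable lebesgue" using Vh q unfolding band_profile_def by blast
  have "(\<lambda>s. exp (\<i> * complex_of_real (z * s))) \<in> borel_measurable lborel"
    by (simp add: borel_measurable_continuous_onI continuous_intros)
  then have e: "(\<lambda>s. exp (\<i> * complex_of_real (z * s))) \<in> borel_measurable lebesgue" by (rule measurable_completion)
  have le: "norm (exp (\<i> * of_real (z * s)) * Vh s q) \<le> \<bar>M\<bar> * indicator {0..B} s" for s
    using band_profile_bound[OF Vh q, of s] by (simp only: norm_mult norm_exp_i_times mult_1_left)
  show i: "integrable lebesgue (\<lambda>s. exp (\<i> * of_real (z * s)) * Vh s q)"
    by (rule Bochner_Integration.integrable_bound[OF ii borel_measurable_times[OF e m]])
      (use le order_trans[OF _ abs_ge_self] in \<open>auto simp only: real_norm_def intro!: AE_I2\<close>)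
  have "norm (LINT s|lebesgue. exp (\<i> * of_real (z * s)) * Vh s q) \<le> (LINT s|lebesgue. \<bar>M\<bar> * indicator {0..B} s)"
    by (rule Bochner_Integration.integral_norm_bound_integral[OF i ii le])
  also have "\<dots> \<le> \<bar>M\<bar> * \<bar>B\<bar>" by (simp add: measure_completion mult_le_0_iff)
  finally have 1: "norm (LINT s|lebesgue. exp (\<i> * of_real (z * s)) * Vh s q) \<le> \<bar>M\<bar> * \<bar>B\<bar>" .
  have "norm (inv_fourier (\<lambda>s. Vh s q) z) = 1 / (2 * pi) * norm (LINT s|lebesgue. exp (\<i> * of_real (z * s)) * Vh s q)"
    unfolding inv_fourier_real norm_mult by (simp add: norm_divide)
  also have "\<dots> \<le> 1 * (\<bar>M\<bar> * \<bar>B\<bar>)" using 1 pi_gt3 by (intro mult_mono) auto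
  finally show "norm (inv_fourier (\<lambda>s. Vh s q) z) \<le> \<bar>M\<bar> * \<bar>B\<bar>" by simp
qed

definition profile_shell :: "(real \<Rightarrow> 'a::euclidean_space \<Rightarrow> complex) \<Rightarrow> real \<Rightarrow> 'a \<Rightarrow> complex" where
  "profile_shell Vh R k = exp (\<i> * of_real (R * norm k)) * shell_transform R (\<lambda>z q. inv_fourier (\<lambda>s. Vh s q) z) k"

text \<open>The pointwise limit of \<open>profile_shell\<close>, with the profile read as a function
  on the ambient space. At k = 0 the quotient is 0 by division by zero, a null set.\<close>

definition profile_limit :: "(real \<Rightarrow> 'a::euclidean_space \<Rightarrow> complex) \<Rightarrow> 'a \<Rightarrow> complex" where
  "profile_limit Vh k = Vh (norm k) (k /\<^sub>R norm k) / (plane_const DIM('a) * of_real (norm k powr ((real DIM('a) - 1) / 2)))"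

text \<open>Linearity, which turns the L^2 bound for one profile into a bound for the approximation
  error. The inverse transforms subtract only for directions on the sphere, so x = 0 is treated
  apart.\<close>

lemma profile_shell_diff:
  fixes Vh Wh :: "real \<Rightarrow> 'a::euclidean_space \<Rightarrow> complex"
  assumes pm: "polar_measure (\<sigma> :: 'a measure)" and Vh: "band_profile B M Vh" and Wh: "band_profile B' M' Wh" and R: "R > 0"
  shows "profile_shell (\<lambda>s q. Vh s q - Wh s q) R k = profile_shell Vh R k - profile_shell Wh R k"
proof -
  have inv: "inv_fourier (\<lambda>s. Vh s q - Wh s q) z = inv_fourier (\<lambda>s. Vh s q) z - inv_fourier (\<lambda>s. Wh s q) z" if "q \<in> sphere 0 1" for q z
    unfolding inv_fourier_real right_diff_distrib
    by (subst Bochner_Integration.integral_diff[OF band_profile_integrable(1)[OF Vh that] band_profile_integrable(1)[OF Wh that]]) (simp only: right_diff_distrib)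
  let ?U = "\<lambda>Vh x. exp (- (\<i> * of_real (k \<bullet> x))) * (of_bool (norm x < 2 * R) * inv_fourier (\<lambda>s. Vh s (x /\<^sub>R norm x)) (norm x - R))"
  have int: "integrable lborel (?U X)" if X: "band_profile B M X" for X :: "real \<Rightarrow> 'a \<Rightarrow> complex" and B M
  proof -
    have b: "norm (inv_fourier (\<lambda>s. X s q) z) \<le> \<bar>M\<bar> * \<bar>B\<bar>" if "q \<in> sphere 0 1" for z q
      by (rule band_profile_integrable(2)[OF X that])
    have "integrable lborel (\<lambda>x. of_bool (norm x < 2 * R) * inv_fourier (\<lambda>s. X s (x /\<^sub>R norm x)) (norm x - R))"
      by (rule shell_transform_L2_le(3)[OF pm R band_profile_inv_fourier_continuous[OF X] b top_greatest])
    note i = this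
    show ?thesis
    proof (rule Bochner_Integration.integrable_bound[OF i])
      have "(\<lambda>x. exp (- (\<i> * complex_of_real (k \<bullet> x)))) \<in> borel_measurable borel"
        by (intro borel_measurable_continuous_onI continuous_intros)
      then show "?U X \<in> borel_measurable lborel"
        using borel_measurable_integrable[OF i] by measurable
      show "AE x in lborel. norm (?U X x) \<le> norm (of_bool (norm x < 2 * R) * inv_fourier (\<lambda>s. X s (x /\<^sub>R norm x)) (norm x - R))"
        by (intro AE_I2) (simp add: norm_mult norm_exp_eq_Re)
    qed
  qed
  have "(LINT x|lborel. ?U (\<lambda>s q. Vh s q - Wh s q) x) = (LINT x|lborel. ?U Vh x - ?U Wh x)"
  proof (rule integral_cong_AE)
    show "AE x in lborel. ?U (\<lambda>s q. Vh s q - Wh s q) x = ?U Vh x - ?U Wh x"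
      using AE_lborel_singleton[of "0::'a"]
    proof eventually_elim
      case (elim x)
      then have "x /\<^sub>R norm x \<in> sphere 0 1" by simp
      then show ?case by (simp only: inv right_diff_distrib)
    qed
    then have ae: "AE x in lborel. ?U Vh x - ?U Wh x = ?U (\<lambda>s q. Vh s q - Wh s q) x" by (auto elim: eventually_mono)
    show "(\<lambda>x. ?U Vh x - ?U Wh x) \<in> borel_measurable lborel"
      by (intro borel_measurable_diff borel_measurable_integrable int[OF Vh] int[OF Wh])
    \<comment> \<open>Equality almost everywhere does not give Borel measurability; an explicit case
      distinction at the exceptional point does.\<close>
    have "?U (\<lambda>s q. Vh s q - Wh s q) = (\<lambda>x. if x = 0 then ?U (\<lambda>s q. Vh s q - Wh s q) 0 else ?U Vh x - ?U Wh x)"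
    proof
      fix x :: 'a
      show "?U (\<lambda>s q. Vh s q - Wh s q) x = (if x = 0 then ?U (\<lambda>s q. Vh s q - Wh s q) 0 else ?U Vh x - ?U Wh x)"
      proof (cases "x = 0")
        case False
        then have "x /\<^sub>R norm x \<in> sphere 0 1" by simp
        then show ?thesis using False by (simp only: inv right_diff_distrib if_False)
      qed simp
    qed
    then show "?U (\<lambda>s q. Vh s q - Wh s q) \<in> borel_measurable lborel"
      by (rule ssubst) (intro measurable_If borel_measurable_const borel_measurable_diff borel_measurable_integrable int[OF Vh] int[OF Wh], simp)
  qed
  also have "\<dots> = (LINT x|lborel. ?U Vh x) - (LINT x|lborel. ?U Wh x)"
    by (rule Bochner_Integration.integral_diff[OF int[OF Vh] int[OF Wh]])
  finally show ?thesis unfolding profile_shell_def shell_transform_def by (simp only: right_diff_distrib)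
qed

text \<open>The majorant D depends on the frequency only. That is the form in which profiles are
  approximated, and it makes the bound independent of R and of the direction.\<close>

lemma profile_shell_L2_le:
  fixes Vh :: "real \<Rightarrow> 'a::euclidean_space \<Rightarrow> complex" and D :: "real \<Rightarrow> real"
  assumes pm: "polar_measure (\<sigma> :: 'a measure)" and Vh: "band_profile B M Vh" and R: "R > 0"
    and Vm: "\<And>q. q \<in> sphere 0 1 \<Longrightarrow> (\<lambda>s. Vh s q) \<in> borel_measurable borel"
    and D: "\<And>s q. q \<in> sphere 0 1 \<Longrightarrow> norm (Vh s q) \<le> D s"
  shows "(\<integral>\<^sup>+k. ennreal ((cmod (profile_shell Vh R k))\<^sup>2) \<partial>lborel) \<le>
      ennreal ((2 * pi) ^ DIM('a) * 2 ^ (DIM('a) - 1)) * ((\<integral>\<^sup>+s. ennreal ((D s)\<^sup>2) \<partial>lborel) * emeasure \<sigma> (space \<sigma>))"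
    and "profile_shell Vh R \<in> borel_measurable borel"
proof -
  have b: "norm (inv_fourier (\<lambda>s. Vh s q) z) \<le> \<bar>M\<bar> * \<bar>B\<bar>" if "q \<in> sphere 0 1" for z q
    by (rule band_profile_integrable(2)[OF Vh that])
  have N: "(\<integral>\<^sup>+z. ennreal ((cmod (inv_fourier (\<lambda>s. Vh s q) z))\<^sup>2) \<partial>lborel) \<le> (\<integral>\<^sup>+s. ennreal ((D s)\<^sup>2) \<partial>lborel)" if q: "q \<in> sphere 0 1" for q
  proof -
    have "integrable lebesgue (\<lambda>s. Vh s q)" using band_profile_integrable(1)[OF Vh q, of 0] by simp
    then have "integrable lborel (\<lambda>s. Vh s q)" using integrable_completion[of "\<lambda>s. Vh s q" lborel] Vm[OF q] by simp
    then have "(\<integral>\<^sup>+z. ennreal ((cmod (inv_fourier (\<lambda>s. Vh s q) z))\<^sup>2) \<partial>lborel) \<le> (\<integral>\<^sup>+s. ennreal ((cmod (Vh s q))\<^sup>2) \<partial>lborel)"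
      by (rule inv_fourier_L2_le)
    also have "\<dots> \<le> (\<integral>\<^sup>+s. ennreal ((D s)\<^sup>2) \<partial>lborel)"
      by (intro nn_integral_mono ennreal_leI power_mono D[OF q]) simp
    finally show ?thesis .
  qed
  note st = shell_transform_L2_le[OF pm R band_profile_inv_fourier_continuous[OF Vh] b N]
  have "cmod (profile_shell Vh R k) = cmod (shell_transform R (\<lambda>z q. inv_fourier (\<lambda>s. Vh s q) z) k)" for k
    by (simp only: profile_shell_def norm_mult norm_exp_i_times mult_1_left)
  then show "(\<integral>\<^sup>+k. ennreal ((cmod (profile_shell Vh R k))\<^sup>2) \<partial>lborel) \<le>
      ennreal ((2 * pi) ^ DIM('a) * 2 ^ (DIM('a) - 1)) * ((\<integral>\<^sup>+s. ennreal ((D s)\<^sup>2) \<partial>lborel) * emeasure \<sigma> (space \<sigma>))"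
    using st(1) by simp
  have "(\<lambda>k::'a. exp (\<i> * complex_of_real (R * norm k))) \<in> borel_measurable borel"
    by (intro borel_measurable_continuous_onI continuous_intros)
  then show "profile_shell Vh R \<in> borel_measurable borel"
    unfolding profile_shell_def[abs_def] using st(2) by measurable
qed

text \<open>The squared power |k|^(d-1) in the denominator cancels the polar Jacobian, so the map
  from profiles to limits is bounded in L^2.\<close>

lemma profile_limit_L2_le:
  fixes Vh :: "real \<Rightarrow> 'a::euclidean_space \<Rightarrow> complex" and D :: "real \<Rightarrow> real"
  assumes pm: "polar_measure (\<sigma> :: 'a measure)" and Dm[measurable]: "D \<in> borel_measurable borel"
    and D: "\<And>s q. q \<in> sphere 0 1 \<Longrightarrow> norm (Vh s q) \<le> D s"
  shows "(\<integral>\<^sup>+k. ennreal ((cmod (profile_limit Vh k))\<^sup>2) \<partial>lborel) \<le>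
      ennreal (inverse ((cmod (plane_const DIM('a)))\<^sup>2)) * ((\<integral>\<^sup>+s. ennreal ((D s)\<^sup>2) \<partial>lborel) * emeasure \<sigma> (space \<sigma>))"
proof -
  define n where "n = DIM('a) - 1"
  have "DIM('a) > 0" by (rule DIM_positive)
  then have n: "real DIM('a) - 1 = real n" by (simp add: n_def)
  define \<kappa> where "\<kappa> = inverse ((cmod (plane_const DIM('a)))\<^sup>2)"
  have \<kappa>: "\<kappa> \<ge> 0" by (simp add: \<kappa>_def)
  have sets_\<sigma>[measurable_cong]: "sets \<sigma> = sets borel" and sph: "AE q in \<sigma>. norm q = 1"
    and polar: "\<And>F :: 'a \<Rightarrow> ennreal. F \<in> borel_measurable borel \<Longrightarrow> (\<integral>\<^sup>+x. F x \<partial>lborel) =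
      (\<integral>\<^sup>+r. ennreal (r ^ n) * indicator {0<..} r * (\<integral>\<^sup>+q. F (r *\<^sub>R q) \<partial>\<sigma>) \<partial>lborel)"
    using pm unfolding polar_measure_def n_def by auto
  define F where "F k = ennreal (\<kappa> * (D (norm k))\<^sup>2 * inverse (norm k ^ n))" for k :: 'a
  have [measurable]: "F \<in> borel_measurable borel" unfolding F_def[abs_def] by measurable
  have le: "ennreal ((cmod (profile_limit Vh k))\<^sup>2) \<le> F k" if k: "k \<noteq> 0" for k
  proof -
    have q: "k /\<^sub>R norm k \<in> sphere 0 1" using k by simp
    have pw: "(norm k powr (real n / 2))\<^sup>2 = norm k ^ n"
    proof -
      have "(norm k powr (real n / 2))\<^sup>2 = norm k powr real n" unfolding power2_eq_square powr_add[symmetric] by simp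
      then show ?thesis using k by (simp add: powr_realpow)
    qed
    have "(cmod (profile_limit Vh k))\<^sup>2 = \<kappa> * (cmod (Vh (norm k) (k /\<^sub>R norm k)))\<^sup>2 * inverse (norm k ^ n)"
      unfolding profile_limit_def norm_divide norm_mult n power_divide power_mult_distrib norm_of_real power2_abs pw
      by (simp add: \<kappa>_def divide_inverse)
    also have "\<dots> \<le> \<kappa> * (D (norm k))\<^sup>2 * inverse (norm k ^ n)"
      using D[OF q] \<kappa> by (intro mult_right_mono mult_left_mono power_mono) auto
    finally show ?thesis unfolding F_def by (rule ennreal_leI)
  qed
  have "(\<integral>\<^sup>+k. ennreal ((cmod (profile_limit Vh k))\<^sup>2) \<partial>lborel) \<le> (\<integral>\<^sup>+k. F k \<partial>lborel)"
  proof (rule nn_integral_mono_AE)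
    show "AE k in lborel. ennreal ((cmod (profile_limit Vh k))\<^sup>2) \<le> F k"
      using AE_lborel_singleton[of "0::'a"] by eventually_elim (rule le)
  qed
  also have "\<dots> = (\<integral>\<^sup>+r. ennreal (r ^ n) * indicator {0<..} r * (\<integral>\<^sup>+q. F (r *\<^sub>R q) \<partial>\<sigma>) \<partial>lborel)"
    by (rule polar) measurable
  also have "\<dots> \<le> (\<integral>\<^sup>+r. (ennreal \<kappa> * emeasure \<sigma> (space \<sigma>)) * ennreal ((D r)\<^sup>2) \<partial>lborel)"
  proof (rule nn_integral_mono)
    fix r :: real
    show "ennreal (r ^ n) * indicator {0<..} r * (\<integral>\<^sup>+q. F (r *\<^sub>R q) \<partial>\<sigma>) \<le> (ennreal \<kappa> * emeasure \<sigma> (space \<sigma>)) * ennreal ((D r)\<^sup>2)"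
    proof (cases "r > 0")
      case True
      have "(\<integral>\<^sup>+q. F (r *\<^sub>R q) \<partial>\<sigma>) = (\<integral>\<^sup>+q. ennreal (\<kappa> * (D r)\<^sup>2 * inverse (r ^ n)) \<partial>\<sigma>)"
      proof (rule nn_integral_cong_AE)
        show "AE q in \<sigma>. F (r *\<^sub>R q) = ennreal (\<kappa> * (D r)\<^sup>2 * inverse (r ^ n))"
          using sph by eventually_elim (use True in \<open>simp add: F_def\<close>)
      qed
      then have "ennreal (r ^ n) * indicator {0<..} r * (\<integral>\<^sup>+q. F (r *\<^sub>R q) \<partial>\<sigma>) =
          (ennreal (r ^ n) * ennreal (\<kappa> * (D r)\<^sup>2 * inverse (r ^ n))) * emeasure \<sigma> (space \<sigma>)"
        using True by (simp add: mult.assoc)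
      also have "ennreal (r ^ n) * ennreal (\<kappa> * (D r)\<^sup>2 * inverse (r ^ n)) = ennreal (r ^ n * (\<kappa> * (D r)\<^sup>2 * inverse (r ^ n)))"
        using True by (simp add: ennreal_mult')
      also have "r ^ n * (\<kappa> * (D r)\<^sup>2 * inverse (r ^ n)) = \<kappa> * (D r)\<^sup>2" using True by simp
      also have "ennreal (\<kappa> * (D r)\<^sup>2) = ennreal \<kappa> * ennreal ((D r)\<^sup>2)" using \<kappa> by (rule ennreal_mult')
      finally show ?thesis by (simp only: mult_ac)
    qed simp
  qed
  also have "\<dots> = (ennreal \<kappa> * emeasure \<sigma> (space \<sigma>)) * (\<integral>\<^sup>+r. ennreal ((D r)\<^sup>2) \<partial>lborel)"
    by (rule nn_integral_cmult) measurable
  finally show ?thesis unfolding \<kappa>_def by (simp only: mult_ac)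
qed

section \<open>Weak limits from pointwise limits and approximation\<close>

text \<open>A free weight S plays the part of Cauchy-Schwarz: S is taken large first to make b^2/S
  small, and a is made small afterwards.\<close>

lemma young_ineq_weighted:
  fixes a b S :: real
  assumes "S > 0"
  shows "a * b \<le> S * a\<^sup>2 + b\<^sup>2 / S"
proof -
  have "0 \<le> (S * a - b)\<^sup>2" by simp
  then have "2 * S * a * b \<le> S\<^sup>2 * a\<^sup>2 + b\<^sup>2" by (simp add: power2_diff power_mult_distrib mult_ac)
  moreover have "0 \<le> S\<^sup>2 * a\<^sup>2 + b\<^sup>2" by simp
  ultimately have "S * (a * b) \<le> S\<^sup>2 * a\<^sup>2 + b\<^sup>2" by (simp only: mult.assoc)
  also have "\<dots> = S * (S * a\<^sup>2 + b\<^sup>2 / S)" using assms by (simp add: distrib_left power2_eq_square)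
  finally show ?thesis using assms by (simp only: mult_le_cancel_left_pos)
qed

lemma nn_integral_mult_le_young:
  fixes f g :: "'a \<Rightarrow> complex"
  assumes S: "S > 0" and [measurable]: "f \<in> borel_measurable M" "g \<in> borel_measurable M"
    and f: "(\<integral>\<^sup>+x. ennreal ((cmod (f x))\<^sup>2) \<partial>M) \<le> ennreal e" and e: "e \<ge> 0"
    and g: "(\<integral>\<^sup>+x. ennreal ((cmod (g x))\<^sup>2) \<partial>M) \<le> ennreal G" and G: "G \<ge> 0"
  shows "(\<integral>\<^sup>+x. ennreal (cmod (f x) * cmod (g x)) \<partial>M) \<le> ennreal (S * e + G / S)"
proof -
  have "(\<integral>\<^sup>+x. ennreal (cmod (f x) * cmod (g x)) \<partial>M) \<le>
      (\<integral>\<^sup>+x. ennreal S * ennreal ((cmod (f x))\<^sup>2) + ennreal (1 / S) * ennreal ((cmod (g x))\<^sup>2) \<partial>M)"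
  proof (rule nn_integral_mono)
    fix x
    have "ennreal (cmod (f x) * cmod (g x)) \<le> ennreal (S * (cmod (f x))\<^sup>2 + 1 / S * (cmod (g x))\<^sup>2)"
      using young_ineq_weighted[OF S, of "cmod (f x)" "cmod (g x)"] by (intro ennreal_leI) simp
    also have "\<dots> = ennreal S * ennreal ((cmod (f x))\<^sup>2) + ennreal (1 / S) * ennreal ((cmod (g x))\<^sup>2)"
      using S by (simp only: ennreal_plus ennreal_mult' mult_nonneg_nonneg zero_le_power2 less_imp_le zero_le_divide_1_iff)
    finally show "ennreal (cmod (f x) * cmod (g x)) \<le> ennreal S * ennreal ((cmod (f x))\<^sup>2) + ennreal (1 / S) * ennreal ((cmod (g x))\<^sup>2)" .
  qed
  also have "\<dots> = ennreal S * (\<integral>\<^sup>+x. ennreal ((cmod (f x))\<^sup>2) \<partial>M) + ennreal (1 / S) * (\<integral>\<^sup>+x. ennreal ((cmod (g x))\<^sup>2) \<partial>M)"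
    by (simp add: nn_integral_add nn_integral_cmult)
  also have "\<dots> \<le> ennreal S * ennreal e + ennreal (1 / S) * ennreal G"
    by (intro add_mono mult_left_mono f g) simp_all
  also have "\<dots> = ennreal (S * e + G / S)"
    using S e G by (simp add: ennreal_mult'[symmetric] ennreal_plus[symmetric] del: ennreal_plus)
  finally show ?thesis .
qed

text \<open>Bounded in L^2 and pointwise null implies weakly null, by truncation at m |g|. The
  truncated part is dominated by m |g|^2; where the truncation acts, |g| is at most |\<phi>|/m, so
  that part costs no more than K/m.\<close>

lemma nn_integral_pointwise_limit_mult:
  fixes g :: "'a \<Rightarrow> complex" and \<phi> :: "nat \<Rightarrow> 'a \<Rightarrow> complex"
  assumes [measurable]: "\<And>n. \<phi> n \<in> borel_measurable M" "g \<in> borel_measurable M"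
    and \<phi>: "\<And>n. (\<integral>\<^sup>+x. ennreal ((cmod (\<phi> n x))\<^sup>2) \<partial>M) \<le> ennreal K" and K: "K \<ge> 0"
    and g: "(\<integral>\<^sup>+x. ennreal ((cmod (g x))\<^sup>2) \<partial>M) < top"
    and lim: "AE x in M. (\<lambda>n. \<phi> n x) \<longlonglongrightarrow> 0" and e: "e > 0"
  shows "\<forall>\<^sub>F n in sequentially. (\<integral>\<^sup>+x. ennreal (cmod (\<phi> n x) * cmod (g x)) \<partial>M) \<le> ennreal e"
proof -
  \<comment> \<open>Gives K/m <= e/2; the added 1 keeps m positive when K is 0.\<close>
  define m where "m = 2 * (K + 1) / e"
  have m: "m > 0" "K / m \<le> e / 2" using K e by (simp_all add: m_def field_simps)
  have "(\<lambda>n. \<integral>\<^sup>+x. ennreal (min (cmod (\<phi> n x)) (m * cmod (g x)) * cmod (g x)) \<partial>M) \<longlonglongrightarrow> (\<integral>\<^sup>+x. 0 \<partial>M)"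
  proof (rule nn_integral_dominated_convergence)
    have "(\<integral>\<^sup>+x. ennreal (m * (cmod (g x))\<^sup>2) \<partial>M) = ennreal m * (\<integral>\<^sup>+x. ennreal ((cmod (g x))\<^sup>2) \<partial>M)"
      using m by (simp add: ennreal_mult' nn_integral_cmult)
    also have "\<dots> < top" using g by (simp add: ennreal_mult_less_top)
    finally show "(\<integral>\<^sup>+x. ennreal (m * (cmod (g x))\<^sup>2) \<partial>M) < \<infinity>" by simp
    show "AE x in M. ennreal (min (cmod (\<phi> n x)) (m * cmod (g x)) * cmod (g x)) \<le> ennreal (m * (cmod (g x))\<^sup>2)" for n
    proof (intro AE_I2 ennreal_leI)
      fix x
      have "min (cmod (\<phi> n x)) (m * cmod (g x)) * cmod (g x) \<le> (m * cmod (g x)) * cmod (g x)"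
        by (intro mult_right_mono) auto
      then show "min (cmod (\<phi> n x)) (m * cmod (g x)) * cmod (g x) \<le> m * (cmod (g x))\<^sup>2"
        by (simp add: power2_eq_square mult.assoc)
    qed
    show "AE x in M. (\<lambda>n. ennreal (min (cmod (\<phi> n x)) (m * cmod (g x)) * cmod (g x))) \<longlonglongrightarrow> 0"
      using lim
    proof eventually_elim
      case (elim x)
      have "(\<lambda>n. min (cmod (\<phi> n x)) (m * cmod (g x)) * cmod (g x)) \<longlonglongrightarrow> min (cmod 0) (m * cmod (g x)) * cmod (g x)"
        by (intro tendsto_mult tendsto_min tendsto_norm elim tendsto_const)
      moreover have z: "min (cmod 0) (m * cmod (g x)) * cmod (g x) = 0" using m by simp
      ultimately have "(\<lambda>n. min (cmod (\<phi> n x)) (m * cmod (g x)) * cmod (g x)) \<longlonglongrightarrow> 0" by (simp only: z)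
      from tendsto_ennrealI[OF this] show ?case by simp
    qed
  qed simp_all
  then have "(\<lambda>n. \<integral>\<^sup>+x. ennreal (min (cmod (\<phi> n x)) (m * cmod (g x)) * cmod (g x)) \<partial>M) \<longlonglongrightarrow> 0" by simp
  moreover have "(0::ennreal) < ennreal (e / 2)" using e by simp
  ultimately have "\<forall>\<^sub>F n in sequentially. (\<integral>\<^sup>+x. ennreal (min (cmod (\<phi> n x)) (m * cmod (g x)) * cmod (g x)) \<partial>M) < ennreal (e / 2)"
    by (rule order_tendstoD(2))
  then show ?thesis
  proof eventually_elim
    case (elim n)
    have "(\<integral>\<^sup>+x. ennreal (cmod (\<phi> n x) * cmod (g x)) \<partial>M) \<le>
        (\<integral>\<^sup>+x. ennreal (min (cmod (\<phi> n x)) (m * cmod (g x)) * cmod (g x)) + ennreal (1 / m) * ennreal ((cmod (\<phi> n x))\<^sup>2) \<partial>M)"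
    proof (rule nn_integral_mono)
      fix x
      have "cmod (\<phi> n x) * cmod (g x) \<le> min (cmod (\<phi> n x)) (m * cmod (g x)) * cmod (g x) + 1 / m * (cmod (\<phi> n x))\<^sup>2"
      proof (cases "cmod (\<phi> n x) \<le> m * cmod (g x)")
        case True
        then show ?thesis using m by (simp add: min_def)
      next
        case False
        then have "cmod (g x) \<le> cmod (\<phi> n x) / m" using m by (simp add: pos_le_divide_eq mult.commute)
        then have "cmod (\<phi> n x) * cmod (g x) \<le> cmod (\<phi> n x) * (cmod (\<phi> n x) / m)" by (rule mult_left_mono) simp
        moreover have "0 \<le> min (cmod (\<phi> n x)) (m * cmod (g x)) * cmod (g x)" using m by simp
        ultimately show ?thesis by (simp add: power2_eq_square)
      qed
      then have "ennreal (cmod (\<phi> n x) * cmod (g x)) \<le> ennreal (min (cmod (\<phi> n x)) (m * cmod (g x)) * cmod (g x) + 1 / m * (cmod (\<phi> n x))\<^sup>2)"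
        by (rule ennreal_leI)
      also have "\<dots> = ennreal (min (cmod (\<phi> n x)) (m * cmod (g x)) * cmod (g x)) + ennreal (1 / m) * ennreal ((cmod (\<phi> n x))\<^sup>2)"
        using m by (subst ennreal_plus) (simp_all add: ennreal_mult'[symmetric])
      finally show "ennreal (cmod (\<phi> n x) * cmod (g x)) \<le> ennreal (min (cmod (\<phi> n x)) (m * cmod (g x)) * cmod (g x)) + ennreal (1 / m) * ennreal ((cmod (\<phi> n x))\<^sup>2)" .
    qed
    also have "\<dots> = (\<integral>\<^sup>+x. ennreal (min (cmod (\<phi> n x)) (m * cmod (g x)) * cmod (g x)) \<partial>M) + ennreal (1 / m) * (\<integral>\<^sup>+x. ennreal ((cmod (\<phi> n x))\<^sup>2) \<partial>M)"
      by (simp add: nn_integral_add nn_integral_cmult)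
    also have "\<dots> \<le> ennreal (e / 2) + ennreal (1 / m) * ennreal K"
      using elim by (intro add_mono mult_left_mono \<phi>) (auto simp: less_imp_le)
    also have "\<dots> = ennreal (e / 2 + K / m)"
      using m K e by (simp add: ennreal_mult'[symmetric] ennreal_plus[symmetric] del: ennreal_plus)
    also have "\<dots> \<le> ennreal e" using m(2) by (intro ennreal_leI) linarith
    finally show ?case .
  qed
qed

text \<open>The difference f - l is split into f - h, h - lh and lh - l. The outer two are small in
  L^2 uniformly in n and are paired with g by the weighted inequality; the middle one tends to 0
  pointwise and is bounded in L^2.\<close>

lemma weak_limit_by_approximation:
  fixes f :: "nat \<Rightarrow> 'a \<Rightarrow> complex" and l g :: "'a \<Rightarrow> complex"
  assumes fm[measurable]: "\<And>n. f n \<in> borel_measurable M" and lm[measurable]: "l \<in> borel_measurable M" and gm[measurable]: "g \<in> borel_measurable M"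
    and f: "\<And>n. (\<integral>\<^sup>+x. ennreal ((cmod (f n x))\<^sup>2) \<partial>M) < top" and l: "(\<integral>\<^sup>+x. ennreal ((cmod (l x))\<^sup>2) \<partial>M) < top"
    and g: "(\<integral>\<^sup>+x. ennreal ((cmod (g x))\<^sup>2) \<partial>M) < top"
    and approx: "\<And>e. e > 0 \<Longrightarrow> \<exists>h lh K. (\<forall>n. h n \<in> borel_measurable M) \<and> lh \<in> borel_measurable M \<and>
      (\<forall>n. (\<integral>\<^sup>+x. ennreal ((cmod (f n x - h n x))\<^sup>2) \<partial>M) \<le> ennreal e) \<and>
      (\<integral>\<^sup>+x. ennreal ((cmod (l x - lh x))\<^sup>2) \<partial>M) \<le> ennreal e \<and> K \<ge> 0 \<and>
      (\<forall>n. (\<integral>\<^sup>+x. ennreal ((cmod (h n x - lh x))\<^sup>2) \<partial>M) \<le> ennreal K) \<and> (AE x in M. (\<lambda>n. h n x) \<longlonglongrightarrow> lh x)"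
  shows "(\<lambda>n. LINT x|M. f n x * cnj (g x)) \<longlonglongrightarrow> (LINT x|M. l x * cnj (g x))"
proof -
  have [measurable]: "cnj \<in> borel_measurable borel" by (intro borel_measurable_continuous_onI continuous_intros)
  obtain G where G: "(\<integral>\<^sup>+x. ennreal ((cmod (g x))\<^sup>2) \<partial>M) = ennreal G" "G \<ge> 0"
    using g by (cases "\<integral>\<^sup>+x. ennreal ((cmod (g x))\<^sup>2) \<partial>M") auto
  have int: "integrable M (\<lambda>x. u x * cnj (g x))" if [measurable]: "u \<in> borel_measurable M" and u: "(\<integral>\<^sup>+x. ennreal ((cmod (u x))\<^sup>2) \<partial>M) < top" for u
  proof (rule integrableI_bounded)
    show "(\<lambda>x. u x * cnj (g x)) \<in> borel_measurable M" by measurable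
    obtain c where c: "(\<integral>\<^sup>+x. ennreal ((cmod (u x))\<^sup>2) \<partial>M) = ennreal c" "c \<ge> 0"
      using u by (cases "\<integral>\<^sup>+x. ennreal ((cmod (u x))\<^sup>2) \<partial>M") auto
    have "(\<integral>\<^sup>+x. ennreal (cmod (u x) * cmod (g x)) \<partial>M) \<le> ennreal (1 * c + G / 1)"
      by (rule nn_integral_mult_le_young) (use c G that in auto)
    also have "\<dots> < top" by simp
    finally show "(\<integral>\<^sup>+x. ennreal (norm (u x * cnj (g x))) \<partial>M) < \<infinity>" by (simp add: norm_mult)
  qed
  show ?thesis
  proof (rule LIMSEQ_I)
    fix r :: real assume r: "r > 0"
    \<comment> \<open>S makes G/S at most r/8 and e makes S e equal to r/8, so each outer term costs
      r/4; with r/4 for the middle one the sum stays below r.\<close>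
    define S where "S = 8 * (G + 1) / r"
    define e where "e = r / (8 * S)"
    have S: "S > 0" "G / S \<le> r / 8" using r G by (simp_all add: S_def field_simps)
    have e: "e > 0" "S * e = r / 8" using r S by (simp_all add: e_def)
    obtain h lh K where hm[measurable]: "\<And>n. h n \<in> borel_measurable M" and lhm[measurable]: "lh \<in> borel_measurable M"
      and h: "\<And>n. (\<integral>\<^sup>+x. ennreal ((cmod (f n x - h n x))\<^sup>2) \<partial>M) \<le> ennreal e"
      and lh: "(\<integral>\<^sup>+x. ennreal ((cmod (l x - lh x))\<^sup>2) \<partial>M) \<le> ennreal e"
      and K: "K \<ge> 0" "\<And>n. (\<integral>\<^sup>+x. ennreal ((cmod (h n x - lh x))\<^sup>2) \<partial>M) \<le> ennreal K"
      and lim: "AE x in M. (\<lambda>n. h n x) \<longlonglongrightarrow> lh x"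
      using approx[OF e(1)] by blast
    have lim0: "AE x in M. (\<lambda>n. h n x - lh x) \<longlonglongrightarrow> 0"
      using lim by eventually_elim (rule LIM_zero)
    have "\<forall>\<^sub>F n in sequentially. (\<integral>\<^sup>+x. ennreal (cmod (h n x - lh x) * cmod (g x)) \<partial>M) \<le> ennreal (r / 4)"
      by (rule nn_integral_pointwise_limit_mult[OF _ gm K(2) K(1) g lim0]) (use r in simp_all)
    then have "\<forall>\<^sub>F n in sequentially. norm ((LINT x|M. f n x * cnj (g x)) - (LINT x|M. l x * cnj (g x))) < r"
    proof eventually_elim
      case (elim n)
      have i: "integrable M (\<lambda>x. f n x * cnj (g x) - l x * cnj (g x))"
        by (intro Bochner_Integration.integrable_diff int fm lm f l)
      have "ennreal (norm ((LINT x|M. f n x * cnj (g x)) - (LINT x|M. l x * cnj (g x)))) =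
          ennreal (norm (LINT x|M. f n x * cnj (g x) - l x * cnj (g x)))"
        by (subst Bochner_Integration.integral_diff[OF int[OF fm f] int[OF lm l]]) (rule refl)
      also have "\<dots> \<le> (\<integral>\<^sup>+x. ennreal (norm (f n x * cnj (g x) - l x * cnj (g x))) \<partial>M)"
        by (rule integral_norm_bound_ennreal[OF i])
      also have "\<dots> \<le> (\<integral>\<^sup>+x. ennreal (cmod (f n x - h n x) * cmod (g x)) + (ennreal (cmod (h n x - lh x) * cmod (g x)) + ennreal (cmod (l x - lh x) * cmod (g x))) \<partial>M)"
      proof (rule nn_integral_mono)
        fix x
        have "f n x - l x = (f n x - h n x) + ((h n x - lh x) - (l x - lh x))" by simp
        then have "norm (f n x - l x) \<le> norm (f n x - h n x) + norm ((h n x - lh x) - (l x - lh x))"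
          using norm_triangle_ineq[of "f n x - h n x" "(h n x - lh x) - (l x - lh x)"] by simp
        also have "\<dots> \<le> cmod (f n x - h n x) + (cmod (h n x - lh x) + cmod (l x - lh x))"
          by (intro add_left_mono norm_triangle_ineq4)
        finally have "norm (f n x - l x) * cmod (g x) \<le> (cmod (f n x - h n x) + (cmod (h n x - lh x) + cmod (l x - lh x))) * cmod (g x)"
          by (rule mult_right_mono) simp
        moreover have "norm (f n x * cnj (g x) - l x * cnj (g x)) = norm (f n x - l x) * cmod (g x)"
          by (simp only: left_diff_distrib[symmetric] norm_mult complex_mod_cnj)
        ultimately have "ennreal (norm (f n x * cnj (g x) - l x * cnj (g x))) \<le> ennreal (cmod (f n x - h n x) * cmod (g x) + (cmod (h n x - lh x) * cmod (g x) + cmod (l x - lh x) * cmod (g x)))"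
          by (intro ennreal_leI) (simp add: distrib_right)
        also have "\<dots> = ennreal (cmod (f n x - h n x) * cmod (g x)) + (ennreal (cmod (h n x - lh x) * cmod (g x)) + ennreal (cmod (l x - lh x) * cmod (g x)))"
          by (simp only: ennreal_plus mult_nonneg_nonneg norm_ge_zero add_nonneg_nonneg)
        finally show "ennreal (norm (f n x * cnj (g x) - l x * cnj (g x))) \<le> ennreal (cmod (f n x - h n x) * cmod (g x)) + (ennreal (cmod (h n x - lh x) * cmod (g x)) + ennreal (cmod (l x - lh x) * cmod (g x)))" .
      qed
      also have "\<dots> = (\<integral>\<^sup>+x. ennreal (cmod (f n x - h n x) * cmod (g x)) \<partial>M) + ((\<integral>\<^sup>+x. ennreal (cmod (h n x - lh x) * cmod (g x)) \<partial>M) + (\<integral>\<^sup>+x. ennreal (cmod (l x - lh x) * cmod (g x)) \<partial>M))"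
        by (simp add: nn_integral_add)
      also have "\<dots> \<le> ennreal (S * e + G / S) + (ennreal (r / 4) + ennreal (S * e + G / S))"
        by (intro add_mono elim nn_integral_mult_le_young[OF S(1) _ gm h less_imp_le[OF e(1)] eq_refl[OF G(1)] G(2)]
            nn_integral_mult_le_young[OF S(1) _ gm lh less_imp_le[OF e(1)] eq_refl[OF G(1)] G(2)] borel_measurable_diff fm hm lm lhm)
      also have "\<dots> = ennreal ((S * e + G / S) + (r / 4 + (S * e + G / S)))"
        using S e r G by (simp add: ennreal_plus[symmetric] del: ennreal_plus)
      finally have "norm ((LINT x|M. f n x * cnj (g x)) - (LINT x|M. l x * cnj (g x))) \<le> (S * e + G / S) + (r / 4 + (S * e + G / S))"
        using S e r G by (subst (asm) ennreal_le_iff) auto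
      also have "\<dots> < r" using S(2) e(2) r by linarith
      finally show ?case .
    qed
    then show "\<exists>no. \<forall>n\<ge>no. norm ((LINT x|M. f n x * cnj (g x)) - (LINT x|M. l x * cnj (g x))) < r"
      unfolding eventually_sequentially .
  qed
qed

text \<open>Only the radial factor a is rough. It is first replaced in L^2 by a continuous \<alpha>
  supported strictly inside (0, B). There the bump weight has a positive lower bound, so it can be
  divided out and the quotient approximated uniformly by polynomials on the compact
  cylinder.\<close>

lemma bump_profile_approximation:
  fixes a :: "real \<Rightarrow> complex" and u :: "'a::euclidean_space \<Rightarrow> complex"
  assumes am[measurable]: "a \<in> borel_measurable borel" and a0: "\<And>s. s \<notin> {0<..<B} \<Longrightarrow> a s = 0" and aA: "\<And>s. norm (a s) \<le> A"
    and cu: "continuous_on UNIV u" and uM: "\<And>x. norm (u x) \<le> M" and B: "B > 0" and e: "e > 0"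
  shows "\<exists>p r D M'. real_polynomial_function p \<and> real_polynomial_function r \<and> D \<in> borel_measurable borel \<and>
    band_profile B M' (bump_profile B 4 p r) \<and>
    (\<forall>s. \<forall>q\<in>sphere 0 1. norm (a s * u (\<bar>s\<bar> *\<^sub>R q) - bump_profile B 4 p r s q) \<le> D s) \<and>
    (\<integral>\<^sup>+s. ennreal ((D s)\<^sup>2) \<partial>lborel) \<le> ennreal e"
proof -
  have M0: "M \<ge> 0" using order_trans[OF norm_ge_zero uM] .
  \<comment> \<open>A positive bound, so that it can stand in the denominator of
    \<open>T\<close>.\<close>
  define A' where "A' = max A 1"
  have A': "A' > 0" "\<And>s. norm (a s) \<le> A'" using aA by (auto simp: A'_def le_max_iff_disj)
  \<comment> \<open>In this form measurability means being a pointwise limit of continuous functions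
    off a negligible set.\<close>
  have "a measurable_on UNIV"
    by (rule lebesgue_measurable_imp_measurable_on) (auto intro: measurable_completion)
  then obtain N g where N: "negligible N" and cg: "\<And>n. continuous_on UNIV (g n)" and lg: "\<And>s. s \<notin> N \<Longrightarrow> (\<lambda>n. g n s) \<longlonglongrightarrow> a s"
    unfolding measurable_on_def by auto
  \<comment> \<open>Radial truncation to the disc of radius A': continuous, the identity on values
    of a, and it makes the approximants uniformly bounded for dominated convergence.\<close>
  define T where "T z = z * of_real (A' / max A' (norm z))" for z :: complex
  have cT: "continuous_on X T" for X
    unfolding T_def using A' by (intro continuous_intros) auto
  have T_id: "T z = z" if "norm z \<le> A'" for z using that A' by (simp add: T_def max_def)
  have T_le: "norm (T z) \<le> A'" for z
  proof -
    have "norm z * (A' / max A' (norm z)) \<le> max A' (norm z) * (A' / max A' (norm z))"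
      using A' by (intro mult_right_mono) auto
    also have "\<dots> = A'" using A' by auto
    finally have le: "norm z * (A' / max A' (norm z)) \<le> A'" .
    have "norm (T z) = norm z * \<bar>A' / max A' (norm z)\<bar>" unfolding T_def norm_mult norm_of_real ..
    moreover have "A' / max A' (norm z) \<ge> 0" using A' by (intro divide_nonneg_nonneg) auto
    ultimately show ?thesis using le by (simp only: abs_of_nonneg)
  qed
  \<comment> \<open>A continuous cut-off that is 0 where s(B - s) <= 1/n and 1 where s(B - s) >=
    2/n.\<close>
  define \<theta> where "\<theta> n s = min 1 (max 0 (real n * (s * (B - s)) - 1))" for n s
  have \<theta>: "0 \<le> \<theta> n s" "\<theta> n s \<le> 1" for n s by (auto simp: \<theta>_def)
  define \<alpha> where "\<alpha> n s = T (g n s) * of_real (\<theta> n s)" for n s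
  have c\<alpha>: "continuous_on UNIV (\<alpha> n)" for n
    unfolding \<alpha>_def[abs_def] \<theta>_def by (intro continuous_intros continuous_on_compose2[OF cT[of UNIV] cg]) auto
  have \<alpha>m[measurable]: "\<alpha> n \<in> borel_measurable borel" for n by (rule borel_measurable_continuous_onI[OF c\<alpha>])
  have \<alpha>_le: "norm (\<alpha> n s) \<le> A'" for n s
    using mult_mono[OF T_le \<theta>(2) _ \<theta>(1), of "g n s" n s] A' \<theta>(1)[of n s] by (simp add: \<alpha>_def norm_mult)
  have out: "s * (B - s) \<le> 0" if "s \<notin> {0<..<B}" for s
    using that B by (auto simp: mult_le_0_iff not_less)
  have \<alpha>0: "\<alpha> n s = 0" if "real n * (s * (B - s)) \<le> 1" for n s using that by (simp add: \<alpha>_def \<theta>_def)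
  have \<alpha>_out: "\<alpha> n s = 0" if "s \<notin> {0<..<B}" for n s
  proof (rule \<alpha>0)
    have "real n * (s * (B - s)) \<le> 0" using out[OF that] by (simp add: mult_le_0_iff)
    then show "real n * (s * (B - s)) \<le> 1" by linarith
  qed
  have lim: "(\<lambda>n. \<alpha> n s) \<longlonglongrightarrow> a s" if s: "s \<notin> N" for s
  proof (cases "s \<in> {0<..<B}")
    case True
    then have pos: "s * (B - s) > 0" by simp
    have "(\<lambda>n. T (g n s)) \<longlonglongrightarrow> T (a s)"
      by (rule continuous_on_tendsto_compose[OF cT[of UNIV] lg[OF s]]) auto
    moreover have "(\<lambda>n. complex_of_real (\<theta> n s)) \<longlonglongrightarrow> 1"
    proof (rule tendsto_eventually)
      obtain m :: nat where m: "real m * (s * (B - s)) > 2" using reals_Archimedean3[OF pos] by blast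
      show "\<forall>\<^sub>F n in sequentially. complex_of_real (\<theta> n s) = 1"
        using eventually_ge_at_top[of m]
      proof eventually_elim
        case (elim n)
        then have "real m * (s * (B - s)) \<le> real n * (s * (B - s))" using pos by (intro mult_right_mono) auto
        then show ?case using m by (simp add: \<theta>_def)
      qed
    qed
    ultimately have "(\<lambda>n. \<alpha> n s) \<longlonglongrightarrow> T (a s) * 1" unfolding \<alpha>_def by (rule tendsto_mult)
    then show ?thesis using T_id[OF A'(2)] by simp
  next
    case False
    then show ?thesis using a0 \<alpha>_out by simp
  qed
  have "AE s in lebesgue. s \<notin> N"
    using N by (intro AE_not_in) (simp add: negligible_iff_null_sets)
  then have ae: "AE s in lborel. s \<notin> N" by (simp add: AE_completion_iff)
  have "(\<lambda>n. \<integral>\<^sup>+s. ennreal ((cmod (a s - \<alpha> n s))\<^sup>2) \<partial>lborel) \<longlonglongrightarrow> (\<integral>\<^sup>+s. 0 \<partial>(lborel :: real measure))"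
  proof (rule nn_integral_dominated_convergence)
    show "AE s in lborel. ennreal ((cmod (a s - \<alpha> n s))\<^sup>2) \<le> ennreal ((2 * A')\<^sup>2) * indicator {0..B} s" for n
    proof (rule AE_I2)
      fix s
      show "ennreal ((cmod (a s - \<alpha> n s))\<^sup>2) \<le> ennreal ((2 * A')\<^sup>2) * indicator {0..B} s"
      proof (cases "s \<in> {0<..<B}")
        case True
        have "cmod (a s - \<alpha> n s) \<le> 2 * A'"
          using norm_triangle_ineq4[of "a s" "\<alpha> n s"] A'(2)[of s] \<alpha>_le[of n s] by linarith
        then have "(cmod (a s - \<alpha> n s))\<^sup>2 \<le> (2 * A')\<^sup>2" by (rule power_mono) simp
        then show ?thesis using True by (simp add: ennreal_leI)
      next
        case False
        then show ?thesis using a0 \<alpha>_out by simp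
      qed
    qed
    have "(\<integral>\<^sup>+s. ennreal ((2 * A')\<^sup>2) * indicator {0..B} s \<partial>lborel) = ennreal ((2 * A')\<^sup>2) * emeasure lborel {0..B}"
      by (rule nn_integral_cmult_indicator) simp
    also have "\<dots> < top" using B by (simp add: ennreal_mult_less_top)
    finally show "(\<integral>\<^sup>+s. ennreal ((2 * A')\<^sup>2) * indicator {0..B} s \<partial>lborel) < \<infinity>" by simp
    show "AE s in lborel. (\<lambda>n. ennreal ((cmod (a s - \<alpha> n s))\<^sup>2)) \<longlonglongrightarrow> 0"
      using ae
    proof eventually_elim
      case (elim s)
      have "(\<lambda>n. (cmod (a s - \<alpha> n s))\<^sup>2) \<longlonglongrightarrow> (cmod (a s - a s))\<^sup>2"
        by (intro tendsto_power tendsto_norm tendsto_diff tendsto_const lim elim)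
      from tendsto_ennrealI[OF this] show ?case by simp
    qed
  qed simp_all
  then have "(\<lambda>n. \<integral>\<^sup>+s. ennreal ((cmod (a s - \<alpha> n s))\<^sup>2) \<partial>lborel) \<longlonglongrightarrow> 0" by simp
  \<comment> \<open>Weighted by 2M^2 this error contributes at most e/2; the added 1 covers M =
    0.\<close>
  moreover have "(0::ennreal) < ennreal (e / (4 * (M\<^sup>2 + 1)))" using e by (simp add: add_nonneg_pos)
  ultimately have "\<forall>\<^sub>F n in sequentially. (\<integral>\<^sup>+s. ennreal ((cmod (a s - \<alpha> n s))\<^sup>2) \<partial>lborel) < ennreal (e / (4 * (M\<^sup>2 + 1)))"
    by (rule order_tendstoD(2))
  from eventually_conj[OF this eventually_gt_at_top[of 0]]
  obtain n where nE: "(\<integral>\<^sup>+s. ennreal ((cmod (a s - \<alpha> n s))\<^sup>2) \<partial>lborel) < ennreal (e / (4 * (M\<^sup>2 + 1)))" and n: "n > 0"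
    unfolding eventually_sequentially by auto
  \<comment> \<open>The quotient of \<alpha> u by the bump weight. The maximum with 1/n keeps the
    denominator positive, and where it differs from s(B - s) the numerator vanishes.\<close>
  define \<Psi> where "\<Psi> x = \<alpha> n (fst x) / of_real ((max (1 / real n) (fst x * (B - fst x))) ^ 4) * u (\<bar>fst x\<bar> *\<^sub>R snd x)" for x :: "real \<times> 'a"
  have "max (1 / real n) t > 0" for t using n by (simp add: less_max_iff_disj)
  then have nz: "max (1 / real n) t \<noteq> 0" for t by (metis less_irrefl)
  have c\<Psi>: "continuous_on X \<Psi>" for X
  proof -
    have 1: "continuous_on X (\<lambda>x::real \<times> 'a. \<alpha> n (fst x))"
      by (rule continuous_on_compose2[OF c\<alpha> continuous_on_fst[OF continuous_on_id]]) simp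
    have 2: "continuous_on X (\<lambda>x::real \<times> 'a. u (\<bar>fst x\<bar> *\<^sub>R snd x))"
      by (rule continuous_on_compose2[OF cu]) (intro continuous_intros, simp)
    have 3: "continuous_on X (\<lambda>x::real \<times> 'a. complex_of_real ((max (1 / real n) (fst x * (B - fst x))) ^ 4))"
      by (intro continuous_intros)
    show ?thesis unfolding \<Psi>_def[abs_def]
      by (rule continuous_on_mult[OF continuous_on_divide[OF 1 3] 2]) (use nz in simp)
  qed
  define W where "W = (B * B) ^ 4"
  \<comment> \<open>Chosen so that the polynomial error, multiplied by the largest bump weight W and
    squared over [0, B], costs at most e/2. The bound by 1 allows \<eta>^2 to be replaced by
    \<eta>.\<close>
  define \<eta> where "\<eta> = min 1 (e / (16 * W\<^sup>2 * B + 16))"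
  have W0: "W \<ge> 0" using B by (simp add: W_def)
  have \<eta>: "\<eta> > 0" "8 * (\<eta>\<^sup>2 * (W\<^sup>2 * B)) \<le> e / 2"
  proof -
    have p: "16 * W\<^sup>2 * B + 16 > 0" using B by (simp add: add_nonneg_pos)
    show "\<eta> > 0" using e p by (simp add: \<eta>_def)
    have "\<eta> \<le> 1" by (simp add: \<eta>_def)
    then have "\<eta> * \<eta> \<le> 1 * \<eta>" using \<open>\<eta> > 0\<close> by (intro mult_right_mono) auto
    then have "\<eta>\<^sup>2 \<le> \<eta>" by (simp only: power2_eq_square mult_1_left)
    also have "\<dots> \<le> e / (16 * W\<^sup>2 * B + 16)" by (simp add: \<eta>_def)
    finally have "\<eta>\<^sup>2 * (16 * W\<^sup>2 * B + 16) \<le> e" using p by (simp only: pos_le_divide_eq)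
    moreover have "\<eta>\<^sup>2 * (16 * W\<^sup>2 * B) \<le> \<eta>\<^sup>2 * (16 * W\<^sup>2 * B + 16)" by (intro mult_left_mono) auto
    ultimately show "8 * (\<eta>\<^sup>2 * (W\<^sup>2 * B)) \<le> e / 2" by linarith
  qed
  let ?K = "{0..B} \<times> sphere (0::'a) 1"
  have cK: "compact ?K" by (intro compact_Times) auto
  have "continuous_on ?K (\<lambda>x. Re (\<Psi> x))" "continuous_on ?K (\<lambda>x. Im (\<Psi> x))" by (intro continuous_intros c\<Psi>)+
  then obtain p r where p: "real_polynomial_function p" "\<And>x. x \<in> ?K \<Longrightarrow> \<bar>Re (\<Psi> x) - p x\<bar> < \<eta>"
    and r: "real_polynomial_function r" "\<And>x. x \<in> ?K \<Longrightarrow> \<bar>Im (\<Psi> x) - r x\<bar> < \<eta>"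
    using Stone_Weierstrass_real_polynomial_function[OF cK _ \<eta>(1)] by metis
  \<comment> \<open>The first term is the error in the radial factor, the second the error of the
    two polynomials, at most \<eta> for each of real and imaginary part; neither depends on
    q.\<close>
  define D where "D s = M * cmod (a s - \<alpha> n s) + 2 * \<eta> * W * indicator {0..B} s" for s
  have Dm: "D \<in> borel_measurable borel" unfolding D_def[abs_def] by measurable
  have Db: "norm (a s * u (\<bar>s\<bar> *\<^sub>R q) - bump_profile B 4 p r s q) \<le> D s" if q: "q \<in> sphere 0 1" for s q
  proof (cases "s \<in> {0<..<B}")
    case False
    then have "max 0 (s * (B - s)) = 0" using out[OF False] by simp
    then have "bump_profile B 4 p r s q = 0" by (simp only: bump_profile_def) simp
    then show ?thesis using a0[OF False] \<alpha>_out[OF False] \<eta> W0 by (simp add: D_def)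
  next
    case True
    define w where "w = (max 0 (s * (B - s))) ^ 4"
    have pos: "s * (B - s) > 0" and sB: "s \<noteq> 0" "B \<noteq> s" using True by auto
    have w: "0 \<le> w" "w \<le> W"
    proof -
      show "0 \<le> w" by (simp add: w_def)
      have "s * (B - s) \<le> B * B" using True by (intro mult_mono) auto
      then show "w \<le> W" unfolding w_def W_def using pos by (intro power_mono) auto
    qed
    have eq: "\<alpha> n s * u (\<bar>s\<bar> *\<^sub>R q) = of_real w * \<Psi> (s, q)"
    proof (cases "s * (B - s) \<le> 1 / real n")
      case True
      then have "real n * (s * (B - s)) \<le> 1" using n by (simp add: pos_le_divide_eq mult.commute)
      then show ?thesis using \<alpha>0 by (simp add: \<Psi>_def)
    next
      case False
      then have "max (1 / real n) (s * (B - s)) = s * (B - s)" "max 0 (s * (B - s)) = s * (B - s)" using pos by auto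
      then show ?thesis using sB by (simp add: \<Psi>_def w_def)
    qed
    have K: "(s, q) \<in> ?K" using True q by simp
    have "norm (\<Psi> (s, q) - Complex (p (s, q)) (r (s, q))) \<le> \<bar>Re (\<Psi> (s, q)) - p (s, q)\<bar> + \<bar>Im (\<Psi> (s, q)) - r (s, q)\<bar>"
      using cmod_le[of "\<Psi> (s, q) - Complex (p (s, q)) (r (s, q))"] by simp
    then have le2: "norm (\<Psi> (s, q) - Complex (p (s, q)) (r (s, q))) \<le> 2 * \<eta>" using p(2)[OF K] r(2)[OF K] by linarith
    have "a s * u (\<bar>s\<bar> *\<^sub>R q) - bump_profile B 4 p r s q =
        (a s - \<alpha> n s) * u (\<bar>s\<bar> *\<^sub>R q) + of_real w * (\<Psi> (s, q) - Complex (p (s, q)) (r (s, q)))"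
      unfolding left_diff_distrib right_diff_distrib eq by (simp add: bump_profile_def w_def)
    then have "norm (a s * u (\<bar>s\<bar> *\<^sub>R q) - bump_profile B 4 p r s q) \<le>
        norm ((a s - \<alpha> n s) * u (\<bar>s\<bar> *\<^sub>R q)) + norm (of_real w * (\<Psi> (s, q) - Complex (p (s, q)) (r (s, q))))"
      by (simp only: norm_triangle_ineq)
    also have "\<dots> = cmod (a s - \<alpha> n s) * cmod (u (\<bar>s\<bar> *\<^sub>R q)) + w * cmod (\<Psi> (s, q) - Complex (p (s, q)) (r (s, q)))"
      using w by (simp only: norm_mult norm_of_real abs_of_nonneg)
    also have "\<dots> \<le> cmod (a s - \<alpha> n s) * M + W * (2 * \<eta>)"
      using w W0 by (intro add_mono mult_mono le2 uM) auto
    also have "\<dots> = D s" using True by (simp add: D_def)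
    finally show ?thesis .
  qed
  have "(\<integral>\<^sup>+s. ennreal ((D s)\<^sup>2) \<partial>lborel) \<le>
      (\<integral>\<^sup>+s. ennreal (2 * M\<^sup>2) * ennreal ((cmod (a s - \<alpha> n s))\<^sup>2) + ennreal (8 * (\<eta>\<^sup>2 * W\<^sup>2)) * indicator {0..B} s \<partial>lborel)"
  proof (rule nn_integral_mono)
    fix s
    have "(x + y)\<^sup>2 \<le> 2 * x\<^sup>2 + 2 * y\<^sup>2" for x y :: real
      using zero_le_power2[of "x - y"] by (simp add: power2_diff power2_sum)
    then have "(D s)\<^sup>2 \<le> 2 * (M * cmod (a s - \<alpha> n s))\<^sup>2 + 2 * (2 * \<eta> * W * indicator {0..B} s)\<^sup>2"
      unfolding D_def .
    also have "\<dots> = 2 * M\<^sup>2 * (cmod (a s - \<alpha> n s))\<^sup>2 + 8 * (\<eta>\<^sup>2 * W\<^sup>2) * indicator {0..B} s"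
      by (simp add: power_mult_distrib indicator_def)
    finally have "ennreal ((D s)\<^sup>2) \<le> ennreal (2 * M\<^sup>2 * (cmod (a s - \<alpha> n s))\<^sup>2 + 8 * (\<eta>\<^sup>2 * W\<^sup>2) * indicator {0..B} s)"
      by (rule ennreal_leI)
    also have "\<dots> = ennreal (2 * M\<^sup>2) * ennreal ((cmod (a s - \<alpha> n s))\<^sup>2) + ennreal (8 * (\<eta>\<^sup>2 * W\<^sup>2)) * indicator {0..B} s"
      by (subst ennreal_plus) (auto simp: ennreal_mult'[symmetric] indicator_def)
    finally show "ennreal ((D s)\<^sup>2) \<le> ennreal (2 * M\<^sup>2) * ennreal ((cmod (a s - \<alpha> n s))\<^sup>2) + ennreal (8 * (\<eta>\<^sup>2 * W\<^sup>2)) * indicator {0..B} s" .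
  qed
  also have "\<dots> = ennreal (2 * M\<^sup>2) * (\<integral>\<^sup>+s. ennreal ((cmod (a s - \<alpha> n s))\<^sup>2) \<partial>lborel) + ennreal (8 * (\<eta>\<^sup>2 * W\<^sup>2)) * emeasure lborel {0..B}"
    by (subst nn_integral_add) (simp_all add: nn_integral_cmult nn_integral_cmult_indicator)
  also have "\<dots> \<le> ennreal (2 * M\<^sup>2) * ennreal (e / (4 * (M\<^sup>2 + 1))) + ennreal (8 * (\<eta>\<^sup>2 * W\<^sup>2)) * ennreal B"
    using nE B by (intro add_mono mult_left_mono) (auto simp: less_imp_le)
  also have "\<dots> = ennreal (2 * M\<^sup>2 * (e / (4 * (M\<^sup>2 + 1))) + 8 * (\<eta>\<^sup>2 * W\<^sup>2) * B)"
    using e B by (subst ennreal_plus) (auto simp: ennreal_mult'[symmetric] intro!: divide_nonneg_nonneg mult_nonneg_nonneg add_nonneg_nonneg)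
  also have "\<dots> \<le> ennreal e"
  proof (rule ennreal_leI)
    have "M\<^sup>2 / (M\<^sup>2 + 1) \<le> 1" by (simp add: divide_le_eq_1 add_nonneg_pos)
    then have "(M\<^sup>2 / (M\<^sup>2 + 1)) * (e / 2) \<le> 1 * (e / 2)" using e by (intro mult_right_mono) auto
    moreover have "2 * m * (e / (4 * x)) = (m / x) * (e / 2)" for m x :: real by (cases "x = 0") (simp_all add: field_simps)
    ultimately show "2 * M\<^sup>2 * (e / (4 * (M\<^sup>2 + 1))) + 8 * (\<eta>\<^sup>2 * W\<^sup>2) * B \<le> e" using \<eta>(2) by (simp only: mult.assoc)
  qed
  finally have De: "(\<integral>\<^sup>+s. ennreal ((D s)\<^sup>2) \<partial>lborel) \<le> ennreal e" .
  have "bounded ((\<lambda>(s, q). bump_profile B 4 p r s q) ` ?K)"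
    by (rule compact_imp_bounded[OF compact_continuous_image[OF continuous_on_bump_profile[OF p(1) r(1)] cK]])
  then obtain M' where M': "\<forall>y\<in>(\<lambda>(s, q). bump_profile B 4 p r s q) ` ?K. norm y \<le> M'" unfolding bounded_iff ..
  have bo: "bump_profile B 4 p r s q = 0" if "s \<notin> {0..B}" for s q
  proof -
    have "s \<notin> {0<..<B}" using that by auto
    then have "max 0 (s * (B - s)) = 0" using out by simp
    then show ?thesis by (simp only: bump_profile_def) simp
  qed
  have bp: "band_profile B \<bar>M'\<bar> (bump_profile B 4 p r)"
    unfolding band_profile_def
  proof (intro conjI ballI allI impI)
    show "bump_profile B 4 p r s q = 0" if "s \<notin> {0..B}" for s q by (rule bo[OF that])
    show "(\<lambda>s. bump_profile B 4 p r s q) \<in> borel_measurable lebesgue" for q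
      by (rule measurable_completion) (simp add: borel_measurable_continuous_onI[OF continuous_on_bump_profile_section[OF p(1) r(1)]])
    fix s :: real
    show "continuous_on (sphere 0 1) (bump_profile B 4 p r s)"
    proof -
      have "continuous_on (sphere 0 1) ((\<lambda>(s, q). bump_profile B 4 p r s q) \<circ> (\<lambda>q. (s, q)))"
        by (rule continuous_on_compose[OF continuous_on_Pair[OF continuous_on_const continuous_on_id] continuous_on_bump_profile[OF p(1) r(1)]])
      then show ?thesis by (simp add: o_def)
    qed
    fix q :: 'a assume q: "q \<in> sphere 0 1"
    show "norm (bump_profile B 4 p r s q) \<le> \<bar>M'\<bar>"
    proof (cases "s \<in> {0..B}")
      case True
      then have "(s, q) \<in> ?K" using q by simp
      from bspec[OF M' imageI[OF this]] show ?thesis by simp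
    next
      case False
      then show ?thesis by (simp add: bo)
    qed
  qed
  show ?thesis using p(1) r(1) Dm bp Db De by blast
qed

text \<open>A null set of radii has a null preimage under the norm, by polar coordinates. This
  carries an exceptional set for b over to the function b(|k|) on the ambient space.\<close>

lemma AE_norm_lborel:
  fixes P :: "real \<Rightarrow> bool"
  assumes pm: "polar_measure (\<sigma> :: 'a::euclidean_space measure)" and P: "AE s in lborel. P s"
  shows "AE k in (lborel :: 'a measure). P (norm k)"
proof -
  obtain N where N: "N \<in> null_sets lborel" "\<And>s. s \<in> space lborel - N \<Longrightarrow> P s" by (rule AE_E3[OF P]) blast
  have "N \<in> sets lborel" by (rule null_setsD2[OF N(1)])
  then have [measurable]: "N \<in> sets borel" by (simp only: sets_lborel)
  have sph: "AE q in \<sigma>. norm q = 1"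
    and polar: "\<And>F :: 'a \<Rightarrow> ennreal. F \<in> borel_measurable borel \<Longrightarrow> (\<integral>\<^sup>+x. F x \<partial>lborel) =
      (\<integral>\<^sup>+r. ennreal (r ^ (DIM('a) - 1)) * indicator {0<..} r * (\<integral>\<^sup>+q. F (r *\<^sub>R q) \<partial>\<sigma>) \<partial>lborel)"
    using pm unfolding polar_measure_def by auto
  have aeN: "AE r in lborel. r \<notin> N" by (rule AE_not_in[OF N(1)])
  have "(\<integral>\<^sup>+k. indicator N (norm (k :: 'a)) \<partial>lborel) =
      (\<integral>\<^sup>+r. ennreal (r ^ (DIM('a) - 1)) * indicator {0<..} r * (\<integral>\<^sup>+q. indicator N (norm (r *\<^sub>R q)) \<partial>\<sigma>) \<partial>lborel)"
    by (rule polar) measurable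
  also have "\<dots> = (\<integral>\<^sup>+r. 0 \<partial>(lborel :: real measure))"
  proof (rule nn_integral_cong_AE)
    show "AE r in lborel. ennreal (r ^ (DIM('a) - 1)) * indicator {0<..} r * (\<integral>\<^sup>+q. indicator N (norm (r *\<^sub>R q)) \<partial>\<sigma>) = 0"
      using aeN
    proof eventually_elim
      case (elim r)
      show ?case
      proof (cases "r > 0")
        case True
        have "(\<integral>\<^sup>+q. indicator N (norm (r *\<^sub>R q)) \<partial>\<sigma>) = (\<integral>\<^sup>+q. 0 \<partial>\<sigma>)"
        proof (rule nn_integral_cong_AE)
          show "AE q in \<sigma>. (indicator N (norm (r *\<^sub>R q)) :: ennreal) = 0"
            using sph by eventually_elim (use True elim in simp)
        qed
        then show ?thesis by simp
      qed simp
    qed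
  qed
  finally have "(\<integral>\<^sup>+k. indicator N (norm (k :: 'a)) \<partial>lborel) = 0" by simp
  then have "AE k in (lborel :: 'a measure). (indicator N (norm k) :: ennreal) = 0"
    by (subst (asm) nn_integral_0_iff_AE) simp_all
  then show ?thesis
  proof eventually_elim
    case (elim k)
    then have "norm k \<notin> N" by (simp add: indicator_eq_0_iff)
    then show ?case using N(2)[of "norm k"] by simp
  qed
qed

lemma band_profile_diff:
  assumes V: "band_profile B M Vh" and W: "band_profile B M' Wh"
  shows "band_profile B (M + M') (\<lambda>s q. Vh s q - Wh s q)"
  unfolding band_profile_def
proof (intro conjI ballI allI impI)
  fix s :: real
  show "continuous_on (sphere 0 1) (\<lambda>q. Vh s q - Wh s q)"
    using V W unfolding band_profile_def by (intro continuous_on_diff) auto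
  fix q :: 'a assume q: "q \<in> sphere 0 1"
  show "(\<lambda>s. Vh s q - Wh s q) \<in> borel_measurable lebesgue"
    using V W q unfolding band_profile_def by (intro borel_measurable_diff) auto
  have "norm (Vh s q) \<le> M" "norm (Wh s q) \<le> M'" using V W q unfolding band_profile_def by auto
  then show "norm (Vh s q - Wh s q) \<le> M + M'" using norm_triangle_ineq4[of "Vh s q" "Wh s q"] by linarith
  show "Vh s q - Wh s q = 0" if "s \<notin> {0..B}" using V W q that unfolding band_profile_def by auto
qed

text \<open>Bump profiles approximate the given profile in L^2 with a radial majorant. The bounds
  for \<open>profile_shell\<close> and \<open>profile_limit\<close> pass this on to both sides of
  the limit, and for the bumps themselves the pointwise limit is available.\<close>

lemma profile_shell_weak_limit:
  fixes a :: "real \<Rightarrow> complex" and u :: "'a::euclidean_space \<Rightarrow> complex" and g L :: "'a \<Rightarrow> complex"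
  assumes dim: "DIM('a) \<in> {1, 2, 3}" and pm: "polar_measure (\<sigma> :: 'a measure)"
    and am[measurable]: "a \<in> borel_measurable borel" and a0: "\<And>s. s \<notin> {0<..<B} \<Longrightarrow> a s = 0" and aA: "\<And>s. norm (a s) \<le> A"
    and cu: "continuous_on UNIV u" and uM: "\<And>x. norm (u x) \<le> M" and B: "B > 0"
    and Vh: "band_profile B M1 Vh" and Vh_eq: "\<And>s q. q \<in> sphere 0 1 \<Longrightarrow> Vh s q = a s * u (\<bar>s\<bar> *\<^sub>R q)"
    and L: "L \<in> borel_measurable lebesgue" "AE k in lborel. L k = profile_limit Vh k"
    and L2: "(\<integral>\<^sup>+k. ennreal ((cmod (L k))\<^sup>2) \<partial>lebesgue) < top"
    and g: "g \<in> borel_measurable lebesgue" "(\<integral>\<^sup>+k. ennreal ((cmod (g k))\<^sup>2) \<partial>lebesgue) < top"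
  shows "\<And>R. R > 0 \<Longrightarrow> profile_shell Vh R \<in> borel_measurable borel"
    and "\<And>R. R > 0 \<Longrightarrow> (\<integral>\<^sup>+k. ennreal ((cmod (profile_shell Vh R k))\<^sup>2) \<partial>lborel) < top"
    and "((\<lambda>R. LINT k|lebesgue. profile_shell Vh R k * cnj (g k)) \<longlongrightarrow> (LINT k|lebesgue. L k * cnj (g k))) at_top"
proof -
  interpret finite_measure \<sigma> using pm unfolding polar_measure_def by blast
  define S where "S = measure \<sigma> (space \<sigma>)"
  have S: "emeasure \<sigma> (space \<sigma>) = ennreal S" "S \<ge> 0" by (simp_all add: S_def emeasure_eq_measure)
  define K1 where "K1 = (2 * pi) ^ DIM('a) * 2 ^ (DIM('a) - 1)"
  define K2 where "K2 = inverse ((cmod (plane_const DIM('a)))\<^sup>2)"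
  have K: "K1 \<ge> 0" "K2 \<ge> 0" by (simp_all add: K1_def K2_def)
  have um: "(\<lambda>s. u (\<bar>s\<bar> *\<^sub>R q)) \<in> borel_measurable borel" for q
    by (intro borel_measurable_continuous_onI continuous_on_compose2[OF cu] continuous_intros) auto
  have Vm: "(\<lambda>s. Vh s q) \<in> borel_measurable borel" if "q \<in> sphere 0 1" for q
    unfolding Vh_eq[OF that] using um[of q] by measurable
  have ind: "(\<integral>\<^sup>+s. ennreal ((c * indicator {0..B} s)\<^sup>2) \<partial>lborel) = ennreal (c\<^sup>2 * B)" for c :: real
  proof -
    have "(\<integral>\<^sup>+s. ennreal ((c * indicator {0..B} s)\<^sup>2) \<partial>lborel) = (\<integral>\<^sup>+s. ennreal (c\<^sup>2) * indicator {0..B} s \<partial>lborel)"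
      by (intro nn_integral_cong) (simp add: indicator_def)
    also have "\<dots> = ennreal (c\<^sup>2) * emeasure lborel {0..B}" by (rule nn_integral_cmult_indicator) simp
    finally show ?thesis using B by (simp add: ennreal_mult')
  qed
  have bnd: "norm (X s q) \<le> \<bar>c\<bar> * indicator {0..B} s" if "band_profile B c X" "q \<in> sphere 0 1" for X :: "real \<Rightarrow> 'a \<Rightarrow> complex" and c s q
    by (rule band_profile_bound[OF that])
  have fin: "ennreal x * (ennreal y * ennreal z) < top" for x y z by (simp add: ennreal_mult_less_top)
  show Vs_m: "profile_shell Vh R \<in> borel_measurable borel" if "R > 0" for R
    by (rule profile_shell_L2_le(2)[OF pm Vh that Vm bnd[OF Vh]])
  have Vs_le: "(\<integral>\<^sup>+k. ennreal ((cmod (profile_shell Vh R k))\<^sup>2) \<partial>lborel) \<le> ennreal K1 * (ennreal (\<bar>M1\<bar>\<^sup>2 * B) * ennreal S)" if "R > 0" for R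
    by (rule profile_shell_L2_le(1)[OF pm Vh that Vm bnd[OF Vh], unfolded ind S(1) K1_def[symmetric]])
  show Vs_fin: "(\<integral>\<^sup>+k. ennreal ((cmod (profile_shell Vh R k))\<^sup>2) \<partial>lborel) < top" if "R > 0" for R
    using Vs_le[OF that] fin by (rule le_less_trans)
  show "((\<lambda>R. LINT k|lebesgue. profile_shell Vh R k * cnj (g k)) \<longlongrightarrow> (LINT k|lebesgue. L k * cnj (g k))) at_top"
  proof (rule tendsto_at_topI_sequentially)
    fix X :: "nat \<Rightarrow> real" assume X: "filterlim X at_top sequentially"
    \<comment> \<open>The L^2 bounds need a positive radius for every n, while a sequence tending to
      infinity is positive only eventually.\<close>
    define Y where "Y n = max 1 (X n)" for n
    have Y: "Y n > 0" for n by (simp add: Y_def)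
    have ev: "\<forall>\<^sub>F n in sequentially. Y n = X n"
      using filterlim_at_top_dense[THEN iffD1, OF X, rule_format, of 1] by eventually_elim (simp add: Y_def)
    have Ylim: "filterlim Y at_top sequentially"
      by (rule filterlim_cong[THEN iffD1, OF refl refl _ X]) (use ev in \<open>auto elim: eventually_mono\<close>)
    have "(\<lambda>n. LINT k|lebesgue. profile_shell Vh (Y n) k * cnj (g k)) \<longlonglongrightarrow> (LINT k|lebesgue. L k * cnj (g k))"
    proof (rule weak_limit_by_approximation)
      show "profile_shell Vh (Y n) \<in> borel_measurable lebesgue" for n
        by (rule measurable_completion) (simp add: Vs_m[OF Y])
      show "(\<integral>\<^sup>+k. ennreal ((cmod (profile_shell Vh (Y n) k))\<^sup>2) \<partial>lebesgue) < top" for n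
        using Vs_fin[OF Y] by (simp only: nn_integral_completion)
      fix e :: real assume e: "e > 0"
      \<comment> \<open>One tolerance for both errors: K1 S and K2 S are the factors by which the
        shell bound and the limit bound enlarge it, and the added 1 keeps the denominator
        positive.\<close>
      define e' where "e' = e / (K1 * S + K2 * S + 1)"
      have p: "K1 * S + K2 * S + 1 > 0" "0 \<le> K1 * S" "0 \<le> K2 * S"
        using K S(2) by (auto intro!: add_nonneg_pos add_nonneg_nonneg mult_nonneg_nonneg)
      have e': "e' > 0" "K1 * (e' * S) \<le> e" "K2 * (e' * S) \<le> e"
      proof -
        show "e' > 0" using e p by (simp add: e'_def)
        have "e' * (K1 * S + K2 * S + 1) = e" using p by (simp add: e'_def)
        then have s: "e' * (K1 * S) + e' * (K2 * S) + e' = e" by (simp add: distrib_left)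
        moreover have "0 \<le> e' * (K1 * S)" "0 \<le> e' * (K2 * S)"
          using p \<open>e' > 0\<close> by (auto intro!: mult_nonneg_nonneg)
        ultimately have "e' * (K1 * S) \<le> e" "e' * (K2 * S) \<le> e" using \<open>e' > 0\<close> by linarith+
        then show "K1 * (e' * S) \<le> e" "K2 * (e' * S) \<le> e" by (simp_all only: mult_ac)
      qed
      obtain p r D M' where pr: "real_polynomial_function p" "real_polynomial_function r" and Dm: "D \<in> borel_measurable borel"
        and bp: "band_profile B M' (bump_profile B 4 p r)"
        and Db: "\<And>s q. q \<in> sphere 0 1 \<Longrightarrow> norm (a s * u (\<bar>s\<bar> *\<^sub>R q) - bump_profile B 4 p r s q) \<le> D s"
        and De: "(\<integral>\<^sup>+s. ennreal ((D s)\<^sup>2) \<partial>lborel) \<le> ennreal e'"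
        using bump_profile_approximation[OF am a0 aA cu uM B e'(1)] by blast
      let ?W = "bump_profile B 4 p r"
      have Wm: "(\<lambda>s. ?W s q) \<in> borel_measurable borel" for q
        by (rule borel_measurable_continuous_onI[OF continuous_on_bump_profile_section[OF pr]])
      have Dd: "norm (Vh s q - ?W s q) \<le> D s" if "q \<in> sphere 0 1" for s q
        using Db[OF that] unfolding Vh_eq[OF that] .
      have dm: "(\<lambda>s. Vh s q - ?W s q) \<in> borel_measurable borel" if "q \<in> sphere 0 1" for q
        by (rule borel_measurable_diff[OF Vm[OF that] Wm])
      have lim_m: "profile_limit ?W \<in> borel_measurable borel"
      proof -
        have pm: "(\<lambda>k::'a. h (norm k, k /\<^sub>R norm k)) \<in> borel_measurable borel" if "real_polynomial_function h" for h :: "real \<times> 'a \<Rightarrow> real"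
        proof -
          have [measurable]: "h \<in> borel_measurable borel"
            by (rule borel_measurable_continuous_onI[OF C1_fun_continuous[OF C1_fun_real_polynomial[OF that]]])
          show ?thesis by measurable
        qed
        note [measurable] = pm[OF pr(1)] pm[OF pr(2)]
        show ?thesis unfolding profile_limit_def[abs_def] bump_profile_def Complex_eq by measurable
      qed
      have Ws_m: "profile_shell ?W (Y n) \<in> borel_measurable borel" for n
        by (rule profile_shell_L2_le(2)[OF pm bp Y Wm bnd[OF bp]])
      have Ws_le: "(\<integral>\<^sup>+k. ennreal ((cmod (profile_shell ?W (Y n) k))\<^sup>2) \<partial>lborel) \<le> ennreal (K1 * (\<bar>M'\<bar>\<^sup>2 * B * S))" for n
      proof -
        have "(\<integral>\<^sup>+k. ennreal ((cmod (profile_shell ?W (Y n) k))\<^sup>2) \<partial>lborel) \<le> ennreal K1 * (ennreal (\<bar>M'\<bar>\<^sup>2 * B) * ennreal S)"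
          by (rule profile_shell_L2_le(1)[OF pm bp Y Wm bnd[OF bp], unfolded ind S(1) K1_def[symmetric]])
        also have "\<dots> = ennreal (K1 * (\<bar>M'\<bar>\<^sup>2 * B * S))"
          using B K S(2) by (simp only: ennreal_mult mult_nonneg_nonneg zero_le_power2 less_imp_le)
        finally show ?thesis .
      qed
      have Wl_le: "(\<integral>\<^sup>+k. ennreal ((cmod (profile_limit ?W k))\<^sup>2) \<partial>lborel) \<le> ennreal (K2 * (\<bar>M'\<bar>\<^sup>2 * B * S))"
      proof -
        have ind_m: "(\<lambda>s. \<bar>M'\<bar> * indicator {0..B} s :: real) \<in> borel_measurable borel" by measurable
        have "(\<integral>\<^sup>+k. ennreal ((cmod (profile_limit ?W k))\<^sup>2) \<partial>lborel) \<le> ennreal K2 * (ennreal (\<bar>M'\<bar>\<^sup>2 * B) * ennreal S)"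
          by (rule profile_limit_L2_le[OF pm ind_m bnd[OF bp], unfolded ind S(1) K2_def[symmetric]])
        also have "\<dots> = ennreal (K2 * (\<bar>M'\<bar>\<^sup>2 * B * S))"
          using B K S(2) by (simp only: ennreal_mult mult_nonneg_nonneg zero_le_power2 less_imp_le)
        finally show ?thesis .
      qed
      \<comment> \<open>From (x + y)^2 <= 2x^2 + 2y^2 and the two L^2 bounds for the bump; finite
        but not small, which is all that the pointwise argument asks for.\<close>
      define K where "K = 2 * (K1 * (\<bar>M'\<bar>\<^sup>2 * B * S)) + 2 * (K2 * (\<bar>M'\<bar>\<^sup>2 * B * S))"
      have Kp: "0 \<le> K1 * (\<bar>M'\<bar>\<^sup>2 * B * S)" "0 \<le> K2 * (\<bar>M'\<bar>\<^sup>2 * B * S)"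
        using \<open>K1 \<ge> 0\<close> \<open>K2 \<ge> 0\<close> S(2) B by (auto intro!: mult_nonneg_nonneg)
      have h1: "(\<integral>\<^sup>+k. ennreal ((cmod (profile_shell Vh (Y n) k - profile_shell ?W (Y n) k))\<^sup>2) \<partial>lborel) \<le> ennreal e" for n
      proof -
        have "(\<integral>\<^sup>+k. ennreal ((cmod (profile_shell (\<lambda>s q. Vh s q - ?W s q) (Y n) k))\<^sup>2) \<partial>lborel) \<le>
            ennreal K1 * ((\<integral>\<^sup>+s. ennreal ((D s)\<^sup>2) \<partial>lborel) * ennreal S)"
          by (rule profile_shell_L2_le(1)[OF pm band_profile_diff[OF Vh bp] Y dm Dd, unfolded S(1) K1_def[symmetric]])
        also have "\<dots> \<le> ennreal K1 * (ennreal e' * ennreal S)" by (intro mult_left_mono mult_right_mono De) simp_all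
        also have "\<dots> = ennreal (K1 * (e' * S))" using \<open>K1 \<ge> 0\<close> S(2) e'(1) by (simp add: ennreal_mult'[symmetric])
        also have "\<dots> \<le> ennreal e" by (rule ennreal_leI[OF e'(2)])
        finally show ?thesis by (simp only: profile_shell_diff[OF pm Vh bp Y])
      qed
      have h2: "(\<integral>\<^sup>+k. ennreal ((cmod (L k - profile_limit ?W k))\<^sup>2) \<partial>lborel) \<le> ennreal e"
      proof -
        have "(\<integral>\<^sup>+k. ennreal ((cmod (L k - profile_limit ?W k))\<^sup>2) \<partial>lborel) = (\<integral>\<^sup>+k. ennreal ((cmod (profile_limit (\<lambda>s q. Vh s q - ?W s q) k))\<^sup>2) \<partial>lborel)"
        proof (rule nn_integral_cong_AE)
          show "AE k in lborel. ennreal ((cmod (L k - profile_limit ?W k))\<^sup>2) = ennreal ((cmod (profile_limit (\<lambda>s q. Vh s q - ?W s q) k))\<^sup>2)"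
            using L(2) by eventually_elim (simp only: profile_limit_def diff_divide_distrib)
        qed
        also have "\<dots> \<le> ennreal K2 * ((\<integral>\<^sup>+s. ennreal ((D s)\<^sup>2) \<partial>lborel) * ennreal S)"
          by (rule profile_limit_L2_le[OF pm Dm Dd, unfolded S(1) K2_def[symmetric]])
        also have "\<dots> \<le> ennreal K2 * (ennreal e' * ennreal S)" by (intro mult_left_mono mult_right_mono De) simp_all
        also have "\<dots> = ennreal (K2 * (e' * S))" using \<open>K2 \<ge> 0\<close> S(2) e'(1) by (simp add: ennreal_mult'[symmetric])
        also have "\<dots> \<le> ennreal e" by (rule ennreal_leI[OF e'(3)])
        finally show ?thesis .
      qed
      have h3: "(\<integral>\<^sup>+k. ennreal ((cmod (profile_shell ?W (Y n) k - profile_limit ?W k))\<^sup>2) \<partial>lborel) \<le> ennreal K" for n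
      proof -
        note [measurable] = Ws_m lim_m
        have "(\<integral>\<^sup>+k. ennreal ((cmod (profile_shell ?W (Y n) k - profile_limit ?W k))\<^sup>2) \<partial>lborel) \<le>
            (\<integral>\<^sup>+k. 2 * ennreal ((cmod (profile_shell ?W (Y n) k))\<^sup>2) + 2 * ennreal ((cmod (profile_limit ?W k))\<^sup>2) \<partial>lborel)"
        proof (rule nn_integral_mono)
          fix k
          have sq: "(x + y)\<^sup>2 \<le> 2 * x\<^sup>2 + 2 * y\<^sup>2" for x y :: real
            using zero_le_power2[of "x - y"] by (simp add: power2_diff power2_sum)
          have "(cmod (profile_shell ?W (Y n) k - profile_limit ?W k))\<^sup>2 \<le> (cmod (profile_shell ?W (Y n) k) + cmod (profile_limit ?W k))\<^sup>2"
            by (intro power_mono norm_triangle_ineq4) simp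
          also have "\<dots> \<le> 2 * (cmod (profile_shell ?W (Y n) k))\<^sup>2 + 2 * (cmod (profile_limit ?W k))\<^sup>2" by (rule sq)
          finally have "ennreal ((cmod (profile_shell ?W (Y n) k - profile_limit ?W k))\<^sup>2) \<le> ennreal (2 * (cmod (profile_shell ?W (Y n) k))\<^sup>2 + 2 * (cmod (profile_limit ?W k))\<^sup>2)"
            by (rule ennreal_leI)
          also have "\<dots> = 2 * ennreal ((cmod (profile_shell ?W (Y n) k))\<^sup>2) + 2 * ennreal ((cmod (profile_limit ?W k))\<^sup>2)"
            by (subst ennreal_plus) (simp_all add: ennreal_mult')
          finally show "ennreal ((cmod (profile_shell ?W (Y n) k - profile_limit ?W k))\<^sup>2) \<le> 2 * ennreal ((cmod (profile_shell ?W (Y n) k))\<^sup>2) + 2 * ennreal ((cmod (profile_limit ?W k))\<^sup>2)" .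
        qed
        also have "\<dots> = 2 * (\<integral>\<^sup>+k. ennreal ((cmod (profile_shell ?W (Y n) k))\<^sup>2) \<partial>lborel) + 2 * (\<integral>\<^sup>+k. ennreal ((cmod (profile_limit ?W k))\<^sup>2) \<partial>lborel)"
          by (simp add: nn_integral_add nn_integral_cmult)
        also have "\<dots> \<le> 2 * ennreal (K1 * (\<bar>M'\<bar>\<^sup>2 * B * S)) + 2 * ennreal (K2 * (\<bar>M'\<bar>\<^sup>2 * B * S))"
          by (intro add_mono mult_left_mono Ws_le Wl_le) simp_all
        also have "\<dots> = ennreal K"
          unfolding K_def using Kp by (subst ennreal_plus) (simp_all only: ennreal_mult' zero_le_numeral ennreal_numeral mult_nonneg_nonneg)
        finally show ?thesis .
      qed
      have h4: "AE k in lborel. (\<lambda>n. profile_shell ?W (Y n) k) \<longlonglongrightarrow> profile_limit ?W k"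
        using AE_lborel_singleton[of "0::'a"]
      proof eventually_elim
        case (elim k)
        show ?case unfolding profile_shell_def profile_limit_def
          by (rule filterlim_compose[OF bump_profile_shell_limit[OF dim elim pr B _ bp] Ylim]) simp
      qed
      have K0: "K \<ge> 0" using Kp by (simp add: K_def)
      show "\<exists>h lh K. (\<forall>n. h n \<in> borel_measurable lebesgue) \<and> lh \<in> borel_measurable lebesgue \<and>
        (\<forall>n. (\<integral>\<^sup>+x. ennreal ((cmod (profile_shell Vh (Y n) x - h n x))\<^sup>2) \<partial>lebesgue) \<le> ennreal e) \<and>
        (\<integral>\<^sup>+x. ennreal ((cmod (L x - lh x))\<^sup>2) \<partial>lebesgue) \<le> ennreal e \<and> K \<ge> 0 \<and>
        (\<forall>n. (\<integral>\<^sup>+x. ennreal ((cmod (h n x - lh x))\<^sup>2) \<partial>lebesgue) \<le> ennreal K) \<and> (AE x in lebesgue. (\<lambda>n. h n x) \<longlonglongrightarrow> lh x)"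
        unfolding nn_integral_completion AE_completion_iff
      proof (intro exI conjI allI)
        show "profile_shell ?W (Y n) \<in> borel_measurable lebesgue" for n
          by (rule measurable_completion) (simp add: Ws_m)
        show "profile_limit ?W \<in> borel_measurable lebesgue"
          by (rule measurable_completion) (simp add: lim_m)
      qed (rule h1 h2 h3 h4 K0)+
    qed (use L L2 g in simp_all)
    then show "(\<lambda>n. LINT k|lebesgue. profile_shell Vh (X n) k * cnj (g k)) \<longlonglongrightarrow> (LINT k|lebesgue. L k * cnj (g k))"
      by (rule Lim_transform_eventually) (use ev in eventually_elim, simp)
  qed
qed

text \<open>The principal power of a product splits when one factor is a positive real, here \<xi>;
  for \<xi> <= 0 both sides vanish. This gives the operator the same shape as the regularised
  one.\<close>

lemma restr_op_eq:
  fixes u :: "real ^ 'n \<Rightarrow> complex"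
  shows "restr_op u s q = plane_const CARD('n) * of_real (s powr ((real CARD('n) - 1) / 2) * of_bool (s > 0)) * u (\<bar>s\<bar> *\<^sub>R q)"
proof (cases "s > 0")
  case True
  define z where "z = 1 / (2 * of_real pi * \<i>)"
  define w where "w = (real CARD('n) - 1) / 2"
  have "(of_real s * z) powr of_real w = of_real s powr of_real w * z powr of_real w"
    by (rule powr_times_real_left) (use True in auto)
  also have "of_real s powr of_real w = (of_real (s powr w) :: complex)" by (rule powr_of_real) (use True in simp)
  finally have "(of_real s * z) powr of_real w = of_real (s powr w) * z powr of_real w" .
  moreover have "of_real \<bar>s\<bar> / (2 * of_real pi * \<i>) = of_real s * z" using True by (simp add: z_def)
  ultimately show ?thesis using True by (simp add: restr_op_def plane_const_def z_def w_def)
qed (simp add: restr_op_def)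

theorem reconstruction_weak_limit:
  fixes u0 :: "real ^ 'n \<Rightarrow> complex" and b :: "real \<Rightarrow> real" and c :: real
  assumes dim: "CARD('n) \<in> {1, 2, 3}" and c: "c > 0"
    and u0_L2: "u0 \<in> L2"
    and u0_cont: "continuous_on UNIV u0"
    and u0_supp: "compact (closure {k. u0 k \<noteq> 0})"
    and b: "b \<in> borel_measurable lebesgue"
    and \<tau>: "\<tau> > 0"
  shows "weakly_tendsto_L2
       (\<lambda>\<epsilon> k. recon_hat c \<epsilon> b u0 k (\<tau> / \<epsilon>\<^sup>2) * exp (\<i> * of_real (c * norm k * \<tau> / \<epsilon>\<^sup>2)))
       (\<lambda>k. exp (- (\<i> * of_real (b (norm k) * \<tau>))) * u0 k) (at_right 0)"
proof -
  have dim': "DIM(real ^ 'n) \<in> {1, 2, 3}" using dim by simp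
  obtain e :: "real ^ 'n" where e: "norm e = 1" using vector_choose_size[of 1] by auto
  obtain \<sigma> :: "(real ^ 'n) measure" where pm: "polar_measure \<sigma>" using sphere_asymptotics[OF e dim'] by blast
  obtain B M where B: "B > 0" "\<And>x. norm x \<ge> B \<Longrightarrow> u0 x = 0" and M: "M > 0" "\<And>x. norm (u0 x) \<le> M"
    using compact_support_bounded[OF u0_cont u0_supp] by blast
  \<comment> \<open>A Borel version of b. The integrals in s do not see the change, while products
    with Borel functions and Fubini become available.\<close>
  obtain b' where b'm: "b' \<in> borel_measurable lborel" and bb': "AE s in lborel. b s = b' s"
    using completion_ex_borel_measurable_real[OF b] by blast
  have b'm[measurable]: "b' \<in> borel_measurable borel" using b'm by simp
  define \<nu> where "\<nu> = (real CARD('n) - 1) / 2"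
  have \<nu>: "\<nu> \<ge> 0" using dim by (auto simp: \<nu>_def)
  \<comment> \<open>The unregularised weight. For d = 1 it is a jump at 0, so continuity of the
    profile in s cannot be expected even for smooth b.\<close>
  define w where "w s = s powr \<nu> * of_bool (s > 0)" for s :: real
  have wm[measurable]: "w \<in> borel_measurable borel" unfolding w_def[abs_def] by measurable
  have w0: "w s = 0" if "s \<le> 0" for s using that by (simp add: w_def)
  have wM: "\<bar>w s\<bar> \<le> B powr \<nu>" if "s \<in> {0..B}" for s
    using that \<nu> by (simp add: w_def powr_mono2)
  have BM: "B powr \<nu> \<ge> 0" by simp
  define ph where "ph b s = exp (- (\<i> * of_real (b s * \<tau>)))" for b :: "real \<Rightarrow> real" and s
  have ph1: "norm (ph f s) = 1" for f s by (simp add: ph_def norm_exp_eq_Re)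
  have ph_m: "ph f \<in> borel_measurable X" if "f \<in> borel_measurable X" for f X
  proof -
    have "(\<lambda>x. exp (- (\<i> * of_real (x * \<tau>)))) \<in> borel_measurable borel"
      by (intro borel_measurable_continuous_onI continuous_intros)
    from measurable_compose[OF that this] show ?thesis unfolding ph_def[abs_def] .
  qed
  define \<kappa> where "\<kappa> = plane_const CARD('n)"
  have \<kappa>: "\<kappa> \<noteq> 0" by (simp add: \<kappa>_def plane_const_nonzero)
  define P where "P f s q = ph f s * (\<kappa> * of_real (w s) * u0 (\<bar>s\<bar> *\<^sub>R q))" for f s and q :: "real ^ 'n"
  have P_bp: "band_profile B (norm \<kappa> * B powr \<nu> * M) (P f)" if "f \<in> borel_measurable lebesgue" for f
    unfolding P_def[abs_def]
    by (rule band_profile_weighted[OF u0_cont B(2) M(2) wm w0 wM BM ph_m[OF that]]) (simp_all add: ph1)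
  have b'l: "b' \<in> borel_measurable lebesgue" by (rule measurable_completion) simp
  have P_m: "(\<lambda>s. P f s q) \<in> borel_measurable lebesgue" if "f \<in> borel_measurable lebesgue" for f q
  proof -
    have "(\<lambda>s. u0 (\<bar>s\<bar> *\<^sub>R q)) \<in> borel_measurable borel"
      by (intro borel_measurable_continuous_onI continuous_on_compose2[OF u0_cont] continuous_intros) auto
    then have "(\<lambda>s. \<kappa> * of_real (w s) * u0 (\<bar>s\<bar> *\<^sub>R q)) \<in> borel_measurable lborel" by simp
    then show ?thesis unfolding P_def by (rule borel_measurable_times[OF ph_m[OF that] measurable_completion])
  qed
  have inv_eq: "inv_fourier (\<lambda>s. P b s q) z = inv_fourier (\<lambda>s. P b' s q) z" for q z
  proof -
    have "(\<lambda>s. exp (\<i> * complex_of_real (z * s))) \<in> borel_measurable lborel"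
      by (simp add: borel_measurable_continuous_onI continuous_intros)
    then have em: "(\<lambda>s. exp (\<i> * complex_of_real (z * s))) \<in> borel_measurable lebesgue" by (rule measurable_completion)
    have "(LINT s|lebesgue. exp (\<i> * of_real (z * s)) * P b s q) = (LINT s|lebesgue. exp (\<i> * of_real (z * s)) * P b' s q)"
    proof (rule integral_cong_AE)
      show "AE s in lebesgue. exp (\<i> * of_real (z * s)) * P b s q = exp (\<i> * of_real (z * s)) * P b' s q"
        using AE_completion[OF bb'] by eventually_elim (simp only: P_def ph_def)
    qed (rule borel_measurable_times[OF em P_m[OF b]] borel_measurable_times[OF em P_m[OF b'l]])+
    then show ?thesis unfolding inv_fourier_real by simp
  qed
  let ?V = "profile_inv_fourier (profile_evol b (restr_op u0))"
  have V_eq: "?V z q \<tau> = inv_fourier (\<lambda>s. P b' s q) z" for z q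
    unfolding inv_eq[symmetric] by (simp add: profile_inv_fourier_def profile_evol_def restr_op_eq P_def ph_def \<kappa>_def w_def \<nu>_def)
  have cV: "continuous_on (UNIV \<times> sphere 0 1) (\<lambda>(z, q). ?V z q \<tau>)"
    unfolding V_eq by (rule band_profile_inv_fourier_continuous[OF P_bp[OF b'l]])
  have rec: "recon_hat c \<epsilon> b u0 k (\<tau> / \<epsilon>\<^sup>2) * exp (\<i> * of_real (c * norm k * \<tau> / \<epsilon>\<^sup>2)) = profile_shell (P b') (c * \<tau> / \<epsilon>\<^sup>2) k"
    if \<epsilon>: "\<epsilon> > 0" for \<epsilon> k
  proof -
    have e: "c * \<tau> / \<epsilon>\<^sup>2 * norm k = c * norm k * \<tau> / \<epsilon>\<^sup>2" by simp
    have st: "space_fourier (shell_op c \<epsilon> ?V) k (\<tau> / \<epsilon>\<^sup>2) =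
        shell_transform (c * \<tau> / \<epsilon>\<^sup>2) (\<lambda>z q. inv_fourier (\<lambda>s. P b' s q) z) k"
      using space_fourier_shell_op[where V="?V" and \<tau>=\<tau>, OF cV c \<epsilon> \<tau>, of k] unfolding V_eq .
    have r: "recon_hat c \<epsilon> b u0 k (\<tau> / \<epsilon>\<^sup>2) = shell_transform (c * \<tau> / \<epsilon>\<^sup>2) (\<lambda>z q. inv_fourier (\<lambda>s. P b' s q) z) k"
      by (simp only: recon_hat_def recon_def o_def st)
    show ?thesis unfolding r profile_shell_def e by (rule mult.commute)
  qed
  \<comment> \<open>All rough factors are gathered in a function of s alone. The cut at B changes
    nothing in the product, because u0 vanishes from radius B on, but it gives a bounded
    support.\<close>
  define a where "a s = ph b' s * (\<kappa> * of_real (w s)) * of_bool (s < B)" for s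
  have am: "a \<in> borel_measurable borel"
    unfolding a_def[abs_def] using ph_m[OF b'm] by measurable
  have a0: "a s = 0" if "s \<notin> {0<..<B}" for s
    using that w0[of s] by (cases "s \<le> 0") (auto simp: a_def)
  have aA: "norm (a s) \<le> norm \<kappa> * B powr \<nu>" for s
  proof (cases "s \<in> {0<..<B}")
    case True
    then have "norm (a s) = norm \<kappa> * \<bar>w s\<bar>" by (simp add: a_def norm_mult ph1)
    then show ?thesis using wM[of s] True by (simp add: mult_left_mono)
  next
    case False
    then show ?thesis by (simp add: a0)
  qed
  have Pa: "P b' s q = a s * u0 (\<bar>s\<bar> *\<^sub>R q)" if "q \<in> sphere 0 1" for s q
  proof (cases "s < B")
    case True
    then show ?thesis by (simp add: P_def a_def)
  next
    case False
    then have "u0 (\<bar>s\<bar> *\<^sub>R q) = 0" using that B by (intro B(2)) simp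
    then show ?thesis by (simp add: P_def)
  qed
  define L where "L k = exp (- (\<i> * of_real (b (norm k) * \<tau>))) * u0 k" for k
  define L' where "L' k = ph b' (norm k) * u0 k" for k
  have L_ae: "AE k in lborel. L k = L' k"
    using AE_norm_lborel[OF pm bb'] by eventually_elim (simp only: L_def L'_def ph_def)
  have L'_m: "L' \<in> borel_measurable lborel"
    unfolding L'_def[abs_def] using ph_m[OF b'm] borel_measurable_continuous_onI[OF u0_cont] by measurable
  \<comment> \<open>The composition of a Lebesgue measurable b with the norm is not measurable by
    composition alone; almost everywhere equality with the Borel version \<open>L'\<close> gives
    it.\<close>
  have Lm: "L \<in> borel_measurable lebesgue"
    by (rule borel_measurable_AE[OF measurable_completion[OF L'_m]])
      (use AE_completion[OF L_ae] in \<open>auto elim: eventually_mono\<close>)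
  have L_lim: "AE k in lborel. L k = profile_limit (P b') k"
    using L_ae AE_lborel_singleton[of "0::real ^ 'n"]
  proof eventually_elim
    case (elim k)
    then show ?case using \<kappa> by (simp add: L'_def profile_limit_def P_def w_def \<nu>_def \<kappa>_def)
  qed
  have normL: "cmod (L k) = cmod (u0 k)" for k by (simp add: L_def norm_mult norm_exp_eq_Re)
  have nn: "(\<integral>\<^sup>+k. ennreal ((cmod (f k))\<^sup>2) \<partial>lebesgue) < top" if "f \<in> L2" for f :: "real ^ 'n \<Rightarrow> complex"
    using that unfolding L2_def by (auto simp: nn_integral_eq_integral)
  have L_L2: "L \<in> L2" using u0_L2 Lm by (simp add: L2_def normL)
  note wk = profile_shell_weak_limit[OF dim' pm am _ aA u0_cont M(2) B(1) P_bp[OF b'l] _ Lm L_lim nn[OF L_L2]]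
  have fl: "filterlim (\<lambda>\<epsilon>. c * \<tau> / \<epsilon>\<^sup>2) at_top (at_right 0)"
    by (rule filterlim_inverse_square_at_top) (use c \<tau> in simp)
  have pos: "\<forall>\<^sub>F \<epsilon>::real in at_right 0. \<epsilon> > 0" by (simp add: eventually_at_right_less)
  show ?thesis
    unfolding weakly_tendsto_L2_def L_def[symmetric]
  proof (intro conjI ballI)
    show "L \<in> L2" by (rule L_L2)
    show "\<forall>\<^sub>F \<epsilon> in at_right 0. (\<lambda>k. recon_hat c \<epsilon> b u0 k (\<tau> / \<epsilon>\<^sup>2) * exp (\<i> * of_real (c * norm k * \<tau> / \<epsilon>\<^sup>2))) \<in> L2"
      using pos
    proof eventually_elim
      case (elim \<epsilon>)
      then have R: "c * \<tau> / \<epsilon>\<^sup>2 > 0" using c \<tau> by simp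
      have m: "profile_shell (P b') (c * \<tau> / \<epsilon>\<^sup>2) \<in> borel_measurable lborel"
        unfolding measurable_lborel1 measurable_lborel2
        by (rule wk(1)[OF _ _ Lm nn[OF L_L2] R]) (erule a0 | erule Pa)+
      have "(\<integral>\<^sup>+k. ennreal ((cmod (profile_shell (P b') (c * \<tau> / \<epsilon>\<^sup>2) k))\<^sup>2) \<partial>lborel) < top"
        by (rule wk(2)[OF _ _ Lm nn[OF L_L2] R]) (erule a0 | erule Pa)+
      then have i: "integrable lborel (\<lambda>k. (cmod (profile_shell (P b') (c * \<tau> / \<epsilon>\<^sup>2) k))\<^sup>2)"
        using m by (intro integrableI_bounded) simp_all
      have "integrable lebesgue (\<lambda>k. (cmod (profile_shell (P b') (c * \<tau> / \<epsilon>\<^sup>2) k))\<^sup>2)"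
        by (rule integrable_completion[THEN iffD2, OF borel_measurable_integrable[OF i] i])
      then show ?case unfolding rec[OF elim] L2_def using measurable_completion[OF m] by simp
    qed
    fix g :: "real ^ 'n \<Rightarrow> complex" assume g: "g \<in> L2"
    then have gm: "g \<in> borel_measurable lebesgue" by (simp add: L2_def)
    have "((\<lambda>\<epsilon>. LINT k|lebesgue. profile_shell (P b') (c * \<tau> / \<epsilon>\<^sup>2) k * cnj (g k)) \<longlongrightarrow> (LINT k|lebesgue. L k * cnj (g k))) (at_right 0)"
    proof (rule filterlim_compose[OF _ fl])
      show "((\<lambda>R. LINT k|lebesgue. profile_shell (P b') R k * cnj (g k)) \<longlongrightarrow> (LINT k|lebesgue. L k * cnj (g k))) at_top"
        by (rule wk(3)[OF _ _ gm nn[OF g]]) (erule a0 | erule Pa)+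
    qed
    then show "((\<lambda>\<epsilon>. LINT k|lebesgue. recon_hat c \<epsilon> b u0 k (\<tau> / \<epsilon>\<^sup>2) * exp (\<i> * of_real (c * norm k * \<tau> / \<epsilon>\<^sup>2)) * cnj (g k)) \<longlongrightarrow> (LINT k|lebesgue. L k * cnj (g k))) (at_right 0)"
      by (rule Lim_transform_eventually) (use pos in \<open>eventually_elim\<close>, simp only: rec)
  qed
qed

theorem theorem2p7:
  fixes u0 :: "real ^ 'n \<Rightarrow> complex" and b W :: "real \<Rightarrow> real" and c \<rho> :: real
  assumes dim: "CARD('n) \<in> {1, 2, 3}"
    and c: "c > 0"
    and u0_L2: "u0 \<in> L2"
    and u0_cont: "continuous_on UNIV u0"
    and u0_supp: "compact (closure {k. u0 k \<noteq> 0})"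
    and b: "b \<in> borel_measurable lebesgue"
    and \<rho>: "\<rho> > 0"
    and W: "regularizing CARD('n) \<rho> W"
    and decay: "\<exists>C>0. \<exists>\<alpha>>0. \<forall>z. \<forall>q\<in>sphere 0 1. \<forall>\<tau>>0.
        cmod (profile_inv_fourier (profile_evol b (restr_reg_op W u0)) z q \<tau>)
          \<le> C * (1 + \<bar>z\<bar>) powr (- real CARD('n) - \<alpha>)"
    and smooth: "\<And>\<tau>. \<tau> > 0 \<Longrightarrow> Ck_submanifold (CARD('n) - 1) (UNIV \<times> sphere 0 1)
        (\<lambda>(\<xi>, q). profile_evol b (restr_reg_op W u0) \<xi> q \<tau>)"
  shows "(\<forall>\<tau>>0. \<forall>k. norm k > \<rho> \<longrightarrow>
      ((\<lambda>\<epsilon>. recon_reg_hat c \<epsilon> b W u0 k (\<tau> / \<epsilon>\<^sup>2) * exp (\<i> * of_real (c * norm k * \<tau> / \<epsilon>\<^sup>2)))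
         \<longlongrightarrow> exp (- (\<i> * of_real (b (norm k) * \<tau>))) * u0 k) (at_right 0)) \<and>
    (\<forall>\<tau>>0. weakly_tendsto_L2
       (\<lambda>\<epsilon> k. recon_hat c \<epsilon> b u0 k (\<tau> / \<epsilon>\<^sup>2) * exp (\<i> * of_real (c * norm k * \<tau> / \<epsilon>\<^sup>2)))
       (\<lambda>k. exp (- (\<i> * of_real (b (norm k) * \<tau>))) * u0 k) (at_right 0))"
proof (intro conjI allI impI)
  fix \<tau> :: real and k :: "real ^ 'n"
  assume \<tau>: "\<tau> > 0" and k: "norm k > \<rho>"
  obtain C \<alpha> where C: "\<alpha> > 0" "\<And>z q. q \<in> sphere 0 1 \<Longrightarrow>
        cmod (profile_inv_fourier (profile_evol b (restr_reg_op W u0)) z q \<tau>)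
          \<le> C * (1 + \<bar>z\<bar>) powr (- real CARD('n) - \<alpha>)"
    using decay \<tau> by blast
  show "((\<lambda>\<epsilon>. recon_reg_hat c \<epsilon> b W u0 k (\<tau> / \<epsilon>\<^sup>2) * exp (\<i> * of_real (c * norm k * \<tau> / \<epsilon>\<^sup>2)))
         \<longlongrightarrow> exp (- (\<i> * of_real (b (norm k) * \<tau>))) * u0 k) (at_right 0)"
    by (rule regularized_reconstruction_limit[OF dim c u0_cont u0_supp b \<rho> W C smooth[OF \<tau>] \<tau> k])
next
  fix \<tau> :: real
  assume "\<tau> > 0"
  then show "weakly_tendsto_L2
       (\<lambda>\<epsilon> k. recon_hat c \<epsilon> b u0 k (\<tau> / \<epsilon>\<^sup>2) * exp (\<i> * of_real (c * norm k * \<tau> / \<epsilon>\<^sup>2)))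
       (\<lambda>k. exp (- (\<i> * of_real (b (norm k) * \<tau>))) * u0 k) (at_right 0)"
    by (rule reconstruction_weak_limit[OF dim c u0_L2 u0_cont u0_supp b])
qed

end
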